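(* For any $0<\delta<1$ and $M_{\max}\ge 2M_{\min}>0$, a $(\delta,M_{\max},M_{\min},\widehat{\mathcal{P}})$-ADSP data structure can be maintained in total expected time $\widetilde{O}\left(mn\frac{\log (M_{\max}/M_{\min})}{\delta}\right)$ plus additional $O(1)$ time per each $\mathsf{Increase}(\cdot,\cdot)$ request in the processed sequence. Each $\mathsf{Distance}(\cdot,\cdot,\cdot)$ query and each $\mathsf{Path}(\cdot,\cdot,\cdot)$ query can be answered in $\widetilde{O}(n)$ time, and each $\mathsf{SSrcDist}(\cdot,\cdot)$ query can be answered in $\widetilde{O}(m)$ time.
   Context: Let $G=(V,E)$ be a directed graph without parallel arcs or isolated vertices, $n=|V|\ge2$, $m=|E|$, with $k$ distinct source-sink pairs $(s_1,t_1),\dots,(s_k,t_k)$, $s_i\ne t_i$. A $u$-$v$ path is a directed path in $G$ from $u$ to $v$. Let $\mathcal{P}_i$ be the set of all $s_i$-$t_i$ paths in $G$ and $\mathcal{P}=\bigcup_{i=1}^k\mathcal{P}_i$. For $U\subseteq V$ and $j>0$, let $\mathcal{P}(U,j)$ be the set of all paths in $\mathcal{P}$ that pass through at least one vertex of $U$ and consist of at most $j$ arcs. A length function is a map $l:E\to\mathbb{R}^+$, and $l(p)=\sum_{e\in p}l(e)$. Random set $\widehat{\mathcal{P}}$: for $j=1,\dots,\lceil\log n\rceil$ ($\log=\log_2$), let $S_j\subseteq V$ be a random set obtained by including each vertex of $V$ independently with probability $p_j=\min\{\frac{10\ln n}{2^j},1\}$; set $\widehat{\mathcal{P}}=\bigcup_{j=1}^{\lceil\log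 n\rceil}\mathcal{P}(S_j,2^j)$. The data structure is given the sets $S_j$; expectations are over their choice. ADSP: for $\delta\ge 0$, $M_{\max}\ge 2M_{\min}>0$ and a set of paths $\mathcal{Q}\subseteq\mathcal{P}$, a $(\delta,M_{\max},M_{\min},\mathcal{Q})$-ADSP data structure maintains the directed graph $G$ with a length function $l$ on its arcs and supports, on-line, the following operations (requests): - $\mathsf{Distance}(u,v,\beta)$, for $u,v\in V$ and $\beta\in[M_{\min},M_{\max}/2]$: let $d^*$ be the length (with respect to the current $l$) of the shortest $u$-$v$ path in $\mathcal{Q}$ ($d^*=\infty$ if there is none). If $d^*\le2\beta$, the query returns a value $d$ with $d\le d^*+\delta\beta$; if $d^*>2\beta$, the query may return either a value $d$ with $d\le d^*+\delta\beta$, or $\infty$. - $\mathsf{Increase}(e,\omega)$, for $e\in E$ and $\omega\ge0$: increases the length $l(e)$ by $\omega$. - $\mathsf{Path}(u,v,\beta)$, for $u,v\in V$ and $\beta\in[M_{\min},M_{\max}/2]$: returns a $u$-$v$ path in $G$ (not necessarily in $\mathcal{Q}$) of length, with respect to the current $l$, at most $\mathsf{Distance}(u,v,\beta)$, as long as $\mathsf{Distance}(u,v,\beta)\neq\infty$. - $\mathsf{SSrcDist}(u,\beta)$, for $u\in V$ and $\beta\in[M_{\min},M_{\max}/2]$: returns $\mathsf{Distance}(u,v,\beta)$ for all $v\in V$. The total maintenance time is the total time spent over the whole sequence of requests, excluding the time charged to answering the individual queries. The notation $\widetilde{O}(\cdot)$ hides factors poly-logarithmic in $n$ and $1/\delta$.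 Arithmetic operations and comparisons on the numbers involved have unit cost. *)

theory Defs
  imports
    "HOL-Probability.Probability"
    "HOL-Library.Monad_Syntax"
    "Graph_Theory.Graph_Theory"
begin

section \<open>Graphs, path sets and the random set of paths\<close>

text \<open>
  Vertices are numbered \<open>0, \<dots>, n - 1\<close> and arcs \<open>0, \<dots>, m - 1\<close>, which is the form in which a
  machine receives the graph. Arcs are not identified with pairs of vertices; the locale
  \<open>nomulti_digraph\<close> excludes parallel arcs.
\<close>

locale commodity_graph = nomulti_digraph G for G :: "(nat, nat) pre_digraph" +
  fixes pairs :: "(nat \<times> nat) list"
  assumes verts_numbered: "verts G = {..<card (verts G)}"
    and arcs_numbered: "arcs G = {..<card (arcs G)}"
    and two_verts: "card (verts G) \<ge> 2"
    and no_isolated: "v \<in> verts G \<Longrightarrow> \<exists>e\<in>arcs G. tail G e = v \<or> head G e = v"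
    and distinct_pairs: "distinct pairs"
    and pairs_in_verts: "set pairs \<subseteq> verts G \<times> verts G"
    and source_neq_sink: "(s, t) \<in> set pairs \<Longrightarrow> s \<noteq> t"

text \<open>A path is the list of its arcs. Since \<open>s \<noteq> t\<close>, this list determines the end points.\<close>

definition pair_paths :: "(nat, nat) pre_digraph \<Rightarrow> (nat \<times> nat) list \<Rightarrow> nat list set" where
  "pair_paths G pairs = (\<Union>(s, t)\<in>set pairs. {p. pre_digraph.apath G s p t})"

definition short_paths_through ::
  "(nat, nat) pre_digraph \<Rightarrow> (nat \<times> nat) list \<Rightarrow> nat set \<Rightarrow> nat \<Rightarrow> nat list set" where
  "short_paths_through G pairs U j =
     {p \<in> pair_paths G pairs. length p \<le> j \<and>
        (\<exists>u v. pre_digraph.apath G u p v \<and> set (pre_digraph.awalk_verts G u p) \<inter> U \<noteq> {})}"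

definition num_levels :: "nat \<Rightarrow> nat" where
  "num_levels n = nat \<lceil>log 2 (real n)\<rceil>"

definition hub_prob :: "nat \<Rightarrow> nat \<Rightarrow> real" where
  "hub_prob n j = min (10 * ln (real n) / 2 ^ j) 1"

text \<open>The joint distribution of the independent random sets \<open>S 1, \<dots>, S (num_levels n)\<close>.\<close>

definition hub_sets :: "nat \<Rightarrow> (nat \<Rightarrow> nat set) pmf" where
  "hub_sets n =
     map_pmf (\<lambda>X j. {v. X (j, v)})
       (Pi_pmf ({1..num_levels n} \<times> {..<n}) False (\<lambda>(j, v). bernoulli_pmf (hub_prob n j)))"

definition hub_paths ::
  "(nat, nat) pre_digraph \<Rightarrow> (nat \<times> nat) list \<Rightarrow> (nat \<Rightarrow> nat set) \<Rightarrow> nat list set" where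
  "hub_paths G pairs S =
     (\<Union>j\<in>{1..num_levels (card (verts G))}. short_paths_through G pairs (S j) (2 ^ j))"


section \<open>Requests and the ADSP specification\<close>

datatype request =
    Distance nat nat real
  | Increase nat real
  | Path nat nat real
  | SSrcDist nat real

datatype answer =
    Value ereal
  | Done
  | Route "nat list"
  | Values "nat \<Rightarrow> ereal"

fun is_increase :: "request \<Rightarrow> bool" where
  "is_increase (Increase e \<omega>) = True"
| "is_increase _ = False"

fun valid_request :: "(nat, nat) pre_digraph \<Rightarrow> real \<Rightarrow> real \<Rightarrow> request \<Rightarrow> bool" where
  "valid_request G Mmax Mmin (Distance u v \<beta>) =
     (u \<in> verts G \<and> v \<in> verts G \<and> \<beta> \<in> {Mmin..Mmax / 2})"
| "valid_request G Mmax Mmin (Increase e \<omega>) = (e \<in> arcs G \<and> \<omega> \<ge> 0)"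
| "valid_request G Mmax Mmin (Path u v \<beta>) =
     (u \<in> verts G \<and> v \<in> verts G \<and> \<beta> \<in> {Mmin..Mmax / 2})"
| "valid_request G Mmax Mmin (SSrcDist u \<beta>) = (u \<in> verts G \<and> \<beta> \<in> {Mmin..Mmax / 2})"

fun update_length :: "(nat \<Rightarrow> real) \<Rightarrow> request \<Rightarrow> nat \<Rightarrow> real" where
  "update_length l (Increase e \<omega>) = l(e := l e + \<omega>)"
| "update_length l _ = l"

text \<open>The length of a shortest \<open>u\<close>-\<open>v\<close> path in \<open>Q\<close>; the infimum over the empty set is \<open>\<infinity>\<close>.\<close>

definition shortest_in ::
  "(nat, nat) pre_digraph \<Rightarrow> nat list set \<Rightarrow> (nat \<Rightarrow> real) \<Rightarrow> nat \<Rightarrow> nat \<Rightarrow> ereal" where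
  "shortest_in G Q l u v =
     (INF p\<in>{p \<in> Q. pre_digraph.apath G u p v}. ereal (\<Sum>e\<leftarrow>p. l e))"

definition distance_spec ::
  "(nat, nat) pre_digraph \<Rightarrow> real \<Rightarrow> real \<Rightarrow> real \<Rightarrow> nat list set \<Rightarrow> (nat \<Rightarrow> real) \<Rightarrow>
     (nat \<Rightarrow> nat \<Rightarrow> real \<Rightarrow> ereal) \<Rightarrow> bool" where
  "distance_spec G \<delta> Mmax Mmin Q l D \<longleftrightarrow>
     (\<forall>u\<in>verts G. \<forall>v\<in>verts G. \<forall>\<beta>\<in>{Mmin..Mmax / 2}.
        let d = shortest_in G Q l u v in
          if d \<le> ereal (2 * \<beta>) then D u v \<beta> \<le> d + ereal (\<delta> * \<beta>)
          else D u v \<beta> \<le> d + ereal (\<delta> * \<beta>) \<or> D u v \<beta> = \<infinity>)"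

fun answer_spec ::
  "(nat, nat) pre_digraph \<Rightarrow> (nat \<Rightarrow> real) \<Rightarrow> (nat \<Rightarrow> nat \<Rightarrow> real \<Rightarrow> ereal) \<Rightarrow>
     request \<Rightarrow> answer \<Rightarrow> bool" where
  "answer_spec G l D (Distance u v \<beta>) a \<longleftrightarrow> a = Value (D u v \<beta>)"
| "answer_spec G l D (Increase e \<omega>) a \<longleftrightarrow> True"
| "answer_spec G l D (Path u v \<beta>) a \<longleftrightarrow>
     (D u v \<beta> \<noteq> \<infinity> \<longrightarrow>
        (\<exists>p. a = Route p \<and> pre_digraph.apath G u p v \<and> ereal (\<Sum>e\<leftarrow>p. l e) \<le> D u v \<beta>))"
| "answer_spec G l D (SSrcDist u \<beta>) a \<longleftrightarrow>
     (\<exists>f. a = Values f \<and> (\<forall>v\<in>verts G. f v = D u v \<beta>))"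

text \<open>
  A server is a transition relation: \<open>step r s a t s'\<close> means that the request \<open>r\<close>, issued in
  state \<open>s\<close>, is answered by \<open>a\<close> after \<open>t\<close> time units and leaves the server in state \<open>s'\<close>.
\<close>

type_synonym 's server = "request \<Rightarrow> 's \<Rightarrow> answer \<Rightarrow> nat \<Rightarrow> 's \<Rightarrow> bool"

text \<open>
  \<open>D\<close> is the function computed by the distance queries. It may change only when a length is
  increased; all queries issued between two such requests refer to the same \<open>D\<close>. The predicate
  is coinductive because the specification has to hold along arbitrarily long request sequences.
\<close>

coinductive adsp_state ::
  "(nat, nat) pre_digraph \<Rightarrow> real \<Rightarrow> real \<Rightarrow> real \<Rightarrow> nat list set \<Rightarrow> 's server \<Rightarrow>
     (nat \<Rightarrow> real) \<Rightarrow> (nat \<Rightarrow> nat \<Rightarrow> real \<Rightarrow> ereal) \<Rightarrow> 's \<Rightarrow> bool"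
  for G :: "(nat, nat) pre_digraph" and \<delta> Mmax Mmin :: real and Q :: "nat list set"
    and step :: "'s server" where
  "\<lbrakk>distance_spec G \<delta> Mmax Mmin Q l D;
    \<And>r. valid_request G Mmax Mmin r \<Longrightarrow> \<exists>a t s'. step r s a t s';
    \<And>r a t s'. valid_request G Mmax Mmin r \<Longrightarrow> step r s a t s' \<Longrightarrow> answer_spec G l D r a;
    \<And>r a t s'. valid_request G Mmax Mmin r \<Longrightarrow> step r s a t s' \<Longrightarrow>
       (\<exists>D'. (is_increase r \<or> D' = D) \<and>
          adsp_state G \<delta> Mmax Mmin Q step (update_length l r) D' s')\<rbrakk>
   \<Longrightarrow> adsp_state G \<delta> Mmax Mmin Q step l D s"

definition adsp ::
  "(nat, nat) pre_digraph \<Rightarrow> real \<Rightarrow> real \<Rightarrow> real \<Rightarrow> nat list set \<Rightarrow> 's server \<Rightarrow>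
     (nat \<Rightarrow> real) \<Rightarrow> 's \<Rightarrow> bool" where
  "adsp G \<delta> Mmax Mmin Q step l s \<longleftrightarrow> (\<exists>D. adsp_state G \<delta> Mmax Mmin Q step l D s)"

text \<open>
  Requests arrive on-line: the next request may depend on all previous answers (the previous
  requests are then determined as well).
\<close>

type_synonym strategy = "answer list \<Rightarrow> request"

inductive session ::
  "'s server \<Rightarrow> strategy \<Rightarrow> 's \<Rightarrow> (request \<times> answer \<times> nat) list \<Rightarrow> 's \<Rightarrow> bool"
  for step :: "'s server" and \<sigma> :: strategy and s0 :: 's where
  session_Nil: "session step \<sigma> s0 [] s0"
| session_snoc:
    "session step \<sigma> s0 h s \<Longrightarrow> r = \<sigma> (map (\<lambda>(_, a, _). a) h) \<Longrightarrow> step r s a t s' \<Longrightarrow>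
       session step \<sigma> s0 (h @ [(r, a, t)]) s'"

definition increase_time :: "(request \<times> answer \<times> nat) list \<Rightarrow> nat" where
  "increase_time h = (\<Sum>(r, a, t)\<leftarrow>filter (\<lambda>(r, _). is_increase r) h. t)"

definition num_increases :: "(request \<times> answer \<times> nat) list \<Rightarrow> nat" where
  "num_increases h = length (filter (\<lambda>(r, _). is_increase r) h)"


section \<open>The machine model\<close>

text \<open>
  A unit-cost machine for real and integer data, programmed in a structured language. Real cells
  hold arbitrary reals. Word cells hold natural numbers below a bound \<open>W\<close>; a program that computes
  a larger number, also as the result of rounding a real, is stuck. Hence neither long integers nor
  the floor operation can be used to do many operations at once. Each program has finitely many
  named registers and arrays; only the latter are indexed at run time.

  Subtraction of words is truncated, the floor of a negative number is \<open>0\<close>, and division by zero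
  follows the conventions of HOL.
\<close>

datatype word_op = WAdd | WSub | WMul | WDiv | WMod
datatype real_op = RAdd | RSub | RMul | RDiv

datatype word_exp =
    WConst nat
  | WReg nat
  | WCell nat word_exp
  | WBin word_op word_exp word_exp
  | WFloor real_exp
and real_exp =
    RWord word_exp
  | RReg nat
  | RCell nat word_exp
  | RBin real_op real_exp real_exp

datatype bool_exp =
    WLess word_exp word_exp
  | RLess real_exp real_exp
  | BNot bool_exp
  | BAnd bool_exp bool_exp

datatype com =
    Skip
  | SetW nat word_exp
  | SetR nat real_exp
  | PutW nat word_exp word_exp
  | PutR nat word_exp real_exp
  | Seq com com
  | Cond bool_exp com com
  | While bool_exp com

record machine_state =
  wreg :: "nat \<Rightarrow> nat"
  rreg :: "nat \<Rightarrow> real"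
  warr :: "nat \<Rightarrow> nat \<Rightarrow> nat"
  rarr :: "nat \<Rightarrow> nat \<Rightarrow> real"

fun word_op_fun :: "word_op \<Rightarrow> nat \<Rightarrow> nat \<Rightarrow> nat" where
  "word_op_fun WAdd = (+)"
| "word_op_fun WSub = (-)"
| "word_op_fun WMul = (*)"
| "word_op_fun WDiv = (div)"
| "word_op_fun WMod = (mod)"

fun real_op_fun :: "real_op \<Rightarrow> real \<Rightarrow> real \<Rightarrow> real" where
  "real_op_fun RAdd = (+)"
| "real_op_fun RSub = (-)"
| "real_op_fun RMul = (*)"
| "real_op_fun RDiv = (/)"

definition as_word :: "nat \<Rightarrow> nat \<Rightarrow> nat option" where
  "as_word W x = (if x < W then Some x else None)"

primrec eval_word :: "nat \<Rightarrow> machine_state \<Rightarrow> word_exp \<Rightarrow> nat option"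
  and eval_real :: "nat \<Rightarrow> machine_state \<Rightarrow> real_exp \<Rightarrow> real option" where
  "eval_word W s (WConst k) = as_word W k"
| "eval_word W s (WReg x) = Some (wreg s x)"
| "eval_word W s (WCell a e) = do { i \<leftarrow> eval_word W s e; Some (warr s a i) }"
| "eval_word W s (WBin f e1 e2) =
     do { x \<leftarrow> eval_word W s e1; y \<leftarrow> eval_word W s e2; as_word W (word_op_fun f x y) }"
| "eval_word W s (WFloor e) = do { x \<leftarrow> eval_real W s e; as_word W (nat \<lfloor>x\<rfloor>) }"
| "eval_real W s (RWord e) = do { x \<leftarrow> eval_word W s e; Some (real x) }"
| "eval_real W s (RReg x) = Some (rreg s x)"
| "eval_real W s (RCell a e) = do { i \<leftarrow> eval_word W s e; Some (rarr s a i) }"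
| "eval_real W s (RBin f e1 e2) =
     do { x \<leftarrow> eval_real W s e1; y \<leftarrow> eval_real W s e2; Some (real_op_fun f x y) }"

primrec eval_bool :: "nat \<Rightarrow> machine_state \<Rightarrow> bool_exp \<Rightarrow> bool option" where
  "eval_bool W s (WLess e1 e2) =
     do { x \<leftarrow> eval_word W s e1; y \<leftarrow> eval_word W s e2; Some (x < y) }"
| "eval_bool W s (RLess e1 e2) =
     do { x \<leftarrow> eval_real W s e1; y \<leftarrow> eval_real W s e2; Some (x < y) }"
| "eval_bool W s (BNot b) = do { x \<leftarrow> eval_bool W s b; Some (\<not> x) }"
| "eval_bool W s (BAnd b1 b2) =
     do { x \<leftarrow> eval_bool W s b1; y \<leftarrow> eval_bool W s b2; Some (x \<and> y) }"

primrec cost_word :: "word_exp \<Rightarrow> nat" and cost_real :: "real_exp \<Rightarrow> nat" where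
  "cost_word (WConst k) = 1"
| "cost_word (WReg x) = 1"
| "cost_word (WCell a e) = 1 + cost_word e"
| "cost_word (WBin f e1 e2) = 1 + cost_word e1 + cost_word e2"
| "cost_word (WFloor e) = 1 + cost_real e"
| "cost_real (RWord e) = 1 + cost_word e"
| "cost_real (RReg x) = 1"
| "cost_real (RCell a e) = 1 + cost_word e"
| "cost_real (RBin f e1 e2) = 1 + cost_real e1 + cost_real e2"

primrec cost_bool :: "bool_exp \<Rightarrow> nat" where
  "cost_bool (WLess e1 e2) = 1 + cost_word e1 + cost_word e2"
| "cost_bool (RLess e1 e2) = 1 + cost_real e1 + cost_real e2"
| "cost_bool (BNot b) = 1 + cost_bool b"
| "cost_bool (BAnd b1 b2) = 1 + cost_bool b1 + cost_bool b2"

text \<open>\<open>exec W c s t s'\<close>: with word bound \<open>W\<close>, \<open>c\<close> takes \<open>s\<close> to \<open>s'\<close> in time \<open>t\<close>.\<close>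

inductive exec :: "nat \<Rightarrow> com \<Rightarrow> machine_state \<Rightarrow> nat \<Rightarrow> machine_state \<Rightarrow> bool" for W :: nat where
  exec_Skip: "exec W Skip s 1 s"
| exec_SetW: "eval_word W s e = Some x \<Longrightarrow>
    exec W (SetW y e) s (1 + cost_word e) (s\<lparr>wreg := (wreg s)(y := x)\<rparr>)"
| exec_SetR: "eval_real W s e = Some x \<Longrightarrow>
    exec W (SetR y e) s (1 + cost_real e) (s\<lparr>rreg := (rreg s)(y := x)\<rparr>)"
| exec_PutW: "eval_word W s d = Some i \<Longrightarrow> eval_word W s e = Some x \<Longrightarrow>
    exec W (PutW a d e) s (1 + cost_word d + cost_word e)
      (s\<lparr>warr := (warr s)(a := (warr s a)(i := x))\<rparr>)"
| exec_PutR: "eval_word W s d = Some i \<Longrightarrow> eval_real W s e = Some x \<Longrightarrow>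
    exec W (PutR a d e) s (1 + cost_word d + cost_real e)
      (s\<lparr>rarr := (rarr s)(a := (rarr s a)(i := x))\<rparr>)"
| exec_Seq: "exec W c1 s t1 s1 \<Longrightarrow> exec W c2 s1 t2 s2 \<Longrightarrow> exec W (Seq c1 c2) s (t1 + t2) s2"
| exec_Cond: "eval_bool W s b = Some x \<Longrightarrow> exec W (if x then c1 else c2) s t s' \<Longrightarrow>
    exec W (Cond b c1 c2) s (1 + cost_bool b + t) s'"
| exec_While_False: "eval_bool W s b = Some False \<Longrightarrow>
    exec W (While b c) s (1 + cost_bool b) s"
| exec_While_True: "eval_bool W s b = Some True \<Longrightarrow> exec W c s t1 s1 \<Longrightarrow>
    exec W (While b c) s1 t2 s2 \<Longrightarrow> exec W (While b c) s (1 + cost_bool b + t1 + t2) s2"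

lemma exec_deterministic:
  "exec W c s t s' \<Longrightarrow> exec W c s t2 s2 \<Longrightarrow> t2 = t \<and> s2 = s'"
proof (induction arbitrary: t2 s2 rule: exec.induct)
  case exec_Skip from exec_Skip.prems show ?case by (cases rule: exec.cases) auto
next
  case exec_SetW from exec_SetW.prems exec_SetW.hyps show ?case by (cases rule: exec.cases) auto
next
  case exec_SetR from exec_SetR.prems exec_SetR.hyps show ?case by (cases rule: exec.cases) auto
next
  case exec_PutW from exec_PutW.prems exec_PutW.hyps show ?case by (cases rule: exec.cases) auto
next
  case exec_PutR from exec_PutR.prems exec_PutR.hyps show ?case by (cases rule: exec.cases) auto
next
  case (exec_Seq c1 s t1 s1 c2 t2' s2')
  from exec_Seq.prems show ?case
    by (cases rule: exec.cases) (use exec_Seq.IH in \<open>metis\<close>)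
next
  case (exec_Cond s b x c1 c2 t s')
  from exec_Cond.prems show ?case
    by (cases rule: exec.cases) (use exec_Cond.hyps exec_Cond.IH in \<open>metis option.inject\<close>)
next
  case (exec_While_False s b c)
  from exec_While_False.prems show ?case
    by (cases rule: exec.cases) (use exec_While_False.hyps in simp_all)
next
  case (exec_While_True s b c t1 s1 t2' s2')
  from exec_While_True.prems show ?case
  proof (cases rule: exec.cases)
    case exec_While_False
    with exec_While_True.hyps show ?thesis by simp
  next
    case exec_While_True': (exec_While_True u1 r u2)
    then show ?thesis using exec_While_True.IH by metis
  qed
qed


section \<open>Data structures as programs\<close>

record data_structure =
  init_prog :: com
  distance_prog :: com
  increase_prog :: com
  path_prog :: com
  ssrc_prog :: com

text \<open>
  Initial memory. Word registers 0, 1, 2: \<open>n\<close>, \<open>m\<close> and the number of pairs. Real registers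
  0, 1, 2: \<open>\<delta>\<close>, \<open>Mmax\<close>, \<open>Mmin\<close>. Word arrays 0, 1: tails and heads of the arcs; 2, 3: sources and
  sinks; 4: the incidence vectors of the sets \<open>S j\<close>, stored in rows of length \<open>n\<close>. Real array 0:
  the initial arc lengths. All other cells are 0.
\<close>

definition input_state ::
  "(nat, nat) pre_digraph \<Rightarrow> (nat \<times> nat) list \<Rightarrow> real \<Rightarrow> real \<Rightarrow> real \<Rightarrow> (nat \<Rightarrow> real) \<Rightarrow>
     (nat \<Rightarrow> nat set) \<Rightarrow> machine_state" where
  "input_state G pairs \<delta> Mmax Mmin l S =
     (let n = card (verts G); m = card (arcs G); k = length pairs in
      \<lparr>wreg = (\<lambda>_. 0)(0 := n, 1 := m, 2 := k),
       rreg = (\<lambda>_. 0)(0 := \<delta>, 1 := Mmax, 2 := Mmin),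
       warr = (\<lambda>_ _. 0)
         (0 := (\<lambda>e. if e < m then tail G e else 0),
          1 := (\<lambda>e. if e < m then head G e else 0),
          2 := (\<lambda>i. if i < k then fst (pairs ! i) else 0),
          3 := (\<lambda>i. if i < k then snd (pairs ! i) else 0),
          4 := (\<lambda>i. if i div n \<in> {1..num_levels n} \<and> i mod n \<in> S (i div n) then 1 else 0)),
       rarr = (\<lambda>_ _. 0)(0 := (\<lambda>e. if e < m then l e else 0))\<rparr>)"

text \<open>Arguments are passed in word registers 3 and 4 and in real register 3.\<close>

fun load_request :: "request \<Rightarrow> machine_state \<Rightarrow> machine_state" where
  "load_request (Distance u v \<beta>) s =
     s\<lparr>wreg := (wreg s)(3 := u, 4 := v), rreg := (rreg s)(3 := \<beta>)\<rparr>"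
| "load_request (Increase e \<omega>) s =
     s\<lparr>wreg := (wreg s)(3 := e), rreg := (rreg s)(3 := \<omega>)\<rparr>"
| "load_request (Path u v \<beta>) s =
     s\<lparr>wreg := (wreg s)(3 := u, 4 := v), rreg := (rreg s)(3 := \<beta>)\<rparr>"
| "load_request (SSrcDist u \<beta>) s =
     s\<lparr>wreg := (wreg s)(3 := u), rreg := (rreg s)(3 := \<beta>)\<rparr>"

fun request_prog :: "data_structure \<Rightarrow> request \<Rightarrow> com" where
  "request_prog A (Distance _ _ _) = distance_prog A"
| "request_prog A (Increase _ _) = increase_prog A"
| "request_prog A (Path _ _ _) = path_prog A"
| "request_prog A (SSrcDist _ _) = ssrc_prog A"

text \<open>
  A distance is returned as a word, which is \<open>0\<close> for \<open>\<infinity>\<close>, together with a real: in word register 5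
  and real register 4 for a single distance, in word array 5 and real array 1 for a table. A path is
  returned as its number of arcs, in word register 5, and its arcs, in word array 6.
\<close>

definition decode_distance :: "nat \<Rightarrow> real \<Rightarrow> ereal" where
  "decode_distance w x = (if w = 0 then \<infinity> else ereal x)"

fun read_answer :: "request \<Rightarrow> machine_state \<Rightarrow> answer" where
  "read_answer (Distance _ _ _) s = Value (decode_distance (wreg s 5) (rreg s 4))"
| "read_answer (Increase _ _) s = Done"
| "read_answer (Path _ _ _) s = Route (map (warr s 6) [0..<wreg s 5])"
| "read_answer (SSrcDist u _) s = Values (\<lambda>v. decode_distance (warr s 5 v) (rarr s 1 v))"

definition serve :: "nat \<Rightarrow> data_structure \<Rightarrow> machine_state server" where
  "serve W A r s a t s' \<longleftrightarrow>
     exec W (request_prog A r) (load_request r s) t s' \<and> a = read_answer r s'"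


section \<open>Resource bounds\<close>

text \<open>
  The word length is logarithmic in \<open>n\<close>, \<open>1 / \<delta>\<close> and \<open>log (Mmax / Mmin)\<close>, that is, words
  can address a memory of size polynomial in these quantities.
\<close>

definition word_bound :: "nat \<Rightarrow> nat \<Rightarrow> real \<Rightarrow> real \<Rightarrow> real \<Rightarrow> nat" where
  "word_bound w n \<delta> Mmax Mmin = nat \<lceil>real n + 1 / \<delta> + log 2 (Mmax / Mmin)\<rceil> ^ w"

text \<open>For \<open>0 < \<delta> < 1\<close>, the factors hidden by the soft-O notation. Without \<open>1 +\<close>, they
  would vanish as \<open>\<delta>\<close> tends to 1.\<close>

definition polylog :: "nat \<Rightarrow> nat \<Rightarrow> real \<Rightarrow> real" where
  "polylog c n \<delta> = (1 + log 2 (real n)) ^ c * (1 + log 2 (1 / \<delta>)) ^ c"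

fun query_time_bound :: "(nat, nat) pre_digraph \<Rightarrow> real \<Rightarrow> request \<Rightarrow> nat \<Rightarrow> bool" where
  "query_time_bound G K (Distance u v \<beta>) t \<longleftrightarrow> real t \<le> K * real (card (verts G))"
| "query_time_bound G K (Path u v \<beta>) t \<longleftrightarrow> real t \<le> K * real (card (verts G))"
| "query_time_bound G K (SSrcDist u \<beta>) t \<longleftrightarrow> real t \<le> K * real (card (arcs G))"
| "query_time_bound G K (Increase e \<omega>) t \<longleftrightarrow> True"

end

theory Submission imports Defs begin
text \<open>
 For every scale \<open>\<beta> = 2 ^ i * Mmin\<close>, every level \<open>j\<close> and every hub in \<open>S j\<close>, truncated shortest-path
 trees into and out of the hub are maintained in the manner of Even and Shiloach, with arc lengths
 rounded to multiples of about \<open>\<delta> * \<beta> / 2 ^ j\<close>. A path of at most \<open>2 ^ j\<close> arcs then loses at most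
 \<open>\<delta> * \<beta>\<close>, while only \<open>O(2 ^ j / \<delta>)\<close> distance values are relevant, so that one tree costs
 \<open>O(m * 2 ^ j / \<delta>)\<close> in total. The expected size of \<open>S j\<close> is \<open>O(n * log n / 2 ^ j)\<close>, hence each level costs
 \<open>O(m * n * log n / \<delta>)\<close> per scale. The grids of the scales are nested, so an increase is passed on to
 larger scales only if it changes a rounded length, which pays for it, and each increase itself costs
 \<open>O(1)\<close> amortised time.
\<close>

section \<open>Execution with a postcondition\<close>

text \<open>Query times must not depend on \<open>Mmax / Mmin\<close>, so the scale of a query
  cannot be sought among all scales. Instead each arc carries the smallest scale at which its length
  matters, these classes are kept in sorted blocks of \<open>n\<close> cells, and the scale is found
  close to the largest class that \<open>\<beta>\<close> admits. Paths that are too long for the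
  scale found are harmless, since no finite answer exceeds the truncation radius. All answers
  between two increases must come from one function \<open>D\<close>. It is the minimum, over the
  hubs, of the labels into and out of the hub; every such value is realised by a walk, from which a
  path query extracts a simple path, and a single-source query computes exactly the same minima by
  one multi-source Dijkstra run per level. All maintenance time is charged to one potential
  \<open>Phi\<close>. Its initial value is the only place where the random sets matter, so the
  expected bound holds against every adaptive strategy.\<close>

declare One_nat_def [simp del]

abbreviation seq_com (infixr ";;" 55) where "c1 ;; c2 \<equiv> Seq c1 c2"
abbreviation wplus (infixl "[+]" 65) where "a [+] b \<equiv> WBin WAdd a b"
abbreviation wminus (infixl "[-]" 65) where "a [-] b \<equiv> WBin WSub a b"
abbreviation wtimes (infixl "[*]" 70) where "a [*] b \<equiv> WBin WMul a b"
abbreviation wdivide (infixl "[div]" 70) where "a [div] b \<equiv> WBin WDiv a b"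
abbreviation wmod (infixl "[mod]" 70) where "a [mod] b \<equiv> WBin WMod a b"
abbreviation rplus (infixl "{+}" 65) where "a {+} b \<equiv> RBin RAdd a b"
abbreviation rtimes (infixl "{*}" 70) where "a {*} b \<equiv> RBin RMul a b"
abbreviation rdivide (infixl "{'/}" 70) where "a {/} b \<equiv> RBin RDiv a b"
abbreviation wless (infix "[<]" 50) where "a [<] b \<equiv> WLess a b"
abbreviation rless (infix "{<}" 50) where "a {<} b \<equiv> RLess a b"
abbreviation word_le (infix "[\<le>]" 50) where "a [\<le>] b \<equiv> BNot (WLess b a)"
abbreviation real_le (infix "{\<le>}" 50) where "a {\<le>} b \<equiv> BNot (RLess b a)"

lemma ex_bool [simp]: "\<exists>x. x" "\<exists>x. \<not> x"
 by blast+

text \<open>The postcondition receives the running time together with the final state, so one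
  calculus yields correctness and cost. \<open>wp\<close> asserts that a terminating run exists;
  \<open>exec_deterministic\<close> makes it the only one, which \<open>serve_step\<close>
  uses.\<close>

definition wp :: "nat \<Rightarrow> com \<Rightarrow> (nat \<Rightarrow> machine_state \<Rightarrow> bool) \<Rightarrow> machine_state \<Rightarrow> bool" where
 "wp W c Q s \<longleftrightarrow> (\<exists>t s'. exec W c s t s' \<and> Q t s')"

inductive_cases exec_SkipE: "exec W Skip s t s'"
inductive_cases exec_SetWE: "exec W (SetW y e) s t s'"
inductive_cases exec_SetRE: "exec W (SetR y e) s t s'"
inductive_cases exec_PutWE: "exec W (PutW a d e) s t s'"
inductive_cases exec_PutRE: "exec W (PutR a d e) s t s'"
inductive_cases exec_SeqE: "exec W (Seq c1 c2) s t s'"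
inductive_cases exec_CondE: "exec W (Cond b c1 c2) s t s'"

lemma wp_Skip [simp]: "wp W Skip Q s \<longleftrightarrow> Q 1 s"
 unfolding wp_def by (auto intro: exec.intros elim: exec_SkipE)

lemma wp_SetW [simp]:
 "wp W (SetW y e) Q s \<longleftrightarrow>
  (\<exists>x. eval_word W s e = Some x \<and> Q (1 + cost_word e) (s\<lparr>wreg := (wreg s)(y := x)\<rparr>))"
 unfolding wp_def by (blast intro: exec.intros elim: exec_SetWE)

lemma wp_SetR [simp]:
 "wp W (SetR y e) Q s \<longleftrightarrow>
  (\<exists>x. eval_real W s e = Some x \<and> Q (1 + cost_real e) (s\<lparr>rreg := (rreg s)(y := x)\<rparr>))"
 unfolding wp_def by (blast intro: exec.intros elim: exec_SetRE)

lemma wp_PutW [simp]: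
 "wp W (PutW a d e) Q s \<longleftrightarrow>
  (\<exists>i x. eval_word W s d = Some i \<and> eval_word W s e = Some x \<and>
    Q (1 + cost_word d + cost_word e) (s\<lparr>warr := (warr s)(a := (warr s a)(i := x))\<rparr>))"
 unfolding wp_def by (blast intro: exec.intros elim: exec_PutWE)

lemma wp_PutR [simp]:
 "wp W (PutR a d e) Q s \<longleftrightarrow>
  (\<exists>i x. eval_word W s d = Some i \<and> eval_real W s e = Some x \<and>
    Q (1 + cost_word d + cost_real e) (s\<lparr>rarr := (rarr s)(a := (rarr s a)(i := x))\<rparr>))"
 unfolding wp_def by (blast intro: exec.intros elim: exec_PutRE)

lemma wp_Seq [simp]:
 "wp W (Seq c1 c2) Q s \<longleftrightarrow> wp W c1 (\<lambda>t1. wp W c2 (\<lambda>t2. Q (t1 + t2))) s"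
 unfolding wp_def by (blast intro: exec.intros elim: exec_SeqE)

lemma wp_Cond [simp]:
 "wp W (Cond b c1 c2) Q s \<longleftrightarrow>
  eval_bool W s b \<noteq> None \<and>
  (eval_bool W s b = Some True \<longrightarrow> wp W c1 (\<lambda>t. Q (1 + cost_bool b + t)) s) \<and>
  (eval_bool W s b = Some False \<longrightarrow> wp W c2 (\<lambda>t. Q (1 + cost_bool b + t)) s)"
proof -
 have *: "exec W (Cond b c1 c2) s t s' \<longleftrightarrow>
   (\<exists>x t'. eval_bool W s b = Some x \<and> t = 1 + cost_bool b + t' \<and> exec W (if x then c1 else c2) s t' s')" for t s'
  by (rule iffI, erule exec_CondE, blast) (elim exE conjE, hypsubst, rule exec_Cond)
 show ?thesis
 proof (cases "eval_bool W s b")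
  case (Some x)
  then show ?thesis by (cases x) (simp_all add: wp_def *, blast+)
 qed (simp add: wp_def *)
qed

lemma as_word_Some [simp]: "x < W \<Longrightarrow> as_word W x = Some x"
 by (simp add: as_word_def)

text \<open>\<open>mw\<close>, \<open>mr\<close>, \<open>ma\<close>, \<open>mb\<close>: the word registers, real registers, word arrays and real arrays
 that a program may write.\<close>

primrec mw :: "com \<Rightarrow> nat set" where
 "mw Skip = {}" | "mw (SetW y e) = {y}" | "mw (SetR y e) = {}" | "mw (PutW a d e) = {}"
| "mw (PutR a d e) = {}" | "mw (Seq c1 c2) = mw c1 \<union> mw c2"
| "mw (Cond b c1 c2) = mw c1 \<union> mw c2" | "mw (While b c) = mw c"

primrec mr :: "com \<Rightarrow> nat set" where
 "mr Skip = {}" | "mr (SetW y e) = {}" | "mr (SetR y e) = {y}" | "mr (PutW a d e) = {}"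
| "mr (PutR a d e) = {}" | "mr (Seq c1 c2) = mr c1 \<union> mr c2"
| "mr (Cond b c1 c2) = mr c1 \<union> mr c2" | "mr (While b c) = mr c"

primrec ma :: "com \<Rightarrow> nat set" where
 "ma Skip = {}" | "ma (SetW y e) = {}" | "ma (SetR y e) = {}" | "ma (PutW a d e) = {a}"
| "ma (PutR a d e) = {}" | "ma (Seq c1 c2) = ma c1 \<union> ma c2"
| "ma (Cond b c1 c2) = ma c1 \<union> ma c2" | "ma (While b c) = ma c"

primrec mb :: "com \<Rightarrow> nat set" where
 "mb Skip = {}" | "mb (SetW y e) = {}" | "mb (SetR y e) = {}" | "mb (PutW a d e) = {}"
| "mb (PutR a d e) = {a}" | "mb (Seq c1 c2) = mb c1 \<union> mb c2"
| "mb (Cond b c1 c2) = mb c1 \<union> mb c2" | "mb (While b c) = mb c"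

definition agrees :: "com \<Rightarrow> machine_state \<Rightarrow> machine_state \<Rightarrow> bool" where
 "agrees c s s' \<longleftrightarrow>
  (\<forall>x. x \<notin> mw c \<longrightarrow> wreg s' x = wreg s x) \<and> (\<forall>x. x \<notin> mr c \<longrightarrow> rreg s' x = rreg s x) \<and>
  (\<forall>x. x \<notin> ma c \<longrightarrow> warr s' x = warr s x) \<and> (\<forall>x. x \<notin> mb c \<longrightarrow> rarr s' x = rarr s x)"

lemma agrees_refl [simp]: "agrees c s s"
 by (simp add: agrees_def)

lemma agrees_trans: "agrees c s s1 \<Longrightarrow> agrees c s1 s2 \<Longrightarrow> agrees c s s2"
 by (simp add: agrees_def)

lemma exec_agrees: "exec W c s t s' \<Longrightarrow> agrees c s s'"
 by (induction rule: exec.induct) (auto simp: agrees_def split: if_splits)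

text \<open>The frame of a program is read off its text. The specification of a subprogram therefore
  mentions only what it computes, and everything preserved is recovered from \<open>agrees\<close>
  at the call.\<close>

lemma wp_call:
 assumes "wp W c P s" "\<And>t s'. P t s' \<Longrightarrow> agrees c s s' \<Longrightarrow> Q t s'"
 shows "wp W c Q s"
 using assms exec_agrees unfolding wp_def by blast

text \<open>\<open>F\<close> bounds the remaining running time.\<close>

lemma wp_while:
 assumes I0: "I s"
  and step: "\<And>s'. I s' \<Longrightarrow> agrees c s s' \<Longrightarrow>
   eval_bool W s' b \<noteq> None \<and> (eval_bool W s' b = Some True \<longrightarrow>
    wp W c (\<lambda>t s''. I s'' \<and> 1 + cost_bool b + t + F s'' \<le> F s') s')"
  and fin: "\<And>t s'. I s' \<Longrightarrow> agrees c s s' \<Longrightarrow> eval_bool W s' b = Some False \<Longrightarrow>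
   t + F s' \<le> F s + 1 + cost_bool b \<Longrightarrow> Q t s'"
 shows "wp W (While b c) Q s"
proof -
 \<comment> \<open>The last, failing test is paid by the additive term and not by \<open>F\<close>.
   Every round costs at least one unit, so \<open>F\<close> decreases strictly and is the
   termination measure as well.\<close>
 have "\<exists>t s''. exec W (While b c) s' t s'' \<and> I s'' \<and> agrees c s s'' \<and>
   eval_bool W s'' b = Some False \<and> t + F s'' \<le> F s' + 1 + cost_bool b"
  if "I s'" "agrees c s s'" for s'
  using that
 proof (induction "F s'" arbitrary: s' rule: less_induct)
  case less
  obtain x where x: "eval_bool W s' b = Some x"
   using step[OF less.prems] by fastforce
  then have y: "x \<longrightarrow> wp W c (\<lambda>t s''. I s'' \<and> 1 + cost_bool b + t + F s'' \<le> F s') s'"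
   using step[OF less.prems] by simp
  show ?case
  proof (cases x)
   case False
   with x less.prems show ?thesis by (intro exI[of _ "1 + cost_bool b"] exI[of _ s'])
    (auto intro: exec.intros)
  next
   case True
   with y obtain t1 s1 where 1: "exec W c s' t1 s1" "I s1" "1 + cost_bool b + t1 + F s1 \<le> F s'"
    unfolding wp_def by blast
   have "agrees c s s1" using exec_agrees[OF 1(1)] less.prems(2) by (rule agrees_trans[rotated])
   with less.hyps[of s1] 1 obtain t2 s2 where 2: "exec W (While b c) s1 t2 s2" "I s2"
    "agrees c s s2" "eval_bool W s2 b = Some False" "t2 + F s2 \<le> F s1 + 1 + cost_bool b" by auto
   have "exec W (While b c) s' (1 + cost_bool b + t1 + t2) s2"
    using True x 1(1) 2(1) by (auto intro: exec.intros)
   moreover have "1 + cost_bool b + t1 + t2 + F s2 \<le> F s' + 1 + cost_bool b"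
    using 1(3) 2(5) by linarith
   ultimately show ?thesis using 2 by blast
  qed
 qed
 from this[OF I0 agrees_refl] fin show ?thesis unfolding wp_def by blast
qed

section \<open>Linked lists of arcs\<close>

text \<open>The arcs \<open>a < k\<close> with \<open>h a = v\<close> form a list in decreasing order; \<open>prv h v k\<close> is one more
 than its first element, and \<open>0\<close> is the end of the list.\<close>

primrec prv :: "(nat \<Rightarrow> nat) \<Rightarrow> nat \<Rightarrow> nat \<Rightarrow> nat" where
 "prv h v 0 = 0"
| "prv h v (Suc k) = (if h k = v then Suc k else prv h v k)"

lemma prv_le: "prv h v k \<le> k"
 by (induction k) auto

lemma prv_hit: "prv h v k \<noteq> 0 \<Longrightarrow> h (prv h v k - 1) = v"
 by (induction k) auto

lemma prv_gap: "prv h v k \<le> a \<Longrightarrow> a < k \<Longrightarrow> h a \<noteq> v"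
 by (induction k) (auto simp: less_Suc_eq split: if_splits)

definition len_list :: "(nat \<Rightarrow> nat) \<Rightarrow> nat \<Rightarrow> nat \<Rightarrow> nat" where
 "len_list h v k = card {a. a < k \<and> h a = v}"

lemma len_list_0 [simp]: "len_list h v 0 = 0"
 by (simp add: len_list_def)

lemma len_list_prv: "len_list h v (prv h v k) = len_list h v k"
proof -
 have "{a. a < prv h v k \<and> h a = v} = {a. a < k \<and> h a = v}"
  using prv_le[of h v k] prv_gap[of h v k] by (force simp: not_le[symmetric])
 then show ?thesis by (simp add: len_list_def)
qed

lemma len_list_Suc: "len_list h v (Suc k) = (if h k = v then Suc (len_list h v k) else len_list h v k)"
proof -
 have "{a. a < Suc k \<and> h a = v} = (if h k = v then insert k else id) {a. a < k \<and> h a = v}"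
  by (auto simp: less_Suc_eq)
 then show ?thesis by (simp add: len_list_def)
qed

lemma len_list_step:
 assumes "p \<noteq> 0" "h (p - 1) = v"
 shows "len_list h v p = Suc (len_list h v (prv h v (p - 1)))"
 using assms len_list_Suc[of h v "p - 1"] by (simp add: len_list_prv)

text \<open>Double counting: every arc lies in the list of exactly one vertex.\<close>

lemma sum_len_list:
 assumes "\<forall>a<A. h a < N"
 shows "(\<Sum>v<N. len_list h v A) = A"
 using assms
proof (induction A)
 case 0 then show ?case by (simp add: len_list_def)
next
 case (Suc A)
 have "(\<Sum>v<N. len_list h v (Suc A)) = (\<Sum>v<N. len_list h v A + (if h A = v then 1 else 0))"
  by (intro sum.cong) (auto simp: len_list_Suc)
 with Suc show ?case by (simp add: sum.distrib)
qed

text \<open>Balanced by additions on both sides, because subtraction of natural numbers is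
  truncated. Changes of the potentials at a single index go through this equation.\<close>

lemma sum_fun_upd:
 fixes F :: "'a \<Rightarrow> nat"
 assumes "finite A" "x \<in> A" "\<And>y. y \<in> A \<Longrightarrow> y \<noteq> x \<Longrightarrow> G y = F y"
 shows "sum G A + F x = sum F A + G x"
proof -
 have "sum G (A - {x}) = sum F (A - {x})" by (rule sum.cong) (use assms in auto)
 then show ?thesis using assms by (simp add: sum.remove[of A x])
qed

section \<open>Truncated shortest-path trees under increasing arc costs\<close>

text \<open>The machine only offers \<open><\<close>; equality is two comparisons and evaluates both
  operands twice, which shows in its cost.\<close>

definition word_eq (infix "[=]" 50) where "a [=] b = BAnd (a [\<le>] b) (b [\<le>] a)"

lemma eval_word_eq [simp]:
 "eval_bool W s (a [=] b) = do { x \<leftarrow> eval_word W s a; y \<leftarrow> eval_word W s b; Some (x = y) }"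
 by (cases "eval_word W s a"; cases "eval_word W s b") (auto simp: word_eq_def)

lemma cost_word_eq [simp]: "cost_bool (a [=] b) = 5 + 2 * cost_word a + 2 * cost_word b"
 by (simp add: word_eq_def)

text \<open>Registers 30 and 31 are the offsets of the current tree in the label arrays 18, 19 and
  in the cost array 17. Registers 32 and 33 hold the truncation bound and the hub, register 34 the
  height of the stack in array 16. Arrays 10 and 11 are tails and heads, 12 and 13 the lists of
  incoming arcs, 14 and 15 those of outgoing arcs.\<close>

definition es_push :: com where
 "es_push =
  SetW 36 (WCell 14 (WReg 35)) ;;
  While (WConst 0 [<] WReg 36)
   (PutW 16 (WReg 34) (WCell 11 (WReg 36 [-] WConst 1)) ;;
    SetW 34 (WReg 34 [+] WConst 1) ;;
    SetW 36 (WCell 15 (WReg 36 [-] WConst 1)))"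

text \<open>A vertex stays on the stack when its pointer or label has moved. Successors are pushed
  without testing whether they are affected; a later step finds out and pops them.\<close>

definition es_step :: com where
 "es_step =
  SetW 35 (WCell 16 (WReg 34 [-] WConst 1)) ;;
  SetW 37 (WReg 30 [+] WReg 35) ;;
  Cond (WReg 35 [mod] WReg 0 [=] WReg 33) (SetW 34 (WReg 34 [-] WConst 1))
   (Cond (WReg 32 [<] WCell 18 (WReg 37)) (SetW 34 (WReg 34 [-] WConst 1))
    (Cond (WCell 19 (WReg 37) [<] WConst 1)
     (PutW 18 (WReg 37) (WCell 18 (WReg 37) [+] WConst 1) ;;
      PutW 19 (WReg 37) (WCell 12 (WReg 35)) ;;
      es_push)
     (SetW 36 (WCell 19 (WReg 37) [-] WConst 1) ;;
      Cond (WCell 18 (WReg 30 [+] WCell 10 (WReg 36)) [+] WCell 17 (WReg 31 [+] WReg 36)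
         [<] WCell 18 (WReg 37))
       (SetW 34 (WReg 34 [-] WConst 1))
       (PutW 19 (WReg 37) (WCell 13 (WReg 36))))))"

definition es_run :: com where
 "es_run = While (WConst 0 [<] WReg 34) es_step"

lemma mods_es_run [simp]:
 "mw es_run = {34, 35, 36, 37}" "mr es_run = {}" "ma es_run = {16, 18, 19}" "mb es_run = {}"
 by (auto simp: es_run_def es_step_def es_push_def)

lemma mods_es_push [simp]:
 "mw es_push = {34, 36}" "mr es_push = {}" "ma es_push = {16}" "mb es_push = {}"
 by (auto simp: es_push_def)

text \<open>A set, because a vertex may lie on the stack several times and only its presence matters
  for the invariant.\<close>

definition stack :: "(nat \<Rightarrow> nat) \<Rightarrow> nat \<Rightarrow> nat set" where
 "stack f k = f ` {..<k}"

lemma stack_push [simp]: "stack (f(k := x)) (k + 1) = insert x (stack f k)"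
 by (auto simp: stack_def lessThan_Suc simp flip: Suc_eq_plus1)

lemma stack_pop: "0 < k \<Longrightarrow> stack f k = insert (f (k - 1)) (stack f (k - 1))"
 by (cases k) (auto simp: stack_def lessThan_Suc)

lemma stack_empty [simp]: "stack f 0 = {}"
 by (simp add: stack_def)

definition sl :: "(nat \<Rightarrow> 'a) \<Rightarrow> nat \<Rightarrow> nat \<Rightarrow> 'a" where
 "sl f b = (\<lambda>x. f (b + x))"

lemma sl_upd [simp]: "sl (f(b + x := z)) b = (sl f b)(x := z)"
 by (auto simp: sl_def)

text \<open>The residue mod \<open>n\<close> identifies the two copies of a vertex, so that the
  sources for a hub \<open>w\<close> are \<open>w\<close> and \<open>n + w\<close>.\<close>

locale es_graph =
 fixes n A :: nat and TL HD :: "nat \<Rightarrow> nat"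
 assumes n_pos: "0 < n"
  and TL_less: "a < A \<Longrightarrow> TL a < 2 * n"
  and HD_less: "a < A \<Longrightarrow> HD a < 2 * n"
begin

text \<open>\<open>c\<close> is one less than the cost of an arc, \<open>d\<close> is a lower bound on the distance from the
 sources, and the arcs from \<open>p v\<close> on have been found not to attain \<open>d v\<close>.
 Vertices outside \<open>K\<close> are in their final state.\<close>

definition es_inv ::
 "nat \<Rightarrow> nat \<Rightarrow> (nat \<Rightarrow> nat) \<Rightarrow> (nat \<Rightarrow> nat) \<Rightarrow> (nat \<Rightarrow> nat) \<Rightarrow> nat set \<Rightarrow> bool" where
 "es_inv w B c d p K \<longleftrightarrow>
  (\<forall>v<2*n. d v \<le> B + 1) \<and> (\<forall>v<2*n. v mod n = w \<longrightarrow> d v = 0) \<and>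
  (\<forall>a<A. d (HD a) \<le> d (TL a) + c a + 1) \<and>
  (\<forall>v<2*n. p v = 0 \<or> (p v \<le> A \<and> HD (p v - 1) = v)) \<and>
  (\<forall>a<A. HD a mod n \<noteq> w \<longrightarrow> p (HD a) \<le> a \<longrightarrow> d (HD a) \<le> d (TL a) + c a) \<and>
  (\<forall>v<2*n. v \<notin> K \<longrightarrow> v mod n = w \<or> d v > B \<or> (p v \<noteq> 0 \<and> d (TL (p v - 1)) + c (p v - 1) < d v))"

text \<open>An arc costs at least one unit, so with all labels 0 no arc attains its head, and all
  lists may count as exhausted.\<close>

lemma es_inv_start:
 "es_inv w B (\<lambda>_. 0) (\<lambda>_. 0) (\<lambda>_. 0) {..<2*n}"
 by (simp add: es_inv_def)

lemma es_inv_cong: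
 assumes inv: "es_inv w B c d p K"
  and c: "\<And>a. a < A \<Longrightarrow> c' a = c a" and d: "\<And>v. v < 2*n \<Longrightarrow> d' v = d v"
  and p: "\<And>v. v < 2*n \<Longrightarrow> p' v = p v"
 shows "es_inv w B c' d' p' K"
proof -
 have "v mod n = w \<or> d' v > B \<or> (p' v \<noteq> 0 \<and> d' (TL (p' v - 1)) + c' (p' v - 1) < d' v)"
  if v: "v < 2*n" "v \<notin> K" for v
 proof -
  have *: "v mod n = w \<or> d v > B \<or> (p v \<noteq> 0 \<and> d (TL (p v - 1)) + c (p v - 1) < d v)"
   using inv v by (auto simp: es_inv_def)
  have "p v = 0 \<or> p v \<le> A" using inv v by (auto simp: es_inv_def)
  then have "p v = 0 \<or> p v - 1 < A" by linarith
  with * v show ?thesis using c[of "p v - 1"] d[OF TL_less, of "p v - 1"] d[of v] p[of v] by auto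
 qed
 moreover have "d' (HD a) \<le> d' (TL a) + c' a + 1 \<and>
  (HD a mod n \<noteq> w \<longrightarrow> p' (HD a) \<le> a \<longrightarrow> d' (HD a) \<le> d' (TL a) + c' a)" if "a < A" for a
  using inv that c[OF that] d[OF TL_less[OF that]] d[OF HD_less[OF that]] p[OF HD_less[OF that]]
  by (simp add: es_inv_def)
 moreover have "d' v \<le> B + 1 \<and> (v mod n = w \<longrightarrow> d' v = 0) \<and> (p' v = 0 \<or> (p' v \<le> A \<and> HD (p' v - 1) = v))"
  if "v < 2*n" for v
  using inv that d[OF that] p[OF that] by (simp add: es_inv_def)
 ultimately show ?thesis unfolding es_inv_def by blast
qed

lemma es_inv_mono: "es_inv w B c d p K \<Longrightarrow> K \<inter> {..<2*n} \<subseteq> K' \<Longrightarrow> es_inv w B c d p K'"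
 unfolding es_inv_def by blast

text \<open>With the list of \<open>v\<close> exhausted, every incoming arc has been rejected, so
  \<open>d v\<close> may grow by one without violating an arc. The scan restarts from the full list,
  and only heads of arcs leaving \<open>v\<close> can lose the arc that attains their label.\<close>

lemma es_inv_bump:
 assumes "es_inv w B c d p K" "v < 2*n" "v mod n \<noteq> w" "d v \<le> B" "p v = 0"
  and "v \<in> K" "\<And>a. a < A \<Longrightarrow> TL a = v \<Longrightarrow> HD a \<in> K'" "K \<subseteq> K'"
 shows "es_inv w B c (d(v := d v + 1)) (p(v := prv HD v A)) K'"
 unfolding es_inv_def
proof (intro conjI allI impI)
 fix x assume x: "x < 2*n"
 show "(d(v := d v + 1)) x \<le> B + 1" using assms x by (auto simp: es_inv_def)
 show "x mod n = w \<Longrightarrow> (d(v := d v + 1)) x = 0" using assms x by (auto simp: es_inv_def)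
 show "(p(v := prv HD v A)) x = 0 \<or> (p(v := prv HD v A)) x \<le> A \<and> HD ((p(v := prv HD v A)) x - 1) = x"
  using assms x prv_le[of HD v A] prv_hit[of HD v A] by (auto simp: es_inv_def)
 assume K: "x \<notin> K'"
 then have xv: "x \<noteq> v" "x \<notin> K" using assms by auto
 have *: "x mod n = w \<or> d x > B \<or> (p x \<noteq> 0 \<and> d (TL (p x - 1)) + c (p x - 1) < d x)"
  using assms(1) x xv by (auto simp: es_inv_def)
 moreover have "TL (p x - 1) \<noteq> v" if "p x \<noteq> 0"
 proof
  assume t: "TL (p x - 1) = v"
  have "p x \<le> A" "HD (p x - 1) = x" using assms(1) x that by (auto simp: es_inv_def)
  with t assms(7)[of "p x - 1"] that have "x \<in> K'" by auto
  with K show False by simp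
 qed
 ultimately show "x mod n = w \<or> B < (d(v := d v + 1)) x \<or> (p(v := prv HD v A)) x \<noteq> 0 \<and>
  (d(v := d v + 1)) (TL ((p(v := prv HD v A)) x - 1)) + c ((p(v := prv HD v A)) x - 1) < (d(v := d v + 1)) x"
  using xv by auto
next
 fix a assume a: "a < A"
 have le: "d (HD a) \<le> d (TL a) + c a + 1" using assms(1) a by (auto simp: es_inv_def)
 have le': "HD a = v \<Longrightarrow> d (HD a) \<le> d (TL a) + c a"
  using assms a by (auto simp: es_inv_def)
 show "(d(v := d v + 1)) (HD a) \<le> (d(v := d v + 1)) (TL a) + c a + 1" using le le' by auto
 assume h: "HD a mod n \<noteq> w" "(p(v := prv HD v A)) (HD a) \<le> a"
 show "(d(v := d v + 1)) (HD a) \<le> (d(v := d v + 1)) (TL a) + c a"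
 proof (cases "HD a = v")
  case True
  with h(2) prv_gap[of HD v A a] a show ?thesis by auto
 next
  case False
  then have "d (HD a) \<le> d (TL a) + c a" using h assms(1) a by (auto simp: es_inv_def)
  with False show ?thesis by auto
 qed
qed

text \<open>The rejected arc joins those behind the pointer. No list entries are skipped, since
  \<open>prv\<close> has no arcs of \<open>v\<close> in between.\<close>

lemma es_inv_advance:
 assumes "es_inv w B c d p K" "v < 2*n" "v \<in> K" "p v \<noteq> 0"
  and "\<not> d (TL (p v - 1)) + c (p v - 1) < d v"
 shows "es_inv w B c d (p(v := prv HD v (p v - 1))) K"
proof -
 have pv: "p v \<le> A" using assms by (auto simp: es_inv_def)
 have "d (HD a) \<le> d (TL a) + c a"
  if "a < A" "HD a mod n \<noteq> w" "(p(v := prv HD v (p v - 1))) (HD a) \<le> a" for a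
 proof (cases "HD a = v")
  case True
  then have "prv HD v (p v - 1) \<le> a" using that by simp
  with True prv_gap[of HD v "p v - 1" a] have "p v - 1 \<le> a" by force
  with True assms that show ?thesis by (cases "a = p v - 1") (auto simp: es_inv_def)
 qed (use that assms in \<open>auto simp: es_inv_def\<close>)
 moreover have "prv HD v (p v - 1) \<le> A" using prv_le[of HD v "p v - 1"] pv by linarith
 ultimately show ?thesis using assms prv_hit[of HD v "p v - 1"] by (auto simp: es_inv_def)
qed

lemma es_inv_remove:
 assumes "es_inv w B c d p K" "K \<subseteq> insert v K'"
  and "v mod n = w \<or> d v > B \<or> (p v \<noteq> 0 \<and> d (TL (p v - 1)) + c (p v - 1) < d v)"
 shows "es_inv w B c d p K'"
 using assms unfolding es_inv_def by blast

text \<open>Growing costs make arcs less tight: rejected arcs remain rejected, which is why the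
  pointers never move back. Only the head of a changed arc may have relied on that arc, so only such
  heads become doubtful.\<close>

lemma es_inv_cost:
 assumes "es_inv w B c d p {}" "\<And>a. a < A \<Longrightarrow> c a \<le> c' a"
  and "\<And>a. a < A \<Longrightarrow> c' a \<noteq> c a \<Longrightarrow> HD a \<in> K"
 shows "es_inv w B c' d p K"
proof -
 have "v mod n = w \<or> d v > B \<or> (p v \<noteq> 0 \<and> d (TL (p v - 1)) + c' (p v - 1) < d v)"
  if v: "v < 2*n" "v \<notin> K" for v
 proof -
  have "v mod n = w \<or> d v > B \<or> (p v \<noteq> 0 \<and> d (TL (p v - 1)) + c (p v - 1) < d v)"
   using assms(1) v by (auto simp: es_inv_def)
  moreover have "c' (p v - 1) = c (p v - 1)" if "p v \<noteq> 0"
  proof -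
   have "p v \<le> A" "HD (p v - 1) = v" using assms(1) v that by (auto simp: es_inv_def)
   with assms(3)[of "p v - 1"] that v show ?thesis by fastforce
  qed
  ultimately show ?thesis by auto
 qed
 moreover have "d (HD a) \<le> d (TL a) + c' a + 1" if "a < A" for a
  using assms(1) assms(2)[OF that] that by (fastforce simp: es_inv_def)
 moreover have "d (HD a) \<le> d (TL a) + c' a" if "a < A" "HD a mod n \<noteq> w" "p (HD a) \<le> a" for a
  using assms(1) assms(2)[OF that(1)] that by (fastforce simp: es_inv_def)
 ultimately show ?thesis using assms(1) by (auto simp: es_inv_def)
qed

text \<open>Each of the \<open>B + 1 - d v\<close> possible increments of \<open>v\<close> must pay
  for itself, for rescanning the incoming list, and for pushing and later popping the outgoing list;
  the last summand is the rest of the current scan. The factor 100 exceeds the cost of one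
  step.\<close>

definition pot :: "nat \<Rightarrow> (nat \<Rightarrow> nat) \<Rightarrow> (nat \<Rightarrow> nat) \<Rightarrow> nat" where
 "pot B d p = (\<Sum>v<2*n. (B + 1 - d v) * (100 * (1 + 2 * len_list TL v A + len_list HD v A)) +
  100 * len_list HD v (p v))"

lemma pot_cong:
 assumes "\<And>v. v < 2*n \<Longrightarrow> d v = d' v" "\<And>v. v < 2*n \<Longrightarrow> p v = p' v"
 shows "pot B d p = pot B d' p'"
 using assms by (simp add: pot_def)

lemma pot_le:
 assumes "es_inv w B c d p K"
 shows "pot B d p \<le> (B + 1) * (200 * n + 300 * A) + 100 * A"
proof -
 have p: "p v \<le> A" if "v < 2*n" for v using assms that by (auto simp: es_inv_def)
 have "len_list HD v (p v) \<le> len_list HD v A" if "v < 2*n" for v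
  unfolding len_list_def using p[OF that] by (intro card_mono) auto
 then have "pot B d p \<le> (\<Sum>v<2*n. (B + 1) * (100 * (1 + 2 * len_list TL v A + len_list HD v A)) +
   100 * len_list HD v A)"
  unfolding pot_def by (intro sum_mono add_mono mult_le_mono) auto
 also have "\<dots> = (\<Sum>v<2*n. (B + 1) * 100 + (B + 1) * 200 * len_list TL v A +
   (B + 1) * 100 * len_list HD v A + 100 * len_list HD v A)"
  by (intro sum.cong) (simp_all add: algebra_simps)
 also have "\<dots> = (B + 1) * 100 * (2 * n) + (B + 1) * 200 * A + (B + 1) * 100 * A + 100 * A"
  using sum_len_list[of A TL "2*n"] sum_len_list[of A HD "2*n"] TL_less HD_less
  by (simp add: sum.distrib flip: sum_distrib_left)
 finally show ?thesis by (simp add: algebra_simps)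
qed

text \<open>The released 100 pay for the step, and the 200 per outgoing arc for pushing its head and
  for the step that will remove it from the stack.\<close>

lemma pot_bump:
 assumes "v < 2*n" "d v \<le> B" "p v = 0"
 shows "pot B (d(v := d v + 1)) (p(v := prv HD v A)) + 100 + 200 * len_list TL v A = pot B d p"
proof -
 define F where "F = (\<lambda>d p v. (B + 1 - d v) * (100 * (1 + 2 * len_list TL v A + len_list HD v A)) +
  100 * len_list HD v (p v))"
 let ?d = "d(v := d v + 1)" and ?p = "p(v := prv HD v A)"
 have "B + 1 - d v = Suc (B - d v)" using assms by linarith
 moreover have "len_list HD v 0 = 0" by (simp add: len_list_def)
 ultimately have "F ?d ?p v + 100 + 200 * len_list TL v A = F d p v"
  using assms by (simp add: F_def len_list_prv)
 moreover have "sum (F ?d ?p) {..<2*n} + F d p v = sum (F d p) {..<2*n} + F ?d ?p v"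
  by (rule sum_fun_upd) (use assms in \<open>auto simp: F_def\<close>)
 ultimately show ?thesis by (simp add: pot_def F_def)
qed

lemma pot_advance:
 assumes "v < 2*n" "p v \<noteq> 0" "HD (p v - 1) = v"
 shows "pot B d (p(v := prv HD v (p v - 1))) + 100 = pot B d p"
proof -
 define F where "F = (\<lambda>p v. (B + 1 - d v) * (100 * (1 + 2 * len_list TL v A + len_list HD v A)) +
  100 * len_list HD v (p v))"
 let ?p = "p(v := prv HD v (p v - 1))"
 have "F ?p v + 100 = F p v"
  using len_list_step[of "p v" HD v] assms by (simp add: F_def)
 moreover have "sum (F ?p) {..<2*n} + F p v = sum (F p) {..<2*n} + F ?p v"
  by (rule sum_fun_upd) (use assms in \<open>auto simp: F_def\<close>)
 ultimately show ?thesis by (simp add: pot_def F_def)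
qed

lemma pot_start: "pot B (\<lambda>_. 0) (\<lambda>_. 0) = (B + 1) * (200 * n + 300 * A)"
proof -
 have "pot B (\<lambda>_. 0) (\<lambda>_. 0) = (\<Sum>v<2*n. (B + 1) * 100 + (B + 1) * 200 * len_list TL v A + (B + 1) * 100 * len_list HD v A)"
  by (simp add: pot_def len_list_def algebra_simps)
 also have "\<dots> = (B + 1) * 100 * (2 * n) + (B + 1) * 200 * A + (B + 1) * 100 * A"
  using sum_len_list[of A TL "2*n"] sum_len_list[of A HD "2*n"] TL_less HD_less
  by (simp add: sum.distrib flip: sum_distrib_left)
 finally show ?thesis by (simp add: algebra_simps)
qed

text \<open>Lists are decreasing, so \<open>prv HD (HD a) a\<close> is the entry that follows
  \<open>a\<close> in the list of its own head; likewise for tails in array 15.\<close>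

definition adj :: "machine_state \<Rightarrow> bool" where
 "adj s \<longleftrightarrow> wreg s 0 = n \<and> (\<forall>a<A. warr s 10 a = TL a) \<and> (\<forall>a<A. warr s 11 a = HD a) \<and>
  (\<forall>v<2*n. warr s 12 v = prv HD v A) \<and> (\<forall>a<A. warr s 13 a = prv HD (HD a) a) \<and>
  (\<forall>v<2*n. warr s 14 v = prv TL v A) \<and> (\<forall>a<A. warr s 15 a = prv TL (TL a) a)"

lemma es_push:
 assumes "adj s" "wreg s 35 = v" "v < 2*n" "wreg s 34 + len_list TL v A < W" "A < W" "1 < W"
  and "stack (warr s 16) (wreg s 34) \<subseteq> {..<2*n}"
 shows "wp W es_push (\<lambda>t s'.
  stack (warr s 16) (wreg s 34) \<subseteq> stack (warr s' 16) (wreg s' 34) \<and>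
  stack (warr s' 16) (wreg s' 34) \<subseteq> {..<2*n} \<and>
  (\<forall>a<A. TL a = v \<longrightarrow> HD a \<in> stack (warr s' 16) (wreg s' 34)) \<and>
  wreg s' 34 = wreg s 34 + len_list TL v A \<and> t \<le> 10 + 30 * len_list TL v A) s"
 unfolding es_push_def using assms
 apply simp
 apply (rule wp_while[where I = "\<lambda>s'. 
  stack (warr s 16) (wreg s 34) \<subseteq> stack (warr s' 16) (wreg s' 34) \<and>
  stack (warr s' 16) (wreg s' 34) \<subseteq> {..<2*n} \<and>
  (\<forall>a<A. TL a = v \<longrightarrow> wreg s' 36 \<le> a \<longrightarrow> HD a \<in> stack (warr s' 16) (wreg s' 34)) \<and>
  (wreg s' 36 = 0 \<or> wreg s' 36 \<le> A \<and> TL (wreg s' 36 - 1) = v) \<and>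
  wreg s' 34 + len_list TL v (wreg s' 36) = wreg s 34 + len_list TL v A" and
  F = "\<lambda>s'. 30 * len_list TL v (wreg s' 36)"])
 subgoal
  using prv_le[of TL v A] prv_hit[of TL v A] prv_gap[of TL v A]
  by (force simp: adj_def len_list_prv)
 subgoal premises prems for s'
 proof -
  let ?q = "wreg s' 36"
  show ?thesis
  proof (cases "?q = 0")
   case False
   then have q: "?q \<le> A" "TL (?q - 1) = v" "?q - 1 < A" using prems by auto
   have adj': "warr s' 11 (?q - 1) = HD (?q - 1)" "warr s' 15 (?q - 1) = prv TL v (?q - 1)"
    using prems(1,9) q by (auto simp: adj_def agrees_def)
   have len: "len_list TL v ?q = Suc (len_list TL v (prv TL v (?q - 1)))"
    using len_list_step[of ?q TL v] False q by simp
   let ?K = "insert (HD (?q - 1)) (stack (warr s' 16) (wreg s' 34))"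
   have "HD a \<in> ?K" if "a < A" "TL a = v" "prv TL v (?q - 1) \<le> a" for a
   proof (cases "a < ?q - 1")
    case True then show ?thesis using prv_gap[OF that(3)] that by auto
   next
    case False
    then show ?thesis using prems(8) that by (cases "a = ?q - 1") auto
   qed
   moreover have "prv TL v (?q - 1) = 0 \<or> prv TL v (?q - 1) \<le> A \<and> TL (prv TL v (?q - 1) - 1) = v"
    using prv_le[of TL v "?q - 1"] prv_hit[of TL v "?q - 1"] q by auto
   moreover have "?K \<subseteq> {..<2*n}" "stack (warr s 16) (wreg s 34) \<subseteq> ?K"
    using prems(8) HD_less[OF q(3)] by auto
   ultimately show ?thesis
    using prems(2-8) False q adj' len by simp
  qed (use prems in simp)
 qed
 subgoal for t s' by (auto simp: len_list_prv adj_def)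
 done

lemma adj_agrees:
 assumes "adj s" "agrees c s s'" "0 \<notin> mw c" "ma c \<inter> {10, 11, 12, 13, 14, 15} = {}"
 shows "adj s'"
 using assms unfolding adj_def agrees_def by auto

text \<open>Amortised form: with 100 added per stack entry, the drop of the potential bounds the
  time, however many labels change.\<close>

lemma es_run:
 assumes "adj s" "wreg s 30 = vb" "wreg s 31 = cb" "wreg s 32 = B" "wreg s 33 = w"
  and "\<And>a. a < A \<Longrightarrow> warr s 17 (cb + a) \<le> B"
  and "es_inv w B (sl (warr s 17) cb) (sl (warr s 18) vb) (sl (warr s 19) vb) (stack (warr s 16) (wreg s 34))"
  and "stack (warr s 16) (wreg s 34) \<subseteq> {..<2*n}"
  and "pot B (sl (warr s 18) vb) (sl (warr s 19) vb) + 100 * wreg s 34 < W"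
  and W: "vb + 2*n < W" "cb + A < W" "2 * B + 2 < W"
 shows "wp W es_run (\<lambda>t s'.
  es_inv w B (sl (warr s 17) cb) (sl (warr s' 18) vb) (sl (warr s' 19) vb) {} \<and>
  (\<forall>x. x \<notin> {vb..<vb + 2*n} \<longrightarrow> warr s' 18 x = warr s 18 x \<and> warr s' 19 x = warr s 19 x) \<and>
  t + pot B (sl (warr s' 18) vb) (sl (warr s' 19) vb) \<le>
   pot B (sl (warr s 18) vb) (sl (warr s 19) vb) + 100 * wreg s 34 + 10) s"
proof -
 let ?d = "\<lambda>s. sl (warr s 18) vb" and ?p = "\<lambda>s. sl (warr s 19) vb" and ?c = "sl (warr s 17) cb"
 let ?K = "\<lambda>s. stack (warr s 16) (wreg s 34)"
 let ?F = "\<lambda>s. pot B (?d s) (?p s) + 100 * wreg s 34"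
 let ?I = "\<lambda>s'. es_inv w B ?c (?d s') (?p s') (?K s') \<and> ?K s' \<subseteq> {..<2*n} \<and> ?F s' \<le> ?F s \<and>
  (\<forall>x. x \<notin> {vb..<vb + 2*n} \<longrightarrow> warr s' 18 x = warr s 18 x \<and> warr s' 19 x = warr s 19 x)"
 show ?thesis
  unfolding es_run_def
 proof (rule wp_while[where I = ?I and F = ?F])
  show "?I s" using assms by simp
  fix s' assume I: "?I s'" and ag: "agrees es_step s s'"
  have adj': "adj s'" by (rule adj_agrees[OF assms(1) ag]) (auto simp: es_step_def)
  have r: "wreg s' 0 = n" "wreg s' 30 = vb" "wreg s' 31 = cb" "wreg s' 32 = B" "wreg s' 33 = w"
   "warr s' 17 = warr s 17"
   using ag assms adj' by (auto simp: agrees_def es_step_def adj_def)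
  show "eval_bool W s' (WConst 0 [<] WReg 34) \<noteq> None \<and>
   (eval_bool W s' (WConst 0 [<] WReg 34) = Some True \<longrightarrow>
   wp W es_step (\<lambda>t s''. ?I s'' \<and> 1 + cost_bool (WConst 0 [<] WReg 34) + t + ?F s'' \<le> ?F s') s')"
  proof (cases "wreg s' 34 = 0")
   case False
   define v where "v = warr s' 16 (wreg s' 34 - 1)"
   have Kv: "?K s' = insert v (stack (warr s' 16) (wreg s' 34 - 1))"
    unfolding v_def by (rule stack_pop) (use False in simp)
   then have v: "v \<in> ?K s'" "v < 2*n" using I by auto
   have inv: "es_inv w B ?c (?d s') (?p s') (?K s')" using I by blast
   have dv: "?d s' v \<le> B + 1" using inv v by (auto simp: es_inv_def)
   let ?K1 = "stack (warr s' 16) (wreg s' 34 - 1)"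
   have K1: "?K1 \<subseteq> {..<2*n}" using I Kv by auto
   have pop: "es_inv w B ?c (?d s') (?p s') ?K1"
    if "v mod n = w \<or> ?d s' v > B \<or> (?p s' v \<noteq> 0 \<and> ?d s' (TL (?p s' v - 1)) + ?c (?p s' v - 1) < ?d s' v)"
    by (rule es_inv_remove[OF inv _ that]) (use Kv in auto)
   \<comment> \<open>The potential that bounds the time also bounds the height of the stack, so the
     stack pointer remains a word.\<close>
   have spW: "wreg s' 34 < W" "wreg s' 34 - 1 < W" using I assms(9) by linarith+
   have "v mod n < W" using mod_less_eq_dividend[of v n] v W by linarith
   note bnds = W n_pos \<open>v < 2*n\<close> spW this
   have ld: "warr s' 18 (vb + v) = ?d s' v" "warr s' 19 (vb + v) = ?p s' v" for v by (simp_all add: sl_def)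
   have lc: "warr s 17 (cb + a) = ?c a" for a by (simp add: sl_def)
   note sim = es_step_def v_def[symmetric] ld lc
   have F100: "100 * wreg s' 34 = 100 * (wreg s' 34 - 1) + 100" using False by simp
   consider (src) "v mod n = w" | (dead) "v mod n \<noteq> w" "?d s' v > B"
    | (bump) "v mod n \<noteq> w" "?d s' v \<le> B" "?p s' v = 0"
    | (adv) "v mod n \<noteq> w" "?d s' v \<le> B" "?p s' v \<noteq> 0" by linarith
   then show ?thesis
   proof cases
    case src
    with pop[OF disjI1] show ?thesis using False I r bnds K1 F100
     by (simp add: sim)
   next
    case dead
    with pop[OF disjI2[OF disjI1]] show ?thesis using False I r bnds K1 F100
     by (simp add: sim)
   next
    case bump
    let ?s1 = "s'\<lparr>wreg := (wreg s')(35 := v, 37 := vb + v),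
     warr := (warr s')(18 := (warr s' 18)(vb + v := ?d s' v + 1),
      19 := (warr s' 19)(vb + v := prv HD v A))\<rparr>"
    have adj1: "adj ?s1" using adj' by (simp add: adj_def)
    have potb: "pot B (?d ?s1) (?p ?s1) + 100 + 200 * len_list TL v A = pot B (?d s') (?p s')"
     using pot_bump[of v "?d s'" B "?p s'"] v bump by simp
    have sp: "wreg s' 34 + len_list TL v A < W"
     using potb I assms(9) by simp
    have call: "wp W es_push (\<lambda>t s''. ?I s'' \<and> 70 + t + ?F s'' \<le> ?F s') ?s1"
    proof (rule wp_call[OF es_push[OF adj1, of v]])
     fix t s'' assume post: "stack (warr ?s1 16) (wreg ?s1 34) \<subseteq> ?K s'' \<and> ?K s'' \<subseteq> {..<2*n} \<and>
      (\<forall>a<A. TL a = v \<longrightarrow> HD a \<in> ?K s'') \<and> wreg s'' 34 = wreg ?s1 34 + len_list TL v A \<and>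
      t \<le> 10 + 30 * len_list TL v A" and ag': "agrees es_push ?s1 s''"
     have same: "warr s'' 18 = warr ?s1 18" "warr s'' 19 = warr ?s1 19"
      using ag' by (auto simp: agrees_def)
     have "es_inv w B ?c ((?d s')(v := ?d s' v + 1)) ((?p s')(v := prv HD v A)) (?K s'')"
      by (rule es_inv_bump[OF inv v(2) bump v(1)]) (use post in auto)
     then have "es_inv w B ?c (?d s'') (?p s'') (?K s'')"
      unfolding same by simp
     then show "?I s'' \<and> 70 + t + ?F s'' \<le> ?F s'"
      using post potb I v unfolding same by auto
    qed (use v sp bnds I in simp_all)
    show ?thesis
     using False I r bnds bump adj' dv
     apply (simp add: sim adj_def)
     apply (rule wp_call[OF call])
     apply auto
     done
   next
    case adv
    define q where "q = ?p s' v - 1"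
    have q: "q < A" "HD q = v" using inv v adv by (auto simp: es_inv_def q_def)
    have ql: "warr s' 10 q = TL q" "warr s' 13 q = prv HD v q" "TL q < 2*n"
     using adj' q TL_less by (auto simp: adj_def)
    have dT: "?d s' (TL q) \<le> B + 1" "?c q \<le> B"
     using inv ql assms(6)[OF q(1)] by (auto simp: es_inv_def sl_def)
    show ?thesis
    proof (cases "?d s' (TL q) + ?c q < ?d s' v")
     case True
     then have "es_inv w B ?c (?d s') (?p s') ?K1" using adv by (intro pop) (auto simp: q_def)
     then show ?thesis using False I r bnds K1 F100 adv True q ql dT W
      by (simp add: sim q_def[symmetric])
    next
     case no: False
     have "es_inv w B ?c (?d s') ((?p s')(v := prv HD v q)) (?K s')"
      unfolding q_def by (rule es_inv_advance[OF inv v(2,1)]) (use adv no in \<open>auto simp: q_def\<close>)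
     moreover have "pot B (?d s') ((?p s')(v := prv HD v q)) + 100 = pot B (?d s') (?p s')"
      unfolding q_def by (rule pot_advance) (use adv q v in \<open>auto simp: q_def\<close>)
     ultimately show ?thesis using False I r bnds K1 F100 adv no q ql dT W
      by (simp add: sim q_def[symmetric])
    qed
   qed
  qed (use W in simp)
 next
  fix t s' assume I: "?I s'" and t: "t + ?F s' \<le> ?F s + 1 + cost_bool (WConst 0 [<] WReg 34)"
   and e: "eval_bool W s' (WConst 0 [<] WReg 34) = Some False"
  from e have "wreg s' 34 = 0" using W by simp
  with I t show "es_inv w B ?c (?d s') (?p s') {} \<and>
   (\<forall>x. x \<notin> {vb..<vb + 2*n} \<longrightarrow> warr s' 18 x = warr s 18 x \<and> warr s' 19 x = warr s 19 x) \<and>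
   t + pot B (?d s') (?p s') \<le> ?F s + 10" by simp
 qed
qed

end

section \<open>The family of trees\<close>

text \<open>A hub \<open>w\<close> of level \<open>j\<close> is encoded as \<open>q = j * n + w\<close>. Vertex \<open>n + v\<close> and arc \<open>m + e\<close> are the
 copies of \<open>v\<close> and \<open>e\<close> in the reversed graph, so that one tree serves both directions.\<close>

locale machine_setup =
 fixes n m L NI Dl W :: nat and ta he :: "nat \<Rightarrow> nat" and \<delta> Mmin :: real and S :: "nat set"
 assumes n2: "2 \<le> n" and m1: "1 \<le> m" and mnn: "m \<le> n * n"
  and ta_less: "e < m \<Longrightarrow> ta e < n" and he_less: "e < m \<Longrightarrow> he e < n"
  and delta0: "0 < \<delta>" and Mmin0: "0 < Mmin" and NI1: "1 \<le> NI" and L1: "1 \<le> L" and nL: "n \<le> 2 ^ L"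
  and Dl: "4 / \<delta> + 1 \<le> real Dl" and S_sub: "S \<subseteq> {n..<Suc L * n}"
  and W_vb: "Suc NI * (Suc L * n) * (2 * n) < W"
  and W_cb: "Suc NI * Suc L * (2 * m) < W"
  and W_B: "(Dl * 2 ^ L + 1) * (1000 * (n + m)) < W"
begin

definition TL :: "nat \<Rightarrow> nat" where "TL a = (if a < m then ta a else n + he (a - m))"
definition HD :: "nat \<Rightarrow> nat" where "HD a = (if a < m then he a else n + ta (a - m))"
definition H :: "nat \<Rightarrow> nat set" where "H j = {q \<in> S. q div n = j}"
definition beta :: "nat \<Rightarrow> real" where "beta i = 2 ^ i * Mmin"
definition unit :: "nat \<Rightarrow> nat \<Rightarrow> real" where "unit i j = \<delta> * beta i / 2 ^ j"
text \<open>The truncation bound. A path of at most \<open>2 ^ j\<close> arcs and of length below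
  \<open>4 * beta i\<close> rounds to at most \<open>(4 / \<delta> + 1) * 2 ^ j\<close> units, which
  explains the lower bound on \<open>Dl\<close>. The bound is the same at all scales.\<close>

definition Bd :: "nat \<Rightarrow> nat" where "Bd j = Dl * 2 ^ j"
text \<open>An arc costs \<open>Nf + 1\<close> units, so rounding is upwards and no arc is free.
  From length \<open>4 * beta i\<close> on, the value is frozen at \<open>Bd j\<close>: such an arc
  alone exceeds the bound, and its further growth causes no work at this scale.\<close>

definition Nf :: "nat \<Rightarrow> nat \<Rightarrow> real \<Rightarrow> nat" where
 "Nf i j x = (if x < 4 * beta i then nat \<lfloor>x / unit i j\<rfloor> else Bd j)"
definition vb :: "nat \<Rightarrow> nat \<Rightarrow> nat" where "vb i q = (i * (Suc L * n) + q) * (2 * n)"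
text \<open>Costs depend on scale and level only, so all hubs of a level share one block, whereas
  labels are kept per hub.\<close>

definition cb :: "nat \<Rightarrow> nat \<Rightarrow> nat" where "cb i j = (i * Suc L + j) * (2 * m)"

sublocale es_graph n "2 * m" TL HD
proof
 show "0 < n" using n2 by simp
 fix a assume "a < 2 * m"
 then show "TL a < 2 * n" "HD a < 2 * n"
  using ta_less[of a] he_less[of a] ta_less[of "a - m"] he_less[of "a - m"] by (auto simp: TL_def HD_def)
qed

lemma finite_S: "finite S"
 using S_sub finite_subset by blast

lemma S_bounds:
 assumes "q \<in> S"
 shows "q < Suc L * n" "1 \<le> q div n" "q div n \<le> L" "q mod n < n"
proof -
 have q: "n \<le> q" "q < Suc L * n" using assms S_sub by auto
 then show "q < Suc L * n" by simp
 show "1 \<le> q div n" using div_le_mono[OF q(1), of n] n2 by simp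
 show "q div n \<le> L" using q(2) n2 by (simp add: less_mult_imp_div_less flip: less_Suc_eq_le)
 show "q mod n < n" using n2 by simp
qed

lemma H_S: "q \<in> H j \<Longrightarrow> q \<in> S \<and> q div n = j"
 by (simp add: H_def)

lemma finite_H: "finite (H j)"
 using finite_S by (simp add: H_def)

lemma beta_pos: "0 < beta i"
 using Mmin0 by (simp add: beta_def)

lemma beta_mono: "i \<le> i' \<Longrightarrow> beta i \<le> beta i'"
 using Mmin0 by (simp add: beta_def)

lemma unit_pos: "0 < unit i j"
 using beta_pos delta0 by (simp add: unit_def)

lemma Bd_mono: "j \<le> L \<Longrightarrow> Bd j \<le> Bd L"
 by (simp add: Bd_def)

lemma vb_le: "i \<le> NI \<Longrightarrow> q < Suc L * n \<Longrightarrow> vb i q + 2 * n < W"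
proof -
 assume "i \<le> NI" "q < Suc L * n"
 then have "i * (Suc L * n) + q + 1 \<le> NI * (Suc L * n) + Suc L * n"
  by (intro add_mono[of "i * (Suc L * n)" _ "q + 1", unfolded add.assoc[symmetric]] mult_le_mono1) auto
 then have "(i * (Suc L * n) + q + 1) * (2 * n) \<le> (NI * (Suc L * n) + Suc L * n) * (2 * n)"
  by (rule mult_le_mono1)
 then show ?thesis using W_vb by (simp add: vb_def algebra_simps)
qed

lemma vb_disjoint:
 assumes "q < Suc L * n" "q' < Suc L * n" "(i, q) \<noteq> (i', q')" "v < 2 * n" "v' < 2 * n"
 shows "vb i q + v \<noteq> vb i' q' + v'"
proof
 assume eq: "vb i q + v = vb i' q' + v'"
 have n: "2 * n > 0" using n2 by simp
 have "(vb i q + v) div (2 * n) = i * (Suc L * n) + q" "(vb i' q' + v') div (2 * n) = i' * (Suc L * n) + q'"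
  using assms n unfolding vb_def by (simp_all only: div_mult_self3 div_less add_0_right)
 with eq have *: "i * (Suc L * n) + q = i' * (Suc L * n) + q'" by simp
 have Q: "0 < Suc L * n" using n2 by simp
 have "(i * (Suc L * n) + q) div (Suc L * n) = i" "(i' * (Suc L * n) + q') div (Suc L * n) = i'"
  using assms Q by (simp_all only: div_mult_self3 div_less add_0_right)
 with * have "i = i'" by simp
 with * assms(3) show False by simp
qed

lemma cb_le: "i \<le> NI \<Longrightarrow> j \<le> L \<Longrightarrow> cb i j + 2 * m < W"
proof -
 assume "i \<le> NI" "j \<le> L"
 then have "(i * Suc L + j + 1) * (2 * m) \<le> (NI * Suc L + Suc L) * (2 * m)"
  by (intro mult_le_mono1) (simp add: add_mono)
 then show ?thesis using W_cb by (simp add: cb_def algebra_simps)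
qed

lemma cb_disjoint:
 assumes "j \<le> L" "j' \<le> L" "(i, j) \<noteq> (i', j')" "a < 2 * m" "a' < 2 * m"
 shows "cb i j + a \<noteq> cb i' j' + a'"
proof
 assume eq: "cb i j + a = cb i' j' + a'"
 have n: "2 * m > 0" using m1 by simp
 have "(cb i j + a) div (2 * m) = i * Suc L + j" "(cb i' j' + a') div (2 * m) = i' * Suc L + j'"
  using assms n unfolding cb_def by (simp_all only: div_mult_self3 div_less add_0_right)
 with eq have *: "i * Suc L + j = i' * Suc L + j'" by simp
 have "(i * Suc L + j) div Suc L = i" "(i' * Suc L + j') div Suc L = i'"
  using assms by (simp_all only: div_mult_self3 div_less add_0_right)
 with * have "i = i'" by simp
 with * assms(3) show False by simp
qed

lemma W_small: "2 * Bd L + 1000 < W" "Dl < W" "2 ^ L < W" "1000 * (n + m) < W" "Suc L * n < W" "2 * m < W" "2 * n < W"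
 "NI < W" "L < W" "n * n < W" "Suc L < W" "n < W" "m < W" "1 < W"
proof -
 have n4: "4 \<le> 2 * n" "0 < n" "0 < 2 * n" using n2 by simp_all
 have 1: "(Bd L + 1) * 1000 \<le> (Bd L + 1) * (1000 * (n + m))" using n2 by (intro mult_le_mono) auto
 have "(Bd L + 1) * (1000 * (n + m)) < W" using W_B by (simp only: Bd_def)
 with 1 have "(Bd L + 1) * 1000 < W" by (rule le_less_trans)
 then show *: "2 * Bd L + 1000 < W" by simp
 have "Dl * 1 \<le> Dl * 2 ^ L" by (intro mult_le_mono) auto
 with * show "Dl < W" unfolding Bd_def by linarith
 have "0 < 4 / \<delta>" using delta0 by simp
 then have "0 < real Dl" using Dl by linarith
 then have "1 * 2 ^ L \<le> Dl * 2 ^ L" by (intro mult_le_mono) auto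
 with * show "2 ^ L < W" unfolding Bd_def by linarith
 have "1 * (1000 * (n + m)) \<le> (Dl * 2 ^ L + 1) * (1000 * (n + m))" by (intro mult_le_mono) auto
 then show *: "1000 * (n + m) < W" using W_B by linarith
 show "2 * m < W" "2 * n < W" "n < W" "m < W" "1 < W" using * n2 by simp_all
 have "1 * (Suc L * n) * 1 \<le> Suc NI * (Suc L * n) * (2 * n)" using n4 by (intro mult_le_mono) auto
 then show Ln: "Suc L * n < W" using W_vb by linarith
 have "NI * 1 * 1 \<le> Suc NI * (Suc L * n) * (2 * n)" using n4 by (intro mult_le_mono) auto
 then show "NI < W" using W_vb by linarith
 have "Suc L * 1 \<le> Suc L * n" using n4 by (intro mult_le_mono) auto
 then have "Suc L * 1 < W" using Ln by (rule le_less_trans)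
 then show "L < W" "Suc L < W" by simp_all
 have "1 * (1 * n) * n \<le> Suc NI * (Suc L * n) * (2 * n)" using n4 by (intro mult_le_mono) auto
 then show "n * n < W" using W_vb by linarith
qed

subsection \<open>Rounding of the arc lengths\<close>

lemma four_beta_div_unit: "4 * beta i / unit i j = 4 * 2 ^ j / \<delta>"
 using beta_pos[of i] delta0 by (simp add: unit_def field_simps)

text \<open>\<open>Dl\<close> is strictly larger than \<open>4 / \<delta>\<close>; hence the value
  \<open>Bd j\<close> is taken by frozen lengths only and identifies them.\<close>

lemma Nf_less: "0 \<le> x \<Longrightarrow> x < 4 * beta i \<Longrightarrow> Nf i j x < Bd j"
proof -
 assume x: "0 \<le> x" "x < 4 * beta i"
 have "x / unit i j < 4 * beta i / unit i j"
  by (rule divide_strict_right_mono[OF x(2) unit_pos])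
 then have "x / unit i j < 4 * 2 ^ j / \<delta>" by (simp only: four_beta_div_unit)
 also have "\<dots> = 4 / \<delta> * 2 ^ j" by simp
 also have "\<dots> < real Dl * 2 ^ j" using Dl by (intro mult_strict_right_mono) auto
 finally have "x / unit i j < real (Bd j)" by (simp add: Bd_def)
 moreover have "0 \<le> x / unit i j" using x unit_pos[of i j] by simp
 ultimately have "nat \<lfloor>x / unit i j\<rfloor> < Bd j" by linarith
 then show ?thesis using x by (simp add: Nf_def)
qed

lemma Nf_le: "0 \<le> x \<Longrightarrow> Nf i j x \<le> Bd j"
 using Nf_less[of x i j] by (cases "x < 4 * beta i") (auto simp: Nf_def)

lemma Nf_mono: "0 \<le> x \<Longrightarrow> x \<le> y \<Longrightarrow> Nf i j x \<le> Nf i j y"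
proof (cases "y < 4 * beta i")
 case True
 assume xy: "0 \<le> x" "x \<le> y"
 then have "x / unit i j \<le> y / unit i j" using unit_pos by (intro divide_right_mono) (auto intro: less_imp_le)
 then have "nat \<lfloor>x / unit i j\<rfloor> \<le> nat \<lfloor>y / unit i j\<rfloor>" by (intro nat_mono floor_mono)
 with True xy show ?thesis by (simp add: Nf_def)
next
 case False
 assume xy: "0 \<le> x" "x \<le> y"
 with False Nf_le[of x i j] show ?thesis by (simp add: Nf_def)
qed

lemma Nf_zero: "Nf i j 0 = 0"
 using beta_pos[of i] by (simp add: Nf_def)

text \<open>A value below \<open>Bd j\<close> certifies that the length is not frozen, and then the
  rounded length is an upper bound.\<close>

lemma Nf_length:
 assumes "0 \<le> x" "Nf i j x < Bd j"
 shows "x \<le> (Nf i j x + 1) * unit i j"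
proof -
 have "x < 4 * beta i" using assms by (simp add: Nf_def split: if_splits)
 then have "x / unit i j \<le> Nf i j x + 1" using assms unit_pos[of i j] by (simp add: Nf_def)
 then show ?thesis using unit_pos[of i j] by (simp add: pos_divide_le_eq)
qed

lemma Nf_unit:
 assumes "0 \<le> x" "x < 4 * beta i"
 shows "(Nf i j x + 1) * unit i j \<le> x + unit i j"
proof -
 have "0 \<le> x / unit i j" using assms unit_pos[of i j] by simp
 then have "real (Nf i j x) \<le> x / unit i j" using assms by (simp add: Nf_def)
 then have "Nf i j x * unit i j \<le> x" using unit_pos[of i j] by (simp add: pos_le_divide_eq)
 then show ?thesis by (simp add: algebra_simps)
qed

text \<open>The grids are nested: if the rounded length does not change on the finest grid of scale \<open>i\<close>,
 then it does not change on any grid of a larger scale.\<close>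

lemma Nf_nested:
 assumes x: "0 \<le> x" "x \<le> y" "x < 4 * beta i" "y < 4 * beta i" "y < (Nf i L x + 1) * unit i L"
  and "i \<le> i'" "j \<le> L"
 shows "Nf i' j y = Nf i' j x"
proof -
 \<comment> \<open>The ratio of the two grid widths is a power of two, hence an integer, and the
   floor on the coarse grid is a function of the floor on the fine one.\<close>
 define K where "K = (2::int) ^ ((i' - i) + (L - j))"
 have "unit i' j * 2 ^ L = unit i L * 2 ^ (i' - i) * 2 ^ L * 2 ^ (L - j)"
  using assms by (simp add: unit_def beta_def field_simps flip: power_add)
 then have u: "unit i' j = unit i L * real_of_int K" by (simp add: K_def power_add)
 have fx: "x / unit i L < Nf i L x + 1" "Nf i L x \<le> x / unit i L" "x / unit i L \<le> y / unit i L" "y / unit i L < Nf i L x + 1"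
  using x unit_pos[of i L] by (auto simp: Nf_def divide_right_mono pos_divide_less_eq) 
 have "\<lfloor>x / unit i L\<rfloor> = int (Nf i L x)" "\<lfloor>y / unit i L\<rfloor> = int (Nf i L x)"
  using fx by (auto intro!: floor_unique)
 moreover have "0 \<le> K" by (simp add: K_def)
 ultimately have "\<lfloor>x / unit i L / real_of_int K\<rfloor> = \<lfloor>y / unit i L / real_of_int K\<rfloor>"
  by (simp only: floor_divide_real_eq_div)
 then have "\<lfloor>x / unit i' j\<rfloor> = \<lfloor>y / unit i' j\<rfloor>" unfolding u by (simp only: divide_divide_eq_left)
 moreover have "x < 4 * beta i'" "y < 4 * beta i'" using x beta_mono[OF assms(6)] by linarith+
 ultimately show ?thesis by (simp add: Nf_def)
qed

lemma Nf_changed: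
 assumes "0 \<le> x" "x \<le> y" "x < 4 * beta i" "\<not> (y < (Nf i L x + 1) * unit i L \<and> y < 4 * beta i)"
 shows "Nf i L x < Nf i L y"
proof (cases "y < 4 * beta i")
 case True
 with assms have "(Nf i L x + 1) * unit i L \<le> y" by simp
 then have "real (Nf i L x + 1) \<le> y / unit i L" using unit_pos[of i L] by (simp add: pos_le_divide_eq)
 then have "int (Nf i L x + 1) \<le> \<lfloor>y / unit i L\<rfloor>" by (simp add: le_floor_iff)
 with True show ?thesis by (simp add: Nf_def[of _ _ y])
next
 case False
 with Nf_less[OF assms(1,3)] show ?thesis by (simp add: Nf_def[of _ _ y])
qed

end

section \<open>Repairing the trees of one scale and one level after an arc has become longer\<close>

definition hub_run :: com where
 "hub_run =
  SetW 46 (WCell 9 (WReg 42 [*] WReg 0 [+] WReg 45)) ;;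
  SetW 33 (WReg 46 [mod] WReg 0) ;;
  SetW 30 ((WReg 41 [*] ((WReg 6 [+] WConst 1) [*] WReg 0) [+] WReg 46) [*] (WConst 2 [*] WReg 0)) ;;
  PutW 16 (WConst 0) (WCell 11 (WReg 40)) ;;
  PutW 16 (WConst 1) (WCell 11 (WReg 1 [+] WReg 40)) ;;
  SetW 34 (WConst 2) ;;
  es_run"

text \<open>Registers 40, 41 and 42 hold the arc, the scale and the level, register 45 the position
  in the hub list. The new cost is written for the arc and for its reversed copy.\<close>

definition upd_level :: com where
 "upd_level =
  SetW 31 ((WReg 41 [*] (WReg 6 [+] WConst 1) [+] WReg 42) [*] (WConst 2 [*] WReg 1)) ;;
  SetW 32 (WReg 8 [*] WCell 7 (WReg 42)) ;;
  Cond (RCell 0 (WReg 40) {<} RWord (WConst 4) {*} RCell 2 (WReg 41))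
   (SetW 44 (WFloor (RCell 0 (WReg 40) {/} (RReg 0 {*} RCell 2 (WReg 41) {/} RWord (WCell 7 (WReg 42))))))
   (SetW 44 (WReg 32)) ;;
  Cond (WCell 17 (WReg 31 [+] WReg 40) [<] WReg 44)
   (PutW 17 (WReg 31 [+] WReg 40) (WReg 44) ;;
    PutW 17 (WReg 31 [+] (WReg 1 [+] WReg 40)) (WReg 44) ;;
    SetW 45 (WConst 0) ;;
    While (WReg 45 [<] WCell 8 (WReg 42)) (hub_run ;; SetW 45 (WReg 45 [+] WConst 1)))
   Skip"

lemma mods_hub_run [simp]:
 "mw hub_run = {30, 33, 34, 35, 36, 37, 46}" "mr hub_run = {}" "ma hub_run = {16, 18, 19}" "mb hub_run = {}"
 by (auto simp: hub_run_def)

lemma mods_upd_level [simp]: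
 "mw upd_level = {30, 31, 32, 33, 34, 35, 36, 37, 44, 45, 46}" "mr upd_level = {}"
 "ma upd_level = {16, 17, 18, 19}" "mb upd_level = {}"
 by (auto simp: upd_level_def)

context machine_setup
begin

text \<open>The tables that are built once. Array 8 and the rows of array 9 list the hubs of each
  level, so that a repair visits hubs only instead of all \<open>n\<close> vertices of the
  level.\<close>

definition static :: "machine_state \<Rightarrow> bool" where
 "static s \<longleftrightarrow> adj s \<and> wreg s 0 = n \<and> wreg s 1 = m \<and> wreg s 6 = L \<and> wreg s 7 = NI \<and> wreg s 8 = Dl \<and>
  rreg s 0 = \<delta> \<and> (\<forall>i<NI. rarr s 2 i = beta i) \<and> (\<forall>j\<le>L. warr s 7 j = 2 ^ j) \<and>
  (\<forall>j\<in>{1..L}. warr s 8 j = card (H j) \<and> (\<lambda>r. warr s 9 (j * n + r)) ` {..<card (H j)} = H j) \<and>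
  (\<forall>q\<in>{n..<Suc L * n}. warr s 4 q = (if q \<in> S then 1 else 0))"

lemma static_agrees:
 assumes "static s" "agrees c s s'" "mw c \<inter> {0, 1, 6, 7, 8} = {}" "0 \<notin> mr c" "2 \<notin> mb c"
  "ma c \<inter> {4, 7, 8, 9, 10, 11, 12, 13, 14, 15} = {}"
 shows "static s'"
 using assms adj_agrees[of s c s'] unfolding static_def agrees_def by auto

lemma static_cong:
 assumes "static s" "wreg s' 0 = wreg s 0" "wreg s' 1 = wreg s 1" "wreg s' 6 = wreg s 6" "wreg s' 7 = wreg s 7"
  "wreg s' 8 = wreg s 8" "rreg s' 0 = rreg s 0" "rarr s' 2 = rarr s 2" "warr s' 4 = warr s 4" "warr s' 7 = warr s 7"
  "warr s' 8 = warr s 8" "warr s' 9 = warr s 9" "warr s' 10 = warr s 10" "warr s' 11 = warr s 11"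
  "warr s' 12 = warr s 12" "warr s' 13 = warr s 13" "warr s' 14 = warr s 14" "warr s' 15 = warr s 15"
 shows "static s'"
 using assms(1) unfolding static_def adj_def assms(2-) .

lemma static_wreg [simp]:
 assumes "f 0 = wreg s 0" "f 1 = wreg s 1" "f 6 = wreg s 6" "f 7 = wreg s 7" "f 8 = wreg s 8"
 shows "static (s\<lparr>wreg := f\<rparr>) = static s"
 by (rule iffI; rule static_cong, assumption) (use assms in simp_all)

text \<open>\<open>K\<close> collects the vertices whose label may have lost its support;
  \<open>K = {}\<close> is the stable state between requests.\<close>

definition tree :: "machine_state \<Rightarrow> nat \<Rightarrow> nat \<Rightarrow> nat set \<Rightarrow> bool" where
 "tree s i q K \<longleftrightarrow> es_inv (q mod n) (Bd (q div n)) (sl (warr s 17) (cb i (q div n)))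
  (sl (warr s 18) (vb i q)) (sl (warr s 19) (vb i q)) K"

definition ipot :: "machine_state \<Rightarrow> nat \<Rightarrow> nat \<Rightarrow> nat" where
 "ipot s i q = pot (Bd (q div n)) (sl (warr s 18) (vb i q)) (sl (warr s 19) (vb i q))"

definition treepot :: "machine_state \<Rightarrow> nat" where
 "treepot s = (\<Sum>(i, q)\<in>{..<NI} \<times> S. ipot s i q)"

lemma card_H: "card (H j) \<le> n"
proof -
 have "H j \<subseteq> (\<lambda>w. j * n + w) ` {..<n}"
 proof
  fix q assume q: "q \<in> H j"
  then have "q = j * n + q mod n" "q mod n < n" using n2 by (auto simp: H_def)
  then show "q \<in> (\<lambda>w. j * n + w) ` {..<n}" by blast
 qed
 from card_mono[OF _ this] show ?thesis
  by (simp add: card_image inj_on_def)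
qed

lemma static_n [simp]: "static s \<Longrightarrow> wreg s 0 = n \<and> wreg s 1 = m \<and> wreg s 6 = L \<and> wreg s 7 = NI \<and> wreg s 8 = Dl \<and> rreg s 0 = \<delta>"
 by (simp add: static_def)

lemma static_adj:
 assumes "static s"
 shows "adj s" "a < 2 * m \<Longrightarrow> warr s 10 a = TL a" "a < 2 * m \<Longrightarrow> warr s 11 a = HD a"
proof -
 show adj: "adj s" using assms by (simp only: static_def)
 show "a < 2 * m \<Longrightarrow> warr s 10 a = TL a" "a < 2 * m \<Longrightarrow> warr s 11 a = HD a"
  using adj by (simp_all add: adj_def)
qed

lemma static_hub:
 assumes "static s" "j \<in> {1..L}"
 shows "warr s 8 j = card (H j)" "(\<lambda>r. warr s 9 (j * n + r)) ` {..<card (H j)} = H j"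
  "r < card (H j) \<Longrightarrow> warr s 9 (j * n + r) \<in> H j"
proof -
 show 1: "warr s 8 j = card (H j)" "(\<lambda>r. warr s 9 (j * n + r)) ` {..<card (H j)} = H j"
  using assms unfolding static_def by blast+
 show "r < card (H j) \<Longrightarrow> warr s 9 (j * n + r) \<in> H j" using 1(2) by blast
qed

text \<open>The 200 cover the two stack entries with which \<open>hub_run\<close> starts; potential
  and stack together then fit into a word, as \<open>es_run\<close> requires.\<close>

lemma ipot_le: "tree s i q K \<Longrightarrow> q \<in> S \<Longrightarrow> ipot s i q + 200 < W"
proof -
 assume t: "tree s i q K" and q: "q \<in> S"
 have "ipot s i q + 200 \<le> (Bd (q div n) + 1) * (200 * n + 300 * (2 * m)) + 100 * (2 * m) + 200"
  using pot_le[OF t[unfolded tree_def]] by (simp add: ipot_def)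
 also have "\<dots> \<le> (Bd L + 1) * (200 * n + 300 * (2 * m)) + 100 * (2 * m) + 200"
  using S_bounds[OF q] by (intro add_mono mult_le_mono Bd_mono) auto
 also have "\<dots> \<le> (Bd L + 1) * (200 * n + 300 * (2 * m)) + (Bd L + 1) * (200 * m + 200 * n)"
 proof (subst add.assoc, rule add_left_mono)
  have "100 * (2 * m) + 200 \<le> 1 * (200 * m + 200 * n)" using n2 by simp
  also have "\<dots> \<le> (Bd L + 1) * (200 * m + 200 * n)" by (rule mult_le_mono1) simp
  finally show "100 * (2 * m) + 200 \<le> (Bd L + 1) * (200 * m + 200 * n)" .
 qed
 also have "\<dots> \<le> (Bd L + 1) * (1000 * (n + m))"
  unfolding add_mult_distrib2[symmetric] by (intro mult_le_mono) auto
 finally show ?thesis using W_B by (simp add: Bd_def)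
qed

text \<open>The arc and its reversed copy have become longer together, so their two heads are the
  only doubtful vertices. Label blocks of different trees are disjoint, hence all other trees
  survive in whatever state they are.\<close>

lemma hub_run:
 assumes st: "static s" and r: "wreg s 40 = e" "e < m" "wreg s 41 = i" "i < NI" "wreg s 42 = j" "j \<in> {1..L}"
  and q: "wreg s 45 < card (H j)" "q = warr s 9 (j * n + wreg s 45)" "wreg s 31 = cb i j" "wreg s 32 = Bd j"
  and c: "\<And>a. a < 2 * m \<Longrightarrow> warr s 17 (cb i j + a) \<le> Bd j"
  and tr: "tree s i q {HD e, HD (m + e)}"
 shows "wp W hub_run (\<lambda>t s'. tree s' i q {} \<and>
  (\<forall>i'<NI. \<forall>q'\<in>S. \<forall>K. (i', q') \<noteq> (i, q) \<longrightarrow> tree s i' q' K \<longrightarrow> tree s' i' q' K) \<and>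
  t + treepot s' \<le> treepot s + 300) s"
proof -
 have qH: "q \<in> H j" unfolding q(2) by (rule static_hub(3)[OF st r(6) q(1)])
 then have qS: "q \<in> S" "q div n = j" by (auto simp: H_def)
 note qb = S_bounds[OF qS(1)]
 have e: "e < 2 * m" "m + e < 2 * m" using r by auto
 have jn: "j * n + wreg s 45 < Suc L * n"
 proof -
  have "j * n \<le> L * n" using r by (intro mult_le_mono) auto
  with q(1) card_H[of j] show ?thesis unfolding mult_Suc by linarith
 qed
 have vbl: "vb i q + 2 * n < W" using vb_le[of i q] r qb by simp
 have iq: "i * (Suc L * n) + q \<le> (i * (Suc L * n) + q) * (2 * n)" using n2 by simp
 let ?s = "s\<lparr>warr := (warr s)(16 := (warr s 16)(0 := HD e, 1 := HD (m + e))),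
  wreg := (wreg s)(46 := q, 33 := q mod n, 30 := vb i q, 34 := 2)\<rparr>"
 have st': "stack (warr ?s 16) (wreg ?s 34) = {HD e, HD (m + e)}"
 proof -
  have "{..<2::nat} = {0, 1}" by auto
  then show ?thesis by (simp add: stack_def)
 qed
 have adj: "adj ?s" using static_adj(1)[OF st] by (simp add: adj_def)
 have hd: "warr s 11 e = HD e" "warr s 11 (m + e) = HD (m + e)"
  using static_adj(3)[OF st] e by blast+
 have call: "wp W es_run (\<lambda>t s'. tree s' i q {} \<and>
  (\<forall>i'<NI. \<forall>q'\<in>S. \<forall>K. (i', q') \<noteq> (i, q) \<longrightarrow> tree s i' q' K \<longrightarrow> tree s' i' q' K) \<and>
  t + treepot s' \<le> treepot s + 210) ?s"
 proof (rule wp_call[OF es_run[OF adj, of "vb i q" "cb i j" "Bd j" "q mod n"]])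
  show "wreg ?s 30 = vb i q" "wreg ?s 31 = cb i j" "wreg ?s 32 = Bd j" "wreg ?s 33 = q mod n"
   using q by simp_all
  show "a < 2 * m \<Longrightarrow> warr ?s 17 (cb i j + a) \<le> Bd j" for a using c by simp
  show "es_inv (q mod n) (Bd j) (sl (warr ?s 17) (cb i j)) (sl (warr ?s 18) (vb i q)) (sl (warr ?s 19) (vb i q))
   (stack (warr ?s 16) (wreg ?s 34))"
   unfolding st' using tr qS by (simp add: tree_def)
  show "stack (warr ?s 16) (wreg ?s 34) \<subseteq> {..<2 * n}" unfolding st' using HD_less e by auto
  show "pot (Bd j) (sl (warr ?s 18) (vb i q)) (sl (warr ?s 19) (vb i q)) + 100 * wreg ?s 34 < W"
   using ipot_le[OF tr qS(1)] qS by (simp add: ipot_def)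
  show "vb i q + 2 * n < W" by (rule vbl)
  show "cb i j + 2 * m < W" using cb_le r by auto
  show "2 * Bd j + 2 < W" using W_small(1) Bd_mono[of j] r by auto
 next
  fix t s'
  assume post: "es_inv (q mod n) (Bd j) (sl (warr ?s 17) (cb i j)) (sl (warr s' 18) (vb i q)) (sl (warr s' 19) (vb i q)) {} \<and>
   (\<forall>x. x \<notin> {vb i q..<vb i q + 2 * n} \<longrightarrow> warr s' 18 x = warr ?s 18 x \<and> warr s' 19 x = warr ?s 19 x) \<and>
   t + pot (Bd j) (sl (warr s' 18) (vb i q)) (sl (warr s' 19) (vb i q))
   \<le> pot (Bd j) (sl (warr ?s 18) (vb i q)) (sl (warr ?s 19) (vb i q)) + 100 * wreg ?s 34 + 10"
   and ag: "agrees es_run ?s s'"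
  have c': "warr s' 17 = warr s 17" using ag by (simp add: agrees_def)
  have 1: "tree s' i q {}" using post c' qS by (simp add: tree_def)
  have same: "sl (warr s' 18) (vb i' q') v = sl (warr s 18) (vb i' q') v \<and>
    sl (warr s' 19) (vb i' q') v = sl (warr s 19) (vb i' q') v"
   if "q' \<in> S" "(i', q') \<noteq> (i, q)" "v < 2 * n" for i' q' v
  proof -
   have "vb i' q' + v \<noteq> vb i q + v'" if "v' < 2 * n" for v'
    by (rule vb_disjoint) (use S_bounds(1) \<open>q' \<in> S\<close> qS \<open>(i', q') \<noteq> (i, q)\<close> \<open>v < 2 * n\<close> that in auto)
   then have "vb i' q' + v \<notin> {vb i q..<vb i q + 2 * n}"
    by (metis atLeastLessThan_iff le_add_diff_inverse nat_add_left_cancel_less)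
   with post show ?thesis by (simp add: sl_def)
  qed
  have 2: "tree s' i' q' K" if "i' < NI" "q' \<in> S" "(i', q') \<noteq> (i, q)" "tree s i' q' K" for i' q' K
   using that(4) unfolding tree_def c' by (rule es_inv_cong) (use same that in auto)
  have "treepot s' + ipot s i q = treepot s + ipot s' i q"
   using sum_fun_upd[of "{..<NI} \<times> S" "(i, q)" "\<lambda>(i, q). ipot s' i q" "\<lambda>(i, q). ipot s i q"]
    finite_S r qS same by (auto simp: treepot_def ipot_def intro!: pot_cong)
  moreover have "t + ipot s' i q \<le> ipot s i q + 210" using post qS by (simp add: ipot_def)
  ultimately show "tree s' i q {} \<and>
   (\<forall>i'<NI. \<forall>q'\<in>S. \<forall>K. (i', q') \<noteq> (i, q) \<longrightarrow> tree s i' q' K \<longrightarrow> tree s' i' q' K) \<and>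
   t + treepot s' \<le> treepot s + 210" using 1 2 by auto
 qed
 have "i * (Suc L * n) + q \<le> vb i q" using iq by (simp add: vb_def)
 then have b: "i * (Suc L * n) + q < W" "i * (Suc L * n) < W" "q < W" "q mod n < W" "j * n + wreg s 45 < W" "j * n < W"
  using vbl qb W_small jn by linarith+
 show ?thesis
  unfolding hub_run_def using st r hd W_small e b q vbl
  apply (simp add: vb_def[symmetric] Suc_eq_plus1[of L, symmetric] del: mult_Suc)
  apply (rule wp_call[OF call[unfolded q(2)]])
  apply auto
  done
qed

end

context machine_setup
begin

definition trees_ok :: "machine_state \<Rightarrow> bool" where
 "trees_ok s \<longleftrightarrow> (\<forall>i<NI. \<forall>q\<in>S. tree s i q {})"

definition cost_ok :: "machine_state \<Rightarrow> (nat \<Rightarrow> nat \<Rightarrow> nat \<Rightarrow> nat) \<Rightarrow> bool" where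
 "cost_ok s N \<longleftrightarrow> (\<forall>i<NI. \<forall>j\<in>{1..L}. \<forall>e<m. N i j e \<le> Bd j \<and>
  warr s 17 (cb i j + e) = N i j e \<and> warr s 17 (cb i j + (m + e)) = N i j e)"

text \<open>Each unit by which a rounded length can still grow stores the price of visiting all hubs
  of its level.\<close>

definition cpot :: "(nat \<Rightarrow> nat \<Rightarrow> nat \<Rightarrow> nat) \<Rightarrow> nat" where
 "cpot N = (\<Sum>(i, j, e)\<in>{..<NI} \<times> {1..L} \<times> {..<m}. (Bd j - N i j e) * (400 * card (H j) + 100))"

definition setN :: "(nat \<Rightarrow> nat \<Rightarrow> nat \<Rightarrow> nat) \<Rightarrow> nat \<Rightarrow> nat \<Rightarrow> nat \<Rightarrow> nat \<Rightarrow> nat \<Rightarrow> nat \<Rightarrow> nat \<Rightarrow> nat" where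
 "setN N i j e y = (\<lambda>i' j' e'. if i' = i \<and> j' = j \<and> e' = e then y else N i' j' e')"

lemma regs_irrelevant [simp]:
 "tree (s\<lparr>wreg := f\<rparr>) i q K = tree s i q K" "tree (s\<lparr>rreg := g\<rparr>) i q K = tree s i q K"
 "trees_ok (s\<lparr>wreg := f\<rparr>) = trees_ok s" "trees_ok (s\<lparr>rreg := g\<rparr>) = trees_ok s"
 "cost_ok (s\<lparr>wreg := f\<rparr>) N = cost_ok s N" "cost_ok (s\<lparr>rreg := g\<rparr>) N = cost_ok s N"
 "treepot (s\<lparr>wreg := f\<rparr>) = treepot s" "treepot (s\<lparr>rreg := g\<rparr>) = treepot s"
 by (simp_all add: tree_def trees_ok_def cost_ok_def treepot_def ipot_def)

lemma cost_okD:
 assumes "cost_ok s N" "i < NI" "j \<in> {1..L}" "e < m"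
 shows "N i j e \<le> Bd j" "warr s 17 (cb i j + e) = N i j e" "warr s 17 (cb i j + (m + e)) = N i j e"
 using assms by (simp_all add: cost_ok_def)

lemma cost_ok_le:
 assumes "cost_ok s N" "i < NI" "j \<in> {1..L}" "a < 2 * m"
 shows "warr s 17 (cb i j + a) \<le> Bd j"
proof (cases "a < m")
 case True with cost_okD[OF assms(1-3), of a] show ?thesis by simp
next
 case False
 then have "a = m + (a - m)" "a - m < m" using assms by auto
 with cost_okD[OF assms(1-3), of "a - m"] show ?thesis by (metis)
qed

lemma cpot_setN:
 assumes "i < NI" "j \<in> {1..L}" "e < m" "N i j e < y" "y \<le> Bd j"
 shows "cpot (setN N i j e y) + 400 * card (H j) + 100 \<le> cpot N"
proof -
 let ?G = "\<lambda>(i', j', e'). (Bd j' - setN N i j e y i' j' e') * (400 * card (H j') + 100)"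
 let ?F = "\<lambda>(i, j, e). (Bd j - N i j e) * (400 * card (H j) + 100)"
 have "sum ?G ({..<NI} \<times> {1..L} \<times> {..<m}) + ?F (i, j, e) = sum ?F ({..<NI} \<times> {1..L} \<times> {..<m}) + ?G (i, j, e)"
  by (rule sum_fun_upd) (use assms in \<open>auto simp: setN_def split: if_splits\<close>)
 moreover have "?G (i, j, e) + 1 * (400 * card (H j) + 100) \<le> ?F (i, j, e)"
  using assms unfolding prod.case add_mult_distrib[symmetric] by (intro mult_le_mono1) (simp add: setN_def)
 ultimately show ?thesis by (simp add: cpot_def)
qed

text \<open>If the rounded length grows, \<open>cpot\<close> pays for visiting the hubs, and each
  tree pays for its own changes out of \<open>treepot\<close>. What remains is a constant for
  evaluating the new rounded length.\<close>

lemma upd_level: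
 assumes st: "static s" and tr: "trees_ok s" and co: "cost_ok s N"
  and r: "wreg s 40 = e" "e < m" "wreg s 41 = i" "i < NI" "wreg s 42 = j" "j \<in> {1..L}"
  and x: "x = rarr s 0 e" "0 \<le> x" "N i j e \<le> Nf i j x"
 shows "wp W upd_level (\<lambda>t s'. trees_ok s' \<and> cost_ok s' (setN N i j e (Nf i j x)) \<and>
  t + treepot s' + cpot (setN N i j e (Nf i j x)) \<le> treepot s + cpot N + 150) s"
proof -
 define y where "y = Nf i j x"
 have y: "y \<le> Bd j" "N i j e \<le> y" using x Nf_le by (auto simp: y_def)
 have yW: "y < W" "Bd j < W" using y W_small(1) Bd_mono[of j] r by auto
 have st2: "rarr s 2 i = beta i" "warr s 7 j = 2 ^ j" using st r unfolding static_def by auto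
 have pj: "Dl * 2 ^ j < W" using yW by (simp add: Bd_def)
 have cbl: "cb i j + 2 * m < W" using cb_le r by auto
 have m0: "0 < 2 * m" using m1 by simp
 have "(i * Suc L + j) * 1 \<le> cb i j" unfolding cb_def using m0 by (intro mult_le_mono) auto
 moreover have c': "cb i j < W" using cbl by simp
 ultimately have ij: "i * Suc L + j < W" by (simp only: mult_1_right le_less_trans)
 then have b: "cb i j < W" "i * Suc L + j < W" "i * Suc L < W"
  using c' le_less_trans[OF le_add1 ij] by blast+
 have fl: "x < 4 * beta i \<Longrightarrow> nat \<lfloor>x / (\<delta> * beta i / 2 ^ j)\<rfloor> = y" "\<not> x < 4 * beta i \<Longrightarrow> Bd j = y"
  by (auto simp: y_def Nf_def unit_def)
 note ct = cost_okD[OF co r(4,6,2)]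
 show ?thesis
 proof (cases "N i j e < y")
  case False
  then have "setN N i j e y = N" using y by (auto simp: setN_def fun_eq_iff)
  then show ?thesis
   unfolding upd_level_def y_def[symmetric]
   using st r st2 W_small b cbl pj yW False ct fl x(1) tr co
   by (simp add: cb_def[symmetric] Bd_def[symmetric] Suc_eq_plus1[of L, symmetric] mult.assoc del: mult_Suc mult_Suc_right)
 next
  case True
  define N' where "N' = setN N i j e y"
  let ?s = "s\<lparr>warr := (warr s)(17 := (warr s 17)(cb i j + e := y, cb i j + (m + e) := y)),
   wreg := (wreg s)(31 := cb i j, 32 := Bd j, 44 := y, 45 := 0)\<rparr>"
  have st1: "static ?s" by (rule static_cong[OF st]) simp_all
  have cost_upd: "warr ?s 17 (cb i' j' + a) = (if i' = i \<and> j' = j \<and> (a = e \<or> a = m + e) then y else warr s 17 (cb i' j' + a))"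
   if "j' \<le> L" "a < 2 * m" for i' j' a
  proof (cases "i' = i \<and> j' = j")
   case False
   have "cb i' j' + a \<noteq> cb i j + e" "cb i' j' + a \<noteq> cb i j + (m + e)"
    by (rule cb_disjoint; use False that r in auto)+
   with False show ?thesis by auto
  qed simp
  have co1: "cost_ok ?s N'"
   unfolding cost_ok_def
  proof (intro allI ballI impI)
   fix i' j' e' assume a: "i' < NI" "j' \<in> {1..L}" "e' < m"
   note c = cost_okD[OF co a]
   show "N' i' j' e' \<le> Bd j' \<and> warr ?s 17 (cb i' j' + e') = N' i' j' e' \<and> warr ?s 17 (cb i' j' + (m + e')) = N' i' j' e'"
    unfolding N'_def setN_def using a r c y cost_upd[of j' e' i'] cost_upd[of j' "m + e'" i'] by auto
  qed
  have tree1: "tree ?s i' q' {}" if "i' < NI" "q' \<in> S" "(i', q' div n) \<noteq> (i, j)" for i' q'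
  proof -
   have "tree s i' q' {}" using tr that by (simp add: trees_ok_def)
   then show ?thesis unfolding tree_def
   proof (rule es_inv_cong)
    show "sl (warr ?s 17) (cb i' (q' div n)) a = sl (warr s 17) (cb i' (q' div n)) a" if "a < 2 * m" for a
     unfolding sl_def using cost_upd[of "q' div n" a i'] that S_bounds[OF \<open>q' \<in> S\<close>] \<open>(i', q' div n) \<noteq> (i, j)\<close> by auto
   qed simp_all
  qed
  have jL: "j \<le> L" using r by simp
  have tree2: "tree ?s i q {HD e, HD (m + e)}" if "q \<in> H j" for q
  proof -
   have q: "q \<in> S" "q div n = j" using that by (auto simp: H_def)
   have "tree s i q {}" using tr q r by (simp add: trees_ok_def)
   then have inv: "es_inv (q mod n) (Bd j) (sl (warr s 17) (cb i j)) (sl (warr ?s 18) (vb i q)) (sl (warr ?s 19) (vb i q)) {}"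
    by (simp add: tree_def q)
   have le: "sl (warr s 17) (cb i j) a \<le> sl (warr ?s 17) (cb i j) a" if "a < 2 * m" for a
    unfolding sl_def cost_upd[of j a i, OF jL that] using ct y by auto
   have ne: "HD a \<in> {HD e, HD (m + e)}" if "a < 2 * m" "sl (warr ?s 17) (cb i j) a \<noteq> sl (warr s 17) (cb i j) a" for a
    using that(2) unfolding sl_def cost_upd[of j a i, OF jL that(1)] by (auto split: if_splits)
   show ?thesis unfolding tree_def q
    by (rule es_inv_cost[OF inv le ne])
  qed
  \<comment> \<open>A stable tree satisfies the invariant for every \<open>K\<close>. So the doubt
    about the two heads can be stated for all hubs of the level, repaired or not, and stability in
    addition for those visited so far.\<close>
  let ?T = "\<lambda>s'. (\<forall>i'<NI. \<forall>q\<in>S. (i', q div n) \<noteq> (i, j) \<longrightarrow> tree s' i' q {}) \<and>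
   (\<forall>q\<in>H j. tree s' i q {HD e, HD (m + e)}) \<and> (\<forall>r<wreg s' 45. tree s' i (warr s' 9 (j * n + r)) {})"
  let ?I = "\<lambda>s'. static s' \<and> cost_ok s' N' \<and> wreg s' 45 \<le> card (H j) \<and> ?T s'"
  have loop: "wp W (While (WReg 45 [<] WCell 8 (WReg 42)) (hub_run ;; SetW 45 (WReg 45 [+] WConst 1)))
   (\<lambda>t s'. trees_ok s' \<and> cost_ok s' N' \<and> t + treepot s' \<le> treepot s + 400 * card (H j) + 10) ?s"
  proof (rule wp_while[where I = ?I and F = "\<lambda>s'. treepot s' + 400 * (card (H j) - wreg s' 45)"])
   show "?I ?s" using st1 co1 tree1 tree2 by simp
  next
   fix s' assume I: "?I s'" and ag: "agrees (hub_run ;; SetW 45 (WReg 45 [+] WConst 1)) ?s s'"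
   have r': "wreg s' 40 = e" "wreg s' 41 = i" "wreg s' 42 = j" "wreg s' 31 = cb i j" "wreg s' 32 = Bd j"
    using ag r by (auto simp: agrees_def)
   have h: "warr s' 8 j = card (H j)" using static_hub(1)[of s' j] I r by blast
   have cW: "card (H j) < W" using card_H[of j] W_small by linarith
   let ?q = "warr s' 9 (j * n + wreg s' 45)"
   have body: "wp W hub_run (\<lambda>t s''. static s'' \<and> cost_ok s'' N' \<and> wreg s'' 45 = wreg s' 45 \<and> warr s'' 9 = warr s' 9 \<and>
     (\<forall>i'<NI. \<forall>q\<in>S. (i', q div n) \<noteq> (i, j) \<longrightarrow> tree s'' i' q {}) \<and>
     (\<forall>q\<in>H j. tree s'' i q {HD e, HD (m + e)}) \<and> (\<forall>r\<le>wreg s' 45. tree s'' i (warr s' 9 (j * n + r)) {}) \<and>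
     t + treepot s'' \<le> treepot s' + 300) s'" if less: "wreg s' 45 < card (H j)"
   proof -
    have qH: "?q \<in> H j" using static_hub(3)[of s' j] I r less by blast
    have "tree s' i ?q {HD e, HD (m + e)}" using I qH by blast
    note run = hub_run[of s' e i j ?q, OF _ r'(1) r(2) r'(2) r(4) r'(3) r(6) less refl r'(4,5) _ this]
    show ?thesis
    proof (rule wp_call[OF run])
     show "static s'" using I by blast
     show "a < 2 * m \<Longrightarrow> warr s' 17 (cb i j + a) \<le> Bd j" for a
      using I cost_ok_le[of s' N' i j a] r by blast
    next
     fix t s'' assume post: "tree s'' i ?q {} \<and>
      (\<forall>i'<NI. \<forall>q'\<in>S. \<forall>K. (i', q') \<noteq> (i, ?q) \<longrightarrow> tree s' i' q' K \<longrightarrow> tree s'' i' q' K) \<and>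
      t + treepot s'' \<le> treepot s' + 300" and ag': "agrees hub_run s' s''"
     have keep: "tree s'' i' q' K" if "i' < NI" "q' \<in> S" "tree s' i' q' K" for i' q' K
     proof (cases "(i', q') = (i, ?q)")
      case True
      then have "tree s'' i' q' {}" using post by simp
      then show ?thesis unfolding tree_def by (rule es_inv_mono) simp
     next
      case False then show ?thesis using post that by blast
     qed
     have "static s''" using static_agrees[OF _ ag'] I by auto
     moreover have "warr s'' 17 = warr s' 17" "wreg s'' 45 = wreg s' 45" "warr s'' 9 = warr s' 9"
      using ag' by (auto simp: agrees_def)
     moreover from this have "cost_ok s'' N'" using I by (simp add: cost_ok_def)
     moreover have "tree s'' i (warr s' 9 (j * n + r)) {}" if "r \<le> wreg s' 45" for r
     proof (cases "r = wreg s' 45")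
      case False
      then have "tree s' i (warr s' 9 (j * n + r)) {}" using I that by auto
      moreover have "warr s' 9 (j * n + r) \<in> S"
       using static_hub(3)[of s' j r] I \<open>j \<in> {1..L}\<close> that less H_S by auto
      ultimately show ?thesis using keep \<open>i < NI\<close> by blast
     qed (use post in simp)
     moreover have "\<forall>i'<NI. \<forall>q\<in>S. (i', q div n) \<noteq> (i, j) \<longrightarrow> tree s'' i' q {}"
     proof (intro allI ballI impI)
      fix i' q' assume a: "i' < NI" "q' \<in> S" "(i', q' div n) \<noteq> (i, j)"
      have "tree s' i' q' {}" using I a by blast
      from keep[OF a(1,2) this] show "tree s'' i' q' {}" .
     qed
     moreover have "\<forall>q\<in>H j. tree s'' i q {HD e, HD (m + e)}"
     proof
      fix q' assume a: "q' \<in> H j"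
      then have "tree s' i q' {HD e, HD (m + e)}" using I by blast
      from keep[OF \<open>i < NI\<close> _ this] a show "tree s'' i q' {HD e, HD (m + e)}" by (simp add: H_def)
     qed
     moreover have "t + treepot s'' \<le> treepot s' + 300" using post by blast
     ultimately show "static s'' \<and> cost_ok s'' N' \<and> wreg s'' 45 = wreg s' 45 \<and> warr s'' 9 = warr s' 9 \<and>
      (\<forall>i'<NI. \<forall>q\<in>S. (i', q div n) \<noteq> (i, j) \<longrightarrow> tree s'' i' q {}) \<and>
      (\<forall>q\<in>H j. tree s'' i q {HD e, HD (m + e)}) \<and> (\<forall>r\<le>wreg s' 45. tree s'' i (warr s' 9 (j * n + r)) {}) \<and>
      t + treepot s'' \<le> treepot s' + 300"
      by simp
    qed
   qed
   show "eval_bool W s' (WReg 45 [<] WCell 8 (WReg 42)) \<noteq> None \<and>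
    (eval_bool W s' (WReg 45 [<] WCell 8 (WReg 42)) = Some True \<longrightarrow>
    wp W (hub_run ;; SetW 45 (WReg 45 [+] WConst 1)) (\<lambda>t s''. ?I s'' \<and>
     1 + cost_bool (WReg 45 [<] WCell 8 (WReg 42)) + t + (treepot s'' + 400 * (card (H j) - wreg s'' 45))
     \<le> treepot s' + 400 * (card (H j) - wreg s' 45)) s')"
   proof (cases "wreg s' 45 < card (H j)")
    case True
    then have eq: "card (H j) - wreg s' 45 = Suc (card (H j) - (wreg s' 45 + 1))" by simp
    show ?thesis using r' h
     apply simp
     apply (intro impI)
     apply (rule wp_call[OF body[OF True]])
     using True cW W_small eq
     apply (simp add: less_Suc_eq_le)
     done
   qed (use r' h in simp)
  next
   fix t s' assume I: "?I s'" and t: "t + (treepot s' + 400 * (card (H j) - wreg s' 45))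
    \<le> treepot ?s + 400 * (card (H j) - wreg ?s 45) + 1 + cost_bool (WReg 45 [<] WCell 8 (WReg 42))"
    and e: "eval_bool W s' (WReg 45 [<] WCell 8 (WReg 42)) = Some False"
    and ag: "agrees (hub_run ;; SetW 45 (WReg 45 [+] WConst 1)) ?s s'"
   have "wreg s' 42 = j" using ag r by (auto simp: agrees_def)
   moreover have "warr s' 8 j = card (H j)" using static_hub(1)[of s' j] I r by blast
   ultimately have dn: "wreg s' 45 = card (H j)" using e I by simp
   have "tree s' i' q {}" if "i' < NI" "q \<in> S" for i' q
   proof (cases "(i', q div n) = (i, j)")
    case True
    then have "q \<in> H j" using that by (simp add: H_def)
    then obtain r where "r < card (H j)" "q = warr s' 9 (j * n + r)"
     using static_hub(2)[of s' j] I \<open>j \<in> {1..L}\<close> by blast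
    then show ?thesis using I dn True by auto
   qed (use I that in blast)
   moreover have "treepot ?s = treepot s" by (simp add: treepot_def ipot_def)
   ultimately show "trees_ok s' \<and> cost_ok s' N' \<and> t + treepot s' \<le> treepot s + 400 * card (H j) + 10"
    using I t dn by (simp add: trees_ok_def)
  qed
  have cp: "cpot N' + 400 * card (H j) + 100 \<le> cpot N"
   unfolding N'_def by (rule cpot_setN) (use r True y in auto)
  show ?thesis
  proof (cases "x < 4 * beta i")
   case xl: True
   show ?thesis
    unfolding upd_level_def y_def[symmetric] N'_def[symmetric]
    using st r st2 W_small b cbl pj yW True ct fl(1)[OF xl] xl x(1)
    apply (simp add: cb_def[symmetric] Bd_def[symmetric] Suc_eq_plus1[of L, symmetric] mult.assoc del: mult_Suc mult_Suc_right)
    apply (rule wp_call[OF loop])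
    using cp by auto
  next
   case xl: False
   note By = fl(2)[OF xl]
   show ?thesis
    unfolding upd_level_def y_def[symmetric] N'_def[symmetric]
    using st r st2 W_small b cbl pj yW True ct xl x(1) By
    apply (simp add: cb_def[symmetric] Bd_def[symmetric] Suc_eq_plus1[of L, symmetric] mult.assoc del: mult_Suc mult_Suc_right)
    apply (rule wp_call[OF loop[unfolded By]])
    using cp by auto
  qed
 qed
qed

end

section \<open>Passing an increase on to larger scales, and the classes of the arcs\<close>

definition scale_loop :: com where
 "scale_loop =
  While (BAnd (WReg 41 [<] WReg 7)
    (BNot (BAnd
     (RCell 0 (WReg 40) {<}
      (RWord (WCell 17 ((WReg 41 [*] (WReg 6 [+] WConst 1) [+] WReg 6) [*] (WConst 2 [*] WReg 1) [+] WReg 40)) {+} RWord (WConst 1))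
      {*} (RReg 0 {*} RCell 2 (WReg 41) {/} RWord (WCell 7 (WReg 6))))
     (RCell 0 (WReg 40) {<} RWord (WConst 4) {*} RCell 2 (WReg 41)))))
   (SetW 42 (WConst 1) ;;
    While (WReg 42 [\<le>] WReg 6) (upd_level ;; SetW 42 (WReg 42 [+] WConst 1)) ;;
    SetW 41 (WReg 41 [+] WConst 1))"

text \<open>Array 22 holds the class of each arc, array 23 the same classes sorted within blocks of
  \<open>n\<close> cells. The search for an entry equal to the old class starts at the right end of
  the block, because increasing the last such entry keeps the block sorted.\<close>

definition bump_class :: com where
 "bump_class =
  SetW 47 (WCell 22 (WReg 40)) ;;
  SetW 48 ((WReg 40 [div] WReg 0 [+] WConst 1) [*] WReg 0) ;;
  While (BNot (WCell 23 (WReg 48 [-] WConst 1) [=] WReg 47)) (SetW 48 (WReg 48 [-] WConst 1)) ;;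
  PutW 23 (WReg 48 [-] WConst 1) (WReg 47 [+] WConst 1) ;;
  PutW 22 (WReg 40) (WReg 47 [+] WConst 1)"

definition class_loop :: com where
 "class_loop =
  While (BAnd (WCell 22 (WReg 40) [<] WReg 7)
    (BNot (RCell 0 (WReg 40) {<} RWord (WConst 4) {*} RCell 2 (WCell 22 (WReg 40)))))
   bump_class"

definition upd :: com where
 "upd = SetW 41 (WCell 22 (WReg 40)) ;; scale_loop ;; class_loop"

lemma mods_scale_loop [simp]:
 "mw scale_loop = {30, 31, 32, 33, 34, 35, 36, 37, 41, 42, 44, 45, 46}" "mr scale_loop = {}"
 "ma scale_loop = {16, 17, 18, 19}" "mb scale_loop = {}"
 by (auto simp: scale_loop_def)

lemma mods_class_loop [simp]:
 "mw class_loop = {47, 48}" "mr class_loop = {}" "ma class_loop = {22, 23}" "mb class_loop = {}"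
 by (auto simp: class_loop_def bump_class_def)

lemma mods_bump_class [simp]:
 "mw bump_class = {47, 48}" "mr bump_class = {}" "ma bump_class = {22, 23}" "mb bump_class = {}"
 by (auto simp: bump_class_def)

lemma mods_upd [simp]:
 "mw upd = {30, 31, 32, 33, 34, 35, 36, 37, 41, 42, 44, 45, 46, 47, 48}" "mr upd = {}"
 "ma upd = {16, 17, 18, 19, 22, 23}" "mb upd = {}"
 by (auto simp: upd_def)

context machine_setup
begin

text \<open>The class of a length is the smallest scale at which it can matter.\<close>

definition cl :: "real \<Rightarrow> nat" where
 "cl x = (LEAST i. i = NI \<or> x < 4 * beta i)"

lemma cl_le: "cl x \<le> NI"
 unfolding cl_def by (rule Least_le) simp

lemma cl_less: "cl x < NI \<Longrightarrow> x < 4 * beta (cl x)"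
 using LeastI[of "\<lambda>i. i = NI \<or> x < 4 * beta i" NI] by (auto simp: cl_def)

lemma below_cl: "i < cl x \<Longrightarrow> 4 * beta i \<le> x"
 using not_less_Least[of i "\<lambda>i. i = NI \<or> x < 4 * beta i"] by (auto simp: cl_def)

lemma cl_eqI:
 assumes "k \<le> NI" "k = NI \<or> x < 4 * beta k" "\<And>i. i < k \<Longrightarrow> 4 * beta i \<le> x"
 shows "cl x = k"
 unfolding cl_def
proof (rule Least_equality)
 fix i assume "i = NI \<or> x < 4 * beta i"
 then show "k \<le> i" using assms(1) assms(3)[of i] by (meson leD not_le_imp_less)
qed (use assms in simp)

lemma cl_mono: "x \<le> y \<Longrightarrow> cl x \<le> cl y"
 using below_cl[of "cl y" x] cl_less[of y] cl_le[of x] by (cases "cl y < cl x") auto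

lemma cost_ok_cong:
 assumes "cost_ok s N" "\<And>i j e. i < NI \<Longrightarrow> j \<in> {1..L} \<Longrightarrow> e < m \<Longrightarrow> N' i j e = N i j e"
 shows "cost_ok s N'"
 using assms by (simp add: cost_ok_def)

lemma cpot_cong:
 assumes "\<And>i j e. i < NI \<Longrightarrow> j \<in> {1..L} \<Longrightarrow> e < m \<Longrightarrow> N' i j e = N i j e"
 shows "cpot N' = cpot N"
 unfolding cpot_def by (rule sum.cong) (auto simp: assms)

text \<open>A pass over the levels of a scale costs time proportional to \<open>L\<close> even where
  no coarser rounded length changes. The price is stored with the rounded lengths on the finest
  grid, whose growth triggers the pass.\<close>

definition cpotL :: "(nat \<Rightarrow> nat \<Rightarrow> nat \<Rightarrow> nat) \<Rightarrow> nat" where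
 "cpotL N = (\<Sum>(i, e)\<in>{..<NI} \<times> {..<m}. (Bd L - N i L e) * (400 * (L + 1)))"

lemma cpotL_cong:
 assumes "\<And>i e. i < NI \<Longrightarrow> e < m \<Longrightarrow> N' i L e = N i L e"
 shows "cpotL N' = cpotL N"
 unfolding cpotL_def by (rule sum.cong) (auto simp: assms)

lemma cpotL_step:
 assumes "i < NI" "e < m" "N i L e < N' i L e" "N' i L e \<le> Bd L"
  and "\<And>i' e'. (i', e') \<noteq> (i, e) \<Longrightarrow> N' i' L e' = N i' L e'"
 shows "cpotL N' + 400 * (L + 1) \<le> cpotL N"
proof -
 let ?G = "\<lambda>(i, e). (Bd L - N' i L e) * (400 * (L + 1))"
 let ?F = "\<lambda>(i, e). (Bd L - N i L e) * (400 * (L + 1))"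
 have "sum ?G ({..<NI} \<times> {..<m}) + ?F (i, e) = sum ?F ({..<NI} \<times> {..<m}) + ?G (i, e)"
 proof (rule sum_fun_upd)
  fix y assume "y \<in> {..<NI} \<times> {..<m}" "y \<noteq> (i, e)"
  then show "?G y = ?F y" using assms(5)[of "fst y" "snd y"] by (cases y) simp
 qed (use assms in auto)
 moreover have "?G (i, e) + 1 * (400 * (L + 1)) \<le> ?F (i, e)"
  using assms unfolding prod.case add_mult_distrib[symmetric] by (intro mult_le_mono1) simp
 ultimately show ?thesis by (simp add: cpotL_def)
qed

text \<open>\<open>N' k\<close> is the table after the levels below \<open>k\<close> have been
  updated. The assumption \<open>N0\<close> on level 0 makes \<open>N' 1\<close> coincide with
  \<open>N\<close>, the state before the loop.\<close>

lemma level_loop: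
 fixes N :: "nat \<Rightarrow> nat \<Rightarrow> nat \<Rightarrow> nat"
 assumes st: "static s" and tr: "trees_ok s" and co: "cost_ok s N"
  and r: "wreg s 40 = e" "e < m" "wreg s 41 = i" "i < NI" "wreg s 42 = 1"
  and x: "x = rarr s 0 e" "0 \<le> x" "\<And>j. j \<in> {1..L} \<Longrightarrow> N i j e \<le> Nf i j x"
 defines "N' \<equiv> \<lambda>k i' j e'. if i' = i \<and> e' = e \<and> j < k then Nf i' j x else N i' j e'"
 assumes N0: "N i 0 e = Nf i 0 x"
 shows "wp W (While (WReg 42 [\<le>] WReg 6) (upd_level ;; SetW 42 (WReg 42 [+] WConst 1)))
  (\<lambda>t s'. static s' \<and> trees_ok s' \<and> cost_ok s' (N' (L + 1)) \<and>
   t + treepot s' + cpot (N' (L + 1)) \<le> treepot s + cpot N + 200 * L + 20) s"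
proof (rule wp_while[where I = "\<lambda>s'. static s' \<and> trees_ok s' \<and> cost_ok s' (N' (wreg s' 42)) \<and> wreg s' 42 \<in> {1..L+1}"
  and F = "\<lambda>s'. treepot s' + cpot (N' (wreg s' 42)) + 200 * (L + 1 - wreg s' 42)"])
 have N1: "N' 1 = N" using N0 by (auto simp: N'_def fun_eq_iff)
 then show "static s \<and> trees_ok s \<and> cost_ok s (N' (wreg s 42)) \<and> wreg s 42 \<in> {1..L+1}"
  using assms by simp
 fix s' assume I: "static s' \<and> trees_ok s' \<and> cost_ok s' (N' (wreg s' 42)) \<and> wreg s' 42 \<in> {1..L+1}"
  and ag: "agrees (upd_level ;; SetW 42 (WReg 42 [+] WConst 1)) s s'"
 have r': "wreg s' 40 = e" "wreg s' 41 = i" "rarr s' 0 e = x" using ag r x by (auto simp: agrees_def)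
 define j where "j = wreg s' 42"
 show "eval_bool W s' (WReg 42 [\<le>] WReg 6) \<noteq> None \<and> (eval_bool W s' (WReg 42 [\<le>] WReg 6) = Some True \<longrightarrow>
  wp W (upd_level ;; SetW 42 (WReg 42 [+] WConst 1)) (\<lambda>t s''.
   (static s'' \<and> trees_ok s'' \<and> cost_ok s'' (N' (wreg s'' 42)) \<and> wreg s'' 42 \<in> {1..L+1}) \<and>
   1 + cost_bool (WReg 42 [\<le>] WReg 6) + t + (treepot s'' + cpot (N' (wreg s'' 42)) + 200 * (L + 1 - wreg s'' 42))
   \<le> treepot s' + cpot (N' (wreg s' 42)) + 200 * (L + 1 - wreg s' 42)) s')"
 proof (cases "j \<le> L")
  case True
  then have j: "j \<in> {1..L}" using I by (simp add: j_def)
  have set: "setN (N' j) i j e (Nf i j x) = N' (j + 1)"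
   by (auto simp: setN_def N'_def fun_eq_iff less_Suc_eq simp flip: Suc_eq_plus1)
  have le: "N' j i j e \<le> Nf i j x" using x(3)[OF j] by (simp add: N'_def)
  have I': "static s'" "trees_ok s'" "cost_ok s' (N' j)" using I by (auto simp: j_def)
  note lv = upd_level[OF I' r'(1) r(2) r'(2) r(4) j_def[symmetric] j r'(3)[symmetric] x(2) le, unfolded set]
  have eq: "200 * (L + 1 - j) = 200 + 200 * (L - j)" using j by auto
  have stk: "agrees upd_level s' s'' \<Longrightarrow> static s''" for s''
   by (rule static_agrees[OF I'(1), of upd_level]) simp_all
  show ?thesis using I'(1) j W_small
   apply (simp add: j_def[symmetric])
   apply (rule wp_call[OF lv])
   apply (frule stk)
   using eq by (auto simp: agrees_def j_def)
 next
  case False then show ?thesis using I by (simp add: j_def)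
 qed
next
 fix t s' assume I: "static s' \<and> trees_ok s' \<and> cost_ok s' (N' (wreg s' 42)) \<and> wreg s' 42 \<in> {1..L+1}"
  and e: "eval_bool W s' (WReg 42 [\<le>] WReg 6) = Some False"
  and t: "t + (treepot s' + cpot (N' (wreg s' 42)) + 200 * (L + 1 - wreg s' 42))
   \<le> treepot s + cpot (N' (wreg s 42)) + 200 * (L + 1 - wreg s 42) + 1 + cost_bool (WReg 42 [\<le>] WReg 6)"
 have N1: "N' 1 = N" using N0 by (auto simp: N'_def fun_eq_iff)
 have "wreg s' 42 = L + 1" using e I by auto
 then show "static s' \<and> trees_ok s' \<and> cost_ok s' (N' (L + 1)) \<and>
   t + treepot s' + cpot (N' (L + 1)) \<le> treepot s + cpot N + 200 * L + 20"
  using I t r N1 by simp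
qed

definition Nl :: "(nat \<Rightarrow> real) \<Rightarrow> nat \<Rightarrow> nat \<Rightarrow> nat \<Rightarrow> nat" where
 "Nl l i j e = Nf i j (l e)"

text \<open>Below the class of the old length everything is frozen, so the loop starts at that
  class. The stored cost on the finest grid tells whether the new length has left its cell. If so,
  the growth on that grid pays for the pass; if not, the nesting of the grids settles this scale and
  all larger ones at once.\<close>

lemma scale_loop:
 assumes st: "static s" and tr: "trees_ok s" and co: "cost_ok s (Nl l)"
  and r: "wreg s 40 = e" "e < m" "wreg s 41 = cl (l e)"
  and x: "x = rarr s 0 e" "0 \<le> l e" "l e \<le> x"
 shows "wp W scale_loop (\<lambda>t s'. static s' \<and> trees_ok s' \<and> cost_ok s' (Nl (l(e := x))) \<and>
  t + treepot s' + cpot (Nl (l(e := x))) + cpotL (Nl (l(e := x))) \<le> treepot s + cpot (Nl l) + cpotL (Nl l) + 60) s"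
proof -
 let ?c = "cl (l e)"
 \<comment> \<open>The rounded lengths at the moment when the scales below \<open>k\<close> already
   reflect the new length of \<open>e\<close>.\<close>
 define M where "M = (\<lambda>k i j e'. if e' = e \<and> i < k then Nf i j x else Nf i j (l e'))"
 let ?b = "BAnd (WReg 41 [<] WReg 7)
    (BNot (BAnd
     (RCell 0 (WReg 40) {<}
      (RWord (WCell 17 ((WReg 41 [*] (WReg 6 [+] WConst 1) [+] WReg 6) [*] (WConst 2 [*] WReg 1) [+] WReg 40)) {+} RWord (WConst 1))
      {*} (RReg 0 {*} RCell 2 (WReg 41) {/} RWord (WCell 7 (WReg 6))))
     (RCell 0 (WReg 40) {<} RWord (WConst 4) {*} RCell 2 (WReg 41))))"
 let ?body = "SetW 42 (WConst 1) ;;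
    While (WReg 42 [\<le>] WReg 6) (upd_level ;; SetW 42 (WReg 42 [+] WConst 1)) ;;
    SetW 41 (WReg 41 [+] WConst 1)"
 let ?I = "\<lambda>s'. static s' \<and> trees_ok s' \<and> cost_ok s' (M (wreg s' 41)) \<and> wreg s' 41 \<in> {?c..NI}"
 let ?F = "\<lambda>s'. treepot s' + cpot (M (wreg s' 41)) + cpotL (M (wreg s' 41))"
 have x0: "0 \<le> x" using x by simp
 have Mc: "M ?c i j e' = Nl l i j e'" for i j e'
 proof (cases "i < ?c \<and> e' = e")
  case True
  then have "4 * beta i \<le> l e" using below_cl by blast
  with True x show ?thesis by (simp add: M_def Nl_def Nf_def)
 qed (auto simp: M_def Nl_def)
 have MNI: "M NI i j e' = Nl (l(e := x)) i j e'" if "i < NI" for i j e'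
  using that by (simp add: M_def Nl_def)
 have ev: "eval_bool W s' ?b = Some (wreg s' 41 < NI \<and> \<not> (x < (Nf (wreg s' 41) L (l e) + 1) * unit (wreg s' 41) L \<and> x < 4 * beta (wreg s' 41)))"
  if I: "?I s'" and ag: "agrees ?body s s'" for s'
 proof -
  define i where "i = wreg s' 41"
  have i: "i \<le> NI" using I by (simp add: i_def)
  have r': "wreg s' 40 = e" "rarr s' 0 e = x" using ag r x by (auto simp: agrees_def)
  have cbl: "cb i L + 2 * m < W" using cb_le i by auto
  have m0: "0 < 2 * m" using m1 by simp
  have "(i * Suc L + L) * 1 \<le> cb i L" unfolding cb_def using m0 by (intro mult_le_mono) auto
  moreover have c': "cb i L < W" using cbl by simp
  ultimately have ij: "i * Suc L + L < W" by (simp only: mult_1_right le_less_trans)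
  have b: "i * Suc L < W" "cb i L + e < W" using le_less_trans[OF le_add1 ij] cbl r by auto
  show ?thesis
  proof (cases "i < NI")
   case True
   then have st2: "rarr s' 2 i = beta i" "warr s' 7 L = 2 ^ L" using I unfolding static_def by auto
   have "warr s' 17 (cb i L + e) = Nf i L (l e)"
    using cost_okD(2)[of s' "M i" i L e] I True L1 r by (simp add: M_def i_def)
   then show ?thesis
    using I True st2 W_small ij b r' c'
    by (simp add: i_def[symmetric] cb_def[symmetric] unit_def Suc_eq_plus1[of L, symmetric] del: mult_Suc mult_Suc_right)
  next
   case False
   then show ?thesis
    using I W_small ij b r' c'
    by (simp add: i_def[symmetric] cb_def[symmetric] Suc_eq_plus1[of L, symmetric] del: mult_Suc mult_Suc_right)
  qed
 qed
 show ?thesis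
  unfolding scale_loop_def
 proof (rule wp_while[where I = ?I and F = ?F])
  show "?I s" using st tr co r Mc cl_le by (auto intro: cost_ok_cong)
  fix s' assume I: "?I s'" and ag: "agrees ?body s s'"
  define i where "i = wreg s' 41"
  have r': "wreg s' 40 = e" "rarr s' 0 e = x" using ag r x by (auto simp: agrees_def)
  show "eval_bool W s' ?b \<noteq> None \<and> (eval_bool W s' ?b = Some True \<longrightarrow>
   wp W ?body (\<lambda>t s''. ?I s'' \<and> 1 + cost_bool ?b + t + ?F s'' \<le> ?F s') s')"
   unfolding ev[OF I ag]
  proof (intro conjI impI)
   assume "Some (wreg s' 41 < NI \<and> \<not> (x < (Nf (wreg s' 41) L (l e) + 1) * unit (wreg s' 41) L \<and> x < 4 * beta (wreg s' 41))) = Some True"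
   then have iN: "i < NI" and ch: "\<not> (x < (Nf i L (l e) + 1) * unit i L \<and> x < 4 * beta i)"
    by (auto simp: i_def)
   have li: "l e < 4 * beta i"
   proof -
    have "?c \<le> i" using I by (simp add: i_def)
    with cl_less[of "l e"] iN beta_mono[of ?c i] show ?thesis by simp
   qed
   have gr: "Nf i L (l e) < Nf i L x" by (rule Nf_changed) (use x li ch in auto)
   let ?s = "s'\<lparr>wreg := (wreg s')(42 := 1)\<rparr>"
   have ll: "wp W (While (WReg 42 [\<le>] WReg 6) (upd_level ;; SetW 42 (WReg 42 [+] WConst 1)))
    (\<lambda>t s''. static s'' \<and> trees_ok s'' \<and> cost_ok s'' (M (i + 1)) \<and> t + treepot s'' + cpot (M (i + 1)) \<le> treepot s' + cpot (M i) + 200 * L + 20) ?s"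
   \<comment> \<open>The table is adjusted at level 0 to meet the premise of
     \<open>level_loop\<close>; this is invisible to \<open>cost_ok\<close> and \<open>cpot\<close>,
     which start at level 1.\<close>
   proof (rule wp_call[OF level_loop[where N = "\<lambda>i' j e'. if i' = i \<and> e' = e \<and> j = 0 then Nf i j x else M i i' j e'" and e = e and i = i and x = x]])
    show "static ?s" "trees_ok ?s" using I by simp_all
    have "cost_ok s' (M i)" using I by (simp add: i_def)
    then show "cost_ok ?s (\<lambda>i' j e'. if i' = i \<and> e' = e \<and> j = 0 then Nf i j x else M i i' j e')"
     by (auto intro: cost_ok_cong)
    show "wreg ?s 40 = e" "e < m" "wreg ?s 41 = i" "i < NI" "wreg ?s 42 = 1" "x = rarr ?s 0 e" "0 \<le> x"
     using r' r iN x0 by (auto simp: i_def)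
    show "(if i = i \<and> e = e \<and> j = 0 then Nf i j x else M i i j e) \<le> Nf i j x" if "j \<in> {1..L}" for j
     using Nf_mono[of "l e" x i j] x by (simp add: M_def)
   next
    fix t s'' assume post: "static s'' \<and> trees_ok s'' \<and> cost_ok s'' (\<lambda>i' j e'. if i' = i \<and> e' = e \<and> j < L + 1 then Nf i' j x
      else if i' = i \<and> e' = e \<and> j = 0 then Nf i j x else M i i' j e') \<and>
     t + treepot s'' + cpot (\<lambda>i' j e'. if i' = i \<and> e' = e \<and> j < L + 1 then Nf i' j x
      else if i' = i \<and> e' = e \<and> j = 0 then Nf i j x else M i i' j e')
     \<le> treepot ?s + cpot (\<lambda>i' j e'. if i' = i \<and> e' = e \<and> j = 0 then Nf i j x else M i i' j e') + 200 * L + 20"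
    have "cpot (\<lambda>i' j e'. if i' = i \<and> e' = e \<and> j < L + 1 then Nf i' j x
      else if i' = i \<and> e' = e \<and> j = 0 then Nf i j x else M i i' j e') = cpot (M (i + 1))"
     by (rule cpot_cong) (auto simp: M_def)
    moreover have "cpot (\<lambda>i' j e'. if i' = i \<and> e' = e \<and> j = 0 then Nf i j x else M i i' j e') = cpot (M i)"
     by (rule cpot_cong) auto
    moreover have "cost_ok s'' (M (i + 1))"
     by (rule cost_ok_cong[OF conjunct1[OF conjunct2[OF conjunct2[OF post]]]]) (auto simp: M_def)
    ultimately show "static s'' \<and> trees_ok s'' \<and> cost_ok s'' (M (i + 1)) \<and> t + treepot s'' + cpot (M (i + 1)) \<le> treepot s' + cpot (M i) + 200 * L + 20"
     using post by simp
   qed simp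
   have cl: "cpotL (M (i + 1)) + 400 * (L + 1) \<le> cpotL (M i)"
    by (rule cpotL_step[of i e]) (use gr iN r Nf_le[OF x0] in \<open>auto simp: M_def\<close>)
   show "wp W ?body (\<lambda>t s''. ?I s'' \<and> 1 + cost_bool ?b + t + ?F s'' \<le> ?F s') s'"
    using W_small
    apply simp
    apply (rule wp_call[OF ll])
    using cl iN W_small I by (auto simp: agrees_def i_def[symmetric])
  qed simp
 next
  fix t s' assume I: "?I s'" and ag: "agrees ?body s s'" and e: "eval_bool W s' ?b = Some False"
   and t: "t + ?F s' \<le> ?F s + 1 + cost_bool ?b"
  define i where "i = wreg s' 41"
  have eq: "M i i' j e' = Nl (l(e := x)) i' j e'" if "i' < NI" "j \<in> {1..L}" for i' j e'
  proof (cases "i < NI \<and> i \<le> i' \<and> e' = e")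
   case True
   then have ch: "x < (Nf i L (l e) + 1) * unit i L" "x < 4 * beta i" using e ev[OF I ag] by (auto simp: i_def)
   have "Nf i' j x = Nf i' j (l e)"
    by (rule Nf_nested[of _ _ i]) (use True x ch that in auto)
   with True show ?thesis by (simp add: M_def Nl_def)
  next
   case False
   then show ?thesis using that I by (auto simp: M_def Nl_def i_def)
  qed
  have "cost_ok s' (Nl (l(e := x)))" by (rule cost_ok_cong[of _ "M i"]) (use I eq in \<open>auto simp: i_def\<close>)
  moreover have "cpot (Nl (l(e := x))) = cpot (M i)" "cpotL (Nl (l(e := x))) = cpotL (M i)"
   using eq L1 by (auto intro!: cpot_cong cpotL_cong)
  moreover have "cpot (M (wreg s 41)) = cpot (Nl l)" "cpotL (M (wreg s 41)) = cpotL (Nl l)"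
   using Mc r by (auto intro!: cpot_cong cpotL_cong)
  ultimately show "static s' \<and> trees_ok s' \<and> cost_ok s' (Nl (l(e := x))) \<and>
   t + treepot s' + cpot (Nl (l(e := x))) + cpotL (Nl (l(e := x))) \<le> treepot s + cpot (Nl l) + cpotL (Nl l) + 60"
   using I t by (simp add: i_def)
 qed
qed

end

text \<open>The value \<open>k\<close> may sit at different positions in the two families; as
  multisets both just exchange one \<open>k\<close> for \<open>y\<close>.\<close>

lemma image_mset_upd:
 assumes "finite A" "x \<in> A" "f x = k" "z \<in> A" "h z = k" "image_mset f (mset_set A) = image_mset h (mset_set A)"
 shows "image_mset (f(x := y)) (mset_set A) = image_mset (h(z := y)) (mset_set A)"
proof -
 have upd: "image_mset (f(x := y)) (mset_set A) = add_mset y (image_mset f (mset_set A) - {#k#})"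
  if "x \<in> A" "f x = k" for f :: "'a \<Rightarrow> 'b" and x
 proof -
  have "mset_set A = add_mset x (mset_set (A - {x}))" using assms(1) that by (simp add: mset_set.remove)
  moreover have "image_mset (f(x := y)) (mset_set (A - {x})) = image_mset f (mset_set (A - {x}))"
   by (rule image_mset_cong) (use assms(1) in auto)
  ultimately show ?thesis using that by simp
 qed
 show ?thesis using upd[of x f] upd[of z h] assms by simp
qed

context machine_setup
begin

text \<open>There are \<open>n\<close> blocks of \<open>n\<close> cells, enough for all arcs because
  \<open>m \<le> n * n\<close>. A binary search in each sorted block finds the largest admissible
  class in nearly linear time, whereas one globally sorted array would be too expensive to maintain
  by linear search.\<close>

definition cls_ok :: "machine_state \<Rightarrow> (nat \<Rightarrow> nat) \<Rightarrow> bool" where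
 "cls_ok s c \<longleftrightarrow> (\<forall>e<m. warr s 22 e = c e) \<and>
  (\<forall>g<n. \<forall>p p'. p \<le> p' \<longrightarrow> p' < n \<longrightarrow> warr s 23 (g * n + p) \<le> warr s 23 (g * n + p')) \<and>
  (\<forall>g<n. image_mset (\<lambda>p. warr s 23 (g * n + p)) (mset_set {..<n}) =
      image_mset (\<lambda>p. warr s 22 (g * n + p)) (mset_set {..<n}))"

lemma block_eq:
 assumes "(p::nat) < n" "p' < n"
 shows "g * n + p = g' * n + p' \<longleftrightarrow> g = g' \<and> p = p'"
proof
 assume eq: "g * n + p = g' * n + p'"
 have "(g * n + p) div n = g" "(g' * n + p') div n = g'" using assms by auto
 with eq show "g = g' \<and> p = p'" by auto
qed simp

lemma bump_class:
 assumes st: "static s" and c: "cls_ok s c" and e: "wreg s 40 = e" "e < m" "c e < NI"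
 shows "wp W bump_class (\<lambda>t s'. cls_ok s' (c(e := c e + 1)) \<and> t \<le> 60 * n + 60) s"
proof -
 define k where "k = c e"
 define g where "g = e div n"
 define f where "f = warr s 23"
 have gn: "g < n" unfolding g_def using e(2) mnn by (intro less_mult_imp_div_less) simp
 have eg: "e = g * n + e mod n" "e mod n < n" using n2 by (auto simp: g_def)
 have we: "warr s 22 e = k" using c e by (simp add: cls_ok_def k_def)
 have ms: "image_mset (\<lambda>p. f (g * n + p)) (mset_set {..<n}) = image_mset (\<lambda>p. warr s 22 (g * n + p)) (mset_set {..<n})"
  using c gn by (simp add: cls_ok_def f_def)
 \<comment> \<open>The old class occurs among the classes of the block, hence also in its sorted
   version; the search cannot run past that position \<open>p0\<close>.\<close>
 have "k \<in># image_mset (\<lambda>p. warr s 22 (g * n + p)) (mset_set {..<n})"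
  using eg we by (auto intro!: image_eqI[of _ _ "e mod n"])
 then obtain p0 where p0: "p0 < n" "f (g * n + p0) = k" unfolding ms[symmetric] by auto
 have gnW: "(g + 1) * n < W" "g * n + n < W"
 proof -
  have "(g + 1) * n \<le> n * n" using gn by (intro mult_le_mono1) simp
  then show "(g + 1) * n < W" using W_small by linarith
  then show "g * n + n < W" by (simp add: add_mult_distrib)
 qed
 let ?s = "s\<lparr>wreg := (wreg s)(47 := k, 48 := g * n + n)\<rparr>"
 let ?post = "\<lambda>t s'. \<exists>r. wreg s' 48 = g * n + r \<and> 0 < r \<and> r \<le> n \<and> f (g * n + (r - 1)) = k \<and>
   (\<forall>p. r \<le> p \<longrightarrow> p < n \<longrightarrow> f (g * n + p) \<noteq> k) \<and> t \<le> 40 * n + 20"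
 have loop: "wp W (While (BNot (WCell 23 (WReg 48 [-] WConst 1) [=] WReg 47)) (SetW 48 (WReg 48 [-] WConst 1))) ?post ?s"
 proof (rule wp_while[where I = "\<lambda>s'. \<exists>r. wreg s' 48 = g * n + r \<and> p0 < r \<and> r \<le> n \<and>
    (\<forall>p. r \<le> p \<longrightarrow> p < n \<longrightarrow> f (g * n + p) \<noteq> k)" and F = "\<lambda>s'. 40 * (wreg s' 48 - g * n)"])
  fix s' assume "\<exists>r. wreg s' 48 = g * n + r \<and> p0 < r \<and> r \<le> n \<and> (\<forall>p. r \<le> p \<longrightarrow> p < n \<longrightarrow> f (g * n + p) \<noteq> k)"
   and ag: "agrees (SetW 48 (WReg 48 [-] WConst 1)) ?s s'"
  then obtain r where r: "wreg s' 48 = g * n + r" "p0 < r" "r \<le> n" "\<forall>p. r \<le> p \<longrightarrow> p < n \<longrightarrow> f (g * n + p) \<noteq> k" by blast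
  obtain r' where r': "r = Suc r'" using r(2) by (cases r) auto
  have rr: "warr s' 23 = f" "wreg s' 47 = k" using ag by (auto simp: agrees_def f_def)
  have "wreg s' 48 - 1 = g * n + r'" using r(1) r' by simp
  moreover have "g * n + r' < W" using gnW r(3) r' by simp
  moreover have "p0 < r' \<and> (\<forall>p. r' \<le> p \<longrightarrow> p < n \<longrightarrow> f (g * n + p) \<noteq> k)" if "f (g * n + r') \<noteq> k"
  proof -
   have "p0 \<noteq> r'" using that p0 by auto
   then have "p0 < r'" using r(2) r' by simp
   moreover have "f (g * n + p) \<noteq> k" if "r' \<le> p" "p < n" for p
    using r(4) that \<open>f (g * n + r') \<noteq> k\<close> r' by (cases "p = r'") auto
   ultimately show ?thesis by blast
  qed
  ultimately show "eval_bool W s' (BNot (WCell 23 (WReg 48 [-] WConst 1) [=] WReg 47)) \<noteq> None \<and>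
   (eval_bool W s' (BNot (WCell 23 (WReg 48 [-] WConst 1) [=] WReg 47)) = Some True \<longrightarrow>
    wp W (SetW 48 (WReg 48 [-] WConst 1)) (\<lambda>t s''. (\<exists>r. wreg s'' 48 = g * n + r \<and> p0 < r \<and> r \<le> n \<and>
      (\<forall>p. r \<le> p \<longrightarrow> p < n \<longrightarrow> f (g * n + p) \<noteq> k)) \<and>
     1 + cost_bool (BNot (WCell 23 (WReg 48 [-] WConst 1) [=] WReg 47)) + t + 40 * (wreg s'' 48 - g * n) \<le> 40 * (wreg s' 48 - g * n)) s')"
   using rr r(1,3) r' W_small by auto
 next
  fix t s' assume "\<exists>r. wreg s' 48 = g * n + r \<and> p0 < r \<and> r \<le> n \<and> (\<forall>p. r \<le> p \<longrightarrow> p < n \<longrightarrow> f (g * n + p) \<noteq> k)"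
   and ag: "agrees (SetW 48 (WReg 48 [-] WConst 1)) ?s s'"
   and ev: "eval_bool W s' (BNot (WCell 23 (WReg 48 [-] WConst 1) [=] WReg 47)) = Some False"
   and t: "t + 40 * (wreg s' 48 - g * n) \<le> 40 * (wreg ?s 48 - g * n) + 1 + cost_bool (BNot (WCell 23 (WReg 48 [-] WConst 1) [=] WReg 47))"
  then obtain r where r: "wreg s' 48 = g * n + r" "p0 < r" "r \<le> n" "\<forall>p. r \<le> p \<longrightarrow> p < n \<longrightarrow> f (g * n + p) \<noteq> k" by blast
  have rr: "warr s' 23 = f" "wreg s' 47 = k" using ag by (auto simp: agrees_def f_def)
  have "wreg s' 48 - 1 = g * n + (r - 1)" "g * n + (r - 1) < W" using r gnW by simp_all
  with ev rr have "f (g * n + (r - 1)) = k" using W_small by simp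
  with r t show "?post t s'" by (intro exI[of _ r]) auto
 qed (use p0 in \<open>auto simp: algebra_simps\<close>)
 have ev48: "(e div n + 1) * n = g * n + n" by (simp add: g_def add_mult_distrib)
 have 1: "e div n < W" "e div n + 1 < W" "g * n + n < W" using gn W_small gnW by (auto simp: g_def)
 have fin: "cls_ok s' (c(e := k + 1))"
  if r: "0 < r" "r \<le> n" "f (g * n + (r - 1)) = k" "\<forall>p. r \<le> p \<longrightarrow> p < n \<longrightarrow> f (g * n + p) \<noteq> k"
   and s': "warr s' 23 = f(g * n + (r - 1) := k + 1)" "warr s' 22 = (warr s 22)(e := k + 1)" for r s'
 proof -
  have r1: "r - 1 < n" using r by simp
  have sorted: "f (g' * n + p) \<le> f (g' * n + p')" if "g' < n" "p \<le> p'" "p' < n" for g' p p'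
   using c that unfolding cls_ok_def f_def by blast
  have val: "warr s' 23 (g' * n + p) = (if g' = g \<and> p = r - 1 then k + 1 else f (g' * n + p))" if "p < n" for g' p
   using block_eq[OF that r1, of g' g] by (simp add: s')
  have "warr s' 23 (g' * n + p) \<le> warr s' 23 (g' * n + p')" if h: "g' < n" "p \<le> p'" "p' < n" for g' p p'
  proof (cases "g' = g \<and> p = r - 1 \<and> p' \<noteq> r - 1")
   case True
   \<comment> \<open>Position \<open>r - 1\<close> is the last one with value \<open>k\<close>, so
     entries further right are at least \<open>k + 1\<close> and sortedness survives the
     increment.\<close>
   then have "f (g' * n + p') \<noteq> k" "k \<le> f (g' * n + p')" using r sorted[OF h] h by auto
   then show ?thesis using True val[of p] val[of p'] h by simp
  next
   case False
   then show ?thesis using sorted[OF h] val[of p g'] val[of p' g'] h r(3) by auto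
  qed
  moreover have "image_mset (\<lambda>p. warr s' 23 (g' * n + p)) (mset_set {..<n}) =
    image_mset (\<lambda>p. warr s' 22 (g' * n + p)) (mset_set {..<n})" if g': "g' < n" for g'
  proof (cases "g' = g")
   case True
   have 1: "(\<lambda>p. warr s' 23 (g * n + p)) = (\<lambda>p. f (g * n + p))(r - 1 := k + 1)" by (auto simp: s')
   have 2: "(\<lambda>p. warr s' 22 (g * n + p)) = (\<lambda>p. warr s 22 (g * n + p))(e mod n := k + 1)"
   proof
    fix p show "warr s' 22 (g * n + p) = ((\<lambda>p. warr s 22 (g * n + p))(e mod n := k + 1)) p"
     by (subst eg(1)[symmetric] | subst s')+ (use eg(1) in \<open>auto\<close>)
   qed
   show ?thesis unfolding True 1 2
    by (rule image_mset_upd[OF _ _ _ _ _ ms]) (use r1 r we eg in auto)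
  next
   case False
   have "image_mset (\<lambda>p. warr s' 23 (g' * n + p)) (mset_set {..<n}) = image_mset (\<lambda>p. f (g' * n + p)) (mset_set {..<n})"
    by (rule image_mset_cong) (use val False in auto)
   moreover have "image_mset (\<lambda>p. warr s' 22 (g' * n + p)) (mset_set {..<n}) = image_mset (\<lambda>p. warr s 22 (g' * n + p)) (mset_set {..<n})"
   proof (rule image_mset_cong)
    fix p assume "p \<in># mset_set {..<n}"
    then have "p < n" by simp
    then have "g' * n + p \<noteq> e" using block_eq[of p "e mod n" g' g] False eg by auto
    then show "warr s' 22 (g' * n + p) = warr s 22 (g' * n + p)" by (simp add: s')
   qed
   ultimately show ?thesis using c g' by (simp add: cls_ok_def f_def)
  qed
  moreover have "\<forall>e'<m. warr s' 22 e' = (c(e := k + 1)) e'" using c by (simp add: s' cls_ok_def)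
  ultimately show ?thesis by (simp add: cls_ok_def)
 qed
 show ?thesis
  unfolding bump_class_def
  using st e we 1 W_small ev48
  apply simp
  apply (rule wp_call[OF loop])
  apply (elim exE conjE)
  subgoal premises prems for t s' r
  proof -
   have rr: "warr s' 23 = f" "wreg s' 47 = k" "wreg s' 40 = e" "warr s' 22 = warr s 22"
    using prems e by (auto simp: agrees_def f_def)
   have kW: "k + 1 < W" using e W_small by (simp add: k_def)
   have r: "wreg s' 48 - 1 = g * n + (r - 1)" "g * n + (r - 1) < W" "r - 1 < n" using prems gnW by simp_all
   have "cls_ok (s'\<lparr>warr := (warr s')(23 := f(g * n + (r - 1) := k + 1), 22 := (warr s 22)(e := k + 1))\<rparr>) (c(e := k + 1))"
    by (rule fin[of r]) (use prems in auto)
   then show ?thesis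
    using prems rr kW W_small r by (simp add: k_def[symmetric])
  qed
  done
qed

end

section \<open>The increase request, and locating the scale of a query\<close>

definition increase :: com where
 "increase = SetW 40 (WReg 3) ;; PutR 0 (WReg 3) (RCell 0 (WReg 3) {+} RReg 3) ;; upd"

text \<open>\<open>bits\<close> is the number of binary digits, the measure of the halving loops and
  of the walks in the tournament tree. The fuel makes the recursion primitive; any fuel from
  \<open>z\<close> on gives the same result.\<close>

primrec bits_fuel :: "nat \<Rightarrow> nat \<Rightarrow> nat" where
 "bits_fuel 0 z = 0"
| "bits_fuel (Suc r) z = (if z = 0 then 0 else Suc (bits_fuel r (z div 2)))"

definition bits :: "nat \<Rightarrow> nat" where "bits z = bits_fuel z z"

lemma bits_fuel_enough: "z \<le> r \<Longrightarrow> bits_fuel r z = bits_fuel z z"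
proof (induction r arbitrary: z rule: less_induct)
 case (less r)
 show ?case
 proof (cases "z = 0")
  case True then show ?thesis by (cases r) auto
 next
  case False
  then obtain r' z' where rz: "r = Suc r'" "z = Suc z'" using less.prems by (cases r; cases z) auto
  have "z div 2 \<le> r'" "z div 2 \<le> z'" using less.prems rz by auto
  with less.IH[of r' "z div 2"] less.IH[of z' "z div 2"] rz less.prems show ?thesis by auto
 qed
qed

lemma bits_0 [simp]: "bits 0 = 0"
 by (simp add: bits_def)

lemma bits_half: "0 < z \<Longrightarrow> bits z = Suc (bits (z div 2))"
proof -
 assume "0 < z"
 then obtain r where "z = Suc r" by (cases z) auto
 then show ?thesis using bits_fuel_enough[of "z div 2" r] by (simp add: bits_def)
qed

lemma bits_mono: "y \<le> z \<Longrightarrow> bits y \<le> bits z"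
proof (induction z arbitrary: y rule: less_induct)
 case (less z)
 show ?case
 proof (cases "y = 0")
  case False
  then have "bits (y div 2) \<le> bits (z div 2)" using less.prems by (intro less.IH div_le_mono) auto
  with False less.prems bits_half[of y] bits_half[of z] show ?thesis by simp
 qed simp
qed

lemma bits_power: "z \<le> 2 ^ r \<Longrightarrow> bits z \<le> r + 1"
proof (induction r arbitrary: z)
 case 0 then show ?case using bits_mono[of z 1] bits_half[of 1] by (simp add: One_nat_def)
next
 case (Suc r)
 then have "bits (z div 2) \<le> r + 1" by (intro Suc.IH) auto
 then show ?case using bits_half[of z] by (cases "z = 0") auto
qed

text \<open>Register 50 accumulates the largest admissible class over all blocks and then climbs at
  most \<open>L\<close> scales. If a search ends with register 52 equal to 0, the truncated
  subtraction reads the first cell of the block, and the guard discards it.\<close>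

definition find_scale :: com where
 "find_scale =
  SetW 50 (WConst 0) ;; SetW 51 (WConst 0) ;;
  While (WReg 51 [<] WReg 0)
   (SetW 52 (WConst 0) ;; SetW 53 (WReg 0) ;;
    While (WReg 52 [<] WReg 53)
     (SetW 54 ((WReg 52 [+] WReg 53) [div] WConst 2) ;;
     SetW 55 (WCell 23 (WReg 51 [*] WReg 0 [+] WReg 54)) ;;
     Cond (BAnd (WReg 55 [<] WReg 7) (RCell 2 (WReg 55) {\<le>} RReg 3))
      (SetW 52 (WReg 54 [+] WConst 1)) (SetW 53 (WReg 54))) ;;
    SetW 55 (WCell 23 (WReg 51 [*] WReg 0 [+] (WReg 52 [-] WConst 1))) ;;
    Cond (BAnd (WConst 0 [<] WReg 52) (WReg 50 [<] WReg 55)) (SetW 50 (WReg 55)) Skip ;;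
    SetW 51 (WReg 51 [+] WConst 1)) ;;
  SetW 51 (WConst 0) ;;
  While (BAnd (BAnd (WReg 51 [<] WReg 6) (WReg 50 [+] WConst 1 [<] WReg 7))
      (RCell 2 (WReg 50 [+] WConst 1) {\<le>} RReg 3))
   (SetW 50 (WReg 50 [+] WConst 1) ;; SetW 51 (WReg 51 [+] WConst 1))"

lemma mods_find_scale [simp]:
 "mw find_scale = {50, 51, 52, 53, 54, 55}" "mr find_scale = {}" "ma find_scale = {}" "mb find_scale = {}"
 by (auto simp: find_scale_def)

lemma mods_increase [simp]:
 "mw increase = {30, 31, 32, 33, 34, 35, 36, 37, 40, 41, 42, 44, 45, 46, 47, 48}" "mr increase = {}"
 "ma increase = {16, 17, 18, 19, 22, 23}" "mb increase = {0}"
 by (auto simp: increase_def)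

context machine_setup
begin

text \<open>A scale \<open>k\<close> below the new class has \<open>4 * beta k \<le> x\<close>, so
  the test goes on exactly until the class of \<open>x\<close> is reached. Each round is one linear
  search in a block.\<close>

lemma class_loop:
 assumes st: "static s" and c: "cls_ok s (\<lambda>e. cl (l e))" and e: "wreg s 40 = e" "e < m"
  and x: "x = rarr s 0 e" "l e \<le> x"
 shows "wp W class_loop (\<lambda>t s'. cls_ok s' (\<lambda>e'. cl ((l(e := x)) e')) \<and>
  t \<le> (cl x - cl (l e)) * (60 * n + 200) + 30) s"
proof -
 let ?b = "BAnd (WCell 22 (WReg 40) [<] WReg 7)
    (BNot (RCell 0 (WReg 40) {<} RWord (WConst 4) {*} RCell 2 (WCell 22 (WReg 40))))"
 let ?c = "\<lambda>k. (\<lambda>e'. cl (l e'))(e := k)"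
 let ?I = "\<lambda>s'. \<exists>k\<le>cl x. cls_ok s' (?c k)"
 show ?thesis
  unfolding class_loop_def
 proof (rule wp_while[where I = ?I and F = "\<lambda>s'. (cl x - warr s' 22 e) * (60 * n + 200)"])
  have "?c (cl (l e)) = (\<lambda>e'. cl (l e'))" by auto
  then have "cls_ok s (?c (cl (l e)))" using c by simp
  then show "?I s" using x cl_mono by blast
  fix s' assume "?I s'" and ag: "agrees bump_class s s'"
  then obtain k where k: "k \<le> cl x" "cls_ok s' (?c k)" by blast
  have w: "warr s' 22 e = k" using k e by (simp add: cls_ok_def)
  have st': "static s'" by (rule static_agrees[OF st ag]) simp_all
  have r': "wreg s' 40 = e" "rarr s' 0 e = x" using ag e x by (auto simp: agrees_def)
  show "eval_bool W s' ?b \<noteq> None \<and> (eval_bool W s' ?b = Some True \<longrightarrow>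
   wp W bump_class (\<lambda>t s''. ?I s'' \<and> 1 + cost_bool ?b + t + (cl x - warr s'' 22 e) * (60 * n + 200)
    \<le> (cl x - warr s' 22 e) * (60 * n + 200)) s')"
  proof (intro conjI impI)
   show "eval_bool W s' ?b \<noteq> None" using st' W_small r' by simp
   assume "eval_bool W s' ?b = Some True"
   then have kN: "k < NI" and "\<not> x < 4 * rarr s' 2 k" using st' W_small r' w by auto
   moreover have "rarr s' 2 k = beta k" using st' kN unfolding static_def by blast
   ultimately have "4 * beta k \<le> x" by simp
   then have kc: "k < cl x" using cl_less[of x] k(1) kN by (cases "k = cl x") auto
   then have eq: "cl x - k = Suc (cl x - (k + 1))" by simp
   show "wp W bump_class (\<lambda>t s''. ?I s'' \<and> 1 + cost_bool ?b + t + (cl x - warr s'' 22 e) * (60 * n + 200)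
    \<le> (cl x - warr s' 22 e) * (60 * n + 200)) s'"
   proof (rule wp_call[OF bump_class[OF st' k(2) r'(1) e(2)]])
    show "?c k e < NI" using kN by simp
    fix t s'' assume post: "cls_ok s'' ((?c k)(e := ?c k e + 1)) \<and> t \<le> 60 * n + 60"
    then have c'': "cls_ok s'' (?c (k + 1))" by simp
    then have "warr s'' 22 e = k + 1" using e by (simp add: cls_ok_def)
    then show "?I s'' \<and> 1 + cost_bool ?b + t + (cl x - warr s'' 22 e) * (60 * n + 200)
      \<le> (cl x - warr s' 22 e) * (60 * n + 200)"
     using c'' kc post eq w by (auto intro!: exI[of _ "k + 1"])
   qed
  qed
 next
  fix t s' assume "?I s'" and ag: "agrees bump_class s s'" and ev: "eval_bool W s' ?b = Some False"
   and t: "t + (cl x - warr s' 22 e) * (60 * n + 200) \<le> (cl x - warr s 22 e) * (60 * n + 200) + 1 + cost_bool ?b"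
  then obtain k where k: "k \<le> cl x" "cls_ok s' (?c k)" by blast
  have w: "warr s' 22 e = k" using k e by (simp add: cls_ok_def)
  have w0: "warr s 22 e = cl (l e)" using c e by (simp add: cls_ok_def)
  have st': "static s'" by (rule static_agrees[OF st ag]) simp_all
  have r': "wreg s' 40 = e" "rarr s' 0 e = x" using ag e x by (auto simp: agrees_def)
  have "cl x = k"
  proof (cases "k < NI")
   case True
   then have "rarr s' 2 k = beta k" using st' unfolding static_def by blast
   with True ev st' W_small r' w have "x < 4 * beta k" by simp
   with below_cl[of k x] k(1) show ?thesis by (cases "k = cl x") auto
  qed (use k(1) cl_le[of x] in simp)
  moreover have "?c (cl x) = (\<lambda>e'. cl ((l(e := x)) e'))" by auto
  ultimately show "cls_ok s' (\<lambda>e'. cl ((l(e := x)) e')) \<and> t \<le> (cl x - cl (l e)) * (60 * n + 200) + 30"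
   using k t w w0 by simp
 qed
qed

definition inv :: "machine_state \<Rightarrow> (nat \<Rightarrow> real) \<Rightarrow> bool" where
 "inv s l \<longleftrightarrow> static s \<and> trees_ok s \<and> cost_ok s (Nl l) \<and> cls_ok s (\<lambda>e. cl (l e)) \<and> (\<forall>e<m. 0 \<le> l e)"

text \<open>The class of an arc grows at most \<open>NI\<close> times. A linear search per growth is
  affordable: over all arcs it amounts to order \<open>m * NI * n\<close>.\<close>

definition clpot :: "(nat \<Rightarrow> real) \<Rightarrow> nat" where
 "clpot l = (\<Sum>e<m. (NI - cl (l e)) * (60 * n + 200))"

text \<open>The summands pay for label changes in the trees, visits of hubs, passes over the levels
  of a scale, and changes of classes.\<close>

definition Phi :: "machine_state \<Rightarrow> (nat \<Rightarrow> real) \<Rightarrow> nat" where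
 "Phi s l = treepot s + cpot (Nl l) + cpotL (Nl l) + clpot l"

lemma clpot_upd:
 assumes "e < m" "l e \<le> x"
 shows "clpot (l(e := x)) + (cl x - cl (l e)) * (60 * n + 200) = clpot l"
proof -
 have "(NI - cl (l e)) = (NI - cl x) + (cl x - cl (l e))" using cl_mono[OF assms(2)] cl_le[of x] by simp
 then have "(NI - cl (l e)) * (60 * n + 200) = (NI - cl x) * (60 * n + 200) + (cl x - cl (l e)) * (60 * n + 200)"
  by (simp only: add_mult_distrib)
 moreover have "(\<Sum>e'<m. (NI - cl ((l(e := x)) e')) * (60 * n + 200)) + (NI - cl (l e)) * (60 * n + 200) =
   (\<Sum>e'<m. (NI - cl (l e')) * (60 * n + 200)) + (NI - cl ((l(e := x)) e)) * (60 * n + 200)"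
  by (rule sum_fun_upd) (use assms in auto)
 ultimately show ?thesis by (simp add: clpot_def)
qed

text \<open>The scale loop has to precede the class loop, since it starts from the class of the old
  length. The two draw on separate parts of the potential.\<close>

lemma upd:
 assumes I: "inv s l" and e: "wreg s 40 = e" "e < m" and x: "x = rarr s 0 e" "l e \<le> x"
 shows "wp W upd (\<lambda>t s'. inv s' (l(e := x)) \<and> t + Phi s' (l(e := x)) \<le> Phi s l + 150) s"
proof -
 have st: "static s" and tr: "trees_ok s" and co: "cost_ok s (Nl l)" and cls: "cls_ok s (\<lambda>e. cl (l e))"
  and l0: "0 \<le> l e" using I e by (auto simp: inv_def)
 have w: "warr s 22 e = cl (l e)" using cls e by (simp add: cls_ok_def)
 let ?s = "s\<lparr>wreg := (wreg s)(41 := cl (l e))\<rparr>"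
 have 1: "wp W scale_loop (\<lambda>t1. wp W class_loop (\<lambda>t2 s'. inv s' (l(e := x)) \<and> 10 + t1 + t2 + Phi s' (l(e := x)) \<le> Phi s l + 150)) ?s"
 proof (rule wp_call[OF scale_loop[of ?s l e x]])
  fix t s1 assume p: "static s1 \<and> trees_ok s1 \<and> cost_ok s1 (Nl (l(e := x))) \<and>
   t + treepot s1 + cpot (Nl (l(e := x))) + cpotL (Nl (l(e := x))) \<le> treepot ?s + cpot (Nl l) + cpotL (Nl l) + 60"
   and ag: "agrees scale_loop ?s s1"
  have w1: "wreg s1 40 = e" "x = rarr s1 0 e" "warr s1 22 = warr s 22" "warr s1 23 = warr s 23"
   using ag e x by (auto simp: agrees_def)
  have c1: "cls_ok s1 (\<lambda>e. cl (l e))" using cls w1 by (simp add: cls_ok_def)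
  show "wp W class_loop (\<lambda>t2 s'. inv s' (l(e := x)) \<and> 10 + t + t2 + Phi s' (l(e := x)) \<le> Phi s l + 150) s1"
  proof (rule wp_call[OF class_loop[OF _ c1 w1(1) e(2) w1(2) x(2)]])
   fix t2 s2 assume q: "cls_ok s2 (\<lambda>e'. cl ((l(e := x)) e')) \<and> t2 \<le> (cl x - cl (l e)) * (60 * n + 200) + 30"
    and ag2: "agrees class_loop s1 s2"
   have "static s2" by (rule static_agrees[OF _ ag2]) (use p in simp_all)
   moreover have m2: "warr s2 17 = warr s1 17" "warr s2 18 = warr s1 18" "warr s2 19 = warr s1 19"
    using ag2 by (auto simp: agrees_def)
   moreover have "trees_ok s2" using p m2 by (simp add: trees_ok_def tree_def)
   moreover have "cost_ok s2 (Nl (l(e := x)))" using p m2 by (simp add: cost_ok_def)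
   moreover have "treepot s2 = treepot s1" using m2 by (simp add: treepot_def ipot_def)
   moreover have "\<forall>e'<m. 0 \<le> (l(e := x)) e'" using I x l0 by (auto simp: inv_def)
   ultimately show "inv s2 (l(e := x)) \<and> 10 + t + t2 + Phi s2 (l(e := x)) \<le> Phi s l + 150"
    using p q clpot_upd[of e l x, OF e(2) x(2)] by (simp add: inv_def Phi_def)
  qed (use p in simp)
 qed (use st tr co e x l0 in simp_all)
 show ?thesis
  unfolding upd_def using e w
  apply simp
  apply (rule wp_call[OF 1])
  apply (erule wp_call)
  apply simp
  done
qed

lemma increase:
 assumes I: "inv s l" and e: "wreg s 3 = e" "e < m" "0 \<le> rreg s 3" and l: "\<forall>e<m. rarr s 0 e = l e"
 shows "wp W increase (\<lambda>t s'. inv s' (l(e := l e + rreg s 3)) \<and> (\<forall>e'<m. rarr s' 0 e' = (l(e := l e + rreg s 3)) e') \<and>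
  t + Phi s' (l(e := l e + rreg s 3)) \<le> Phi s l + 200) s"
proof -
 let ?x = "l e + rreg s 3"
 let ?s = "s\<lparr>wreg := (wreg s)(40 := e), rarr := (rarr s)(0 := (rarr s 0)(e := ?x))\<rparr>"
 have "static ?s" by (rule static_cong[of s]) (use I in \<open>simp_all add: inv_def\<close>)
 then have I': "inv ?s l" using I by (simp add: inv_def trees_ok_def tree_def cost_ok_def cls_ok_def)
 have P: "Phi ?s l = Phi s l" by (simp add: Phi_def treepot_def ipot_def)
 show ?thesis
  unfolding increase_def using e l
  apply simp
  apply (rule wp_call[OF upd[OF I', of e ?x]])
  using e P by (auto simp: agrees_def)
qed

end

section \<open>Distance queries\<close>

definition dist_loop :: com where
 "dist_loop =
  SetW 56 (WConst 0) ;; SetW 57 (WReg 0) ;;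
  While (WReg 57 [<] (WReg 6 [+] WConst 1) [*] WReg 0)
   (Cond (WConst 0 [<] WCell 4 (WReg 57))
     (SetW 58 ((WReg 50 [*] ((WReg 6 [+] WConst 1) [*] WReg 0) [+] WReg 57) [*] (WConst 2 [*] WReg 0)) ;;
     SetW 59 (WCell 18 (WReg 58 [+] (WReg 0 [+] WReg 3)) [+] WCell 18 (WReg 58 [+] WReg 4)) ;;
     Cond (WReg 59 [\<le>] WReg 8 [*] WCell 7 (WReg 57 [div] WReg 0))
      (SetR 5 (RWord (WReg 59) {*} (RReg 0 {*} RCell 2 (WReg 50) {/} RWord (WCell 7 (WReg 57 [div] WReg 0)))) ;;
       Cond (BAnd (WConst 0 [<] WReg 56) (RReg 4 {\<le>} RReg 5)) Skip
        (SetW 56 (WConst 1) ;; SetR 4 (RReg 5) ;; SetW 60 (WReg 57)))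
      Skip)
     Skip ;;
    SetW 57 (WReg 57 [+] WConst 1))"

text \<open>Register 56 is set once a candidate hub has been found and becomes the word that
  separates finite answers from \<open>\<infinity>\<close>. Register 60 keeps the best hub for the
  path queries.\<close>

definition distance_query :: com where
 "distance_query = (find_scale ;; dist_loop) ;; SetW 5 (WReg 56)"

lemma mods_dist_loop [simp]:
 "mw dist_loop = {56, 57, 58, 59, 60}" "mr dist_loop = {4, 5}" "ma dist_loop = {}" "mb dist_loop = {}"
 by (auto simp: dist_loop_def)

context machine_setup
begin

lemma static_tables:
 assumes "static s"
 shows "i < NI \<Longrightarrow> rarr s 2 i = beta i" "j \<le> L \<Longrightarrow> warr s 7 j = 2 ^ j"
  "q \<in> {n..<Suc L * n} \<Longrightarrow> warr s 4 q = (if q \<in> S then 1 else 0)"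
 using assms unfolding static_def by blast+

definition okc :: "real \<Rightarrow> nat \<Rightarrow> bool" where "okc \<beta> k \<longleftrightarrow> k < NI \<and> beta k \<le> \<beta>"

text \<open>The inserted 0 is the default when no cell is admissible; scale 0 is admissible for
  every legal \<open>\<beta>\<close>.\<close>

definition top_class :: "(nat \<Rightarrow> nat) \<Rightarrow> real \<Rightarrow> nat \<Rightarrow> nat" where
 "top_class a \<beta> x = Max (insert 0 {a y | y. y < x \<and> okc \<beta> (a y)})"

text \<open>The scale for a query with parameter \<open>\<beta>\<close>. The largest admissible scale cannot be found within the
 time bound, which does not depend on \<open>Mmax / Mmin\<close>; but no scale more than \<open>L\<close> above
 the largest relevant class is needed.\<close>

definition scale :: "(nat \<Rightarrow> nat) \<Rightarrow> real \<Rightarrow> nat" where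
 "scale a \<beta> = Max {i. okc \<beta> i \<and> i \<le> top_class a \<beta> (n * n) + L}"

lemma okc_le: "okc \<beta> k \<Longrightarrow> k' \<le> k \<Longrightarrow> okc \<beta> k'"
 using beta_mono[of k' k] by (auto simp: okc_def)

lemma fin_top: "finite (insert 0 {a y | y. y < (x::nat) \<and> okc \<beta> (a y)})"
 by simp

lemma top_class_ok: "okc \<beta> 0 \<Longrightarrow> okc \<beta> (top_class a \<beta> x)"
 using Max_in[OF fin_top[of a x \<beta>]] by (auto simp: top_class_def)

lemma top_class_ge: "y < x \<Longrightarrow> okc \<beta> (a y) \<Longrightarrow> a y \<le> top_class a \<beta> x"
 unfolding top_class_def by (rule Max_ge) auto

text \<open>Admissible entries form a prefix of a sorted block, so the block contributes at most its
  last admissible entry, at position \<open>p - 1\<close>.\<close>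

lemma top_class_block:
 assumes "p \<le> n" "\<And>r. r < p \<Longrightarrow> okc \<beta> (a (x + r))" "\<And>r. p \<le> r \<Longrightarrow> r < n \<Longrightarrow> \<not> okc \<beta> (a (x + r))"
  and "\<And>r r'. r \<le> r' \<Longrightarrow> r' < n \<Longrightarrow> a (x + r) \<le> a (x + r')"
 shows "top_class a \<beta> (x + n) = (if 0 < p \<and> top_class a \<beta> x < a (x + (p - 1)) then a (x + (p - 1)) else top_class a \<beta> x)"
proof -
 let ?t = "top_class a \<beta> x" and ?m = "if 0 < p \<and> top_class a \<beta> x < a (x + (p - 1)) then a (x + (p - 1)) else top_class a \<beta> x"
 show ?thesis
  unfolding top_class_def[of a \<beta> "x + n"]
 proof (rule Max_eqI)
  fix z assume "z \<in> insert 0 {a y | y. y < x + n \<and> okc \<beta> (a y)}"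
  then consider "z = 0" | y where "z = a y" "y < x" "okc \<beta> (a y)" | r where "z = a (x + r)" "r < n" "okc \<beta> (a (x + r))"
   by auto (metis add.commute add_diff_inverse_nat less_diff_conv2 not_le_imp_less)
  then show "z \<le> ?m"
  proof cases
   case 2 then show ?thesis using top_class_ge[of y x \<beta> a] by auto
  next
   case 3
   then have "r < p" using assms(3)[of r] by force
   then have "a (x + r) \<le> a (x + (p - 1))" using assms(1) by (intro assms(4)) auto
   with \<open>r < p\<close> 3 show ?thesis by auto
  qed simp
 next
  have "?t \<in> insert 0 {a y | y. y < x \<and> okc \<beta> (a y)}" unfolding top_class_def by (rule Max_in) auto
  then have "?t \<in> insert 0 {a y | y. y < x + n \<and> okc \<beta> (a y)}" by auto
  moreover have "a (x + (p - 1)) \<in> {a y | y. y < x + n \<and> okc \<beta> (a y)}" if "0 < p"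
   using assms(1) assms(2)[of "p - 1"] that by auto
  ultimately show "?m \<in> insert 0 {a y | y. y < x + n \<and> okc \<beta> (a y)}" by auto
 qed simp
qed

lemma scale_ok:
 assumes "okc \<beta> 0"
 shows "okc \<beta> (scale a \<beta>)" "scale a \<beta> \<le> top_class a \<beta> (n * n) + L"
  "okc \<beta> i \<Longrightarrow> i \<le> top_class a \<beta> (n * n) + L \<Longrightarrow> i \<le> scale a \<beta>"
proof -
 let ?X = "{i. okc \<beta> i \<and> i \<le> top_class a \<beta> (n * n) + L}"
 have f: "finite ?X" by (rule finite_subset[of _ "{..<NI}"]) (auto simp: okc_def)
 have "?X \<noteq> {}" using assms by auto
 with Max_in[OF f] show "okc \<beta> (scale a \<beta>)" "scale a \<beta> \<le> top_class a \<beta> (n * n) + L" by (auto simp: scale_def)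
 show "okc \<beta> i \<Longrightarrow> i \<le> top_class a \<beta> (n * n) + L \<Longrightarrow> i \<le> scale a \<beta>"
  unfolding scale_def by (rule Max_ge[OF f]) simp
qed

text \<open>Admissibility is downward closed and the block is sorted, so there is a single change
  from admissible to inadmissible. The interval at least halves in every round, which
  \<open>bits\<close> measures.\<close>

lemma binary_search:
 assumes st: "static s" and g: "g < n" "wreg s 51 = g" and a: "a = warr s 23" and b: "\<beta> = rreg s 3"
  and r: "wreg s 52 = 0" "wreg s 53 = n"
  and srt: "\<And>r r'. r \<le> r' \<Longrightarrow> r' < n \<Longrightarrow> a (g * n + r) \<le> a (g * n + r')"
 shows "wp W (While (WReg 52 [<] WReg 53)
     (SetW 54 ((WReg 52 [+] WReg 53) [div] WConst 2) ;;
     SetW 55 (WCell 23 (WReg 51 [*] WReg 0 [+] WReg 54)) ;;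
     Cond (BAnd (WReg 55 [<] WReg 7) (RCell 2 (WReg 55) {\<le>} RReg 3))
      (SetW 52 (WReg 54 [+] WConst 1)) (SetW 53 (WReg 54))))
  (\<lambda>t s'. wreg s' 52 \<le> n \<and> (\<forall>r<wreg s' 52. okc \<beta> (a (g * n + r))) \<and>
    (\<forall>r. wreg s' 52 \<le> r \<longrightarrow> r < n \<longrightarrow> \<not> okc \<beta> (a (g * n + r))) \<and> t \<le> 60 * L + 70) s"
 (is "wp W (While ?b ?c) _ _")
proof (rule wp_while[where I = "\<lambda>s'. wreg s' 52 \<le> wreg s' 53 \<and> wreg s' 53 \<le> n \<and>
   (\<forall>r<wreg s' 52. okc \<beta> (a (g * n + r))) \<and> (\<forall>r. wreg s' 53 \<le> r \<longrightarrow> r < n \<longrightarrow> \<not> okc \<beta> (a (g * n + r)))"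
  and F = "\<lambda>s'. 60 * bits (wreg s' 53 - wreg s' 52)"])
 fix s' assume I: "wreg s' 52 \<le> wreg s' 53 \<and> wreg s' 53 \<le> n \<and>
   (\<forall>r<wreg s' 52. okc \<beta> (a (g * n + r))) \<and> (\<forall>r. wreg s' 53 \<le> r \<longrightarrow> r < n \<longrightarrow> \<not> okc \<beta> (a (g * n + r)))"
  and ag: "agrees ?c s s'"
 have st': "static s'" by (rule static_agrees[OF st ag]) simp_all
 have rr: "wreg s' 51 = g" "warr s' 23 = a" "rreg s' 3 = \<beta>" using ag g a b by (auto simp: agrees_def)
 define lo hi where "lo = wreg s' 52" and "hi = wreg s' 53"
 define mid where "mid = (lo + hi) div 2"
 show "eval_bool W s' ?b \<noteq> None \<and> (eval_bool W s' ?b = Some True \<longrightarrow>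
  wp W ?c (\<lambda>t s''. (wreg s'' 52 \<le> wreg s'' 53 \<and> wreg s'' 53 \<le> n \<and>
   (\<forall>r<wreg s'' 52. okc \<beta> (a (g * n + r))) \<and> (\<forall>r. wreg s'' 53 \<le> r \<longrightarrow> r < n \<longrightarrow> \<not> okc \<beta> (a (g * n + r)))) \<and>
   1 + cost_bool ?b + t + 60 * bits (wreg s'' 53 - wreg s'' 52) \<le> 60 * bits (wreg s' 53 - wreg s' 52)) s')"
 proof (cases "lo < hi")
  case True
  then have mid: "lo \<le> mid" "mid < hi" by (auto simp: mid_def)
  have hn: "hi \<le> n" using I by (simp add: hi_def)
  have "(g + 1) * n \<le> n * n" using g by (intro mult_le_mono1) simp
  then have gnW: "g * n + mid < W" "g * n < W" using W_small(10) mid hn by (simp_all add: add_mult_distrib)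
  have W2: "lo + hi < W" "mid + 1 < W" "mid < W" "2 < W" using W_small(4) mid hn n2 by simp_all
  have h1: "bits (hi - lo) = Suc (bits ((hi - lo) div 2))" using True by (intro bits_half) simp
  have "hi - (mid + 1) \<le> (hi - lo) div 2" "mid - lo \<le> (hi - lo) div 2" using True by (auto simp: mid_def)
  then have h2: "bits (hi - (mid + 1)) \<le> bits ((hi - lo) div 2)" "bits (mid - lo) \<le> bits ((hi - lo) div 2)"
   by (auto intro: bits_mono)
  have okr: "(a (g * n + mid) < NI \<and> rarr s' 2 (a (g * n + mid)) \<le> \<beta>) \<longleftrightarrow> okc \<beta> (a (g * n + mid))"
   using static_tables(1)[OF st'] by (auto simp: okc_def)
  have up: "okc \<beta> (a (g * n + r))" if "okc \<beta> (a (g * n + mid))" "r < mid + 1" for r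
   by (rule okc_le[OF that(1) srt]) (use that mid hn in auto)
  have dn: "\<not> okc \<beta> (a (g * n + r))" if "\<not> okc \<beta> (a (g * n + mid))" "mid \<le> r" "r < n" for r
   using okc_le[OF _ srt[OF that(2,3)]] that(1) by blast
  show ?thesis
  proof (cases "okc \<beta> (a (g * n + mid))")
   case ok: True
   with okr have "a (g * n + mid) < NI" "rarr s' 2 (a (g * n + mid)) \<le> \<beta>" by auto
   then show ?thesis
    using st' rr True W_small(10,11,12,14) mid hn gnW W2 h1 h2 up[OF ok] I
    by (simp add: lo_def[symmetric] hi_def[symmetric] mid_def[symmetric])
  next
   case ok: False
   with okr have "\<not> (a (g * n + mid) < NI \<and> rarr s' 2 (a (g * n + mid)) \<le> \<beta>)" by auto
   then show ?thesis
    using st' rr True W_small(10,11,12,14) mid hn gnW W2 h1 h2 dn[OF ok] I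
    by (auto simp: lo_def[symmetric] hi_def[symmetric] mid_def[symmetric] not_less)
  qed
 next
  case False then show ?thesis by (simp add: lo_def hi_def)
 qed
next
 have "bits n \<le> L + 1" using bits_power[OF nL] .
 then show "wreg s' 52 \<le> n \<and> (\<forall>r<wreg s' 52. okc \<beta> (a (g * n + r))) \<and>
    (\<forall>r. wreg s' 52 \<le> r \<longrightarrow> r < n \<longrightarrow> \<not> okc \<beta> (a (g * n + r))) \<and> t \<le> 60 * L + 70"
  if "wreg s' 52 \<le> wreg s' 53 \<and> wreg s' 53 \<le> n \<and>
   (\<forall>r<wreg s' 52. okc \<beta> (a (g * n + r))) \<and> (\<forall>r. wreg s' 53 \<le> r \<longrightarrow> r < n \<longrightarrow> \<not> okc \<beta> (a (g * n + r)))"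
   "eval_bool W s' ?b = Some False" 
   "t + 60 * bits (wreg s' 53 - wreg s' 52) \<le> 60 * bits (wreg s 53 - wreg s 52) + 1 + cost_bool ?b" for t s'
  using that r by auto
qed (use r in simp)

text \<open>There are \<open>n\<close> binary searches of about \<open>L\<close> rounds each,
  followed by a climb of at most \<open>L\<close> scales; \<open>NI\<close> does not enter the
  time.\<close>

lemma find_scale:
 assumes I: "inv s l" and b: "\<beta> = rreg s 3" "okc \<beta> 0"
 shows "wp W find_scale (\<lambda>t s'. wreg s' 50 = scale (warr s 23) \<beta> \<and> t \<le> 400 * n * L) s"
proof -
 define a where "a = warr s 23"
 have st: "static s" and cls: "cls_ok s (\<lambda>e. cl (l e))" using I by (auto simp: inv_def)
 have srt: "a (g * n + r) \<le> a (g * n + r')" if "g < n" "r \<le> r'" "r' < n" for g r r'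
  using cls that unfolding cls_ok_def a_def by blast
 let ?bs = "While (WReg 52 [<] WReg 53)
     (SetW 54 ((WReg 52 [+] WReg 53) [div] WConst 2) ;;
     SetW 55 (WCell 23 (WReg 51 [*] WReg 0 [+] WReg 54)) ;;
     Cond (BAnd (WReg 55 [<] WReg 7) (RCell 2 (WReg 55) {\<le>} RReg 3))
      (SetW 52 (WReg 54 [+] WConst 1)) (SetW 53 (WReg 54)))"
 let ?body = "SetW 52 (WConst 0) ;; SetW 53 (WReg 0) ;; ?bs ;;
    SetW 55 (WCell 23 (WReg 51 [*] WReg 0 [+] (WReg 52 [-] WConst 1))) ;;
    Cond (BAnd (WConst 0 [<] WReg 52) (WReg 50 [<] WReg 55)) (SetW 50 (WReg 55)) Skip ;;
    SetW 51 (WReg 51 [+] WConst 1)"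
 let ?s1 = "s\<lparr>wreg := (wreg s)(50 := 0, 51 := 0)\<rparr>"
 let ?I1 = "\<lambda>s'. wreg s' 51 \<le> n \<and> wreg s' 50 = top_class a \<beta> (wreg s' 51 * n)"
 have outer: "wp W (While (WReg 51 [<] WReg 0) ?body) (\<lambda>t s'. wreg s' 50 = top_class a \<beta> (n * n) \<and> t \<le> n * (60 * L + 200) + 20) ?s1"
 proof (rule wp_while[where I = ?I1 and F = "\<lambda>s'. (n - wreg s' 51) * (60 * L + 200)"])
  show "?I1 ?s1" by (simp add: top_class_def)
  fix s' assume I1: "?I1 s'" and ag: "agrees ?body ?s1 s'"
  have st': "static s'" by (rule static_agrees[OF _ ag]) (use st in simp_all)
  have rr: "warr s' 23 = a" "rreg s' 3 = \<beta>" using ag b by (auto simp: agrees_def a_def)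
  define g where "g = wreg s' 51"
  show "eval_bool W s' (WReg 51 [<] WReg 0) \<noteq> None \<and> (eval_bool W s' (WReg 51 [<] WReg 0) = Some True \<longrightarrow>
   wp W ?body (\<lambda>t s''. ?I1 s'' \<and> 1 + cost_bool (WReg 51 [<] WReg 0) + t + (n - wreg s'' 51) * (60 * L + 200)
    \<le> (n - wreg s' 51) * (60 * L + 200)) s')"
  proof (cases "g < n")
   case True
   let ?s2 = "s'\<lparr>wreg := (wreg s')(52 := 0, 53 := n)\<rparr>"
   have st2: "static ?s2" using st' by simp
   have eq: "n - g = Suc (n - (g + 1))" using True by simp
   have eq2: "(g + 1) * n = g * n + n" by (simp add: add_mult_distrib)
   have "(g + 1) * n \<le> n * n" using True by (intro mult_le_mono1) simp
   then have gnW: "g * n + n < W" "g * n < W" using W_small(10) by (simp_all add: add_mult_distrib)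
   have bs: "wp W ?bs (\<lambda>t s''. wreg s'' 52 \<le> n \<and> (\<forall>r<wreg s'' 52. okc \<beta> (a (g * n + r))) \<and>
    (\<forall>r. wreg s'' 52 \<le> r \<longrightarrow> r < n \<longrightarrow> \<not> okc \<beta> (a (g * n + r))) \<and> t \<le> 60 * L + 70) ?s2"
    by (rule binary_search[OF st2 True]) (use rr srt[OF True] in \<open>simp_all add: g_def\<close>)
   have tg: "wreg s' 50 = top_class a \<beta> (g * n)" using I1 by (simp add: g_def)
   show ?thesis
    using st' rr True W_small(12,14)
    apply (simp add: g_def[symmetric])
    apply (rule wp_call[OF bs])
    apply (elim conjE)
    subgoal premises prems for t s''
    proof -
     let ?p = "wreg s'' 52"
     have q: "wreg s'' 0 = n" "wreg s'' 51 = g" "warr s'' 23 = a" "wreg s'' 50 = wreg s' 50"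
      using prems st' by (auto simp: agrees_def g_def)
     have tc: "top_class a \<beta> (g * n + n) = (if 0 < ?p \<and> top_class a \<beta> (g * n) < a (g * n + (?p - 1)) then a (g * n + (?p - 1)) else top_class a \<beta> (g * n))"
      by (rule top_class_block) (use prems srt True in \<open>auto simp: g_def\<close>)
     have pW: "?p - 1 < W" "g * n + (?p - 1) < W" using prems gnW W_small(12) by (auto simp: g_def)
     have lt: "g + 1 \<le> n" "g + 1 < W" using True W_small(12) by simp_all
     have tt: "t \<le> 60 * L + 70" using prems by blast
     show ?thesis
     proof (cases "0 < ?p \<and> top_class a \<beta> (g * n) < a (g * n + (?p - 1))")
      case c: True
      have "top_class a \<beta> ((g + 1) * n) = a (g * n + (?p - 1))" unfolding eq2 tc if_P[OF c] ..
      then show ?thesis using q pW gnW(2) tg eq conjunct1[OF c] conjunct2[OF c] lt tt W_small(14) by simp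
     next
      case c: False
      have "top_class a \<beta> ((g + 1) * n) = top_class a \<beta> (g * n)" unfolding eq2 tc if_not_P[OF c] ..
      then show ?thesis using q pW gnW(2) tg eq c lt tt W_small(14) by simp
     qed
    qed
    done
  next
   case False then show ?thesis using st' by (simp add: g_def)
  qed
 next
  fix t s' assume I1: "?I1 s'" and ag: "agrees ?body ?s1 s'" and ev: "eval_bool W s' (WReg 51 [<] WReg 0) = Some False"
   and t: "t + (n - wreg s' 51) * (60 * L + 200) \<le> (n - wreg ?s1 51) * (60 * L + 200) + 1 + cost_bool (WReg 51 [<] WReg 0)"
  have "static s'" by (rule static_agrees[OF _ ag]) (use st in simp_all)
  then have "wreg s' 51 = n" using ev I1 by simp
  then show "wreg s' 50 = top_class a \<beta> (n * n) \<and> t \<le> n * (60 * L + 200) + 20" using I1 t by simp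
 qed
 let ?k = "top_class a \<beta> (n * n)"
 let ?b2 = "BAnd (BAnd (WReg 51 [<] WReg 6) (WReg 50 [+] WConst 1 [<] WReg 7)) (RCell 2 (WReg 50 [+] WConst 1) {\<le>} RReg 3)"
 let ?c2 = "SetW 50 (WReg 50 [+] WConst 1) ;; SetW 51 (WReg 51 [+] WConst 1)"
 have climb: "wp W (While ?b2 ?c2) (\<lambda>t s'. wreg s' 50 = scale a \<beta> \<and> t \<le> 50 * L + 30) s2"
  if s2: "static s2" "rreg s2 3 = \<beta>" "wreg s2 50 = ?k" "wreg s2 51 = 0" for s2
 proof (rule wp_while[where I = "\<lambda>s'. wreg s' 50 = ?k + wreg s' 51 \<and> wreg s' 51 \<le> L \<and> okc \<beta> (wreg s' 50)"
    and F = "\<lambda>s'. 50 * (L - wreg s' 51)"])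
  show "wreg s2 50 = ?k + wreg s2 51 \<and> wreg s2 51 \<le> L \<and> okc \<beta> (wreg s2 50)"
   using s2 top_class_ok[OF b(2)] by simp
  fix s' assume I2: "wreg s' 50 = ?k + wreg s' 51 \<and> wreg s' 51 \<le> L \<and> okc \<beta> (wreg s' 50)" and ag: "agrees ?c2 s2 s'"
  have st': "static s'" by (rule static_agrees[OF s2(1) ag]) simp_all
  have rb: "rreg s' 3 = \<beta>" using ag s2 by (auto simp: agrees_def)
  have kW: "wreg s' 50 + 1 < W" "wreg s' 51 + 1 < W" using I2 W_small(8,11) by (auto simp: okc_def)
  have ok: "okc \<beta> (wreg s' 50 + 1) \<longleftrightarrow> wreg s' 50 + 1 < NI \<and> rarr s' 2 (wreg s' 50 + 1) \<le> \<beta>"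
   using static_tables(1)[OF st'] by (auto simp: okc_def)
  show "eval_bool W s' ?b2 \<noteq> None \<and> (eval_bool W s' ?b2 = Some True \<longrightarrow> wp W ?c2 (\<lambda>t s''.
   (wreg s'' 50 = ?k + wreg s'' 51 \<and> wreg s'' 51 \<le> L \<and> okc \<beta> (wreg s'' 50)) \<and>
   1 + cost_bool ?b2 + t + 50 * (L - wreg s'' 51) \<le> 50 * (L - wreg s' 51)) s')"
   using st' rb kW I2 ok W_small(14) by (auto simp: not_less)
 next
  fix t s' assume I2: "wreg s' 50 = ?k + wreg s' 51 \<and> wreg s' 51 \<le> L \<and> okc \<beta> (wreg s' 50)" and ag: "agrees ?c2 s2 s'"
   and ev: "eval_bool W s' ?b2 = Some False" and t: "t + 50 * (L - wreg s' 51) \<le> 50 * (L - wreg s2 51) + 1 + cost_bool ?b2"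
  have st': "static s'" by (rule static_agrees[OF s2(1) ag]) simp_all
  have rb: "rreg s' 3 = \<beta>" using ag s2 by (auto simp: agrees_def)
  have kW: "wreg s' 50 + 1 < W" "wreg s' 51 + 1 < W" using I2 W_small(8,11) by (auto simp: okc_def)
  have ok: "okc \<beta> (wreg s' 50 + 1) \<longleftrightarrow> wreg s' 50 + 1 < NI \<and> rarr s' 2 (wreg s' 50 + 1) \<le> \<beta>"
   using static_tables(1)[OF st'] by (auto simp: okc_def)
  have stop: "wreg s' 51 = L \<or> \<not> okc \<beta> (wreg s' 50 + 1)" using ev st' rb kW ok W_small(14) I2 by auto
  have "scale a \<beta> = wreg s' 50"
  proof (rule antisym)
   show "wreg s' 50 \<le> scale a \<beta>" by (rule scale_ok(3)[OF b(2)]) (use I2 in auto)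
   show "scale a \<beta> \<le> wreg s' 50"
   proof (rule ccontr)
    assume h: "\<not> scale a \<beta> \<le> wreg s' 50"
    \<comment> \<open>A larger scale would make the next one admissible too, so the loop must have
      stopped because \<open>L\<close> steps were done; but then \<open>scale\<close> cannot be
      larger.\<close>
    then have "okc \<beta> (wreg s' 50 + 1)" by (intro okc_le[OF scale_ok(1)[OF b(2), of a]]) simp
    with stop have "wreg s' 51 = L" by blast
    with h I2 scale_ok(2)[OF b(2), of a] show False by simp
   qed
  qed
  then show "wreg s' 50 = scale a \<beta> \<and> t \<le> 50 * L + 30" using t s2 by simp
 qed
 have tm: "n * (60 * L + 200) + (50 * L + 100) \<le> 400 * n * L"
 proof -
  have "50 * L + 100 \<le> 150 * L" using L1 by simp
  also have "150 * L \<le> 75 * (n * L)" using n2 by simp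
  finally have "50 * L + 100 \<le> 75 * (n * L)" .
  moreover have "n * 1 \<le> n * L" by (rule mult_le_mono2[OF L1])
  moreover have "n * (60 * L + 200) = 60 * (n * L) + 200 * n" by (simp add: algebra_simps)
  moreover have "400 * n * L = 400 * (n * L)" by simp
  ultimately show ?thesis by linarith
 qed
 show ?thesis
  unfolding find_scale_def a_def[symmetric]
  using W_small
  apply simp
  apply (rule wp_call[OF outer])
  apply (elim conjE)
  apply simp
  apply (rule wp_call[OF climb])
  subgoal by (rule static_cong[OF st]) (auto simp: agrees_def)
  subgoal by (use b in \<open>auto simp: agrees_def\<close>)
  subgoal by simp
  subgoal by simp
  subgoal using tm by simp
  done
qed

end

lemma mods_distance_query [simp]:
 "mw distance_query = {5, 50, 51, 52, 53, 54, 55, 56, 57, 58, 59, 60}" "mr distance_query = {4, 5}"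
 "ma distance_query = {}" "mb distance_query = {}"
 by (auto simp: distance_query_def)

context machine_setup
begin

definition lab :: "machine_state \<Rightarrow> nat \<Rightarrow> nat \<Rightarrow> nat \<Rightarrow> nat" where
 "lab s i q x = warr s 18 (vb i q + x)"

text \<open>\<open>n + u\<close> is the copy of \<open>u\<close> in the reversed graph: its label
  measures the way from \<open>u\<close> to the hub, the label of \<open>v\<close> the way from the
  hub to \<open>v\<close>.\<close>

definition dsum :: "machine_state \<Rightarrow> nat \<Rightarrow> nat \<Rightarrow> nat \<Rightarrow> nat \<Rightarrow> nat" where
 "dsum s i q u v = lab s i q (n + u) + lab s i q v"

text \<open>The sum of the labels, and not only each of them, has to stay within the truncation
  bound. This caps the reported values, as \<open>Dst_cap\<close> needs.\<close>

definition cand :: "machine_state \<Rightarrow> nat \<Rightarrow> nat \<Rightarrow> nat \<Rightarrow> nat set" where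
 "cand s i u v = {q \<in> S. dsum s i q u v \<le> Bd (q div n)}"

definition dval :: "machine_state \<Rightarrow> nat \<Rightarrow> nat \<Rightarrow> nat \<Rightarrow> nat \<Rightarrow> real" where
 "dval s i q u v = real (dsum s i q u v) * unit i (q div n)"

definition Dm :: "machine_state \<Rightarrow> nat \<Rightarrow> nat \<Rightarrow> nat \<Rightarrow> ereal" where
 "Dm s i u v = (INF q\<in>cand s i u v. ereal (dval s i q u v))"

lemma lab_le: "inv s l \<Longrightarrow> i < NI \<Longrightarrow> q \<in> S \<Longrightarrow> x < 2 * n \<Longrightarrow> lab s i q x \<le> Bd (q div n) + 1"
proof -
 assume a: "inv s l" "i < NI" "q \<in> S" "x < 2 * n"
 then have "tree s i q {}" by (auto simp: inv_def trees_ok_def)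
 with a(4) have "sl (warr s 18) (vb i q) x \<le> Bd (q div n) + 1" unfolding tree_def es_inv_def by blast
 then show ?thesis by (simp add: lab_def sl_def)
qed

lemma hub_index:
 assumes "i < NI" "q < Suc L * n"
 shows "i * (Suc L * n) + q < W" "i * (Suc L * n) < W" "vb i q + 2 * n < W" "vb i q < W"
proof -
 show v: "vb i q + 2 * n < W" using vb_le[of i q] assms by simp
 have "(i * (Suc L * n) + q) * 1 \<le> vb i q" unfolding vb_def using n2 by (intro mult_le_mono) auto
 then have "i * (Suc L * n) + q \<le> vb i q" by (simp only: mult_1_right)
 then show *: "i * (Suc L * n) + q < W" using v by linarith
 show "i * (Suc L * n) < W" using le_less_trans[OF le_add1 *] .
 show "vb i q < W" using v by simp
qed

text \<open>The state of the search for the best hub when all codes below \<open>k\<close> have been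
  inspected.\<close>

definition found :: "machine_state \<Rightarrow> nat \<Rightarrow> nat \<Rightarrow> nat \<Rightarrow> nat \<Rightarrow> machine_state \<Rightarrow> bool" where
 "found s i u v k s' \<longleftrightarrow> (if wreg s' 56 = 0 then \<forall>q\<in>cand s i u v. \<not> q < k
  else wreg s' 60 \<in> cand s i u v \<and> rreg s' 4 = dval s i (wreg s' 60) u v \<and>
    (\<forall>q\<in>cand s i u v. q < k \<longrightarrow> rreg s' 4 \<le> dval s i q u v))"

lemma found_skip:
 assumes "found s i u v q s'" "wreg s'' 56 = wreg s' 56" "wreg s'' 60 = wreg s' 60" "rreg s'' 4 = rreg s' 4"
  and "q \<notin> cand s i u v \<or> wreg s' 56 \<noteq> 0 \<and> rreg s' 4 \<le> dval s i q u v"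
 shows "found s i u v (q + 1) s''"
proof (cases "wreg s' 56 = 0")
 case True
 have "\<not> r < q + 1" if "r \<in> cand s i u v" for r
  using assms(1,5) that True by (cases "r = q") (auto simp: found_def)
 with True assms(2) show ?thesis by (simp add: found_def)
next
 case False
 have "rreg s' 4 \<le> dval s i r u v" if "r \<in> cand s i u v" "r < q + 1" for r
  using assms(1,5) that False by (cases "r = q") (auto simp: found_def)
 with False assms show ?thesis by (simp add: found_def)
qed

lemma found_new:
 assumes "found s i u v q s'" "wreg s'' 56 = 1" "wreg s'' 60 = q" "rreg s'' 4 = dval s i q u v"
  and "q \<in> cand s i u v" "wreg s' 56 = 0 \<or> dval s i q u v \<le> rreg s' 4"
 shows "found s i u v (q + 1) s''"
proof -
 have "dval s i q u v \<le> dval s i r u v" if r: "r \<in> cand s i u v" "r < q + 1" for r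
 proof (cases "r = q")
  case False
  then have "r < q" using r by simp
  then have "wreg s' 56 \<noteq> 0" "rreg s' 4 \<le> dval s i r u v" using assms(1) r by (auto simp: found_def split: if_splits)
  with assms(6) show ?thesis by auto
 qed simp
 with assms show ?thesis by (simp add: found_def)
qed

lemma found_Dm:
 assumes "found s i u v (Suc L * n) s'"
 shows "decode_distance (wreg s' 56) (rreg s' 4) = Dm s i u v"
  "wreg s' 56 \<noteq> 0 \<Longrightarrow> wreg s' 60 \<in> cand s i u v \<and> rreg s' 4 = dval s i (wreg s' 60) u v"
proof -
 have all: "q < Suc L * n" if "q \<in> cand s i u v" for q
  using that S_bounds(1) by (simp add: cand_def)
 show "wreg s' 56 \<noteq> 0 \<Longrightarrow> wreg s' 60 \<in> cand s i u v \<and> rreg s' 4 = dval s i (wreg s' 60) u v"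
  using assms by (simp add: found_def)
 show "decode_distance (wreg s' 56) (rreg s' 4) = Dm s i u v"
 proof (cases "wreg s' 56 = 0")
  case True
  then have "cand s i u v = {}" using assms all by (auto simp: found_def)
  with True show ?thesis by (simp add: Dm_def decode_distance_def top_ereal_def)
 next
  case False
  then have f: "wreg s' 60 \<in> cand s i u v" "rreg s' 4 = dval s i (wreg s' 60) u v"
   "\<And>q. q \<in> cand s i u v \<Longrightarrow> rreg s' 4 \<le> dval s i q u v" using assms all by (auto simp: found_def)
  have "Dm s i u v = ereal (rreg s' 4)"
   unfolding Dm_def by (rule INF_eqI) (use f in auto)
  with False show ?thesis by (simp add: decode_distance_def)
 qed
qed

lemma dist_loop:
 assumes I: "inv s l" and i: "wreg s 50 = i" "i < NI" and u: "wreg s 3 = u" "u < n" and v: "wreg s 4 = v" "v < n"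
 shows "wp W dist_loop (\<lambda>t s'. found s i u v (Suc L * n) s' \<and> t \<le> 120 * n * L) s"
proof -
 have st: "static s" using I by (simp add: inv_def)
 let ?b = "WReg 57 [<] (WReg 6 [+] WConst 1) [*] WReg 0"
 let ?inner = "SetW 58 ((WReg 50 [*] ((WReg 6 [+] WConst 1) [*] WReg 0) [+] WReg 57) [*] (WConst 2 [*] WReg 0)) ;;
     SetW 59 (WCell 18 (WReg 58 [+] (WReg 0 [+] WReg 3)) [+] WCell 18 (WReg 58 [+] WReg 4)) ;;
     Cond (WReg 59 [\<le>] WReg 8 [*] WCell 7 (WReg 57 [div] WReg 0))
      (SetR 5 (RWord (WReg 59) {*} (RReg 0 {*} RCell 2 (WReg 50) {/} RWord (WCell 7 (WReg 57 [div] WReg 0)))) ;;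
       Cond (BAnd (WConst 0 [<] WReg 56) (RReg 4 {\<le>} RReg 5)) Skip
        (SetW 56 (WConst 1) ;; SetR 4 (RReg 5) ;; SetW 60 (WReg 57)))
      Skip"
 let ?body = "Cond (WConst 0 [<] WCell 4 (WReg 57)) (?inner) Skip ;; SetW 57 (WReg 57 [+] WConst 1)"
 let ?s = "s\<lparr>wreg := (wreg s)(56 := 0, 57 := n)\<rparr>"
 have loop: "wp W (While ?b ?body) (\<lambda>t s'. found s i u v (Suc L * n) s' \<and> t \<le> 110 * n * L + 10) ?s"
 proof (rule wp_while[where I = "\<lambda>s'. found s i u v (wreg s' 57) s' \<and> wreg s' 57 \<in> {n..Suc L * n}"
   and F = "\<lambda>s'. 110 * (Suc L * n - wreg s' 57)"])
  show "found s i u v (wreg ?s 57) ?s \<and> wreg ?s 57 \<in> {n..Suc L * n}"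
   using S_sub by (auto simp: found_def cand_def)
  fix s' assume I1: "found s i u v (wreg s' 57) s' \<and> wreg s' 57 \<in> {n..Suc L * n}" and ag: "agrees ?body ?s s'"
  have st': "static s'" by (rule static_cong[OF st]) (use ag in \<open>auto simp: agrees_def\<close>)
  have rr: "wreg s' 50 = i" "wreg s' 3 = u" "wreg s' 4 = v" "warr s' 18 = warr s 18"
   using ag i u v by (auto simp: agrees_def)
  define q where "q = wreg s' 57"
  show "eval_bool W s' ?b \<noteq> None \<and> (eval_bool W s' ?b = Some True \<longrightarrow> wp W ?body (\<lambda>t s''.
   (found s i u v (wreg s'' 57) s'' \<and> wreg s'' 57 \<in> {n..Suc L * n}) \<and>
   1 + cost_bool ?b + t + 110 * (Suc L * n - wreg s'' 57) \<le> 110 * (Suc L * n - wreg s' 57)) s')"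
  proof (cases "q < Suc L * n")
   case True
   have q: "n \<le> q" using I1 by (simp add: q_def)
   have eq: "Suc L * n - q = Suc (Suc L * n - (q + 1))" using True by simp
   have qW: "q + 1 < W" using True W_small(5) by simp
   have S4: "warr s' 4 q = (if q \<in> S then 1 else 0)" using static_tables(3)[OF st'] q True by simp
   have fd: "found s i u v q s'" using I1 by (simp add: q_def)
   show ?thesis
   proof (cases "q \<in> S")
    case False
    then have "found s i u v (q + 1) (s'\<lparr>wreg := (wreg s')(57 := q + 1)\<rparr>)"
     by (intro found_skip[OF fd]) (simp_all add: cand_def)
    then show ?thesis using False S4 st' qW W_small(5,11,14) eq q True
     by (simp add: q_def[symmetric] Suc_eq_plus1[of L, symmetric] del: mult_Suc)
   next
    case qS: True
    note qb = S_bounds[OF qS]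
    note hx = hub_index[OF i(2) True]
    have b2: "beta i = rarr s' 2 i" "warr s' 7 (q div n) = 2 ^ (q div n)"
     using static_tables[OF st'] i qb by simp_all
    \<comment> \<open>Labels end at \<open>Bd j + 1\<close>, so even the sum of two of them is a
      word.\<close>
    have l: "lab s i q (n + u) \<le> Bd (q div n) + 1" "lab s i q v \<le> Bd (q div n) + 1"
     using lab_le[OF I i(2) qS] u v by simp_all
    have "Bd (q div n) \<le> Bd L" using Bd_mono qb by simp
    then have ds: "dsum s i q u v < W" "Bd (q div n) < W" "q div n < W" using l W_small(1,9) qb by (simp_all add: dsum_def)
    have dd: "warr s 18 (vb i q + (n + u)) + warr s 18 (vb i q + v) = dsum s i q u v" by (simp add: dsum_def lab_def)
    have ix: "vb i q + (n + u) < W" "vb i q + v < W" "n + u < W" using hx u v W_small(7) by simp_all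
    have unit: "\<delta> * rarr s' 2 i / 2 ^ (q div n) = unit i (q div n)" using b2 by (simp add: unit_def)
    let ?x = "real (dsum s i q u v) * unit i (q div n)"
    have xval: "?x = dval s i q u v" by (simp add: dval_def)
    show ?thesis
    proof (cases "dsum s i q u v \<le> Bd (q div n)")
     case False
     then have "found s i u v (q + 1) (s'\<lparr>wreg := f\<rparr>)" if "f 56 = wreg s' 56" "f 60 = wreg s' 60" for f
      using that by (intro found_skip[OF fd]) (simp_all add: cand_def)
     then show ?thesis using False S4 qS st' qW W_small(1,5,7,11,12,14) eq q True hx ix ds dd rr b2
      by (simp add: q_def[symmetric] vb_def[symmetric] Bd_def[symmetric] Suc_eq_plus1[of L, symmetric] del: mult_Suc)
    next
     case le: True
     then have qc: "q \<in> cand s i u v" using qS by (simp add: cand_def)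
     show ?thesis
     proof (cases "0 < wreg s' 56 \<and> rreg s' 4 \<le> dval s i q u v")
      case True
      then have "found s i u v (q + 1) (s'\<lparr>rreg := g, wreg := f\<rparr>)"
       if "f 56 = wreg s' 56" "f 60 = wreg s' 60" "g 4 = rreg s' 4" for f g
       using that xval by (intro found_skip[OF fd]) simp_all
      then show ?thesis using True le S4 qS st' qW W_small(1,5,7,11,12,14) eq q \<open>q < Suc L * n\<close> hx ix ds dd rr b2(2) unit
       by (simp add: q_def[symmetric] vb_def[symmetric] Bd_def[symmetric] Suc_eq_plus1[of L, symmetric] xval del: mult_Suc times_divide_eq_right)
     next
      case False
      then have "found s i u v (q + 1) (s'\<lparr>rreg := g, wreg := f\<rparr>)"
       if "f 56 = 1" "f 60 = q" "g 4 = dval s i q u v" for f g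
       using that xval qc by (intro found_new[OF fd]) auto
      moreover have "wreg s' 56 \<noteq> 0 \<Longrightarrow> dval s i q u v < rreg s' 4" using False by auto
      ultimately show ?thesis using le S4 qS st' qW W_small(1,5,7,11,12,14) eq q \<open>q < Suc L * n\<close> hx ix ds dd rr b2(2) unit
       by (cases "wreg s' 56 = 0")
        (simp_all add: q_def[symmetric] vb_def[symmetric] Bd_def[symmetric] Suc_eq_plus1[of L, symmetric] xval del: mult_Suc times_divide_eq_right)
     qed
    qed
   qed
  next
   case False
   then show ?thesis using st' W_small(5,11,14) by (simp add: q_def Suc_eq_plus1[of L, symmetric] del: mult_Suc)
  qed
 next
  fix t s' assume I1: "found s i u v (wreg s' 57) s' \<and> wreg s' 57 \<in> {n..Suc L * n}" and ag: "agrees ?body ?s s'"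
   and ev: "eval_bool W s' ?b = Some False"
   and t: "t + 110 * (Suc L * n - wreg s' 57) \<le> 110 * (Suc L * n - wreg ?s 57) + 1 + cost_bool ?b"
  have st': "static s'" by (rule static_cong[OF st]) (use ag in \<open>auto simp: agrees_def\<close>)
  have "wreg s' 57 = Suc L * n"
   using ev st' W_small(5,11,14) I1 by (simp add: Suc_eq_plus1[of L, symmetric] del: mult_Suc)
  moreover have "Suc L * n - n = n * L" by simp
  ultimately show "found s i u v (Suc L * n) s' \<and> t \<le> 110 * n * L + 10" using I1 t by (simp add: mult.commute mult.left_commute)
 qed
 have "2 * 1 \<le> n * L" using n2 L1 by (intro mult_le_mono)
 then show ?thesis
  unfolding dist_loop_def using st W_small(14)
  apply simp
  apply (rule wp_call[OF loop])
  apply (simp add: mult.assoc)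
  done
qed

text \<open>The function \<open>D\<close> of the specification. It depends on the state only through
  the labels and the sorted classes, which no query writes, so it can change only in an
  increase.\<close>

definition Dst :: "machine_state \<Rightarrow> nat \<Rightarrow> nat \<Rightarrow> real \<Rightarrow> ereal" where
 "Dst s u v \<beta> = Dm s (scale (warr s 23) \<beta>) u v"

lemma scale_dist:
 assumes I: "inv s l" and b: "rreg s 3 = \<beta>" "okc \<beta> 0" and u: "wreg s 3 = u" "u < n" and v: "wreg s 4 = v" "v < n"
 shows "wp W (find_scale ;; dist_loop) (\<lambda>t s'. wreg s' 50 = scale (warr s 23) \<beta> \<and>
  found s (scale (warr s 23) \<beta>) u v (Suc L * n) s' \<and> t \<le> 520 * n * L) s"
proof -
 let ?i = "scale (warr s 23) \<beta>"
 have st: "static s" using I by (simp add: inv_def)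
 show ?thesis
  unfolding wp_Seq
  apply (rule wp_call[OF find_scale[OF I b(1)[symmetric] b(2)]])
 proof -
  fix t s1 assume p: "wreg s1 50 = ?i \<and> t \<le> 400 * n * L" and ag: "agrees find_scale s s1"
  have e: "warr s1 = warr s" "rarr s1 = rarr s" "rreg s1 = rreg s" "wreg s1 3 = u" "wreg s1 4 = v"
   using ag u v by (auto simp: agrees_def)
  have "static s1" by (rule static_agrees[OF st ag]) simp_all
  then have I1: "inv s1 l" using I e by (simp add: inv_def trees_ok_def tree_def cost_ok_def cls_ok_def)
  have f: "found s1 i u v k s' = found s i u v k s'" for i k s'
   using e by (simp add: found_def cand_def dval_def dsum_def lab_def)
  have i: "?i < NI" using scale_ok(1)[OF b(2)] by (simp add: okc_def)
  show "wp W dist_loop (\<lambda>t2 s'. wreg s' 50 = ?i \<and> found s ?i u v (Suc L * n) s' \<and> t + t2 \<le> 520 * n * L) s1"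
   by (rule wp_call[OF dist_loop[OF I1 conjunct1[OF p] i e(4) u(2) e(5) v(2)]]) (use p f in \<open>auto simp: agrees_def\<close>)
 qed
qed

lemma distance_query:
 assumes I: "inv s l" and b: "rreg s 3 = \<beta>" "okc \<beta> 0" and u: "wreg s 3 = u" "u < n" and v: "wreg s 4 = v" "v < n"
 shows "wp W distance_query (\<lambda>t s'. decode_distance (wreg s' 5) (rreg s' 4) = Dst s u v \<beta> \<and> t \<le> 600 * n * L) s"
proof -
 have nL: "2 * 1 \<le> n * L" using n2 L1 by (intro mult_le_mono)
 have "wp W ((find_scale ;; dist_loop) ;; SetW 5 (WReg 56))
  (\<lambda>t s'. decode_distance (wreg s' 5) (rreg s' 4) = Dst s u v \<beta> \<and> t \<le> 600 * n * L) s"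
  apply (subst wp_Seq)
  apply (rule wp_call[OF scale_dist[OF I b u v]])
  using found_Dm nL by (auto simp: Dst_def)
 then show ?thesis by (simp only: distance_query_def)
qed

end

section \<open>Path queries\<close>

definition clear_marks :: com where
 "clear_marks = SetW 61 (WConst 0) ;;
  While (WReg 61 [<] WReg 0) (PutW 20 (WReg 61) (WConst 0) ;; SetW 61 (WReg 61 [+] WConst 1))"

text \<open>The parents are followed from \<open>v\<close> up to the hub. Each vertex on the way is
  marked in array 20 with one more than the arc that leads on towards \<open>v\<close>; the mark
  \<open>m + 1\<close> of \<open>v\<close> itself is merely nonzero.\<close>

definition mark_out :: com where
 "mark_out =
  SetW 58 ((WReg 50 [*] ((WReg 6 [+] WConst 1) [*] WReg 0) [+] WReg 60) [*] (WConst 2 [*] WReg 0)) ;;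
  SetW 62 (WReg 60 [mod] WReg 0) ;;
  PutW 20 (WReg 4) (WReg 1 [+] WConst 1) ;;
  SetW 63 (WReg 4) ;;
  While (BNot (WReg 63 [=] WReg 62))
   (SetW 64 (WCell 19 (WReg 58 [+] WReg 63) [-] WConst 1) ;;
    SetW 63 (WCell 10 (WReg 64)) ;;
    PutW 20 (WReg 63) (WReg 64 [+] WConst 1))"

text \<open>Parent arcs here are reversed copies, hence the subtraction of \<open>m\<close>.
  Stopping at the first marked vertex makes the route simple although the two tree paths may
  cross.\<close>

definition walk_in :: com where
 "walk_in =
  SetW 63 (WReg 3) ;; SetW 5 (WConst 0) ;;
  While (WCell 20 (WReg 63) [=] WConst 0)
   (SetW 64 (WCell 19 (WReg 58 [+] (WReg 0 [+] WReg 63)) [-] WConst 1 [-] WReg 1) ;;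
    PutW 6 (WReg 5) (WReg 64) ;; SetW 5 (WReg 5 [+] WConst 1) ;; SetW 63 (WCell 11 (WReg 64)))"

definition walk_out :: com where
 "walk_out =
  While (BNot (WReg 63 [=] WReg 4))
   (SetW 64 (WCell 20 (WReg 63) [-] WConst 1) ;;
    PutW 6 (WReg 5) (WReg 64) ;; SetW 5 (WReg 5 [+] WConst 1) ;; SetW 63 (WCell 11 (WReg 64)))"

definition path_query :: com where
 "path_query = (find_scale ;; dist_loop) ;;
  Cond (WConst 0 [<] WReg 56) (clear_marks ;; mark_out ;; walk_in ;; walk_out) (SetW 5 (WConst 0))"

lemma mods_path [simp]:
 "mw clear_marks = {61}" "mr clear_marks = {}" "ma clear_marks = {20}" "mb clear_marks = {}"
 "mw mark_out = {58, 62, 63, 64}" "mr mark_out = {}" "ma mark_out = {20}" "mb mark_out = {}"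
 "mw walk_in = {5, 63, 64}" "mr walk_in = {}" "ma walk_in = {6}" "mb walk_in = {}"
 "mw walk_out = {5, 63, 64}" "mr walk_out = {}" "ma walk_out = {6}" "mb walk_out = {}"
 by (auto simp: clear_marks_def mark_out_def walk_in_def walk_out_def)

lemma mods_path_query [simp]:
 "mw path_query = {5, 50, 51, 52, 53, 54, 55, 56, 57, 58, 59, 60, 61, 62, 63, 64}" "mr path_query = {4, 5}"
 "ma path_query = {6, 20}" "mb path_query = {}"
 by (auto simp: path_query_def)

context machine_setup
begin

primrec wk :: "nat \<Rightarrow> nat list \<Rightarrow> nat \<Rightarrow> bool" where
 "wk u [] v \<longleftrightarrow> u = v"
| "wk u (e # p) v \<longleftrightarrow> e < m \<and> ta e = u \<and> wk (he e) p v"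

definition vs :: "nat \<Rightarrow> nat list \<Rightarrow> nat list" where "vs u p = u # map he p"

definition nsum :: "(nat \<Rightarrow> real) \<Rightarrow> nat \<Rightarrow> nat \<Rightarrow> nat list \<Rightarrow> nat" where
 "nsum l i j p = (\<Sum>e\<leftarrow>p. Nf i j (l e) + 1)"

lemma nsum_simps [simp]:
 "nsum l i j [] = 0" "nsum l i j (e # p) = Nf i j (l e) + 1 + nsum l i j p"
 "nsum l i j (p @ r) = nsum l i j p + nsum l i j r"
 by (simp_all add: nsum_def)

lemma wk_append: "wk u (p @ r) v \<longleftrightarrow> (\<exists>x. wk u p x \<and> wk x r v)"
 by (induction p arbitrary: u) auto

lemma wk_less: "wk u p v \<Longrightarrow> u < n \<Longrightarrow> set (vs u p) \<subseteq> {..<n} \<and> v < n"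
proof (induction p arbitrary: u)
 case (Cons e p)
 have "set (vs (he e) p) \<subseteq> {..<n} \<and> v < n" using Cons.IH[of "he e"] Cons.prems he_less by simp
 then show ?case using Cons.prems by (simp add: vs_def)
qed (simp add: vs_def)

lemma wk_ta: "wk u p v \<Longrightarrow> e \<in> set p \<Longrightarrow> ta e \<in> set (vs u p) \<and> e < m"
 by (induction p arbitrary: u) (auto simp: vs_def)

lemma wk_last: "wk u p v \<Longrightarrow> v \<in> set (vs u p)"
 by (induction p arbitrary: u) (auto simp: vs_def)

lemma wk_split: "wk w p v \<Longrightarrow> x \<in> set (vs w p) \<Longrightarrow> \<exists>a r. p = a @ r \<and> wk w a x \<and> wk x r v"
proof (induction p arbitrary: w)
 case Nil
 then show ?case by (auto simp: vs_def)
next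
 case (Cons e p)
 show ?case
 proof (cases "x = w")
  case True
  then have "e # p = [] @ e # p \<and> wk w [] x \<and> wk x (e # p) v" using Cons.prems by simp
  then show ?thesis by blast
 next
  case False
  have "wk (he e) p v" "x \<in> set (vs (he e) p)" using Cons.prems False by (auto simp: vs_def)
  from Cons.IH[OF this] obtain a r where "p = a @ r" "wk (he e) a x" "wk x r v" by blast
  then have "e # p = (e # a) @ r \<and> wk w (e # a) x \<and> wk x r v" using Cons.prems by simp
  then show ?thesis by blast
 qed
qed

lemma inv_agrees:
 assumes I: "inv s l" and ag: "agrees c s s'" and c: "mw c \<inter> {0, 1, 6, 7, 8} = {}" "0 \<notin> mr c" "2 \<notin> mb c"
  "ma c \<inter> {4, 7, 8, 9, 10, 11, 12, 13, 14, 15, 17, 18, 19, 22, 23} = {}"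
 shows "inv s' l" "lab s' = lab s" "warr s' 19 = warr s 19"
proof -
 have "static s'" by (rule static_agrees[OF _ ag]) (use I c in \<open>auto simp: inv_def\<close>)
 moreover have *: "warr s' 17 = warr s 17" "warr s' 18 = warr s 18" "warr s' 19 = warr s 19"
  "warr s' 22 = warr s 22" "warr s' 23 = warr s 23"
  using ag c by (auto simp: agrees_def)
 ultimately show "inv s' l" using I by (simp add: inv_def trees_ok_def tree_def cost_ok_def cls_ok_def)
 show "lab s' = lab s" "warr s' 19 = warr s 19" using * by (auto simp: lab_def fun_eq_iff)
qed

text \<open>In the stable state a vertex inside the bound and different from the hub is supported by
  its current arc. That arc costs \<open>c + 1\<close>, so the strict inequality says that it
  attains the label; labels drop strictly along parents.\<close>

lemma tree_parent:
 assumes I: "inv s l" and i: "i < NI" and q: "q \<in> S" "j = q div n" and x: "x < 2 * n" "x mod n \<noteq> q mod n"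
  and d: "lab s i q x \<le> Bd j"
 defines "a \<equiv> warr s 19 (vb i q + x) - 1"
 shows "warr s 19 (vb i q + x) \<noteq> 0" "a < 2 * m" "HD a = x"
  "lab s i q (TL a) + warr s 17 (cb i j + a) < lab s i q x"
proof -
 have "tree s i q {}" using I i q by (auto simp: inv_def trees_ok_def)
 then have t: "es_inv (q mod n) (Bd j) (sl (warr s 17) (cb i j)) (sl (warr s 18) (vb i q)) (sl (warr s 19) (vb i q)) {}"
  by (simp add: tree_def q)
 have ld: "lab s i q y = sl (warr s 18) (vb i q) y" for y by (simp add: lab_def sl_def)
 have "x mod n = q mod n \<or> sl (warr s 18) (vb i q) x > Bd j \<or>
   sl (warr s 19) (vb i q) x \<noteq> 0 \<and> sl (warr s 18) (vb i q) (TL (sl (warr s 19) (vb i q) x - 1)) +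
   sl (warr s 17) (cb i j) (sl (warr s 19) (vb i q) x - 1) < sl (warr s 18) (vb i q) x"
  using t x(1) unfolding es_inv_def by blast
 then have "sl (warr s 19) (vb i q) x \<noteq> 0 \<and> sl (warr s 18) (vb i q) (TL (sl (warr s 19) (vb i q) x - 1)) +
   sl (warr s 17) (cb i j) (sl (warr s 19) (vb i q) x - 1) < sl (warr s 18) (vb i q) x"
  using x(2) d unfolding ld by linarith
 moreover have "sl (warr s 19) (vb i q) x = 0 \<or> sl (warr s 19) (vb i q) x \<le> 2 * m \<and> HD (sl (warr s 19) (vb i q) x - 1) = x"
  using t x(1) unfolding es_inv_def by blast
 ultimately show "warr s 19 (vb i q + x) \<noteq> 0" "a < 2 * m" "HD a = x"
  "lab s i q (TL a) + warr s 17 (cb i j + a) < lab s i q x"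
  unfolding a_def ld by (auto simp: sl_def)
qed

lemma tree_out:
 assumes I: "inv s l" and i: "i < NI" and q: "q \<in> S" "j = q div n" and x: "x < n" "x \<noteq> q mod n"
  and d: "lab s i q x \<le> Bd j"
 shows "\<exists>e<m. warr s 19 (vb i q + x) = e + 1 \<and> he e = x \<and> lab s i q (ta e) + Nf i j (l e) + 1 \<le> lab s i q x"
proof -
 have x': "x < 2 * n" "x mod n \<noteq> q mod n" using x by auto
 note p = tree_parent[OF I i q x' d]
 let ?a = "warr s 19 (vb i q + x) - 1"
 have am: "?a < m" using p(3) x by (auto simp: HD_def split: if_splits)
 have "cost_ok s (Nl l)" using I by (simp add: inv_def)
 from cost_okD(2)[OF this i _ am] S_bounds[OF q(1)] q have "warr s 17 (cb i j + ?a) = Nf i j (l ?a)"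
  by (simp add: Nl_def)
 then show ?thesis using p am by (intro exI[of _ ?a]) (auto simp: HD_def TL_def)
qed

text \<open>The parent arc \<open>m + e\<close> of \<open>n + x\<close>, read forwards, is an arc
  \<open>e\<close> leaving \<open>x\<close>; parents of the reversed copy thus lead towards the
  hub.\<close>

lemma tree_in:
 assumes I: "inv s l" and i: "i < NI" and q: "q \<in> S" "j = q div n" and x: "x < n" "x \<noteq> q mod n"
  and d: "lab s i q (n + x) \<le> Bd j"
 shows "\<exists>e<m. warr s 19 (vb i q + (n + x)) = m + e + 1 \<and> ta e = x \<and> lab s i q (n + he e) + Nf i j (l e) + 1 \<le> lab s i q (n + x)"
proof -
 have x': "n + x < 2 * n" "(n + x) mod n \<noteq> q mod n" using x by auto
 note p = tree_parent[OF I i q x' d]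
 let ?a = "warr s 19 (vb i q + (n + x)) - 1"
 have am: "\<not> ?a < m" using p(3) he_less[of ?a] by (auto simp: HD_def)
 define e where "e = ?a - m"
 have em: "e < m" "warr s 19 (vb i q + (n + x)) = m + e + 1" using am p(1,2) by (auto simp: e_def)
 have "cost_ok s (Nl l)" using I by (simp add: inv_def)
 from cost_okD(3)[OF this i _ em(1)] S_bounds[OF q(1)] q have "warr s 17 (cb i j + (m + e)) = Nf i j (l e)"
  by (simp add: Nl_def)
 then show ?thesis using p em by (intro exI[of _ e]) (auto simp: HD_def TL_def)
qed

lemma inv_static: "inv s l \<Longrightarrow> static s"
 by (simp add: inv_def)

lemma clear_marks:
 assumes "static s"
 shows "wp W clear_marks (\<lambda>t s'. (\<forall>x<n. warr s' 20 x = 0) \<and> t \<le> 30 * n + 20) s"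
 unfolding clear_marks_def using assms W_small(14)
 apply simp
 apply (rule wp_while[where I = "\<lambda>s'. wreg s' 61 \<le> n \<and> (\<forall>x<wreg s' 61. warr s' 20 x = 0)" and F = "\<lambda>s'. 20 * (n - wreg s' 61)"])
 subgoal by simp
 subgoal for s' using W_small(12) by (auto simp: agrees_def less_Suc_eq[of _ "wreg s' 61"] Suc_eq_plus1[of "wreg s' 61", symmetric])
 subgoal for t s' by (auto simp: agrees_def)
 done

text \<open>All vertices marked so far have labels at least that of the current one, and the next
  label is strictly smaller. Hence the next vertex is new, the path is simple, and the number of
  unmarked vertices bounds the remaining time.\<close>

lemma mark_out:
 assumes I: "inv s l" and i: "wreg s 50 = i" "i < NI" and q: "wreg s 60 = q" "q \<in> S" "j = q div n"
  and v: "wreg s 4 = v" "v < n" "lab s i q v \<le> Bd j" and z: "\<forall>x<n. warr s 20 x = 0"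
 shows "wp W mark_out (\<lambda>t s'. wreg s' 58 = vb i q \<and> (\<exists>p. wk (q mod n) p v \<and> distinct (vs (q mod n) p) \<and>
   (\<forall>e\<in>set p. warr s' 20 (ta e) = e + 1) \<and> (\<forall>y<n. warr s' 20 y \<noteq> 0 \<longleftrightarrow> y \<in> set (vs (q mod n) p)) \<and>
   nsum l i j p \<le> lab s i q v) \<and> t \<le> 60 * n + 80) s"
proof -
 let ?w = "q mod n"
 have st: "static s" using I by (simp add: inv_def)
 note qb = S_bounds[OF q(2)]
 note hx = hub_index[OF i(2) qb(1)]
 let ?b = "BNot (WReg 63 [=] WReg 62)"
 let ?c = "SetW 64 (WCell 19 (WReg 58 [+] WReg 63) [-] WConst 1) ;; SetW 63 (WCell 10 (WReg 64)) ;;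
    PutW 20 (WReg 63) (WReg 64 [+] WConst 1)"
 let ?s = "s\<lparr>warr := (warr s)(20 := (warr s 20)(v := m + 1)), wreg := (wreg s)(58 := vb i q, 62 := ?w, 63 := v)\<rparr>"
 let ?Q = "\<lambda>x s' p. wk x p v \<and> distinct (vs x p) \<and> (\<forall>e\<in>set p. warr s' 20 (ta e) = e + 1) \<and>
   (\<forall>y<n. warr s' 20 y \<noteq> 0 \<longleftrightarrow> y \<in> set (vs x p)) \<and> nsum l i j p + lab s i q x \<le> lab s i q v \<and>
   (\<forall>y\<in>set (vs x p). lab s i q x \<le> lab s i q y)"
 let ?card = "\<lambda>s'. card {y. y < n \<and> warr s' 20 y \<noteq> 0}"
 let ?post = "\<lambda>t s'. wreg s' 58 = vb i q \<and> (\<exists>p. wk ?w p v \<and> distinct (vs ?w p) \<and>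
   (\<forall>e\<in>set p. warr s' 20 (ta e) = e + 1) \<and> (\<forall>y<n. warr s' 20 y \<noteq> 0 \<longleftrightarrow> y \<in> set (vs ?w p)) \<and>
   nsum l i j p \<le> lab s i q v) \<and> t \<le> 60 * n + 20"
 have loop: "wp W (While ?b ?c) ?post ?s"
 proof (rule wp_while[where I = "\<lambda>s'. wreg s' 63 < n \<and> (\<exists>p. ?Q (wreg s' 63) s' p)" and F = "\<lambda>s'. 60 * (n - ?card s')"])
  show "wreg ?s 63 < n \<and> (\<exists>p. ?Q (wreg ?s 63) ?s p)"
   using v z by (auto simp: vs_def intro!: exI[of _ "[]"])
  fix s' assume I1: "wreg s' 63 < n \<and> (\<exists>p. ?Q (wreg s' 63) s' p)" and ag: "agrees ?c ?s s'"
  define x where "x = wreg s' 63"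
  from I1 obtain p where Q: "?Q x s' p" and xn: "x < n" by (auto simp: x_def)
  have st': "static s'" by (rule static_cong[OF st]) (use ag in \<open>auto simp: agrees_def\<close>)
  have rr: "wreg s' 58 = vb i q" "wreg s' 62 = ?w" "warr s' 19 = warr s 19" using ag by (auto simp: agrees_def)
  show "eval_bool W s' ?b \<noteq> None \<and> (eval_bool W s' ?b = Some True \<longrightarrow> wp W ?c (\<lambda>t s''.
   (wreg s'' 63 < n \<and> (\<exists>p. ?Q (wreg s'' 63) s'' p)) \<and> 1 + cost_bool ?b + t + 60 * (n - ?card s'') \<le> 60 * (n - ?card s')) s')"
  proof (cases "x = ?w")
   case False
   have "lab s i q x \<le> Bd j" using Q v by linarith
   from tree_out[OF I i(2) q(2,3) xn False this] obtain e where e: "e < m" "warr s 19 (vb i q + x) = e + 1"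
    "he e = x" "lab s i q (ta e) + Nf i j (l e) + 1 \<le> lab s i q x" by blast
   have tl: "warr s' 10 e = ta e" using static_adj(2)[OF st', of e] e by (simp add: TL_def)
   have eW: "e + 1 < W" "e < W" "vb i q + x < W" using e W_small(13) xn hx by simp_all
   have new: "ta e \<notin> set (vs x p)" using Q e by fastforce
   have tan: "ta e < n" using ta_less e by simp
   have z0: "warr s' 20 (ta e) = 0" using Q new tan by blast
   let ?s' = "s'\<lparr>warr := (warr s')(20 := (warr s' 20)(ta e := e + 1)), wreg := (wreg s')(64 := e, 63 := ta e)\<rparr>"
   have "{y. y < n \<and> warr ?s' 20 y \<noteq> 0} = insert (ta e) {y. y < n \<and> warr s' 20 y \<noteq> 0}" using tan by auto
   then have card: "?card ?s' = Suc (?card s')" using z0 by simp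
   have "?card ?s' \<le> card {..<n}" by (rule card_mono) auto
   then have cn: "?card s' < n" using card by simp
   have follow: "warr ?s' 20 (ta f) = f + 1" if "f \<in> set (e # p)" for f
    using Q that wk_ta[of x p v f] new by (cases "ta f = ta e") auto
   have "?Q (ta e) ?s' (e # p)"
    using Q e new follow tan by (auto simp: vs_def)
   then have post: "\<exists>p. ?Q (ta e) ?s' p" by blast
   have fin: "60 * (n - ?card ?s') + 60 \<le> 60 * (n - ?card s')" using card cn by simp
   show ?thesis using False rr e tl eW tan post fin W_small(14)
    by (simp add: x_def[symmetric])
  qed (use rr in \<open>simp add: x_def\<close>)
 next
  fix t s' assume I1: "wreg s' 63 < n \<and> (\<exists>p. ?Q (wreg s' 63) s' p)" and ag: "agrees ?c ?s s'"
   and ev: "eval_bool W s' ?b = Some False" and t: "t + 60 * (n - ?card s') \<le> 60 * (n - ?card ?s) + 1 + cost_bool ?b"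
  have rr: "wreg s' 58 = vb i q" "wreg s' 62 = ?w" using ag by (auto simp: agrees_def)
  then have "wreg s' 63 = ?w" using ev by simp
  moreover have "60 * (n - ?card ?s) \<le> 60 * n" by simp
  ultimately show "?post t s'" using I1 t rr by fastforce
 qed
 have mm: "as_word W (q mod n) = Some (q mod n)" using qb(4) W_small(12) by (intro as_word_Some) linarith
 have "m + 1 < W" using W_small(4) n2 by simp
 then show ?thesis
  unfolding mark_out_def
  using st i q v hx W_small(1,5,7,11,12,13,14) qb
  apply (simp add: vb_def[symmetric] Suc_eq_plus1[of L, symmetric] mm del: mult_Suc)
  apply (rule wp_call[OF loop[unfolded q(3)]])
  apply auto
  done
qed

lemma map_snoc_upd: "map (f(k := e)) [0..<k + 1] = map f [0..<k] @ [e]"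
 by (simp flip: Suc_eq_plus1)

lemma distinct_vs_length:
 assumes "distinct (vs u p)" "wk u p v" "u < n"
 shows "length p < n"
proof -
 have "card (set (vs u p)) \<le> card {..<n}" using wk_less[OF assms(2,3)] by (intro card_mono) auto
 then show ?thesis using distinct_card[OF assms(1)] by (simp add: vs_def)
qed

text \<open>Again the labels decrease strictly along the walk, so vertices do not repeat and fewer
  than \<open>n\<close> arcs are written.\<close>

lemma walk_in:
 assumes I: "inv s l" and r: "wreg s 58 = vb i q" "i < NI" and q: "q \<in> S" "j = q div n"
  and u: "wreg s 3 = u" "u < n" "lab s i q (n + u) \<le> Bd j" and z: "warr s 20 (q mod n) \<noteq> 0"
 shows "wp W walk_in (\<lambda>t s'. (\<exists>p. p = map (warr s' 6) [0..<wreg s' 5] \<and> wk u p (wreg s' 63) \<and>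
   warr s 20 (wreg s' 63) \<noteq> 0 \<and> distinct (vs u p) \<and> (\<forall>y\<in>set (vs u p). y \<noteq> wreg s' 63 \<longrightarrow> warr s 20 y = 0) \<and>
   nsum l i j p \<le> lab s i q (n + u)) \<and> t \<le> 60 * n + 30) s"
proof -
 have st: "static s" using I by (simp add: inv_def)
 note qb = S_bounds[OF q(1)]
 note hx = hub_index[OF r(2) qb(1)]
 let ?b = "WCell 20 (WReg 63) [=] WConst 0"
 let ?c = "SetW 64 (WCell 19 (WReg 58 [+] (WReg 0 [+] WReg 63)) [-] WConst 1 [-] WReg 1) ;;
    PutW 6 (WReg 5) (WReg 64) ;; SetW 5 (WReg 5 [+] WConst 1) ;; SetW 63 (WCell 11 (WReg 64))"
 let ?s = "s\<lparr>wreg := (wreg s)(63 := u, 5 := 0)\<rparr>"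
 let ?Q = "\<lambda>x p. wk u p x \<and> distinct (vs u p) \<and> (\<forall>y\<in>set (vs u p). y \<noteq> x \<longrightarrow> warr s 20 y = 0) \<and>
   (\<forall>y\<in>set (vs u p). lab s i q (n + x) \<le> lab s i q (n + y)) \<and>
   nsum l i j p + lab s i q (n + x) \<le> lab s i q (n + u)"
 let ?I = "\<lambda>s'. ?Q (wreg s' 63) (map (warr s' 6) [0..<wreg s' 5])"
 let ?post = "\<lambda>t s'. (\<exists>p. p = map (warr s' 6) [0..<wreg s' 5] \<and> wk u p (wreg s' 63) \<and>
   warr s 20 (wreg s' 63) \<noteq> 0 \<and> distinct (vs u p) \<and> (\<forall>y\<in>set (vs u p). y \<noteq> wreg s' 63 \<longrightarrow> warr s 20 y = 0) \<and>
   nsum l i j p \<le> lab s i q (n + u)) \<and> t \<le> 60 * n + 15"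
 have loop: "wp W (While ?b ?c) ?post ?s"
 proof (rule wp_while[where I = ?I and F = "\<lambda>s'. 60 * (n - wreg s' 5)"])
  show "?I ?s" by (simp add: vs_def)
  fix s' assume I1: "?I s'" and ag: "agrees ?c ?s s'"
  define x p where "x = wreg s' 63" and "p = map (warr s' 6) [0..<wreg s' 5]"
  have Q: "?Q x p" using I1 by (simp add: x_def p_def)
  have xn: "x < n" using Q wk_less[of u p x] u by blast
  have st': "static s'" by (rule static_cong[OF st]) (use ag in \<open>auto simp: agrees_def\<close>)
  have rr: "wreg s' 58 = vb i q" "warr s' 19 = warr s 19" "warr s' 20 = warr s 20" using ag r by (auto simp: agrees_def)
  have kn: "wreg s' 5 < n" using distinct_vs_length[of u p x] Q u by (simp add: p_def)
  show "eval_bool W s' ?b \<noteq> None \<and> (eval_bool W s' ?b = Some True \<longrightarrow> wp W ?c (\<lambda>t s''.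
   ?I s'' \<and> 1 + cost_bool ?b + t + 60 * (n - wreg s'' 5) \<le> 60 * (n - wreg s' 5)) s')"
  proof (cases "warr s 20 x = 0")
   case True
   \<comment> \<open>The hub is marked, so an unmarked vertex is not the hub and has a
     parent.\<close>
   then have xw: "x \<noteq> q mod n" using z by auto
   have "lab s i q (n + x) \<le> Bd j" using Q u by linarith
   from tree_in[OF I r(2) q xn xw this] obtain e where e: "e < m" "warr s 19 (vb i q + (n + x)) = m + e + 1"
    "ta e = x" "lab s i q (n + he e) + Nf i j (l e) + 1 \<le> lab s i q (n + x)" by blast
   have hd: "warr s' 11 e = he e" using static_adj(3)[OF st', of e] e by (simp add: HD_def)
   have eW: "e < W" "m + e < W" "n + x < W" "vb i q + (n + x) < W" "wreg s' 5 + 1 < W"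
    using e W_small(4,6,7,12,13) xn hx kn by simp_all
   have new: "he e \<notin> set (vs u p)" using Q e by fastforce
   have Q': "?Q (he e) (p @ [e])"
    using Q e new True by (fastforce simp: vs_def wk_append)
   have mp: "map ((warr s' 6)(wreg s' 5 := e)) [0..<wreg s' 5 + 1] = p @ [e]"
    unfolding map_snoc_upd p_def ..
   have fin: "60 * (n - (wreg s' 5 + 1)) + 60 \<le> 60 * (n - wreg s' 5)" using kn by simp
   show ?thesis using True rr e hd eW Q' fin W_small(14) st'
    by (simp add: x_def[symmetric] mp del: upt_Suc)
  qed (use rr W_small(14) in \<open>simp add: x_def\<close>)
 next
  fix t s' assume I1: "?I s'" and ag: "agrees ?c ?s s'"
   and ev: "eval_bool W s' ?b = Some False" and t: "t + 60 * (n - wreg s' 5) \<le> 60 * (n - wreg ?s 5) + 1 + cost_bool ?b"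
  have rr: "warr s' 20 = warr s 20" using ag by (auto simp: agrees_def)
  then have "warr s 20 (wreg s' 63) \<noteq> 0" using ev W_small(14) by simp
  then show "?post t s'" using I1 t by simp
 qed
 show ?thesis
  unfolding walk_in_def
  using u W_small(14)
  apply simp
  apply (rule wp_call[OF loop])
  apply auto
  done
qed

text \<open>The marks determine the continuation: the mark of a vertex on the out-path names the arc
  by which the path leaves it.\<close>

lemma walk_out:
 assumes st: "static s" and u: "u < n" and v: "wreg s 4 = v"
  and p: "p = map (warr s 6) [0..<wreg s 5]" "wk u p (wreg s 63)" "wk (wreg s 63) r v"
   "\<forall>e\<in>set r. warr s 20 (ta e) = e + 1" "distinct (vs u (p @ r))"
 shows "wp W walk_out (\<lambda>t s'. map (warr s' 6) [0..<wreg s' 5] = p @ r \<and> t \<le> 60 * n + 20) s"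
 unfolding walk_out_def
proof (rule wp_while[where I = "\<lambda>s'. \<exists>p' r'. p' = map (warr s' 6) [0..<wreg s' 5] \<and> wk u p' (wreg s' 63) \<and>
  wk (wreg s' 63) r' v \<and> p' @ r' = p @ r \<and> set r' \<subseteq> set r" and F = "\<lambda>s'. 60 * (n - wreg s' 5)"])
 let ?b = "BNot (WReg 63 [=] WReg 4)"
 let ?c = "SetW 64 (WCell 20 (WReg 63) [-] WConst 1) ;;
    PutW 6 (WReg 5) (WReg 64) ;; SetW 5 (WReg 5 [+] WConst 1) ;; SetW 63 (WCell 11 (WReg 64))"
 let ?I = "\<lambda>s'. \<exists>p' r'. p' = map (warr s' 6) [0..<wreg s' 5] \<and> wk u p' (wreg s' 63) \<and>
  wk (wreg s' 63) r' v \<and> p' @ r' = p @ r \<and> set r' \<subseteq> set r"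
 show "?I s" using p by blast
 have all: "wk u (p @ r) v" using p by (auto simp: wk_append)
 {
  fix s' assume I1: "?I s'" and ag: "agrees ?c s s'"
  then obtain p' r' where Q: "p' = map (warr s' 6) [0..<wreg s' 5]" "wk u p' (wreg s' 63)"
  "wk (wreg s' 63) r' v" "p' @ r' = p @ r" "set r' \<subseteq> set r" by blast
  have st': "static s'" by (rule static_cong[OF st]) (use ag in \<open>auto simp: agrees_def\<close>)
  have rr: "wreg s' 4 = v" "warr s' 20 = warr s 20" using ag v by (auto simp: agrees_def)
  show "eval_bool W s' ?b \<noteq> None \<and> (eval_bool W s' ?b = Some True \<longrightarrow> wp W ?c (\<lambda>t s''.
   ?I s'' \<and> 1 + cost_bool ?b + t + 60 * (n - wreg s'' 5) \<le> 60 * (n - wreg s' 5)) s')"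
  proof (cases "wreg s' 63 = v")
   case False
   then obtain e r'' where e: "r' = e # r''" using Q by (cases r') auto
   have em: "e < m" "ta e = wreg s' 63" "wk (he e) r'' v" using Q e by auto
   have M: "warr s 20 (wreg s' 63) = e + 1" using p(4) Q(5) e em(2) by auto
   have hd: "warr s' 11 e = he e" using static_adj(3)[OF st', of e] em by (simp add: HD_def)
   have "length (p @ r) < n" by (rule distinct_vs_length[OF p(5) all u])
   then have kn: "wreg s' 5 + 1 \<le> n" unfolding Q(4)[symmetric] using Q(1) e by simp
   have mp: "map ((warr s' 6)(wreg s' 5 := e)) [0..<wreg s' 5 + 1] = p' @ [e]"
    unfolding map_snoc_upd Q(1) ..
   have eW: "e < W" "wreg s' 5 + 1 < W" using em W_small(12,13) kn by simp_all
   have Q': "\<exists>r'. wk u (p' @ [e]) (he e) \<and> wk (he e) r' v \<and> (p' @ [e]) @ r' = p @ r \<and> set r' \<subseteq> set r"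
    using Q e em by (intro exI[of _ r'']) (auto simp: wk_append)
   have fin: "60 * (n - (wreg s' 5 + 1)) + 60 \<le> 60 * (n - wreg s' 5)" using kn by simp
   show ?thesis using False rr M hd eW Q' fin W_small(14) st'
    by (simp add: mp del: upt_Suc)
  qed (use rr in simp)
 }
 fix t s' assume I1: "?I s'" and ag: "agrees ?c s s'"
  and ev: "eval_bool W s' ?b = Some False" and t: "t + 60 * (n - wreg s' 5) \<le> 60 * (n - wreg s 5) + 1 + cost_bool ?b"
 then obtain p' r' where Q: "p' = map (warr s' 6) [0..<wreg s' 5]" "wk u p' (wreg s' 63)"
  "wk (wreg s' 63) r' v" "p' @ r' = p @ r" "set r' \<subseteq> set r" by blast
 have "wreg s' 4 = v" using ag v by (auto simp: agrees_def)
 then have x: "wreg s' 63 = v" using ev by simp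
 \<comment> \<open>At \<open>v\<close> nothing is left: a nonempty rest would end in
   \<open>v\<close> once more and repeat a vertex of a simple route.\<close>
 have "r' = []"
 proof (rule ccontr)
  assume "r' \<noteq> []"
  then obtain e r'' where e: "r' = e # r''" by (cases r') auto
  have "v \<in> set (vs (he e) r'')" using Q e by (intro wk_last) auto
  then have "v \<in> set (map he r')" using e by (simp add: vs_def)
  moreover have "v \<in> set (vs u p')" using Q x wk_last by simp
  ultimately show False using p(5) unfolding Q(4)[symmetric] by (auto simp: vs_def)
 qed
 then show "map (warr s' 6) [0..<wreg s' 5] = p @ r \<and> t \<le> 60 * n + 20" using Q t by simp
qed

end

section \<open>A tournament tree as priority queue\<close>

definition set_leaf :: com where
 "set_leaf =
  PutW 25 (WReg 73) (WReg 74) ;;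
  While (WConst 1 [<] WReg 73)
   (SetW 73 (WReg 73 [div] WConst 2) ;;
    Cond (WCell 25 (WConst 2 [*] WReg 73) [<] WCell 25 (WConst 2 [*] WReg 73 [+] WConst 1))
     (PutW 25 (WReg 73) (WCell 25 (WConst 2 [*] WReg 73)))
     (PutW 25 (WReg 73) (WCell 25 (WConst 2 [*] WReg 73 [+] WConst 1))))"

definition find_min :: com where
 "find_min =
  SetW 73 (WConst 1) ;;
  While (WReg 73 [<] WReg 75)
   (Cond (WCell 25 (WConst 2 [*] WReg 73) [<] WCell 25 (WConst 2 [*] WReg 73 [+] WConst 1))
     (SetW 73 (WConst 2 [*] WReg 73))
     (SetW 73 (WConst 2 [*] WReg 73 [+] WConst 1)))"

lemma mods_tour [simp]:
 "mw set_leaf = {73}" "mr set_leaf = {}" "ma set_leaf = {25}" "mb set_leaf = {}"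
 "mw find_min = {73}" "mr find_min = {}" "ma find_min = {}" "mb find_min = {}"
 by (auto simp: set_leaf_def find_min_def)

text \<open>A tournament tree on \<open>P\<close> leaves, stored in heap order.\<close>

definition tour :: "nat \<Rightarrow> (nat \<Rightarrow> nat) \<Rightarrow> bool" where
 "tour P T \<longleftrightarrow> (\<forall>x. 1 \<le> x \<longrightarrow> x < P \<longrightarrow> T x = min (T (2 * x)) (T (2 * x + 1)))"

lemma tour_min:
 assumes "tour P T" "1 \<le> x" "x < 2 * P"
 shows "T 1 \<le> T x"
 using assms(2,3)
proof (induction x rule: less_induct)
 case (less x)
 show ?case
 proof (cases "x = 1")
  case False
  then have h: "1 \<le> x div 2" "x div 2 < x" "x div 2 < P" using less.prems by auto
  then have "T 1 \<le> T (x div 2)" using less.IH[of "x div 2"] by simp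
  moreover have "T (x div 2) = min (T (2 * (x div 2))) (T (2 * (x div 2) + 1))"
   using assms(1) h by (simp add: tour_def)
  moreover have "x = 2 * (x div 2) \<or> x = 2 * (x div 2) + 1" by presburger
  ultimately show ?thesis by (metis min_le_iff_disj min.cobounded1 min.cobounded2 order.trans)
 qed simp
qed

text \<open>Changing a leaf can violate the minimum condition only at its proper ancestors
  \<open>x div 2 ^ r\<close> with \<open>r \<ge> 1\<close>. The invariant \<open>?ok\<close> admits
  violations exactly there, and this set shrinks as the loop moves upwards.\<close>

lemma set_leaf:
 assumes T: "tour (2 ^ L) (warr s 25)" and x: "wreg s 73 = 2 ^ L + v" "v < 2 ^ L" "wreg s 74 = k" and W: "2 * 2 ^ L < W" "2 < W"
 shows "wp W set_leaf (\<lambda>t s'. tour (2 ^ L) (warr s' 25) \<and>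
  (\<forall>y. 2 ^ L \<le> y \<longrightarrow> warr s' 25 y = (if y = 2 ^ L + v then k else warr s 25 y)) \<and> t \<le> 60 * L + 150) s"
proof -
 let ?P = "(2::nat) ^ L"
 let ?s = "s\<lparr>warr := (warr s)(25 := (warr s 25)(?P + v := k))\<rparr>"
 let ?c = "SetW 73 (WReg 73 [div] WConst 2) ;;
    Cond (WCell 25 (WConst 2 [*] WReg 73) [<] WCell 25 (WConst 2 [*] WReg 73 [+] WConst 1))
     (PutW 25 (WReg 73) (WCell 25 (WConst 2 [*] WReg 73)))
     (PutW 25 (WReg 73) (WCell 25 (WConst 2 [*] WReg 73 [+] WConst 1)))"
 let ?ok = "\<lambda>T x. \<forall>y. 1 \<le> y \<longrightarrow> y < ?P \<longrightarrow> (\<forall>r\<ge>1. y \<noteq> x div 2 ^ r) \<longrightarrow> T y = min (T (2 * y)) (T (2 * y + 1))"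
 let ?lv = "\<lambda>T. \<forall>y. ?P \<le> y \<longrightarrow> T y = (if y = ?P + v then k else warr s 25 y)"
 define J where "J = (\<lambda>T x. ?ok T x \<and> ?lv T \<and> 1 \<le> x \<and> x < 2 * ?P)"
 let ?I = "\<lambda>s'. J (warr s' 25) (wreg s' 73)"
 have par: "y = (2 * y) div 2 ^ 1" "y = (2 * y + 1) div 2 ^ 1" for y :: nat by auto
 have loop: "wp W (While (WConst 1 [<] WReg 73) ?c) (\<lambda>t s'. tour ?P (warr s' 25) \<and> ?lv (warr s' 25) \<and> t \<le> 60 * L + 130) ?s"
 proof (rule wp_while[where I = ?I and F = "\<lambda>s'. 60 * bits (wreg s' 73)"])
  have "warr ?s 25 y = min (warr ?s 25 (2 * y)) (warr ?s 25 (2 * y + 1))"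
   if y: "1 \<le> y" "y < ?P" "\<forall>r\<ge>1. y \<noteq> (?P + v) div 2 ^ r" for y
  proof -
   have "2 * y \<noteq> ?P + v" "2 * y + 1 \<noteq> ?P + v"
    using spec[OF y(3), of 1] par[of y] by (metis le_refl)+
   moreover have "warr s 25 y = min (warr s 25 (2 * y)) (warr s 25 (2 * y + 1))"
    using T y by (simp add: tour_def)
   ultimately show ?thesis using y(2) by simp
  qed
  then show "?I ?s" using x by (auto simp: J_def)
  fix s' assume I0: "?I s'" and ag: "agrees ?c ?s s'"
  note I = I0[unfolded J_def]
  define z where "z = wreg s' 73"
  define x' where "x' = z div 2"
  define T' where "T' = warr s' 25"
  show "eval_bool W s' (WConst 1 [<] WReg 73) \<noteq> None \<and> (eval_bool W s' (WConst 1 [<] WReg 73) = Some True \<longrightarrow>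
   wp W ?c (\<lambda>t s''. ?I s'' \<and> 1 + cost_bool (WConst 1 [<] WReg 73) + t + 60 * bits (wreg s'' 73) \<le> 60 * bits (wreg s' 73)) s')"
  proof (cases "1 < z")
   case True
   have x': "1 \<le> x'" "x' < ?P" "z = 2 * x' \<or> z = 2 * x' + 1" using True I by (auto simp: x'_def z_def)
   have xW: "2 * x' + 1 < W" "x' < W" "2 * x' < W" using x' W by linarith+
   have bz: "bits z = Suc (bits x')" unfolding x'_def by (rule bits_half) (use True in simp)
   define N where "N = T'(x' := min (T' (2 * x')) (T' (2 * x' + 1)))"
   have okN: "N y = min (N (2 * y)) (N (2 * y + 1))" if y: "1 \<le> y" "y < ?P" "\<forall>r\<ge>1. y \<noteq> x' div 2 ^ r" for y
   proof (cases "y = x'")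
    case True
    then show ?thesis using x' by (simp add: N_def)
   next
    case False
    have "y \<noteq> z div 2 ^ r" if r1: "r \<ge> 1" for r
    proof (cases "r = 1")
     case True then show ?thesis using False by (simp add: x'_def)
    next
     case r: False
     then obtain r' where r': "r = Suc r'" "r' \<ge> 1" using r1 by (cases r) auto
     have "z div 2 ^ r = x' div 2 ^ r'" unfolding r'(1) x'_def by (simp add: div_mult2_eq)
     then show ?thesis using y(3) r'(2) by simp
    qed
    then have "T' y = min (T' (2 * y)) (T' (2 * y + 1))" using I y by (auto simp: z_def T'_def)
    moreover have "2 * y \<noteq> x'" "2 * y + 1 \<noteq> x'" using spec[OF y(3), of 1] par[of y] by (metis le_refl)+
    ultimately show ?thesis using False by (simp add: N_def)
   qed
   have lvN: "?lv N" using I x' by (auto simp: N_def T'_def)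
   have NI: "J N x'" using okN lvN x' by (auto simp: J_def)
   have Nl: "T'(x' := T' (2 * x')) = N" if "T' (2 * x') < T' (2 * x' + 1)" using that by (simp add: N_def min_def)
   have Nr: "T'(x' := T' (2 * x' + 1)) = N" if "\<not> T' (2 * x') < T' (2 * x' + 1)" using that by (simp add: N_def min_def)
   have "eval_bool W s' (WConst 1 [<] WReg 73) = Some True" using True W by (simp add: z_def)
   moreover have "wp W ?c (\<lambda>t s''. ?I s'' \<and> 1 + cost_bool (WConst 1 [<] WReg 73) + t + 60 * bits (wreg s'' 73) \<le> 60 * bits (wreg s' 73)) s'"
   proof (cases "T' (2 * x') < T' (2 * x' + 1)")
    case c: True
    show ?thesis using c W xW bz NI unfolding Nl[OF c, symmetric]
     by (simp add: z_def[symmetric] x'_def[symmetric] T'_def[symmetric])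
   next
    case c: False
    show ?thesis using c W xW bz NI unfolding Nr[OF c, symmetric]
     by (simp add: z_def[symmetric] x'_def[symmetric] T'_def[symmetric])
   qed
   ultimately show ?thesis by blast
  next
   case False then show ?thesis using W by (simp add: z_def)
  qed
 next
  fix t s' assume I0: "?I s'" and ev: "eval_bool W s' (WConst 1 [<] WReg 73) = Some False"
   and t: "t + 60 * bits (wreg s' 73) \<le> 60 * bits (wreg ?s 73) + 1 + cost_bool (WConst 1 [<] WReg 73)"
  note I = I0[unfolded J_def]
  have "wreg s' 73 = 1" using I ev W by simp
  then have "tour ?P (warr s' 25)" using I by (auto simp: tour_def)
  moreover have "bits (wreg ?s 73) \<le> L + 1 + 1" using x by (intro bits_power) (simp add: power_add)
  ultimately show "tour ?P (warr s' 25) \<and> ?lv (warr s' 25) \<and> t \<le> 60 * L + 130" using I t by simp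
 qed
 show ?thesis
  unfolding set_leaf_def using x
  apply simp
  apply (rule wp_call[OF loop])
  apply simp
  done
qed

text \<open>A child carrying the smaller value also carries the global minimum. \<open>bits\<close>
  is the depth of a node plus one, so the descent takes \<open>L\<close> steps.\<close>

lemma find_min:
 assumes T: "tour (2 ^ L) (warr s 25)" and x: "wreg s 75 = 2 ^ L" and W: "2 * 2 ^ L < W" "2 < W"
 shows "wp W find_min (\<lambda>t s'. \<exists>v<2 ^ L. wreg s' 73 = 2 ^ L + v \<and> warr s 25 (2 ^ L + v) = warr s 25 1 \<and> t \<le> 60 * L + 90) s"
proof -
 let ?P = "(2::nat) ^ L"
 let ?s = "s\<lparr>wreg := (wreg s)(73 := 1)\<rparr>"
 let ?c = "Cond (WCell 25 (WConst 2 [*] WReg 73) [<] WCell 25 (WConst 2 [*] WReg 73 [+] WConst 1))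
     (SetW 73 (WConst 2 [*] WReg 73))
     (SetW 73 (WConst 2 [*] WReg 73 [+] WConst 1))"
 have double: "bits (2 * z) = Suc (bits z)" "bits (2 * z + 1) = Suc (bits z)" if "1 \<le> z" for z
  using bits_half[of "2 * z"] bits_half[of "2 * z + 1"] that by simp_all
 let ?I = "\<lambda>s'. 1 \<le> wreg s' 73 \<and> wreg s' 73 < 2 * ?P \<and> warr s 25 (wreg s' 73) = warr s 25 1"
 have loop: "wp W (While (WReg 73 [<] WReg 75) ?c) (\<lambda>t s'. ?I s' \<and> \<not> wreg s' 73 < ?P \<and> t \<le> 60 * L + 70) ?s"
 proof (rule wp_while[where I = ?I and F = "\<lambda>s'. 60 * (L + 2 - bits (wreg s' 73))"])
  have "(1::nat) \<le> 2 ^ L" by simp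
  then have "(1::nat) < 2 * 2 ^ L" by linarith
  then show "?I ?s" by simp
  fix s' assume I: "?I s'" and ag: "agrees ?c ?s s'"
  have rr: "wreg s' 75 = ?P" "warr s' 25 = warr s 25" using ag x by (auto simp: agrees_def)
  define z where "z = wreg s' 73"
  show "eval_bool W s' (WReg 73 [<] WReg 75) \<noteq> None \<and> (eval_bool W s' (WReg 73 [<] WReg 75) = Some True \<longrightarrow>
   wp W ?c (\<lambda>t s''. ?I s'' \<and> 1 + cost_bool (WReg 73 [<] WReg 75) + t + 60 * (L + 2 - bits (wreg s'' 73)) \<le> 60 * (L + 2 - bits (wreg s' 73))) s')"
  proof (cases "z < ?P")
   case True
   have z1: "1 \<le> z" using I by (simp add: z_def)
   have zW: "2 * z + 1 < W" "z < W" "2 * z < W" using True W by linarith+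
   have "bits z \<le> L + 1" using True by (intro bits_power) simp
   then have b: "L + 2 - bits z = Suc (L + 2 - Suc (bits z))" by simp
   have m: "warr s 25 z = min (warr s 25 (2 * z)) (warr s 25 (2 * z + 1))" using T True z1 by (simp add: tour_def)
   have Iz: "warr s 25 z = warr s 25 1" using I by (simp add: z_def)
   show ?thesis
   proof (cases "warr s 25 (2 * z) < warr s 25 (2 * z + 1)")
    case c: True
    then have "warr s 25 (2 * z) = warr s 25 1" using m Iz by simp
    then show ?thesis using c rr True zW W z1 double(1)[OF z1] b by (simp add: z_def[symmetric])
   next
    case c: False
    then have "warr s 25 (2 * z + 1) = warr s 25 1" using m Iz by simp
    then show ?thesis using c rr True zW W z1 double(2)[OF z1] b by (simp add: z_def[symmetric])
   qed
  next
   case False then show ?thesis using rr by (simp add: z_def)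
  qed
 next
  fix t s' assume I: "?I s'" and ag: "agrees ?c ?s s'" and ev: "eval_bool W s' (WReg 73 [<] WReg 75) = Some False"
   and t: "t + 60 * (L + 2 - bits (wreg s' 73)) \<le> 60 * (L + 2 - bits (wreg ?s 73)) + 1 + cost_bool (WReg 73 [<] WReg 75)"
  have rr: "wreg s' 75 = ?P" using ag x by (auto simp: agrees_def)
  have b1: "bits 1 = 1" using bits_half[of 1] by simp
  have "60 * (L + 2 - bits (wreg ?s 73)) \<le> 60 * L + 60" by (simp add: b1)
  then show "?I s' \<and> \<not> wreg s' 73 < ?P \<and> t \<le> 60 * L + 70" using I t ev rr by simp
 qed
 show ?thesis
  unfolding find_min_def using W
  apply simp
  apply (rule wp_call[OF loop])
  subgoal for t s' by (rule exI[of _ "wreg s' 73 - 2 ^ L"]) auto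
  done
qed

context machine_setup
begin

text \<open>A walk whose rounded length is within the bound contains no frozen arc, so each true
  length is at most its rounded length.\<close>

lemma length_le:
 assumes "\<And>e. e \<in> set p \<Longrightarrow> 0 \<le> l e" "nsum l i j p \<le> Bd j"
 shows "(\<Sum>e\<leftarrow>p. l e) \<le> real (nsum l i j p) * unit i j"
 using assms
proof (induction p)
 case (Cons e p)
 have "Nf i j (l e) < Bd j" using Cons.prems(2) by simp
 then have "l e \<le> (Nf i j (l e) + 1) * unit i j" using Nf_length[of "l e" i j] Cons.prems(1) by simp
 moreover have "(\<Sum>e\<leftarrow>p. l e) \<le> real (nsum l i j p) * unit i j" using Cons by simp
 ultimately show ?case by (simp add: algebra_simps)
qed simp

text \<open>The route follows the in-path to its first vertex on the out-path and continues there.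
  Its rounded length is at most the sum of the two labels of the best hub, whose value is the answer
  to the distance query.\<close>

lemma path_query:
 assumes I: "inv s l" and b: "rreg s 3 = \<beta>" "okc \<beta> 0" and u: "wreg s 3 = u" "u < n" and v: "wreg s 4 = v" "v < n"
 shows "wp W path_query (\<lambda>t s'. (Dst s u v \<beta> \<noteq> \<infinity> \<longrightarrow> (\<exists>p. map (warr s' 6) [0..<wreg s' 5] = p \<and> wk u p v \<and>
  distinct (vs u p) \<and> ereal (\<Sum>e\<leftarrow>p. l e) \<le> Dst s u v \<beta>)) \<and> t \<le> 1000 * n * L) s"
proof -
 have nL: "2 * 1 \<le> n * L" using n2 L1 by (intro mult_le_mono)
 have n1: "n * 1 \<le> n * L" by (rule mult_le_mono2[OF L1])
 define i where "i = scale (warr s 23) \<beta>"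
 have iN: "i < NI" using scale_ok(1)[OF b(2)] by (simp add: i_def okc_def)
 have ext: "wp W (clear_marks ;; mark_out ;; walk_in ;; walk_out) (\<lambda>t s'. (\<exists>p. map (warr s' 6) [0..<wreg s' 5] = p \<and> wk u p v \<and>
  distinct (vs u p) \<and> ereal (\<Sum>e\<leftarrow>p. l e) \<le> ereal (dval s1 i q u v)) \<and> t \<le> 210 * n + 200) s1"
  if I1: "inv s1 l" and r1: "wreg s1 3 = u" "wreg s1 4 = v" "wreg s1 50 = i" "wreg s1 60 = q" and q: "q \<in> cand s1 i u v" for s1 q
 proof -
  define j where "j = q div n"
  have qS: "q \<in> S" and ds: "dsum s1 i q u v \<le> Bd j" using q by (auto simp: cand_def j_def)
  have lu: "lab s1 i q (n + u) \<le> Bd j" and lv: "lab s1 i q v \<le> Bd j" using ds by (auto simp: dsum_def)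
  show ?thesis
   unfolding wp_Seq
  proof (rule wp_call[OF clear_marks[OF inv_static[OF I1]]])
   fix t2 s2 assume p2: "(\<forall>x<n. warr s2 20 x = 0) \<and> t2 \<le> 30 * n + 20" and ag2: "agrees clear_marks s1 s2"
   have i2: "inv s2 l" "lab s2 = lab s1" using inv_agrees[OF I1 ag2] by simp_all
   have r2: "wreg s2 3 = u" "wreg s2 4 = v" "wreg s2 50 = i" "wreg s2 60 = q" using ag2 r1 by (auto simp: agrees_def)
   show "wp W mark_out (\<lambda>t1. wp W walk_in (\<lambda>t1a. wp W walk_out (\<lambda>t2a s'. (\<exists>p. map (warr s' 6) [0..<wreg s' 5] = p \<and> wk u p v \<and>
     distinct (vs u p) \<and> ereal (\<Sum>e\<leftarrow>p. l e) \<le> ereal (dval s1 i q u v)) \<and> t2 + (t1 + (t1a + t2a)) \<le> 210 * n + 200))) s2"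
   proof (rule wp_call[OF mark_out[OF i2(1) r2(3) iN r2(4) qS j_def r2(2) v(2) _ conjunct1[OF p2]]])
    show "lab s2 i q v \<le> Bd j" using lv i2 by simp
    fix t3 s3 assume p3: "wreg s3 58 = vb i q \<and> (\<exists>p. wk (q mod n) p v \<and> distinct (vs (q mod n) p) \<and>
     (\<forall>e\<in>set p. warr s3 20 (ta e) = e + 1) \<and> (\<forall>y<n. warr s3 20 y \<noteq> 0 \<longleftrightarrow> y \<in> set (vs (q mod n) p)) \<and>
     nsum l i j p \<le> lab s2 i q v) \<and> t3 \<le> 60 * n + 80" and ag3: "agrees mark_out s2 s3"
    then obtain pp where pp: "wk (q mod n) pp v" "distinct (vs (q mod n) pp)" "\<forall>e\<in>set pp. warr s3 20 (ta e) = e + 1"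
     "\<forall>y<n. warr s3 20 y \<noteq> 0 \<longleftrightarrow> y \<in> set (vs (q mod n) pp)" "nsum l i j pp \<le> lab s2 i q v" by blast
    have i3: "inv s3 l" "lab s3 = lab s1" using inv_agrees[OF i2(1) ag3] i2(2) by simp_all
    have r3: "wreg s3 3 = u" "wreg s3 4 = v" "wreg s3 50 = i" "wreg s3 60 = q" using ag3 r2 by (auto simp: agrees_def)
    have qn: "q mod n < n" using n2 by simp
    have z3: "warr s3 20 (q mod n) \<noteq> 0" using pp(4) qn by (simp add: vs_def)
    show "wp W walk_in (\<lambda>t1a. wp W walk_out (\<lambda>t2a s'. (\<exists>p. map (warr s' 6) [0..<wreg s' 5] = p \<and> wk u p v \<and>
     distinct (vs u p) \<and> ereal (\<Sum>e\<leftarrow>p. l e) \<le> ereal (dval s1 i q u v)) \<and> t2 + (t3 + (t1a + t2a)) \<le> 210 * n + 200)) s3"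
    proof (rule wp_call[OF walk_in[OF i3(1) _ iN qS j_def r3(1) u(2) _ z3]])
     show "wreg s3 58 = vb i q" using p3 by simp
     show "lab s3 i q (n + u) \<le> Bd j" using lu i3 by simp
     fix t4 s4 assume p4: "(\<exists>p. p = map (warr s4 6) [0..<wreg s4 5] \<and> wk u p (wreg s4 63) \<and>
      warr s3 20 (wreg s4 63) \<noteq> 0 \<and> distinct (vs u p) \<and> (\<forall>y\<in>set (vs u p). y \<noteq> wreg s4 63 \<longrightarrow> warr s3 20 y = 0) \<and>
      nsum l i j p \<le> lab s3 i q (n + u)) \<and> t4 \<le> 60 * n + 30" and ag4: "agrees walk_in s3 s4"
     define x where "x = wreg s4 63"
     obtain p where p: "p = map (warr s4 6) [0..<wreg s4 5]" "wk u p x" "warr s3 20 x \<noteq> 0" "distinct (vs u p)"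
      "\<forall>y\<in>set (vs u p). y \<noteq> x \<longrightarrow> warr s3 20 y = 0" "nsum l i j p \<le> lab s3 i q (n + u)" using p4 by (auto simp: x_def)
     have i4: "inv s4 l" using inv_agrees(1)[OF i3(1) ag4] by simp
     have r4: "wreg s4 4 = v" "warr s4 20 = warr s3 20" using ag4 r3 by (auto simp: agrees_def)
     have xn: "x < n" using wk_less[OF p(2) u(2)] by simp
     then have "x \<in> set (vs (q mod n) pp)" using pp(4) p(3) by blast
     \<comment> \<open>Only the part of the marked path behind the meeting vertex \<open>x\<close>
       is used, so cutting short can only improve the length bound.\<close>
     then obtain a r where ar: "pp = a @ r" "wk (q mod n) a x" "wk x r v" using wk_split[OF pp(1)] by blast
     have vr: "set (map he r) \<subseteq> set (vs (q mod n) pp)" using ar(1) by (auto simp: vs_def)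
     have marked: "warr s3 20 y \<noteq> 0" if "y \<in> set (map he r)" for y
      using vr that pp(4) wk_less[OF pp(1) qn] by blast
     have xr: "x \<notin> set (map he r)"
     proof
      assume xin: "x \<in> set (map he r)"
      have "x \<in> set (vs (q mod n) a)" by (rule wk_last[OF ar(2)])
      moreover have "distinct (vs (q mod n) a @ map he r)" using pp(2) unfolding ar(1) by (simp add: vs_def)
      ultimately show False using xin unfolding distinct_append by blast
     qed
     have dr: "distinct (map he r)" using pp(2) unfolding ar(1) by (simp add: vs_def)
     \<comment> \<open>Before \<open>x\<close> the walk met unmarked vertices only, while everything
       behind \<open>x\<close> on the out-path is marked and differs from \<open>x\<close>.\<close>
     have "set (vs u p) \<inter> set (map he r) = {}"
     proof (rule equals0I)
      fix y assume y: "y \<in> set (vs u p) \<inter> set (map he r)"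
      have "y \<noteq> x"
      proof
       assume "y = x"
       then show False using xr IntD2[OF y] by simp
      qed
      then have "warr s3 20 y = 0" using bspec[OF p(5) IntD1[OF y]] by simp
      then show False using marked[OF IntD2[OF y]] by simp
     qed
     then have dist: "distinct (vs u (p @ r))" using p(4) dr by (auto simp: vs_def)
     have fol: "\<forall>e\<in>set r. warr s4 20 (ta e) = e + 1" using pp(3) ar(1) r4 by simp
     have wkx: "wk u p (wreg s4 63)" "wk (wreg s4 63) r v" using p(2) ar(3) by (simp_all add: x_def)
     show "wp W walk_out (\<lambda>t2a s'. (\<exists>p. map (warr s' 6) [0..<wreg s' 5] = p \<and> wk u p v \<and>
      distinct (vs u p) \<and> ereal (\<Sum>e\<leftarrow>p. l e) \<le> ereal (dval s1 i q u v)) \<and> t2 + (t3 + (t4 + t2a)) \<le> 210 * n + 200) s4"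
     proof (rule wp_call[OF walk_out[OF inv_static[OF i4] u(2) r4(1) p(1) wkx fol dist]])
      fix t5 s5 assume p5: "map (warr s5 6) [0..<wreg s5 5] = p @ r \<and> t5 \<le> 60 * n + 20"
      have wkall: "wk u (p @ r) v" using p(2) ar(3) by (auto simp: wk_append)
      have ns: "nsum l i j (p @ r) \<le> dsum s1 i q u v"
       using p(6) pp(5) i2 i3 ar(1) by (simp add: dsum_def)
      have "(\<Sum>e\<leftarrow>p @ r. l e) \<le> real (nsum l i j (p @ r)) * unit i j"
       by (rule length_le) (use ns ds wk_ta[OF wkall] I1 in \<open>auto simp: inv_def\<close>)
      also have "\<dots> \<le> dval s1 i q u v"
       unfolding dval_def j_def[symmetric] using ns unit_pos[of i j] by (intro mult_right_mono) auto
      finally show "(\<exists>p. map (warr s5 6) [0..<wreg s5 5] = p \<and> wk u p v \<and>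
       distinct (vs u p) \<and> ereal (\<Sum>e\<leftarrow>p. l e) \<le> ereal (dval s1 i q u v)) \<and> t2 + (t3 + (t4 + t5)) \<le> 210 * n + 200"
       using p5 p4 p3 p2 wkall dist by auto
     qed
    qed
   qed
  qed
 qed
 show ?thesis
  unfolding path_query_def
  apply (subst wp_Seq)
  apply (rule wp_call[OF scale_dist[OF I b u v]])
 proof -
  fix t1 s1 assume p1: "wreg s1 50 = scale (warr s 23) \<beta> \<and> found s (scale (warr s 23) \<beta>) u v (Suc L * n) s1 \<and> t1 \<le> 520 * n * L"
   and ag: "agrees (find_scale ;; dist_loop) s s1"
  have i1: "inv s1 l" "lab s1 = lab s" using inv_agrees[OF I ag] by simp_all
  have r1: "wreg s1 3 = u" "wreg s1 4 = v" "wreg s1 50 = i" using ag u v p1 by (auto simp: agrees_def i_def)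
  have fd: "found s i u v (Suc L * n) s1" using p1 by (simp add: i_def)
  have D: "Dst s u v \<beta> = decode_distance (wreg s1 56) (rreg s1 4)" using found_Dm(1)[OF fd] by (simp add: Dst_def i_def)
  show "wp W (Cond (WConst 0 [<] WReg 56) (clear_marks ;; mark_out ;; walk_in ;; walk_out) (SetW 5 (WConst 0)))
  (\<lambda>t2 s'. (Dst s u v \<beta> \<noteq> \<infinity> \<longrightarrow> (\<exists>p. map (warr s' 6) [0..<wreg s' 5] = p \<and> wk u p v \<and>
   distinct (vs u p) \<and> ereal (\<Sum>e\<leftarrow>p. l e) \<le> Dst s u v \<beta>)) \<and> t1 + t2 \<le> 1000 * n * L) s1"
  proof (cases "wreg s1 56 = 0")
   case True
   then have "Dst s u v \<beta> = \<infinity>" using D by (simp add: decode_distance_def)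
   then show ?thesis using True p1 nL W_small(14) by simp
  next
   case False
   have qc: "wreg s1 60 \<in> cand s i u v" "rreg s1 4 = dval s i (wreg s1 60) u v" using found_Dm(2)[OF fd False] by auto
   have same: "cand s1 = cand s" "dval s1 = dval s" using i1(2) by (auto simp: cand_def dval_def dsum_def fun_eq_iff)
   have Dv: "Dst s u v \<beta> = ereal (dval s1 i (wreg s1 60) u v)" using D qc False same by (simp add: decode_distance_def)
   have "wp W (clear_marks ;; mark_out ;; walk_in ;; walk_out) (\<lambda>t s'. (Dst s u v \<beta> \<noteq> \<infinity> \<longrightarrow> (\<exists>p. map (warr s' 6) [0..<wreg s' 5] = p \<and> wk u p v \<and>
   distinct (vs u p) \<and> ereal (\<Sum>e\<leftarrow>p. l e) \<le> Dst s u v \<beta>)) \<and> t1 + (1 + cost_bool (WConst 0 [<] WReg 56) + t) \<le> 1000 * n * L) s1"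
   proof (rule wp_call[OF ext[OF i1(1) r1 refl]])
    show "wreg s1 60 \<in> cand s1 i u v" using qc same by simp
    fix t s' assume p: "(\<exists>p. map (warr s' 6) [0..<wreg s' 5] = p \<and> wk u p v \<and> distinct (vs u p) \<and>
     ereal (\<Sum>e\<leftarrow>p. l e) \<le> ereal (dval s1 i (wreg s1 60) u v)) \<and> t \<le> 210 * n + 200"
    have "t1 + (1 + cost_bool (WConst 0 [<] WReg 56) + t) \<le> 1000 * n * L" 
    proof -
     have "1 + cost_bool (WConst 0 [<] WReg 56) = 4" by simp
     moreover have "t1 \<le> 520 * (n * L)" "t \<le> 210 * n + 200" using p p1 by (simp_all add: mult.assoc)
     moreover have "1000 * n * L = 1000 * (n * L)" by simp
     ultimately show ?thesis using nL n1 by linarith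
    qed
    then show "(Dst s u v \<beta> \<noteq> \<infinity> \<longrightarrow> (\<exists>p. map (warr s' 6) [0..<wreg s' 5] = p \<and> wk u p v \<and>
     distinct (vs u p) \<and> ereal (\<Sum>e\<leftarrow>p. l e) \<le> Dst s u v \<beta>)) \<and> t1 + (1 + cost_bool (WConst 0 [<] WReg 56) + t) \<le> 1000 * n * L"
     unfolding Dv using p by blast
   qed
   then show ?thesis using False W_small(14) by (simp del: wp_Seq)
  qed
 qed
qed

end

section \<open>Dijkstra's algorithm from the hubs of one level\<close>

definition relax :: com where
 "relax =
  SetW 80 (WCell 24 (WReg 77) [+] WCell 17 (WReg 76 [+] (WReg 78 [-] WConst 1)) [+] WConst 1) ;;
  SetW 79 (WCell 11 (WReg 78 [-] WConst 1)) ;;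
  Cond (WReg 80 [<] WCell 24 (WReg 79))
   (PutW 24 (WReg 79) (WReg 80) ;; SetW 73 (WReg 75 [+] WReg 79) ;; SetW 74 (WReg 80) ;; set_leaf)
   Skip ;;
  SetW 78 (WCell 15 (WReg 78 [-] WConst 1))"

definition scan :: com where
 "scan = SetW 78 (WCell 14 (WReg 77)) ;; While (WConst 0 [<] WReg 78) relax"

definition extract_min :: com where
 "extract_min = find_min ;; SetW 77 (WReg 73 [-] WReg 75) ;; SetW 74 (WReg 71 [+] WConst 1) ;; set_leaf ;; scan"

definition dijkstra :: com where
 "dijkstra = While (WCell 25 (WConst 1) [\<le>] WReg 71) extract_min"

lemma mods_dijkstra [simp]:
 "mw relax = {73, 74, 78, 79, 80}" "mr relax = {}" "ma relax = {24, 25}" "mb relax = {}"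
 "mw scan = {73, 74, 78, 79, 80}" "mr scan = {}" "ma scan = {24, 25}" "mb scan = {}"
 "mw extract_min = {73, 74, 77, 78, 79, 80}" "mr extract_min = {}" "ma extract_min = {24, 25}" "mb extract_min = {}"
 "mw dijkstra = {73, 74, 77, 78, 79, 80}" "mr dijkstra = {}" "ma dijkstra = {24, 25}" "mb dijkstra = {}"
 by (auto simp: relax_def scan_def extract_min_def dijkstra_def)

context machine_setup
begin

text \<open>Array 24 holds the tentative labels \<open>f\<close> and array 25 the tournament
  \<open>T\<close>. An extracted vertex keeps its label, but its leaf is set to the bound plus one;
  this discrepancy marks it as settled without a further array.\<close>

definition settled :: "nat \<Rightarrow> (nat \<Rightarrow> nat) \<Rightarrow> (nat \<Rightarrow> nat) \<Rightarrow> nat set" where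
 "settled B f T = {x. x < n \<and> f x \<le> B \<and> T (2 ^ L + x) = B + 1}"

text \<open>\<open>g\<close> are the initial labels; the arcs in \<open>E\<close> still have to be relaxed.\<close>

definition dj_inv ::
 "(nat \<Rightarrow> real) \<Rightarrow> nat \<Rightarrow> nat \<Rightarrow> (nat \<Rightarrow> nat) \<Rightarrow> (nat \<Rightarrow> nat) \<Rightarrow> (nat \<Rightarrow> nat) \<Rightarrow> nat set \<Rightarrow> bool" where
 "dj_inv l i j g f T E \<longleftrightarrow> tour (2 ^ L) T \<and> (\<forall>x. n \<le> x \<longrightarrow> x < 2 ^ L \<longrightarrow> T (2 ^ L + x) = Bd j + 1) \<and>
  (\<forall>x<n. f x \<le> Bd j + 1 \<and> f x \<le> g x \<and> (T (2 ^ L + x) = f x \<or> T (2 ^ L + x) = Bd j + 1)) \<and>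
  (\<forall>x<n. f x \<le> Bd j \<longrightarrow> (\<exists>w<n. \<exists>p. wk w p x \<and> g w + nsum l i j p \<le> f x)) \<and>
  (\<forall>x\<in>settled (Bd j) f T. \<forall>y<n. y \<notin> settled (Bd j) f T \<longrightarrow> f x \<le> f y) \<and>
  (\<forall>e<m. ta e \<in> settled (Bd j) f T \<longrightarrow> e \<notin> E \<longrightarrow> f (he e) \<le> f (ta e) + (Nf i j (l e) + 1))"

text \<open>The vertex \<open>v\<close> being scanned has the largest settled label and the new
  label exceeds it, so the improved head is not settled and the set of settled vertices stays the
  same.\<close>

lemma dj_relax:
 assumes D: "dj_inv l i j g f T E" and e: "e < m" "ta e = v" and v: "v \<in> settled (Bd j) f T"
  and mx: "\<And>x. x \<in> settled (Bd j) f T \<Longrightarrow> f x \<le> f v"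
  and nf: "nf = f v + (Nf i j (l e) + 1)" "nf < f (he e)"
  and T': "tour (2 ^ L) T'" "\<And>y. 2 ^ L \<le> y \<Longrightarrow> T' y = (if y = 2 ^ L + he e then nf else T y)"
 shows "dj_inv l i j g (f(he e := nf)) T' (E - {e}) \<and> settled (Bd j) (f(he e := nf)) T' = settled (Bd j) f T \<and> f v < nf"
proof -
 let ?h = "he e" and ?f = "f(he e := nf)"
 have h: "?h < n" using he_less e by simp
 have fh: "f ?h \<le> Bd j + 1" using D h by (simp add: dj_inv_def)
 have vn: "v < n" "f v \<le> Bd j" using v by (auto simp: settled_def)
 have hD: "?h \<notin> settled (Bd j) f T" using mx[of ?h] nf by auto
 have T'x: "T' (2 ^ L + x) = (if x = ?h then nf else T (2 ^ L + x))" for x using T'(2)[of "2 ^ L + x"] by simp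
 have S: "settled (Bd j) ?f T' = settled (Bd j) f T"
  using hD nf fh by (auto simp: settled_def T'x)
 have hv: "?h \<noteq> v" using hD v by auto
 have att: "\<exists>w<n. \<exists>p. wk w p x \<and> g w + nsum l i j p \<le> ?f x" if x: "x < n" "?f x \<le> Bd j" for x
 proof (cases "x = ?h")
  case True
  obtain w p where "w < n" "wk w p v" "g w + nsum l i j p \<le> f v" using D vn by (auto simp: dj_inv_def)
  then have "wk w (p @ [e]) ?h \<and> g w + nsum l i j (p @ [e]) \<le> nf" using e nf by (auto simp: wk_append)
  with True have "wk w (p @ [e]) x \<and> g w + nsum l i j (p @ [e]) \<le> ?f x" by simp
  with \<open>w < n\<close> show ?thesis by blast
 next
  case False then show ?thesis using D x by (auto simp: dj_inv_def)
 qed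
 have "?f (he a) \<le> ?f (ta a) + (Nf i j (l a) + 1)" if a: "a < m" "ta a \<in> settled (Bd j) f T" "a \<notin> E - {e}" for a
 proof (cases "a = e")
  case True then show ?thesis using e nf hv by simp
 next
  case False
  then have "f (he a) \<le> f (ta a) + (Nf i j (l a) + 1)" using D a by (auto simp: dj_inv_def)
  moreover have "ta a \<noteq> ?h" using a hD by auto
  ultimately show ?thesis using nf by auto
 qed
 moreover have "?f x \<le> ?f y" if "x \<in> settled (Bd j) f T" "y < n" "y \<notin> settled (Bd j) f T" for x y
 proof -
  have "x \<noteq> ?h" using that hD by auto
  moreover have "f x \<le> f y" using D that by (auto simp: dj_inv_def)
  moreover have "f x \<le> nf" using mx[OF that(1)] nf by simp
  ultimately show ?thesis by simp
 qed
 moreover have "?f x \<le> Bd j + 1 \<and> ?f x \<le> g x \<and> (T' (2 ^ L + x) = ?f x \<or> T' (2 ^ L + x) = Bd j + 1)" if "x < n" for x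
  using D that nf fh by (auto simp: dj_inv_def T'x)
 moreover have "T' (2 ^ L + x) = Bd j + 1" if "n \<le> x" "x < 2 ^ L" for x
  using D that h by (auto simp: dj_inv_def T'x)
 ultimately show ?thesis using T'(1) att S nf by (simp add: dj_inv_def)
qed

lemma dj_skip:
 assumes D: "dj_inv l i j g f T E" and e: "\<not> f (ta e) + (Nf i j (l e) + 1) < f (he e)"
 shows "dj_inv l i j g f T (E - {e})"
proof -
 have "f (he a) \<le> f (ta a) + (Nf i j (l a) + 1)" if a: "a < m" "ta a \<in> settled (Bd j) f T" "a \<notin> E - {e}" for a
  using D a e by (cases "a = e") (auto simp: dj_inv_def)
 then show ?thesis using D by (simp add: dj_inv_def)
qed

lemma dj_cong_E:
 assumes "dj_inv l i j g f T E" "\<And>e. e < m \<Longrightarrow> ta e \<in> settled (Bd j) f T \<Longrightarrow> e \<in> E \<Longrightarrow> e \<in> E'"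
 shows "dj_inv l i j g f T E'"
 using assms unfolding dj_inv_def by blast

text \<open>Settled vertices and the padding leaves carry \<open>Bd j + 1\<close>; a minimum of at
  most \<open>Bd j\<close> therefore belongs to an unsettled vertex. Its outgoing arcs are the ones
  that become due.\<close>

lemma dj_extract:
 assumes D: "dj_inv l i j g f T {}" and v: "v < 2 ^ L" "T (2 ^ L + v) = T 1" "T 1 \<le> Bd j"
  and T': "tour (2 ^ L) T'" "\<And>y. 2 ^ L \<le> y \<Longrightarrow> T' y = (if y = 2 ^ L + v then Bd j + 1 else T y)"
 shows "v < n" "v \<notin> settled (Bd j) f T" "settled (Bd j) f T' = insert v (settled (Bd j) f T)"
  "dj_inv l i j g f T' {e. ta e = v}" "\<And>x. x \<in> settled (Bd j) f T' \<Longrightarrow> f x \<le> f v"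
proof -
 show vn: "v < n"
 proof (rule ccontr)
  assume "\<not> v < n"
  then have "T (2 ^ L + v) = Bd j + 1" using D v(1) by (simp add: dj_inv_def)
  with v show False by simp
 qed
 have tr: "tour (2 ^ L) T" using D by (simp add: dj_inv_def)
 have lf: "T (2 ^ L + y) = f y \<or> T (2 ^ L + y) = Bd j + 1" if "y < n" for y using D that by (simp add: dj_inv_def)
 have fv: "T (2 ^ L + v) = f v" using lf[OF vn] v by auto
 show vD: "v \<notin> settled (Bd j) f T" using v by (auto simp: settled_def)
 have T'x: "T' (2 ^ L + x) = (if x = v then Bd j + 1 else T (2 ^ L + x))" for x using T'(2)[of "2 ^ L + x"] by simp
 show S: "settled (Bd j) f T' = insert v (settled (Bd j) f T)"
  using vn fv v by (auto simp: settled_def T'x)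
 have low: "f v \<le> f y" if y: "y < n" "y \<notin> settled (Bd j) f T" for y
 proof (cases "f y \<le> Bd j")
  case True
  then have "T (2 ^ L + y) = f y" using lf[OF y(1)] y by (auto simp: settled_def)
  moreover have "T 1 \<le> T (2 ^ L + y)" by (rule tour_min[OF tr]) (use y nL in auto)
  ultimately show ?thesis using fv v by simp
 next
  case False then show ?thesis using fv v by simp
 qed
 have up: "f x \<le> f v" if "x \<in> settled (Bd j) f T" for x
  using D that vn vD by (auto simp: dj_inv_def)
 then show "\<And>x. x \<in> settled (Bd j) f T' \<Longrightarrow> f x \<le> f v" unfolding S by auto
 have "f x \<le> f y" if "x \<in> settled (Bd j) f T'" "y < n" "y \<notin> settled (Bd j) f T'" for x y
  using that low[of y] up unfolding S by (metis insert_iff order.trans)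
 moreover have "f (he e) \<le> f (ta e) + (Nf i j (l e) + 1)" if "e < m" "ta e \<in> settled (Bd j) f T'" "ta e \<noteq> v" for e
  using D that unfolding S by (auto simp: dj_inv_def)
 moreover have "f x \<le> Bd j + 1 \<and> f x \<le> g x \<and> (T' (2 ^ L + x) = f x \<or> T' (2 ^ L + x) = Bd j + 1)" if "x < n" for x
  using D that by (auto simp: dj_inv_def T'x)
 moreover have "T' (2 ^ L + x) = Bd j + 1" if "n \<le> x" "x < 2 ^ L" for x
  using D that by (auto simp: dj_inv_def T'x)
 moreover have "\<exists>w<n. \<exists>p. wk w p x \<and> g w + nsum l i j p \<le> f x" if "x < n" "f x \<le> Bd j" for x
  using D that by (auto simp: dj_inv_def)
 ultimately show "dj_inv l i j g f T' {e. ta e = v}" using T'(1) by (simp add: dj_inv_def)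
qed

text \<open>A label within the bound belongs to a settled vertex, whose arcs have been relaxed. If
  the tail lies beyond the bound, the inequality holds because no label exceeds
  \<open>Bd j + 1\<close>.\<close>

lemma dj_final:
 assumes D: "dj_inv l i j g f T {}" and T1: "\<not> T 1 \<le> Bd j"
 shows "\<And>e. e < m \<Longrightarrow> f (he e) \<le> f (ta e) + (Nf i j (l e) + 1)"
proof -
 fix e assume e: "e < m"
 have tn: "ta e < n" "he e < n" using ta_less he_less e by simp_all
 have tr: "tour (2 ^ L) T" using D by (simp add: dj_inv_def)
 show "f (he e) \<le> f (ta e) + (Nf i j (l e) + 1)"
 proof (cases "f (ta e) \<le> Bd j")
  case True
  have "T 1 \<le> T (2 ^ L + ta e)" by (rule tour_min[OF tr]) (use tn nL in auto)
  then have "T (2 ^ L + ta e) \<noteq> f (ta e)" using True T1 by auto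
  then have "T (2 ^ L + ta e) = Bd j + 1" using D tn by (auto simp: dj_inv_def)
  then have "ta e \<in> settled (Bd j) f T" using True tn by (simp add: settled_def)
  then show ?thesis using D e by (auto simp: dj_inv_def)
 next
  case False
  have "f (he e) \<le> Bd j + 1" using D tn by (auto simp: dj_inv_def)
  then show ?thesis using False by linarith
 qed
qed

definition dj_env :: "(nat \<Rightarrow> real) \<Rightarrow> nat \<Rightarrow> nat \<Rightarrow> machine_state \<Rightarrow> bool" where
 "dj_env l i j s \<longleftrightarrow> inv s l \<and> i < NI \<and> j \<in> {1..L} \<and> wreg s 71 = Bd j \<and> wreg s 75 = 2 ^ L \<and> wreg s 76 = cb i j"

lemma dj_env_agrees:
 assumes "dj_env l i j s" "agrees c s s'" "mw c \<inter> {0, 1, 6, 7, 8, 71, 75, 76} = {}" "mr c = {}" "mb c = {}"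
  "ma c \<subseteq> {5, 6, 20, 24, 25}"
 shows "dj_env l i j s'"
proof -
 have "inv s' l" by (rule inv_agrees(1)[of s l c]) (use assms in \<open>auto simp: dj_env_def\<close>)
 then show ?thesis using assms by (auto simp: dj_env_def agrees_def)
qed

lemma relax:
 assumes E: "dj_env l i j s" and D: "dj_inv l i j g (warr s 24) (warr s 25) {e. e < q \<and> ta e = v}"
  and v: "wreg s 77 = v" "v \<in> settled (Bd j) (warr s 24) (warr s 25)"
  and mx: "\<And>x. x \<in> settled (Bd j) (warr s 24) (warr s 25) \<Longrightarrow> warr s 24 x \<le> warr s 24 v"
  and q: "wreg s 78 = q" "0 < q" "q \<le> m" "ta (q - 1) = v"
 shows "wp W relax (\<lambda>t s'. dj_inv l i j g (warr s' 24) (warr s' 25) {e. e < wreg s' 78 \<and> ta e = v} \<and>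
  settled (Bd j) (warr s' 24) (warr s' 25) = settled (Bd j) (warr s 24) (warr s 25) \<and>
  (\<forall>x\<in>settled (Bd j) (warr s 24) (warr s 25). warr s' 24 x = warr s 24 x) \<and>
  wreg s' 78 = prv TL v (q - 1) \<and> t \<le> 60 * L + 220) s"
proof -
 define e where "e = q - 1"
 have e: "e < m" "ta e = v" "e < 2 * m" using q by (auto simp: e_def)
 have vn: "v < n" "warr s 24 v \<le> Bd j" using v(2) by (auto simp: settled_def)
 have I: "inv s l" and iN: "i < NI" and jL: "j \<in> {1..L}" and r: "wreg s 71 = Bd j" "wreg s 75 = 2 ^ L" "wreg s 76 = cb i j"
  using E by (auto simp: dj_env_def)
 have st: "static s" by (rule inv_static[OF I])
 have hd: "warr s 11 e = he e" using static_adj(3)[OF st e(3)] e by (simp add: HD_def)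
 have "adj s" by (rule static_adj(1)[OF st])
 then have nx: "warr s 15 e = prv TL v e" using e by (simp add: adj_def TL_def)
 have "cost_ok s (Nl l)" using I by (simp add: inv_def)
 note c = cost_okD(1,2)[OF this iN jL e(1), unfolded Nl_def]
 define nf where "nf = warr s 24 v + (Nf i j (l e) + 1)"
 have BW: "2 * Bd j + 1000 < W" using W_small(1) Bd_mono[of j] jL by simp
 have cW: "cb i j + e < W" using cb_le[of i j] iN jL e by simp
 have nfW: "nf < W" "warr s 24 v + Nf i j (l e) < W" using vn c BW by (simp_all add: nf_def)
 have eW: "e < W" using e W_small by simp
 have hn: "he e < n" using he_less e by simp
 have PW: "2 ^ L + he e < W" "2 * 2 ^ L < W" "2 < W"
 proof -
  have "0 < 4 / \<delta>" using delta0 by simp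
  then have "0 < real Dl" using Dl by linarith
  then have "1 * 2 ^ L \<le> Dl * 2 ^ L" by (intro mult_le_mono) auto
  then have "2 ^ L \<le> Bd L" by (simp add: Bd_def)
  then show "2 * 2 ^ L < W" "2 < W" "2 ^ L + he e < W" using W_small(1) hn nL by linarith+
 qed
 have sets: "{e'. e' < q \<and> ta e' = v} - {e} = {e'. e' < e \<and> ta e' = v}" using q by (auto simp: e_def)
 \<comment> \<open>The list of \<open>v\<close> has no entry between \<open>prv TL v e\<close> and
   \<open>e\<close>, so moving the pointer loses no arc that is still due.\<close>
 have gap: "{e'. e' < prv TL v e \<and> ta e' = v} \<supseteq> {e'. e' < e \<and> ta e' = v}"
 proof
  fix e' assume a: "e' \<in> {e'. e' < e \<and> ta e' = v}"
  then have "TL e' = v" using e by (simp add: TL_def)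
  then show "e' \<in> {e'. e' < prv TL v e \<and> ta e' = v}" using prv_gap[of TL v e e'] a by force
 qed
 have prog: "q - 1 = e" using q by (simp add: e_def)
 show ?thesis
 proof (cases "nf < warr s 24 (he e)")
  case False
  have "dj_inv l i j g (warr s 24) (warr s 25) {e'. e' < e \<and> ta e' = v}"
   using dj_skip[OF D, of e] False e sets by (simp add: nf_def)
  then have "dj_inv l i j g (warr s 24) (warr s 25) {e'. e' < prv TL v e \<and> ta e' = v}"
   by (rule dj_cong_E) (use gap in auto)
  then show ?thesis
   unfolding relax_def using False q(1,2) v r hd nx c cW nfW eW W_small(14) prog
   by (simp add: nf_def)
 next
  case True
  let ?s = "s\<lparr>warr := (warr s)(24 := (warr s 24)(he e := nf)), wreg := (wreg s)(80 := nf, 79 := he e, 73 := 2 ^ L + he e, 74 := nf)\<rparr>"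
  have tr: "tour (2 ^ L) (warr ?s 25)" using D by (simp add: dj_inv_def)
  have call: "wp W set_leaf (\<lambda>t s'. dj_inv l i j g (warr s' 24) (warr s' 25) {e'. e' < prv TL v e \<and> ta e' = v} \<and>
   settled (Bd j) (warr s' 24) (warr s' 25) = settled (Bd j) (warr s 24) (warr s 25) \<and>
   (\<forall>x\<in>settled (Bd j) (warr s 24) (warr s 25). warr s' 24 x = warr s 24 x) \<and>
   wreg s' 78 = q \<and> warr s' 15 = warr s 15 \<and> t \<le> 60 * L + 150) ?s"
  proof (rule wp_call[OF set_leaf[OF tr, of "he e" nf]])
   show "wreg ?s 73 = 2 ^ L + he e" "he e < 2 ^ L" "wreg ?s 74 = nf" using hn nL by simp_all
   show "2 * 2 ^ L < W" "2 < W" using PW by simp_all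
   fix t s' assume p: "tour (2 ^ L) (warr s' 25) \<and> (\<forall>y. 2 ^ L \<le> y \<longrightarrow> warr s' 25 y = (if y = 2 ^ L + he e then nf else warr ?s 25 y)) \<and> t \<le> 60 * L + 150"
    and ag: "agrees set_leaf ?s s'"
   have f': "warr s' 24 = (warr s 24)(he e := nf)" "wreg s' 78 = q" "warr s' 15 = warr s 15" using ag q by (auto simp: agrees_def)
   have R: "dj_inv l i j g (warr s' 24) (warr s' 25) ({e. e < q \<and> ta e = v} - {e}) \<and>
     settled (Bd j) (warr s' 24) (warr s' 25) = settled (Bd j) (warr s 24) (warr s 25) \<and> warr s 24 v < nf"
    unfolding f'(1) by (rule dj_relax[OF D e(1,2) v(2) mx nf_def True]) (use p in auto)
   have "dj_inv l i j g (warr s' 24) (warr s' 25) {e'. e' < prv TL v e \<and> ta e' = v}"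
    by (rule dj_cong_E[OF conjunct1[OF R]]) (use gap sets in auto)
   moreover have "warr s' 24 x = warr s 24 x" if "x \<in> settled (Bd j) (warr s 24) (warr s 25)" for x
    using mx[OF that] True R f' by auto
   ultimately show "dj_inv l i j g (warr s' 24) (warr s' 25) {e'. e' < prv TL v e \<and> ta e' = v} \<and>
    settled (Bd j) (warr s' 24) (warr s' 25) = settled (Bd j) (warr s 24) (warr s 25) \<and>
    (\<forall>x\<in>settled (Bd j) (warr s 24) (warr s 25). warr s' 24 x = warr s 24 x) \<and>
    wreg s' 78 = q \<and> warr s' 15 = warr s 15 \<and> t \<le> 60 * L + 150" using R f' p by simp
  qed
  have nfe: "warr s 24 v + Nf i j (l e) + 1 = nf" by (simp add: nf_def)
  show ?thesis
   unfolding relax_def using True q(1,2) v r hd c cW nfW(1) nfW(2) eW W_small(14) prog PW nfe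
   apply simp
   apply (rule wp_call[OF call])
   using nx by auto
 qed
qed

lemma scan:
 assumes E: "dj_env l i j s" and D: "dj_inv l i j g (warr s 24) (warr s 25) {e. ta e = v}"
  and v: "wreg s 77 = v" "v \<in> settled (Bd j) (warr s 24) (warr s 25)"
  and mx: "\<And>x. x \<in> settled (Bd j) (warr s 24) (warr s 25) \<Longrightarrow> warr s 24 x \<le> warr s 24 v"
 shows "wp W scan (\<lambda>t s'. dj_inv l i j g (warr s' 24) (warr s' 25) {} \<and>
  settled (Bd j) (warr s' 24) (warr s' 25) = settled (Bd j) (warr s 24) (warr s 25) \<and>
  t \<le> 300 * (L + 2) * len_list TL v (2 * m) + 20) s"
proof -
 have vn: "v < n" using v(2) by (auto simp: settled_def)
 have I: "inv s l" using E by (auto simp: dj_env_def)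
 have "adj s" by (rule static_adj(1)[OF inv_static[OF I]])
 then have nx: "warr s 14 v = prv TL v (2 * m)" using vn by (simp add: adj_def)
 let ?D = "settled (Bd j) (warr s 24) (warr s 25)"
 let ?s = "s\<lparr>wreg := (wreg s)(78 := prv TL v (2 * m))\<rparr>"
 \<comment> \<open>Since \<open>v < n\<close>, arcs with this tail belong to the original graph; the
   reversed copies do not occur in the list.\<close>
 have hit: "prv TL v k = 0 \<or> (prv TL v k \<le> m \<and> ta (prv TL v k - 1) = v)" if "k \<le> 2 * m" for k
 proof (cases "prv TL v k = 0")
  case False
  then have "TL (prv TL v k - 1) = v" by (rule prv_hit)
  then show ?thesis using vn False by (auto simp: TL_def split: if_splits)
 qed simp
 let ?I = "\<lambda>s'. dj_inv l i j g (warr s' 24) (warr s' 25) {e. e < wreg s' 78 \<and> ta e = v} \<and>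
  settled (Bd j) (warr s' 24) (warr s' 25) = ?D \<and> (\<forall>x\<in>?D. warr s' 24 x = warr s 24 x) \<and>
  (wreg s' 78 = 0 \<or> (wreg s' 78 \<le> m \<and> ta (wreg s' 78 - 1) = v))"
 have loop: "wp W (While (WConst 0 [<] WReg 78) relax) (\<lambda>t s'. dj_inv l i j g (warr s' 24) (warr s' 25) {} \<and>
  settled (Bd j) (warr s' 24) (warr s' 25) = ?D \<and> t \<le> 300 * (L + 2) * len_list TL v (2 * m) + 10) ?s"
 proof (rule wp_while[where I = ?I and F = "\<lambda>s'. 300 * (L + 2) * len_list TL v (wreg s' 78)"])
  have "dj_inv l i j g (warr s 24) (warr s 25) {e. e < prv TL v (2 * m) \<and> ta e = v}"
  proof (rule dj_cong_E[OF D])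
   fix e assume "e < m" "e \<in> {e. ta e = v}"
   then show "e \<in> {e. e < prv TL v (2 * m) \<and> ta e = v}" using prv_gap[of TL v "2 * m" e] by (force simp: TL_def)
  qed
  then show "?I ?s" using hit[of "2 * m"] by simp
  fix s' assume I1: "?I s'" and ag: "agrees relax ?s s'"
  have E': "dj_env l i j s'" by (rule dj_env_agrees[OF _ ag]) (use E in \<open>simp_all add: dj_env_def inv_def cls_ok_def\<close>)
  have v': "wreg s' 77 = v" using ag v by (auto simp: agrees_def)
  define q where "q = wreg s' 78"
  show "eval_bool W s' (WConst 0 [<] WReg 78) \<noteq> None \<and> (eval_bool W s' (WConst 0 [<] WReg 78) = Some True \<longrightarrow>
   wp W relax (\<lambda>t s''. ?I s'' \<and> 1 + cost_bool (WConst 0 [<] WReg 78) + t + 300 * (L + 2) * len_list TL v (wreg s'' 78)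
    \<le> 300 * (L + 2) * len_list TL v (wreg s' 78)) s')"
  proof (cases "q = 0")
   case False
   then have q: "0 < q" "q \<le> m" "ta (q - 1) = v" using I1 by (auto simp: q_def)
   then have "q - 1 < m" by linarith
   then have "TL (q - 1) = v" using q(3) by (simp add: TL_def)
   then have len: "len_list TL v q = Suc (len_list TL v (prv TL v (q - 1)))"
    using q by (intro len_list_step) auto
   have D': "dj_inv l i j g (warr s' 24) (warr s' 25) {e. e < q \<and> ta e = v}" using I1 by (simp add: q_def)
   have vS: "v \<in> settled (Bd j) (warr s' 24) (warr s' 25)" using I1 v by simp
   have mx': "warr s' 24 x \<le> warr s' 24 v" if "x \<in> settled (Bd j) (warr s' 24) (warr s' 25)" for x
    using mx I1 that v(2) by auto
   have "wp W relax (\<lambda>t s''. ?I s'' \<and> 1 + cost_bool (WConst 0 [<] WReg 78) + t + 300 * (L + 2) * len_list TL v (wreg s'' 78)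
    \<le> 300 * (L + 2) * len_list TL v (wreg s' 78)) s'"
   proof (rule wp_call[OF relax[OF E' D' v' vS mx' q_def[symmetric] q]])
    fix t s'' assume p: "dj_inv l i j g (warr s'' 24) (warr s'' 25) {e. e < wreg s'' 78 \<and> ta e = v} \<and>
     settled (Bd j) (warr s'' 24) (warr s'' 25) = settled (Bd j) (warr s' 24) (warr s' 25) \<and>
     (\<forall>x\<in>settled (Bd j) (warr s' 24) (warr s' 25). warr s'' 24 x = warr s' 24 x) \<and>
     wreg s'' 78 = prv TL v (q - 1) \<and> t \<le> 60 * L + 220"
    have "1 + cost_bool (WConst 0 [<] WReg 78) + t + 300 * (L + 2) * len_list TL v (wreg s'' 78)
     \<le> 300 * (L + 2) * len_list TL v (wreg s' 78)"
     using p unfolding q_def[symmetric] len by simp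
    moreover have "settled (Bd j) (warr s'' 24) (warr s'' 25) = ?D" using conjunct1[OF conjunct2[OF p]] I1 by simp
    moreover have "\<forall>x\<in>?D. warr s'' 24 x = warr s 24 x"
    proof
     fix x assume x: "x \<in> ?D"
     then have "warr s' 24 x = warr s 24 x" using I1 by blast
     moreover have "x \<in> settled (Bd j) (warr s' 24) (warr s' 25)" using x I1 by simp
     then have "warr s'' 24 x = warr s' 24 x" using p by blast
     ultimately show "warr s'' 24 x = warr s 24 x" by simp
    qed
    moreover have w78: "wreg s'' 78 = prv TL v (q - 1)" using p by blast
    moreover have "wreg s'' 78 = 0 \<or> wreg s'' 78 \<le> m \<and> ta (wreg s'' 78 - 1) = v"
     unfolding w78 by (rule hit) (use q in simp)
    ultimately show "?I s'' \<and> 1 + cost_bool (WConst 0 [<] WReg 78) + t + 300 * (L + 2) * len_list TL v (wreg s'' 78)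
     \<le> 300 * (L + 2) * len_list TL v (wreg s' 78)"
     using conjunct1[OF p] by (intro conjI) assumption+
   qed
   then show ?thesis using W_small(14) by simp
  qed (use W_small(14) in \<open>simp add: q_def\<close>)
 next
  fix t s' assume I1: "?I s'" and ev: "eval_bool W s' (WConst 0 [<] WReg 78) = Some False"
   and t: "t + 300 * (L + 2) * len_list TL v (wreg s' 78) \<le> 300 * (L + 2) * len_list TL v (wreg ?s 78) + 1 + cost_bool (WConst 0 [<] WReg 78)"
  have "wreg s' 78 = 0" using ev W_small(14) by simp
  then show "dj_inv l i j g (warr s' 24) (warr s' 25) {} \<and>
   settled (Bd j) (warr s' 24) (warr s' 25) = ?D \<and> t \<le> 300 * (L + 2) * len_list TL v (2 * m) + 10"
   using I1 t by (simp add: len_list_prv)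
 qed
 show ?thesis
  unfolding scan_def using v nx
  apply simp
  apply (rule wp_call[OF loop])
  apply auto
  done
qed

text \<open>Every unsettled vertex stores the price of its extraction and of relaxing its outgoing
  arcs, each at most one update of the tournament tree.\<close>

definition dj_pot :: "nat set \<Rightarrow> nat" where
 "dj_pot D = (\<Sum>x<n. if x \<in> D then 0 else 300 * (L + 2) * (len_list TL x (2 * m) + 1))"

lemma dj_pot_insert:
 assumes "v < n" "v \<notin> D"
 shows "dj_pot (insert v D) + 300 * (L + 2) * (len_list TL v (2 * m) + 1) = dj_pot D"
proof -
 let ?F = "\<lambda>D x. if x \<in> D then 0 else 300 * (L + 2) * (len_list TL x (2 * m) + 1)"
 have "sum (?F (insert v D)) {..<n} + ?F D v = sum (?F D) {..<n} + ?F (insert v D) v"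
  by (rule sum_fun_upd) (use assms in auto)
 with assms show ?thesis by (simp add: dj_pot_def)
qed

lemma dj_pot_le: "dj_pot D \<le> 300 * (L + 2) * (n + 2 * m)"
proof -
 have "dj_pot D \<le> (\<Sum>x<n. 300 * (L + 2) * (len_list TL x (2 * m) + 1))"
  unfolding dj_pot_def by (rule sum_mono) simp
 also have "\<dots> = 300 * (L + 2) * ((\<Sum>x<n. len_list TL x (2 * m)) + n)"
  by (simp only: sum_distrib_left[symmetric] sum.distrib) simp
 also have "\<dots> \<le> 300 * (L + 2) * ((\<Sum>x<2 * n. len_list TL x (2 * m)) + n)"
  by (intro mult_le_mono2 add_right_mono sum_mono2) auto
 also have "(\<Sum>x<2 * n. len_list TL x (2 * m)) = 2 * m"
  using TL_less by (intro sum_len_list) auto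
 finally show ?thesis by (simp only: add.commute)
qed

lemma P_bounds: "2 * 2 ^ L < W" "2 < W" "2 ^ L + n < W" "1 < W"
proof -
 have "0 < 4 / \<delta>" using delta0 by simp
 then have "0 < real Dl" using Dl by linarith
 then have "1 * 2 ^ L \<le> Dl * 2 ^ L" by (intro mult_le_mono) auto
 then have "2 ^ L \<le> Bd L" by (simp add: Bd_def)
 then show "2 * 2 ^ L < W" "2 < W" "2 ^ L + n < W" "1 < W" using W_small(1) nL by linarith+
qed

lemma dijkstra:
 assumes E: "dj_env l i j s" and D: "dj_inv l i j g (warr s 24) (warr s 25) {}"
 shows "wp W dijkstra (\<lambda>t s'. dj_inv l i j g (warr s' 24) (warr s' 25) {} \<and> \<not> warr s' 25 1 \<le> Bd j \<and>
  t \<le> 300 * (L + 2) * (n + 2 * m) + 10) s"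
 unfolding dijkstra_def
proof (rule wp_while[where I = "\<lambda>s'. dj_inv l i j g (warr s' 24) (warr s' 25) {}"
  and F = "\<lambda>s'. dj_pot (settled (Bd j) (warr s' 24) (warr s' 25))"])
 let ?b = "WCell 25 (WConst 1) [\<le>] WReg 71"
 show "dj_inv l i j g (warr s 24) (warr s 25) {}" by (rule D)
 fix s' assume D': "dj_inv l i j g (warr s' 24) (warr s' 25) {}" and ag: "agrees extract_min s s'"
 have E': "dj_env l i j s'" by (rule dj_env_agrees[OF E ag]) simp_all
 then have r: "wreg s' 71 = Bd j" "wreg s' 75 = 2 ^ L" "j \<in> {1..L}" by (auto simp: dj_env_def)
 have BW: "Bd j + 1 < W" using W_small(1) Bd_mono[of j] r by simp
 have tr: "tour (2 ^ L) (warr s' 25)" using D' by (simp add: dj_inv_def)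
 show "eval_bool W s' ?b \<noteq> None \<and> (eval_bool W s' ?b = Some True \<longrightarrow> wp W extract_min (\<lambda>t s''.
  dj_inv l i j g (warr s'' 24) (warr s'' 25) {} \<and> 1 + cost_bool ?b + t + dj_pot (settled (Bd j) (warr s'' 24) (warr s'' 25))
  \<le> dj_pot (settled (Bd j) (warr s' 24) (warr s' 25))) s')"
 proof (intro conjI impI)
  show "eval_bool W s' ?b \<noteq> None" using P_bounds by simp
  assume "eval_bool W s' ?b = Some True"
  then have T1: "warr s' 25 1 \<le> Bd j" using P_bounds r by simp
  show "wp W extract_min (\<lambda>t s''. dj_inv l i j g (warr s'' 24) (warr s'' 25) {} \<and>
   1 + cost_bool ?b + t + dj_pot (settled (Bd j) (warr s'' 24) (warr s'' 25))
   \<le> dj_pot (settled (Bd j) (warr s' 24) (warr s' 25))) s'"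
   unfolding extract_min_def
   apply (subst wp_Seq)
   apply (rule wp_call[OF find_min[OF tr r(2) P_bounds(1,2)]])
  proof (elim exE conjE)
   fix t1 s1 v assume v: "v < 2 ^ L" "wreg s1 73 = 2 ^ L + v" "warr s' 25 (2 ^ L + v) = warr s' 25 1" "t1 \<le> 60 * L + 90"
    and ag1: "agrees find_min s' s1"
   have s1: "warr s1 = warr s'" "wreg s1 71 = Bd j" "wreg s1 75 = 2 ^ L" using ag1 r by (auto simp: agrees_def)
   let ?s2 = "s1\<lparr>wreg := (wreg s1)(77 := v, 74 := Bd j + 1)\<rparr>"
   have E2: "dj_env l i j ?s2" using dj_env_agrees[OF E' ag1] by (simp add: dj_env_def inv_def cls_ok_def)
   have tr2: "tour (2 ^ L) (warr ?s2 25)" using tr s1 by simp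
   have "wp W (set_leaf ;; scan) (\<lambda>t s''. dj_inv l i j g (warr s'' 24) (warr s'' 25) {} \<and>
    t1 + t + 30 + dj_pot (settled (Bd j) (warr s'' 24) (warr s'' 25))
    \<le> dj_pot (settled (Bd j) (warr s' 24) (warr s' 25))) ?s2"
    apply (subst wp_Seq)
   proof (rule wp_call[OF set_leaf[OF tr2, of v "Bd j + 1"]])
    show "wreg ?s2 73 = 2 ^ L + v" "v < 2 ^ L" "wreg ?s2 74 = Bd j + 1" "2 * 2 ^ L < W" "2 < W" using v P_bounds by simp_all
    fix t2 s2 assume p: "tour (2 ^ L) (warr s2 25) \<and> (\<forall>y. 2 ^ L \<le> y \<longrightarrow> warr s2 25 y = (if y = 2 ^ L + v then Bd j + 1 else warr ?s2 25 y)) \<and> t2 \<le> 60 * L + 150"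
     and ag2: "agrees set_leaf ?s2 s2"
    have E3: "dj_env l i j s2" by (rule dj_env_agrees[OF E2 ag2]) simp_all
    have s2: "warr s2 24 = warr s' 24" "wreg s2 77 = v" using ag2 s1 by (auto simp: agrees_def)
    have T2: "warr s2 25 y = (if y = 2 ^ L + v then Bd j + 1 else warr s' 25 y)" if "2 ^ L \<le> y" for y
     using p that s1 by simp
    note ex = dj_extract[OF D' v(1,3) T1 conjunct1[OF p] T2, folded s2(1)]
    have vS: "v \<in> settled (Bd j) (warr s2 24) (warr s2 25)" using ex(3) by simp
    show "wp W scan (\<lambda>t s''. dj_inv l i j g (warr s'' 24) (warr s'' 25) {} \<and>
     t1 + (t2 + t) + 30 + dj_pot (settled (Bd j) (warr s'' 24) (warr s'' 25))
     \<le> dj_pot (settled (Bd j) (warr s' 24) (warr s' 25))) s2"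
    proof (rule wp_call[OF scan[OF E3 ex(4) s2(2) vS ex(5)]])
     fix t3 s3 assume p3: "dj_inv l i j g (warr s3 24) (warr s3 25) {} \<and>
      settled (Bd j) (warr s3 24) (warr s3 25) = settled (Bd j) (warr s2 24) (warr s2 25) \<and>
      t3 \<le> 300 * (L + 2) * len_list TL v (2 * m) + 20"
     have "dj_pot (settled (Bd j) (warr s2 24) (warr s2 25)) + 300 * (L + 2) * (len_list TL v (2 * m) + 1) =
      dj_pot (settled (Bd j) (warr s2 24) (warr s' 25))"
      using dj_pot_insert[OF ex(1,2)] ex(3) by simp
     moreover have "300 * (L + 2) * (len_list TL v (2 * m) + 1) = 300 * (L + 2) * len_list TL v (2 * m) + 300 * L + 600"
      by (simp add: algebra_simps)
     ultimately show "dj_inv l i j g (warr s3 24) (warr s3 25) {} \<and>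
      t1 + (t2 + t3) + 30 + dj_pot (settled (Bd j) (warr s3 24) (warr s3 25))
      \<le> dj_pot (settled (Bd j) (warr s' 24) (warr s' 25))"
      using p3 p v(4) s2(1) by simp
    qed
   qed
   then have fin: "wp W (set_leaf ;; scan) (\<lambda>t s''. dj_inv l i j g (warr s'' 24) (warr s'' 25) {} \<and>
    1 + cost_bool ?b + (t1 + (4 + (4 + t))) + dj_pot (settled (Bd j) (warr s'' 24) (warr s'' 25))
    \<le> dj_pot (settled (Bd j) (warr s' 24) (warr s' 25))) ?s2"
    by (rule wp_call) auto
   show "wp W (SetW 77 (WReg 73 [-] WReg 75) ;; SetW 74 (WReg 71 [+] WConst 1) ;; set_leaf ;; scan)
    (\<lambda>t2 s''. dj_inv l i j g (warr s'' 24) (warr s'' 25) {} \<and>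
     1 + cost_bool ?b + (t1 + t2) + dj_pot (settled (Bd j) (warr s'' 24) (warr s'' 25))
     \<le> dj_pot (settled (Bd j) (warr s' 24) (warr s' 25))) s1"
    using v s1 BW P_bounds fin
    by (simp add: add.assoc del: cost_bool.simps)
  qed
 qed
next
 let ?b = "WCell 25 (WConst 1) [\<le>] WReg 71"
 fix t s' assume D': "dj_inv l i j g (warr s' 24) (warr s' 25) {}" and ag: "agrees extract_min s s'"
  and ev: "eval_bool W s' ?b = Some False"
  and t: "t + dj_pot (settled (Bd j) (warr s' 24) (warr s' 25)) \<le> dj_pot (settled (Bd j) (warr s 24) (warr s 25)) + 1 + cost_bool ?b"
 have "wreg s' 71 = Bd j" using ag E by (auto simp: agrees_def dj_env_def)
 then have "\<not> warr s' 25 1 \<le> Bd j" using ev P_bounds by simp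
 then show "dj_inv l i j g (warr s' 24) (warr s' 25) {} \<and> \<not> warr s' 25 1 \<le> Bd j \<and> t \<le> 300 * (L + 2) * (n + 2 * m) + 10"
  using D' t dj_pot_le[of "settled (Bd j) (warr s 24) (warr s 25)"] by simp
qed

end

section \<open>Single-source queries\<close>

definition fill :: "nat \<Rightarrow> word_exp \<Rightarrow> com" where
 "fill a b = SetW 79 (WConst 0) ;;
  While (WReg 79 [<] b) (PutW a (WReg 79) (WReg 83) ;; SetW 79 (WReg 79 [+] WConst 1))"

definition hubs_in :: com where
 "hubs_in = SetW 82 (WConst 0) ;;
  While (WReg 82 [<] WReg 0)
   (Cond (WConst 0 [<] WCell 4 (WReg 70 [*] WReg 0 [+] WReg 82))
     (SetW 81 ((WReg 50 [*] ((WReg 6 [+] WConst 1) [*] WReg 0) [+] (WReg 70 [*] WReg 0 [+] WReg 82)) [*] (WConst 2 [*] WReg 0)) ;;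
     SetW 74 (WCell 18 (WReg 81 [+] (WReg 0 [+] WReg 3))) ;;
     Cond (WReg 74 [\<le>] WReg 71)
      (PutW 24 (WReg 82) (WReg 74) ;; SetW 73 (WReg 75 [+] WReg 82) ;; set_leaf) Skip)
     Skip ;;
    SetW 82 (WReg 82 [+] WConst 1))"

definition level_out :: com where
 "level_out = SetW 82 (WConst 0) ;;
  While (WReg 82 [<] WReg 0)
   (Cond (WCell 24 (WReg 82) [\<le>] WReg 71)
     (SetR 5 (RWord (WCell 24 (WReg 82)) {*} RReg 6) ;;
     Cond (BAnd (WConst 0 [<] WCell 5 (WReg 82)) (RCell 1 (WReg 82) {\<le>} RReg 5)) Skip
      (PutW 5 (WReg 82) (WConst 1) ;; PutR 1 (WReg 82) (RReg 5)))
     Skip ;;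
    SetW 82 (WReg 82 [+] WConst 1))"

definition level :: com where
 "level =
  SetW 71 (WReg 8 [*] WCell 7 (WReg 70)) ;;
  SetW 76 ((WReg 50 [*] (WReg 6 [+] WConst 1) [+] WReg 70) [*] (WConst 2 [*] WReg 1)) ;;
  SetR 6 (RReg 0 {*} RCell 2 (WReg 50) {/} RWord (WCell 7 (WReg 70))) ;;
  SetW 83 (WReg 71 [+] WConst 1) ;;
  fill 24 (WReg 0) ;; fill 25 (WConst 2 [*] WReg 75) ;; hubs_in ;; dijkstra ;; level_out"

text \<open>Evaluating the distance query for \<open>n\<close> targets would cost about
  \<open>n * n\<close>, too much for sparse graphs. On each level one Dijkstra run, started at all
  hubs with their labels from \<open>u\<close>, yields the minimum over the hubs for all targets at
  once.\<close>

definition ssrc_query :: com where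
 "ssrc_query =
  find_scale ;; SetW 75 (WCell 7 (WReg 6)) ;; SetW 83 (WConst 0) ;; fill 5 (WReg 0) ;; SetW 70 (WConst 1) ;;
  While (WReg 70 [\<le>] WReg 6) (level ;; SetW 70 (WReg 70 [+] WConst 1))"

lemma mods_ssrc [simp]:
 "mw (fill a b) = {79}" "mr (fill a b) = {}" "ma (fill a b) = {a}" "mb (fill a b) = {}"
 "mw hubs_in = {73, 74, 81, 82}" "mr hubs_in = {}" "ma hubs_in = {24, 25}" "mb hubs_in = {}"
 "mw level_out = {82}" "mr level_out = {5}" "ma level_out = {5}" "mb level_out = {1}"
 "mw level = {71, 73, 74, 76, 77, 78, 79, 80, 81, 82, 83}" "mr level = {5, 6}" "ma level = {5, 24, 25}" "mb level = {1}"
 by (auto simp: fill_def hubs_in_def level_out_def level_def)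

lemma mods_ssrc_query [simp]:
 "mw ssrc_query = {50, 51, 52, 53, 54, 55, 70, 71, 73, 74, 75, 76, 77, 78, 79, 80, 81, 82, 83}" "mr ssrc_query = {5, 6}"
 "ma ssrc_query = {5, 24, 25}" "mb ssrc_query = {1}"
 by (auto simp: ssrc_query_def)

lemma fill:
 assumes b: "\<And>s'. (\<forall>x. x \<noteq> 79 \<longrightarrow> wreg s' x = wreg s x) \<Longrightarrow> eval_word W s' b = Some N" "cost_word b \<le> 5"
  and c: "wreg s 83 = c" and N: "N < W" "1 < W"
 shows "wp W (fill a b) (\<lambda>t s'. (\<forall>x. warr s' a x = (if x < N then c else warr s a x)) \<and> t \<le> 40 * N + 20) s"
 unfolding fill_def using N
 apply simp
 apply (rule wp_while[where I = "\<lambda>s'. wreg s' 79 \<le> N \<and> (\<forall>x. warr s' a x = (if x < wreg s' 79 then c else warr s a x))"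
   and F = "\<lambda>s'. 40 * (N - wreg s' 79)"])
 subgoal by simp
 subgoal premises prems for s'
 proof -
  have e: "eval_word W s' b = Some N" by (rule b(1)) (use prems(4) in \<open>auto simp: agrees_def\<close>)
  have c': "wreg s' 83 = c" using prems(4) c by (auto simp: agrees_def)
  show ?thesis
  proof (cases "wreg s' 79 < N")
   case True
   then have W': "wreg s' 79 + 1 < W" using N by simp
   have lt: "x < wreg s' 79 + 1 \<longleftrightarrow> x < wreg s' 79 \<or> x = wreg s' 79" for x by auto
   show ?thesis using e c' True W' N b(2) prems(3) by (simp add: lt)
  qed (use e in simp)
 qed
 subgoal premises prems for t s'
 proof -
  have e: "eval_word W s' b = Some N" by (rule b(1)) (use prems(4) in \<open>auto simp: agrees_def\<close>)
  have "wreg s' 79 = N" using e prems(3,5) by simp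
  then show ?thesis using prems(3,6) b(2) by simp
 qed
 done

text \<open>The word 0 encodes \<open>\<infinity>\<close>, and the conditional update of a table
  entry amounts to taking a minimum of decoded values.\<close>

lemma decode_min:
 "decode_distance w x = min (decode_distance w x) \<infinity>"
 "w = 0 \<Longrightarrow> decode_distance 1 y = min (decode_distance w x) (ereal y)"
 "w \<noteq> 0 \<Longrightarrow> y < x \<Longrightarrow> decode_distance 1 y = min (decode_distance w x) (ereal y)"
 "w \<noteq> 0 \<Longrightarrow> x \<le> y \<Longrightarrow> decode_distance w x = min (decode_distance w x) (ereal y)"
 by (auto simp: decode_distance_def min_def)

context machine_setup
begin

text \<open>The start labels of the Dijkstra run: the way from \<open>u\<close> to a hub of level
  \<open>j\<close>, and a value beyond the bound for vertices that are no hubs.\<close>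

definition hub_label :: "machine_state \<Rightarrow> nat \<Rightarrow> nat \<Rightarrow> nat \<Rightarrow> nat \<Rightarrow> nat" where
 "hub_label s i j u x = (if j * n + x \<in> S then lab s i (j * n + x) (n + u) else Bd j + 1)"

lemma hub_code:
 assumes "j \<in> {1..L}" "x < n"
 shows "(j * n + x) div n = j" "(j * n + x) mod n = x" "j * n + x \<in> {n..<Suc L * n}"
proof -
 show "(j * n + x) div n = j" "(j * n + x) mod n = x" using assms by simp_all
 have "j * n \<le> L * n" "1 * n \<le> j * n" using assms by (intro mult_le_mono1; simp)+
 then show "j * n + x \<in> {n..<Suc L * n}" using assms(2) unfolding atLeastLessThan_iff mult_Suc by linarith
qed

lemma hub_label_le: "inv s l \<Longrightarrow> i < NI \<Longrightarrow> j \<in> {1..L} \<Longrightarrow> u < n \<Longrightarrow> x < n \<Longrightarrow> hub_label s i j u x \<le> Bd j + 1"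
 using lab_le[of s l i "j * n + x" "n + u"] hub_code(1)[of j x] by (simp add: hub_label_def)

lemma hubs_in:
 assumes E: "dj_env l i j s" and r: "wreg s 70 = j" "wreg s 50 = i" "wreg s 3 = u" "u < n"
  and f: "\<forall>x<n. warr s 24 x = Bd j + 1" and T: "\<forall>x<2 * 2 ^ L. warr s 25 x = Bd j + 1"
 shows "wp W hubs_in (\<lambda>t s'. dj_inv l i j (hub_label s i j u) (warr s' 24) (warr s' 25) {} \<and> t \<le> n * (60 * L + 300) + 20) s"
proof -
 have I: "inv s l" and iN: "i < NI" and jL: "j \<in> {1..L}" using E by (auto simp: dj_env_def)
 let ?g = "hub_label s i j u"
 let ?c = "Cond (WConst 0 [<] WCell 4 (WReg 70 [*] WReg 0 [+] WReg 82))
     (SetW 81 ((WReg 50 [*] ((WReg 6 [+] WConst 1) [*] WReg 0) [+] (WReg 70 [*] WReg 0 [+] WReg 82)) [*] (WConst 2 [*] WReg 0)) ;;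
     SetW 74 (WCell 18 (WReg 81 [+] (WReg 0 [+] WReg 3))) ;;
     Cond (WReg 74 [\<le>] WReg 71)
      (PutW 24 (WReg 82) (WReg 74) ;; SetW 73 (WReg 75 [+] WReg 82) ;; set_leaf) Skip)
     Skip ;;
    SetW 82 (WReg 82 [+] WConst 1)"
 let ?J = "\<lambda>f T k. k \<le> n \<and> tour (2 ^ L) T \<and> (\<forall>x. n \<le> x \<longrightarrow> x < 2 ^ L \<longrightarrow> T (2 ^ L + x) = Bd j + 1) \<and>
  (\<forall>x<n. f x = (if x < k then ?g x else Bd j + 1) \<and> T (2 ^ L + x) = f x)"
 define J where "J = ?J"
 let ?s = "s\<lparr>wreg := (wreg s)(82 := 0)\<rparr>"
 have fin: "dj_inv l i j ?g f T {}" if JJ: "J f T n" for f T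
 proof -
  \<comment> \<open>Leaves and labels still agree, so nothing counts as settled and the clauses
    about settled vertices hold vacuously.\<close>
  have D: "settled (Bd j) f T = {}" using JJ by (auto simp: J_def settled_def)
  have att: "\<exists>w<n. \<exists>p. wk w p x \<and> ?g w + nsum l i j p \<le> f x" if "x < n" for x
   using JJ that by (intro exI[of _ x] conjI exI[of _ "[]"]) (simp_all add: J_def)
  show ?thesis unfolding dj_inv_def D using JJ att hub_label_le[OF I iN jL r(4)] by (simp add: J_def)
 qed
 have loop: "wp W (While (WReg 82 [<] WReg 0) ?c) (\<lambda>t s'. J (warr s' 24) (warr s' 25) n \<and> t \<le> n * (60 * L + 300) + 10) ?s"
 proof (rule wp_while[where I = "\<lambda>s'. J (warr s' 24) (warr s' 25) (wreg s' 82)" and F = "\<lambda>s'. (n - wreg s' 82) * (60 * L + 300)"])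
  have "n \<le> x \<Longrightarrow> x < 2 ^ L \<Longrightarrow> warr s 25 (2 ^ L + x) = Bd j + 1" for x using T by simp
  moreover have "x < n \<Longrightarrow> warr s 25 (2 ^ L + x) = Bd j + 1" for x using T nL by simp
  moreover have "tour (2 ^ L) (warr s 25)" using T by (simp add: tour_def)
  ultimately show "J (warr ?s 24) (warr ?s 25) (wreg ?s 82)" using f by (simp add: J_def)
  fix s' assume J: "J (warr s' 24) (warr s' 25) (wreg s' 82)" and ag: "agrees ?c ?s s'"
  define x where "x = wreg s' 82"
  have E': "dj_env l i j s'" by (rule dj_env_agrees[OF _ ag]) (use E in \<open>simp_all add: dj_env_def inv_def cls_ok_def\<close>)
  then have st': "static s'" and r': "wreg s' 71 = Bd j" "wreg s' 75 = 2 ^ L" by (auto simp: dj_env_def inv_def)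
  have rr: "wreg s' 70 = j" "wreg s' 50 = i" "wreg s' 3 = u" "warr s' 18 = warr s 18" using ag r by (auto simp: agrees_def)
  show "eval_bool W s' (WReg 82 [<] WReg 0) \<noteq> None \<and> (eval_bool W s' (WReg 82 [<] WReg 0) = Some True \<longrightarrow>
   wp W ?c (\<lambda>t s''. J (warr s'' 24) (warr s'' 25) (wreg s'' 82) \<and> 1 + cost_bool (WReg 82 [<] WReg 0) + t + (n - wreg s'' 82) * (60 * L + 300)
    \<le> (n - wreg s' 82) * (60 * L + 300)) s')"
  proof (cases "x < n")
   case True
   let ?q = "j * n + x"
   note hc = hub_code[OF jL True]
   have qW: "?q < Suc L * n" using hc(3) by simp
   note hx = hub_index[OF iN qW]
   have jW: "?q < W" "j * n < W" using qW W_small(5) by linarith+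
   have uW: "n + u < W" "vb i ?q + (n + u) < W" "x + 1 < W" "2 ^ L + x < W" using hx r(4) W_small(7) P_bounds True by simp_all
   have S4: "warr s' 4 ?q = (if ?q \<in> S then 1 else 0)" using static_tables(3)[OF st' hc(3)] .
   have eq: "(n - x) * (60 * L + 300) = (n - (x + 1)) * (60 * L + 300) + (60 * L + 300)"
   proof -
    have "n - x = Suc (n - (x + 1))" using True by simp
    then show ?thesis by simp
   qed
   have lt: "y < x + 1 \<longleftrightarrow> y < x \<or> y = x" for y by auto
   have lg: "?q \<in> S \<Longrightarrow> warr s 18 (vb i ?q + (n + u)) = ?g x" by (simp add: hub_label_def lab_def)
   have gle: "?g x \<le> Bd j + 1" by (rule hub_label_le[OF I iN jL r(4) True])
   have skip: "J (warr s' 24) (warr s' 25) (x + 1)" if "?g x = Bd j + 1"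
    using J that True by (auto simp: J_def lt x_def[symmetric])
   show ?thesis
   proof (cases "?q \<in> S \<and> ?g x \<le> Bd j")
    case False
    then have sk: "J (warr s' 24) (warr s' 25) (x + 1)" using gle by (intro skip) (auto simp: hub_label_def)
    show ?thesis
    proof (cases "?q \<in> S")
     case inS: True
     then have "\<not> ?g x \<le> Bd j" using False by simp
     then show ?thesis using inS True sk lg[OF inS] S4 hx jW uW st' rr r' W_small(1,5,7,11,12,14) eq
      by (simp add: x_def[symmetric] vb_def[symmetric] Suc_eq_plus1[of L, symmetric] del: mult_Suc)
    next
     case notS: False
     then show ?thesis using True sk S4 jW uW st' rr r' W_small(12,14) eq
      by (simp add: x_def[symmetric] del: mult_Suc)
    qed
   next
    case ok: True
    let ?s2 = "s'\<lparr>warr := (warr s')(24 := (warr s' 24)(x := ?g x)), wreg := (wreg s')(81 := vb i ?q, 74 := ?g x, 73 := 2 ^ L + x)\<rparr>"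
    have tr: "tour (2 ^ L) (warr ?s2 25)" using J by (simp add: J_def)
    have call: "wp W set_leaf (\<lambda>t s''. J (warr s'' 24) (warr s'' 25) (x + 1) \<and> wreg s'' 82 = x \<and> t \<le> 60 * L + 150) ?s2"
    proof (rule wp_call[OF set_leaf[OF tr, of x "?g x"]])
     show "wreg ?s2 73 = 2 ^ L + x" "x < 2 ^ L" "wreg ?s2 74 = ?g x" "2 * 2 ^ L < W" "2 < W" using True nL P_bounds by simp_all
     fix t s'' assume p: "tour (2 ^ L) (warr s'' 25) \<and> (\<forall>y. 2 ^ L \<le> y \<longrightarrow> warr s'' 25 y = (if y = 2 ^ L + x then ?g x else warr ?s2 25 y)) \<and> t \<le> 60 * L + 150"
      and ag2: "agrees set_leaf ?s2 s''"
     have f2: "warr s'' 24 = (warr s' 24)(x := ?g x)" "wreg s'' 82 = x" using ag2 by (auto simp: agrees_def x_def)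
     have T2: "warr s'' 25 (2 ^ L + y) = (if y = x then ?g x else warr s' 25 (2 ^ L + y))" for y
      using p by simp
     show "J (warr s'' 24) (warr s'' 25) (x + 1) \<and> wreg s'' 82 = x \<and> t \<le> 60 * L + 150"
      using p J True f2 by (auto simp: J_def lt T2 x_def[symmetric])
    qed
    show ?thesis using ok True lg S4 hx jW uW st' rr r' W_small(1,5,7,11,12,14)
     apply (simp add: x_def[symmetric] vb_def[symmetric] Suc_eq_plus1[of L, symmetric] del: mult_Suc)
     apply (rule wp_call[OF call])
     using eq uW W_small(14) by auto
   qed
  next
   case False then show ?thesis using st' by (simp add: x_def)
  qed
 next
  fix t s' assume J: "J (warr s' 24) (warr s' 25) (wreg s' 82)" and ag: "agrees ?c ?s s'"
   and ev: "eval_bool W s' (WReg 82 [<] WReg 0) = Some False"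
   and t: "t + (n - wreg s' 82) * (60 * L + 300) \<le> (n - wreg ?s 82) * (60 * L + 300) + 1 + cost_bool (WReg 82 [<] WReg 0)"
  have "dj_env l i j s'" by (rule dj_env_agrees[OF _ ag]) (use E in \<open>simp_all add: dj_env_def inv_def cls_ok_def\<close>)
  then have "wreg s' 0 = n" by (simp add: dj_env_def inv_def)
  then have "wreg s' 82 = n" using ev J by (simp add: J_def)
  then show "J (warr s' 24) (warr s' 25) n \<and> t \<le> n * (60 * L + 300) + 10" using J t by simp
 qed
 show ?thesis
  unfolding hubs_in_def using W_small(14)
  apply simp
  apply (rule wp_call[OF loop])
  using fin by auto
qed

lemma level_out:
 assumes st: "static s" and B: "wreg s 71 = B"
 shows "wp W level_out (\<lambda>t s'. (\<forall>v<n. decode_distance (warr s' 5 v) (rarr s' 1 v) =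
  min (decode_distance (warr s 5 v) (rarr s 1 v)) (if warr s 24 v \<le> B then ereal (real (warr s 24 v) * rreg s 6) else \<infinity>)) \<and>
  t \<le> 80 * n + 20) s"
proof -
 let ?c = "Cond (WCell 24 (WReg 82) [\<le>] WReg 71)
     (SetR 5 (RWord (WCell 24 (WReg 82)) {*} RReg 6) ;;
     Cond (BAnd (WConst 0 [<] WCell 5 (WReg 82)) (RCell 1 (WReg 82) {\<le>} RReg 5)) Skip
      (PutW 5 (WReg 82) (WConst 1) ;; PutR 1 (WReg 82) (RReg 5)))
     Skip ;;
    SetW 82 (WReg 82 [+] WConst 1)"
 let ?lev = "\<lambda>v. if warr s 24 v \<le> B then ereal (real (warr s 24 v) * rreg s 6) else \<infinity>"
 let ?s = "s\<lparr>wreg := (wreg s)(82 := 0)\<rparr>"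
 define J where "J = (\<lambda>a b k. k \<le> n \<and> (\<forall>v<n. if v < k then decode_distance (a v) (b v) =
  min (decode_distance (warr s 5 v) (rarr s 1 v)) (?lev v) else a v = warr s 5 v \<and> b v = rarr s 1 v))"
 have step: "J a' b' (x + 1)" if "J a b x" "x < n" "\<And>y. y \<noteq> x \<Longrightarrow> a' y = a y \<and> b' y = b y"
  "decode_distance (a' x) (b' x) = min (decode_distance (a x) (b x)) (?lev x)" for a b a' b' x
  unfolding J_def
 proof (intro conjI allI impI)
  show "x + 1 \<le> n" using that(2) by simp
  fix v assume v: "v < n"
  show "if v < x + 1 then decode_distance (a' v) (b' v) = min (decode_distance (warr s 5 v) (rarr s 1 v)) (?lev v)
   else a' v = warr s 5 v \<and> b' v = rarr s 1 v"
  proof (cases "v = x")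
   case True
   have "a x = warr s 5 x \<and> b x = rarr s 1 x" using that(1,2) by (simp add: J_def)
   with True that(4) show ?thesis by simp
  next
   case False
   then have "v < x + 1 \<longleftrightarrow> v < x" by auto
   with False that(1) that(3)[OF False] v show ?thesis by (simp add: J_def)
  qed
 qed
 have loop: "wp W (While (WReg 82 [<] WReg 0) ?c) (\<lambda>t s'. J (warr s' 5) (rarr s' 1) n \<and> t \<le> 80 * n + 10) ?s"
 proof (rule wp_while[where I = "\<lambda>s'. J (warr s' 5) (rarr s' 1) (wreg s' 82)" and F = "\<lambda>s'. 80 * (n - wreg s' 82)"])
  show "J (warr ?s 5) (rarr ?s 1) (wreg ?s 82)" by (simp add: J_def)
  fix s' assume J: "J (warr s' 5) (rarr s' 1) (wreg s' 82)" and ag: "agrees ?c ?s s'"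
  define x where "x = wreg s' 82"
  have st': "static s'" by (rule static_cong[OF st]) (use ag in \<open>auto simp: agrees_def\<close>)
  have rr: "wreg s' 71 = B" "warr s' 24 = warr s 24" "rreg s' 6 = rreg s 6" using ag B by (auto simp: agrees_def)
  show "eval_bool W s' (WReg 82 [<] WReg 0) \<noteq> None \<and> (eval_bool W s' (WReg 82 [<] WReg 0) = Some True \<longrightarrow>
   wp W ?c (\<lambda>t s''. J (warr s'' 5) (rarr s'' 1) (wreg s'' 82) \<and> 1 + cost_bool (WReg 82 [<] WReg 0) + t + 80 * (n - wreg s'' 82)
    \<le> 80 * (n - wreg s' 82)) s')"
  proof (cases "x < n")
   case True
   have xW: "x + 1 < W" using True W_small(12) by simp
   have eq: "80 * (n - x) = 80 * (n - (x + 1)) + 80" using True by simp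
   note st1 = step[OF J[folded x_def] True]
   show ?thesis
   proof (cases "warr s 24 x \<le> B")
    case False
    have "J (warr s' 5) (rarr s' 1) (x + 1)" by (rule st1) (use False in \<open>auto simp: decode_min(1)[symmetric]\<close>)
    then show ?thesis using False True rr st' xW eq W_small(14) by (simp add: x_def[symmetric])
   next
    case le: True
    let ?y = "real (warr s 24 x) * rreg s 6"
    show ?thesis
    proof (cases "warr s' 5 x \<noteq> 0 \<and> rarr s' 1 x \<le> ?y")
     case True
     have "J (warr s' 5) (rarr s' 1) (x + 1)" by (rule st1) (use True le decode_min(4)[of "warr s' 5 x" "rarr s' 1 x" ?y] in auto)
     then show ?thesis using True \<open>x < n\<close> le rr st' xW eq W_small(14) by (simp add: x_def[symmetric])
    next
     case False
     have "J ((warr s' 5)(x := 1)) ((rarr s' 1)(x := ?y)) (x + 1)"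
     proof (rule st1)
      show "decode_distance (((warr s' 5)(x := 1)) x) (((rarr s' 1)(x := ?y)) x) =
       min (decode_distance (warr s' 5 x) (rarr s' 1 x)) (?lev x)"
       using False le decode_min(2)[of "warr s' 5 x" ?y "rarr s' 1 x"] decode_min(3)[of "warr s' 5 x" ?y "rarr s' 1 x"]
       by (cases "warr s' 5 x = 0") auto
     qed auto
     moreover have "warr s' 5 x \<noteq> 0 \<Longrightarrow> ?y < rarr s' 1 x" using False by auto
     ultimately show ?thesis using \<open>x < n\<close> le rr st' xW eq W_small(14)
      by (cases "warr s' 5 x = 0") (simp_all add: x_def[symmetric])
    qed
   qed
  next
   case False then show ?thesis using st' by (simp add: x_def)
  qed
 next
  fix t s' assume J: "J (warr s' 5) (rarr s' 1) (wreg s' 82)" and ag: "agrees ?c ?s s'"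
   and ev: "eval_bool W s' (WReg 82 [<] WReg 0) = Some False"
   and t: "t + 80 * (n - wreg s' 82) \<le> 80 * (n - wreg ?s 82) + 1 + cost_bool (WReg 82 [<] WReg 0)"
  have st': "static s'" by (rule static_cong[OF st]) (use ag in \<open>auto simp: agrees_def\<close>)
  then have "wreg s' 82 = n" using ev J by (simp add: J_def)
  then show "J (warr s' 5) (rarr s' 1) n \<and> t \<le> 80 * n + 10" using J t by simp
 qed
 show ?thesis
  unfolding level_out_def using W_small(14)
  apply simp
  apply (rule wp_call[OF loop])
  by (auto simp: J_def)
qed

text \<open>Following the parents terminates because labels decrease strictly; the collected arcs
  form a walk from the hub.\<close>

lemma tree_path:
 assumes I: "inv s l" and i: "i < NI" and q: "q \<in> S" "j = q div n"
 shows "v < n \<Longrightarrow> lab s i q v \<le> Bd j \<Longrightarrow> \<exists>p. wk (q mod n) p v \<and> nsum l i j p \<le> lab s i q v"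
proof (induction "lab s i q v" arbitrary: v rule: less_induct)
 case less
 show ?case
 proof (cases "v = q mod n")
  case True
  then show ?thesis by (intro exI[of _ "[]"]) simp
 next
  case False
  from tree_out[OF I i q less.prems(1) False less.prems(2)] obtain e where e: "e < m" "he e = v"
   "lab s i q (ta e) + Nf i j (l e) + 1 \<le> lab s i q v" by blast
  then obtain p where p: "wk (q mod n) p (ta e)" "nsum l i j p \<le> lab s i q (ta e)"
   using less.hyps[of "ta e"] less.prems ta_less[of e] by auto
  then have "wk (q mod n) (p @ [e]) v \<and> nsum l i j (p @ [e]) \<le> lab s i q v" using e by (auto simp: wk_append)
  then show ?thesis by blast
 qed
qed

lemma lab_arc:
 assumes I: "inv s l" and i: "i < NI" and q: "q \<in> S" "j = q div n" and e: "e < m"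
 shows "lab s i q (he e) \<le> lab s i q (ta e) + (Nf i j (l e) + 1)"
  "lab s i q (n + ta e) \<le> lab s i q (n + he e) + (Nf i j (l e) + 1)"
proof -
 have "tree s i q {}" using I i q by (auto simp: inv_def trees_ok_def)
 then have t: "\<forall>a<2 * m. lab s i q (HD a) \<le> lab s i q (TL a) + warr s 17 (cb i j + a) + 1"
  by (simp add: tree_def q es_inv_def lab_def sl_def)
 have "cost_ok s (Nl l)" using I by (simp add: inv_def)
 note c = cost_okD[OF this i _ e, of j, unfolded Nl_def]
 have jL: "j \<in> {1..L}" using S_bounds[OF q(1)] q(2) by simp
 show "lab s i q (he e) \<le> lab s i q (ta e) + (Nf i j (l e) + 1)"
  using t[rule_format, of e] e c(2)[OF jL] by (simp add: HD_def TL_def)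
 show "lab s i q (n + ta e) \<le> lab s i q (n + he e) + (Nf i j (l e) + 1)"
  using t[rule_format, of "m + e"] e c(3)[OF jL] by (simp add: HD_def TL_def)
qed

lemma lab_source: "inv s l \<Longrightarrow> i < NI \<Longrightarrow> q \<in> S \<Longrightarrow> lab s i q (q mod n) = 0 \<and> lab s i q (n + q mod n) = 0"
proof -
 assume a: "inv s l" "i < NI" "q \<in> S"
 then have "tree s i q {}" by (auto simp: inv_def trees_ok_def)
 then have t: "\<forall>v<2 * n. v mod n = q mod n \<longrightarrow> lab s i q v = 0" by (simp add: tree_def es_inv_def lab_def sl_def)
 have "q mod n < n" using n2 by simp
 then show ?thesis using t by simp
qed

text \<open>Triangle inequality for the labels. With label 0 at the hub it makes every label a lower
  bound on the rounded lengths of walks from, respectively to, the hub.\<close>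

lemma lab_walk:
 assumes "inv s l" "i < NI" "q \<in> S" "j = q div n" "wk x p y"
 shows "lab s i q y \<le> lab s i q x + nsum l i j p \<and> lab s i q (n + x) \<le> lab s i q (n + y) + nsum l i j p"
 using assms(5)
proof (induction p arbitrary: x)
 case (Cons e p)
 have e: "e < m" "ta e = x" "wk (he e) p y" using Cons.prems by auto
 show ?case using Cons.IH[OF e(3)] lab_arc[OF assms(1-4) e(1)] e(2) by simp
qed simp

text \<open>Equality and not just approximation, since \<open>SSrcDist\<close> must return the
  values of \<open>Distance\<close>. The Dijkstra label is at most the sum for each hub, by
  continuing along the path of its tree; conversely it is realised by a walk from some hub, on which
  the label of that hub is a lower bound.\<close>

lemma level_value:
 assumes I: "inv s l" and i: "i < NI" and j: "j \<in> {1..L}" and v: "v < n"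
  and f: "dj_inv l i j (hub_label s i j u) f T {}" "\<not> T 1 \<le> Bd j"
 shows "(if f v \<le> Bd j then ereal (real (f v) * unit i j) else \<infinity>) = (INF q\<in>{q \<in> cand s i u v. q div n = j}. ereal (dval s i q u v))"
proof -
 have walk: "f y \<le> f x + nsum l i j p" if "wk x p y" for x p y
  using that
 proof (induction p arbitrary: x)
  case (Cons e p)
  then have "f (he e) \<le> f (ta e) + (Nf i j (l e) + 1)" by (intro dj_final[OF f]) auto
  moreover have "f y \<le> f (he e) + nsum l i j p" using Cons by auto
  ultimately show ?case using Cons.prems by simp
 qed simp
 have low: "f v \<le> dsum s i q u v" if q: "q \<in> cand s i u v" "q div n = j" for q
 proof -
  have qS: "q \<in> S" "lab s i q v \<le> Bd j" using q by (auto simp: cand_def dsum_def)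
  obtain p where p: "wk (q mod n) p v" "nsum l i j p \<le> lab s i q v" using tree_path[OF I i qS(1) q(2)[symmetric] v qS(2)] by blast
  have w: "q mod n < n" "j * n + q mod n = q" using n2 q(2) by auto
  then have "f (q mod n) \<le> lab s i q (n + u)" using f(1) qS(1) by (auto simp: dj_inv_def hub_label_def dest!: spec[of _ "q mod n"])
  then show ?thesis using walk[OF p(1)] p(2) by (simp add: dsum_def)
 qed
 show ?thesis
 proof (cases "f v \<le> Bd j")
  case True
  then obtain w p where w: "w < n" "wk w p v" "hub_label s i j u w + nsum l i j p \<le> f v"
   using f(1) v unfolding dj_inv_def by blast
  let ?q = "j * n + w"
  have qS: "?q \<in> S" using w(3) True by (auto simp: hub_label_def split: if_splits)
  note hc = hub_code[OF j w(1)]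
  have "lab s i ?q v \<le> nsum l i j p"
   using lab_walk[OF I i qS hc(1)[symmetric] w(2)] lab_source[OF I i qS] hc by simp
  then have ds: "dsum s i ?q u v \<le> f v" using w(3) qS by (simp add: dsum_def hub_label_def)
  then have c: "?q \<in> {q \<in> cand s i u v. q div n = j}" using qS hc True by (simp add: cand_def)
  have e: "dsum s i ?q u v = f v" using low[of ?q] c ds by simp
  have "(INF q\<in>{q \<in> cand s i u v. q div n = j}. ereal (dval s i q u v)) = ereal (real (f v) * unit i j)"
  proof (rule INF_eqI)
   fix q assume q: "q \<in> {q \<in> cand s i u v. q div n = j}"
   then have "real (f v) \<le> real (dsum s i q u v)" using low by simp
   then show "ereal (real (f v) * unit i j) \<le> ereal (dval s i q u v)"
    using q unit_pos[of i j] by (auto simp: dval_def intro: mult_right_mono)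
  next
   fix y assume y: "\<And>q. q \<in> {q \<in> cand s i u v. q div n = j} \<Longrightarrow> y \<le> ereal (dval s i q u v)"
   show "y \<le> ereal (real (f v) * unit i j)" using y[OF c] e hc by (simp add: dval_def)
  qed
  with True show ?thesis by simp
 next
  case False
  have "{q \<in> cand s i u v. q div n = j} = {}"
  proof (rule equals0I)
   fix q assume q: "q \<in> {q \<in> cand s i u v. q div n = j}"
   then have "f v \<le> dsum s i q u v" "dsum s i q u v \<le> Bd j" using low by (auto simp: cand_def)
   with False show False by simp
  qed
  with False show ?thesis by (simp only: image_empty Inf_empty if_False top_ereal_def)
 qed
qed

text \<open>The assumption \<open>2 ^ L \<le> 2 * n\<close> keeps the reset of the padded tournament
  tree linear in \<open>n\<close>. The 80 are reserved for the register assignments that precede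
  this part of \<open>level\<close>.\<close>

lemma level_rest:
 assumes E: "dj_env l i j s" and r: "wreg s 70 = j" "wreg s 50 = i" "wreg s 3 = u" "u < n" "wreg s 83 = Bd j + 1" "rreg s 6 = unit i j"
  and P: "2 ^ L \<le> 2 * n"
 shows "wp W (fill 24 (WReg 0) ;; fill 25 (WConst 2 [*] WReg 75) ;; hubs_in ;; dijkstra ;; level_out) (\<lambda>t s'.
  (\<forall>v<n. decode_distance (warr s' 5 v) (rarr s' 1 v) = min (decode_distance (warr s 5 v) (rarr s 1 v))
    (INF q\<in>{q \<in> cand s i u v. q div n = j}. ereal (dval s i q u v))) \<and> t + 80 \<le> 600 * (L + 2) * (n + 2 * m)) s"
proof -
 have I: "inv s l" and iN: "i < NI" and jL: "j \<in> {1..L}" and r75: "wreg s 71 = Bd j" "wreg s 75 = 2 ^ L"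
  using E by (auto simp: dj_env_def)
 have n0: "wreg s 0 = n" using inv_static[OF I] by simp
 let ?R = "\<lambda>(t::nat) (s'::machine_state). (\<forall>v<n. decode_distance (warr s' 5 v) (rarr s' 1 v) = min (decode_distance (warr s 5 v) (rarr s 1 v))
    (INF q\<in>{q \<in> cand s i u v. q div n = j}. ereal (dval s i q u v))) \<and> t + 80 \<le> 600 * (L + 2) * (n + 2 * m)"
 have "wp W (fill 24 (WReg 0)) (\<lambda>t s'. (\<forall>x. warr s' 24 x = (if x < n then Bd j + 1 else warr s 24 x)) \<and> t \<le> 40 * n + 20) s"
  by (rule fill) (use n0 r W_small(12,14) in auto)
 then show ?thesis
  unfolding wp_Seq
 proof (rule wp_call)
  fix t1 s1 assume p1: "(\<forall>x. warr s1 24 x = (if x < n then Bd j + 1 else warr s 24 x)) \<and> t1 \<le> 40 * n + 20"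
   and ag1: "agrees (fill 24 (WReg 0)) s s1"
  have E1: "dj_env l i j s1" by (rule dj_env_agrees[OF E ag1]) simp_all
  have q1: "wreg s1 70 = j" "wreg s1 50 = i" "wreg s1 3 = u" "wreg s1 83 = Bd j + 1" "rreg s1 6 = unit i j" "wreg s1 75 = 2 ^ L"
   "warr s1 5 = warr s 5" "rarr s1 1 = rarr s 1" "warr s1 18 = warr s 18"
   using ag1 r r75 by (auto simp: agrees_def)
  have "wp W (fill 25 (WConst 2 [*] WReg 75)) (\<lambda>t s'. (\<forall>x. warr s' 25 x = (if x < 2 * 2 ^ L then Bd j + 1 else warr s1 25 x)) \<and> t \<le> 40 * (2 * 2 ^ L) + 20) s1"
   by (rule fill) (use q1 P_bounds in auto)
  then show "wp W (fill 25 (WConst 2 [*] WReg 75)) (\<lambda>t1a::nat. wp W hubs_in (\<lambda>t1b::nat. wp W dijkstra (\<lambda>t1c::nat. wp W level_out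
   (\<lambda>t2::nat. ?R (t1 + (t1a + (t1b + (t1c + t2)))))))) s1"
  proof (rule wp_call)
   fix t2 s2 assume p2: "(\<forall>x. warr s2 25 x = (if x < 2 * 2 ^ L then Bd j + 1 else warr s1 25 x)) \<and> t2 \<le> 40 * (2 * 2 ^ L) + (20::nat)"
    and ag2: "agrees (fill 25 (WConst 2 [*] WReg 75)) s1 s2"
   have E2: "dj_env l i j s2" by (rule dj_env_agrees[OF E1 ag2]) simp_all
   have q2: "wreg s2 70 = j" "wreg s2 50 = i" "wreg s2 3 = u" "rreg s2 6 = unit i j" "warr s2 24 = warr s1 24"
    "warr s2 5 = warr s 5" "rarr s2 1 = rarr s 1" "warr s2 18 = warr s 18"
    using ag2 q1 by (auto simp: agrees_def)
   show "wp W hubs_in (\<lambda>t1b::nat. wp W dijkstra (\<lambda>t1c::nat. wp W level_out (\<lambda>t2a::nat. ?R (t1 + (t2 + (t1b + (t1c + t2a))))))) s2"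
   proof (rule wp_call[OF hubs_in[OF E2 q2(1-3) r(4)]])
    show "\<forall>x<n. warr s2 24 x = Bd j + 1" using p1 q2 by simp
    show "\<forall>x<2 * 2 ^ L. warr s2 25 x = Bd j + 1" using p2 by simp
    fix t3 s3 assume p3: "dj_inv l i j (hub_label s2 i j u) (warr s3 24) (warr s3 25) {} \<and> t3 \<le> n * (60 * L + 300) + 20"
     and ag3: "agrees hubs_in s2 s3"
    have E3: "dj_env l i j s3" by (rule dj_env_agrees[OF E2 ag3]) simp_all
    have q3: "rreg s3 6 = unit i j" "warr s3 5 = warr s 5" "rarr s3 1 = rarr s 1"
     using ag3 q2 by (auto simp: agrees_def)
    have hl: "hub_label s2 i j u = hub_label s i j u" using q2(8) by (simp add: hub_label_def lab_def fun_eq_iff)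
    show "wp W dijkstra (\<lambda>t1c::nat. wp W level_out (\<lambda>t2a::nat. ?R (t1 + (t2 + (t3 + (t1c + t2a)))))) s3"
    proof (rule wp_call[OF dijkstra[OF E3 conjunct1[OF p3]]])
     fix t4 s4 assume p4: "dj_inv l i j (hub_label s2 i j u) (warr s4 24) (warr s4 25) {} \<and> \<not> warr s4 25 1 \<le> Bd j \<and>
      t4 \<le> 300 * (L + 2) * (n + 2 * m) + 10" and ag4: "agrees dijkstra s3 s4"
     have E4: "dj_env l i j s4" by (rule dj_env_agrees[OF E3 ag4]) simp_all
     have q4: "rreg s4 6 = unit i j" "warr s4 5 = warr s 5" "rarr s4 1 = rarr s 1" "static s4" "wreg s4 71 = Bd j"
      using ag4 q3 E4 by (auto simp: agrees_def dj_env_def inv_def)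
     show "wp W level_out (\<lambda>t2a::nat. ?R (t1 + (t2 + (t3 + (t4 + t2a))))) s4"
     proof (rule wp_call[OF level_out[OF q4(4,5)]])
      fix t5 and s5 :: machine_state assume p5: "(\<forall>v<n. decode_distance (warr s5 5 v) (rarr s5 1 v) =
       min (decode_distance (warr s4 5 v) (rarr s4 1 v)) (if warr s4 24 v \<le> Bd j then ereal (real (warr s4 24 v) * rreg s4 6) else \<infinity>)) \<and>
       t5 \<le> 80 * n + 20"
      have D4: "dj_inv l i j (hub_label s i j u) (warr s4 24) (warr s4 25) {}" "\<not> warr s4 25 1 \<le> Bd j"
       using p4 hl by auto
      have "300 * (L + 2) * (n + 2 * m) + (640 * n + n * (60 * L) + 300) \<le> 600 * (L + 2) * (n + 2 * m)"
      proof -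
       have "n * 1 \<le> n * L" by (rule mult_le_mono2[OF L1])
       moreover have "2 * 1 \<le> n * L" by (rule mult_le_mono[OF n2 L1])
       moreover have "n * (60 * L) = 60 * (n * L)" by simp
       ultimately have "640 * n + n * (60 * L) + 300 \<le> 300 * (n * L) + 600 * n" by linarith
       also have "\<dots> \<le> 300 * (L + 2) * (n + 2 * m)" by (simp add: algebra_simps)
       finally have "640 * n + n * (60 * L) + 300 \<le> 300 * (L + 2) * (n + 2 * m)" .
       moreover have "600 * (L + 2) * (n + 2 * m) = 300 * (L + 2) * (n + 2 * m) + 300 * (L + 2) * (n + 2 * m)"
        by (simp add: algebra_simps)
       ultimately show ?thesis by (simp only: add_left_mono)
      qed
      moreover have "40 * (2 * 2 ^ L) \<le> 160 * n" using P by simp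
      moreover have "n * (60 * L + 300) = n * (60 * L) + 300 * n" by (simp add: algebra_simps)
      ultimately have "t1 + (t2 + (t3 + (t4 + t5))) + 80 \<le> 600 * (L + 2) * (n + 2 * m)"
       using p1 p2 p3 p4 p5 n2 by linarith
      moreover have "\<forall>v<n. decode_distance (warr s5 5 v) (rarr s5 1 v) = min (decode_distance (warr s 5 v) (rarr s 1 v))
       (INF q\<in>{q \<in> cand s i u v. q div n = j}. ereal (dval s i q u v))"
      proof (intro allI impI)
       fix v assume v: "v < n"
       show "decode_distance (warr s5 5 v) (rarr s5 1 v) = min (decode_distance (warr s 5 v) (rarr s 1 v))
        (INF q\<in>{q \<in> cand s i u v. q div n = j}. ereal (dval s i q u v))"
        unfolding level_value[OF I iN jL v D4, symmetric] using p5 q4 v by simp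
      qed
      ultimately show "?R (t1 + (t2 + (t3 + (t4 + t5)))) s5" by simp
     qed
    qed
   qed
  qed
 qed
qed

lemma level:
 assumes I: "inv s l" and r: "wreg s 50 = i" "i < NI" "wreg s 70 = j" "j \<in> {1..L}" "wreg s 75 = 2 ^ L" "wreg s 3 = u" "u < n"
  and P: "2 ^ L \<le> 2 * n"
 shows "wp W level (\<lambda>t s'. (\<forall>v<n. decode_distance (warr s' 5 v) (rarr s' 1 v) = min (decode_distance (warr s 5 v) (rarr s 1 v))
    (INF q\<in>{q \<in> cand s i u v. q div n = j}. ereal (dval s i q u v))) \<and> t \<le> 600 * (L + 2) * (n + 2 * m)) s"
proof -
 have st: "static s" by (rule inv_static[OF I])
 have st2: "rarr s 2 i = beta i" "warr s 7 j = 2 ^ j" using static_tables[OF st] r by simp_all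
 have BW: "Bd j + 1 < W" "Bd j < W" using W_small(1) Bd_mono[of j] r by simp_all
 have pj: "Dl * 2 ^ j < W" using BW by (simp add: Bd_def)
 have cbl: "cb i j + 2 * m < W" using cb_le r by auto
 have m0: "0 < 2 * m" using m1 by simp
 have "(i * Suc L + j) * 1 \<le> cb i j" unfolding cb_def using m0 by (intro mult_le_mono) auto
 moreover have c': "cb i j < W" using cbl by simp
 ultimately have ij: "i * Suc L + j < W" by (simp only: mult_1_right le_less_trans)
 then have b: "cb i j < W" "i * Suc L + j < W" "i * Suc L < W"
  using c' le_less_trans[OF le_add1 ij] by blast+
 let ?s = "s\<lparr>rreg := (rreg s)(6 := unit i j), wreg := (wreg s)(71 := Bd j, 76 := cb i j, 83 := Bd j + 1)\<rparr>"
 have E: "dj_env l i j ?s"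
 proof -
  have "static ?s" by (rule static_cong[OF st]) simp_all
  then have "inv ?s l" using I by (simp add: inv_def trees_ok_def tree_def cost_ok_def cls_ok_def)
  then show ?thesis using r by (simp add: dj_env_def)
 qed
 have same: "cand ?s = cand s" "dval ?s = dval s" by (auto simp: cand_def dval_def dsum_def lab_def fun_eq_iff)
 have rest: "wp W (fill 24 (WReg 0) ;; fill 25 (WConst 2 [*] WReg 75) ;; hubs_in ;; dijkstra ;; level_out) (\<lambda>t s'.
  (\<forall>v<n. decode_distance (warr s' 5 v) (rarr s' 1 v) = min (decode_distance (warr s 5 v) (rarr s 1 v))
    (INF q\<in>{q \<in> cand s i u v. q div n = j}. ereal (dval s i q u v))) \<and> t + 80 \<le> 600 * (L + 2) * (n + 2 * m)) ?s"
  using level_rest[OF E _ _ _ r(7) _ _ P] r same by simp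
 define K where "K = 600 * (L + 2) * (n + 2 * m)"
 define prog where "prog = (fill 24 (WReg 0) ;; fill 25 (WConst 2 [*] WReg 75) ;; hubs_in ;; dijkstra ;; level_out)"
 show ?thesis
  unfolding level_def prog_def[symmetric] K_def[symmetric]
  using st r st2 W_small(1,6,11,13,14) b pj BW
  apply (simp add: cb_def[symmetric] Bd_def[symmetric] unit_def[symmetric] Suc_eq_plus1[of L, symmetric] mult.assoc
    del: mult_Suc mult_Suc_right times_divide_eq_right)
  apply (rule wp_call[OF rest[folded prog_def K_def]])
  apply auto
  done
qed

text \<open>After the levels below \<open>k\<close>, the table holds the infima over the candidates
  of those levels, and a new level enters through the infimum of a union.\<close>

lemma ssrc_query:
 assumes I: "inv s l" and b: "rreg s 3 = \<beta>" "okc \<beta> 0" and u: "wreg s 3 = u" "u < n" and P: "2 ^ L \<le> 2 * n"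
 shows "wp W ssrc_query (\<lambda>t s'. (\<forall>v<n. decode_distance (warr s' 5 v) (rarr s' 1 v) = Dst s u v \<beta>) \<and>
  t \<le> 1200 * L * (L + 2) * (n + 2 * m)) s"
proof -
 define i where "i = scale (warr s 23) \<beta>"
 have iN: "i < NI" using scale_ok(1)[OF b(2)] by (simp add: i_def okc_def)
 let ?K = "600 * (L + 2) * (n + 2 * m)"
 let ?c = "level ;; SetW 70 (WReg 70 [+] WConst 1)"
 let ?cand = "\<lambda>k v. {q \<in> cand s i u v. q div n < k}"
 let ?inf = "\<lambda>k v. INF q\<in>?cand k v. ereal (dval s i q u v)"
 have loop: "wp W (While (WReg 70 [\<le>] WReg 6) ?c) (\<lambda>t s'. (\<forall>v<n. decode_distance (warr s' 5 v) (rarr s' 1 v) = Dst s u v \<beta>) \<and>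
  t \<le> L * (?K + 40) + 10) s0"
  if I0: "inv s0 l" and L0: "lab s0 = lab s" and r0: "wreg s0 50 = i" "wreg s0 75 = 2 ^ L" "wreg s0 3 = u" "wreg s0 70 = 1"
   and z: "\<forall>v<n. warr s0 5 v = 0" for s0
 proof (rule wp_while[where I = "\<lambda>s'. inv s' l \<and> lab s' = lab s \<and> wreg s' 70 \<in> {1..L + 1} \<and>
    (\<forall>v<n. decode_distance (warr s' 5 v) (rarr s' 1 v) = ?inf (wreg s' 70) v)" and F = "\<lambda>s'. (L + 1 - wreg s' 70) * (?K + 40)"])
  \<comment> \<open>Hubs start at level 1, so the cleared table, read as \<open>\<infinity>\<close>,
    is the empty infimum.\<close>
  have "?cand 1 v = {}" for v
  proof (rule equals0I)
   fix q assume "q \<in> ?cand 1 v"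
   then have "q \<in> S" "q div n < 1" by (auto simp: cand_def)
   with S_bounds(2)[of q] show False by linarith
  qed
  then have inf1: "?inf 1 v = \<infinity>" for v by (simp only: image_empty Inf_empty top_ereal_def)
  have "\<forall>v<n. decode_distance (warr s0 5 v) (rarr s0 1 v) = ?inf (wreg s0 70) v"
   unfolding r0(4) inf1 using z by (simp add: decode_distance_def)
  then show "inv s0 l \<and> lab s0 = lab s \<and> wreg s0 70 \<in> {1..L + 1} \<and> (\<forall>v<n. decode_distance (warr s0 5 v) (rarr s0 1 v) = ?inf (wreg s0 70) v)"
   using I0 L0 r0(4) by simp
 next
  fix s' assume J: "inv s' l \<and> lab s' = lab s \<and> wreg s' 70 \<in> {1..L + 1} \<and>
    (\<forall>v<n. decode_distance (warr s' 5 v) (rarr s' 1 v) = ?inf (wreg s' 70) v)" and ag: "agrees ?c s0 s'"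
  define j where "j = wreg s' 70"
  have r': "wreg s' 50 = i" "wreg s' 75 = 2 ^ L" "wreg s' 3 = u" using ag r0 by (auto simp: agrees_def)
  have I': "inv s' l" and st': "static s'" using J by (auto simp: inv_def)
  show "eval_bool W s' (WReg 70 [\<le>] WReg 6) \<noteq> None \<and> (eval_bool W s' (WReg 70 [\<le>] WReg 6) = Some True \<longrightarrow>
   wp W ?c (\<lambda>t s''. (inv s'' l \<and> lab s'' = lab s \<and> wreg s'' 70 \<in> {1..L + 1} \<and>
    (\<forall>v<n. decode_distance (warr s'' 5 v) (rarr s'' 1 v) = ?inf (wreg s'' 70) v)) \<and>
    1 + cost_bool (WReg 70 [\<le>] WReg 6) + t + (L + 1 - wreg s'' 70) * (?K + 40) \<le> (L + 1 - wreg s' 70) * (?K + 40)) s')"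
  proof (cases "j \<le> L")
   case True
   then have jL: "j \<in> {1..L}" using J by (simp add: j_def)
   have same: "cand s' = cand s" "dval s' = dval s" using J by (auto simp: cand_def dval_def dsum_def fun_eq_iff)
   have jW: "j + 1 < W" using True W_small(11) by simp
   have eq: "(L + 1 - j) * (?K + 40) = (L + 1 - (j + 1)) * (?K + 40) + (?K + 40)"
   proof -
    have "L + 1 - j = Suc (L + 1 - (j + 1))" using True by simp
    then show ?thesis by simp
   qed
   have "wp W ?c (\<lambda>t s''. (inv s'' l \<and> lab s'' = lab s \<and> wreg s'' 70 \<in> {1..L + 1} \<and>
    (\<forall>v<n. decode_distance (warr s'' 5 v) (rarr s'' 1 v) = ?inf (wreg s'' 70) v)) \<and>
    1 + cost_bool (WReg 70 [\<le>] WReg 6) + t + (L + 1 - wreg s'' 70) * (?K + 40) \<le> (L + 1 - wreg s' 70) * (?K + 40)) s'"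
    unfolding wp_Seq
   proof (rule wp_call[OF level[OF I' r'(1) iN j_def[symmetric] jL r'(2,3) u(2) P]])
    fix t s'' assume p: "(\<forall>v<n. decode_distance (warr s'' 5 v) (rarr s'' 1 v) = min (decode_distance (warr s' 5 v) (rarr s' 1 v))
     (INF q\<in>{q \<in> cand s' i u v. q div n = j}. ereal (dval s' i q u v))) \<and> t \<le> ?K" and ag2: "agrees level s' s''"
    have I2: "inv s'' l" "lab s'' = lab s" using inv_agrees[OF I' ag2] J by simp_all
    have w70: "wreg s'' 70 = j" using ag2 by (auto simp: agrees_def j_def)
    have "decode_distance (warr s'' 5 v) (rarr s'' 1 v) = ?inf (j + 1) v" if v: "v < n" for v
    proof -
     have "?cand (j + 1) v = ?cand j v \<union> {q \<in> cand s i u v. q div n = j}" by auto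
     then have "?inf (j + 1) v = min (?inf j v) (INF q\<in>{q \<in> cand s i u v. q div n = j}. ereal (dval s i q u v))"
      by (simp only: image_Un Inf_union_distrib inf_min)
     then show ?thesis using p J v same by (simp add: j_def)
    qed
    moreover have "inv (s''\<lparr>wreg := (wreg s'')(70 := j + 1)\<rparr>) l" "lab (s''\<lparr>wreg := (wreg s'')(70 := j + 1)\<rparr>) = lab s"
     using I2 by (auto simp: inv_def cls_ok_def lab_def fun_eq_iff)
    ultimately show "wp W (SetW 70 (WReg 70 [+] WConst 1)) (\<lambda>t2 s''. (inv s'' l \<and> lab s'' = lab s \<and> wreg s'' 70 \<in> {1..L + 1} \<and>
     (\<forall>v<n. decode_distance (warr s'' 5 v) (rarr s'' 1 v) = ?inf (wreg s'' 70) v)) \<and>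
     1 + cost_bool (WReg 70 [\<le>] WReg 6) + (t + t2) + (L + 1 - wreg s'' 70) * (?K + 40) \<le> (L + 1 - wreg s' 70) * (?K + 40)) s''"
     using w70 jW W_small(14) jL p eq unfolding j_def[symmetric] by simp
   qed
   then show ?thesis using st' by (simp del: wp_Seq)
  next
   case False then show ?thesis using st' by (simp add: j_def)
  qed
 next
  fix t s' assume J: "inv s' l \<and> lab s' = lab s \<and> wreg s' 70 \<in> {1..L + 1} \<and>
    (\<forall>v<n. decode_distance (warr s' 5 v) (rarr s' 1 v) = ?inf (wreg s' 70) v)" 
   and ev: "eval_bool W s' (WReg 70 [\<le>] WReg 6) = Some False"
   and t: "t + (L + 1 - wreg s' 70) * (?K + 40) \<le> (L + 1 - wreg s0 70) * (?K + 40) + 1 + cost_bool (WReg 70 [\<le>] WReg 6)"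
  have "wreg s' 6 = L" using J by (simp add: inv_def)
  then have w: "wreg s' 70 = L + 1" using ev J by auto
  have "?cand (L + 1) v = cand s i u v" for v using S_bounds(3) by (auto simp: cand_def less_Suc_eq_le simp flip: Suc_eq_plus1)
  then have "?inf (L + 1) v = Dst s u v \<beta>" for v by (simp add: Dst_def Dm_def i_def)
  then show "(\<forall>v<n. decode_distance (warr s' 5 v) (rarr s' 1 v) = Dst s u v \<beta>) \<and> t \<le> L * (?K + 40) + 10"
   using J w t r0 by simp
 qed
 have K: "400 * n * L + (40 * n + 100) + L * (?K + 40) \<le> 1200 * L * (L + 2) * (n + 2 * m)"
 proof -
  have "n * 1 \<le> n * L" by (rule mult_le_mono2[OF L1])
  moreover have "2 * 1 \<le> n * L" "2 * L \<le> n * L" by (rule mult_le_mono[OF n2 L1], rule mult_le_mono1[OF n2])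
  moreover have "400 * n * L = 400 * (n * L)" by simp
  ultimately have "400 * n * L + (40 * n + 100) + 40 * L \<le> 540 * (n * L)" by linarith
  also have "\<dots> \<le> L * ?K" by (simp add: algebra_simps)
  finally show ?thesis by (simp add: algebra_simps)
 qed
 show ?thesis
  unfolding ssrc_query_def
  apply (subst wp_Seq)
  apply (rule wp_call[OF find_scale[OF I b(1)[symmetric] b(2)]])
 proof -
  fix t1 s1 assume p1: "wreg s1 50 = scale (warr s 23) \<beta> \<and> t1 \<le> 400 * n * L" and ag1: "agrees find_scale s s1"
  have I1: "inv s1 l" "lab s1 = lab s" using inv_agrees[OF I ag1] by simp_all
  have st1: "static s1" by (rule inv_static[OF I1(1)])
  have r1: "wreg s1 50 = i" "wreg s1 3 = u" "warr s1 7 L = 2 ^ L" using p1 ag1 u static_tables(2)[OF st1, of L] by (auto simp: agrees_def i_def)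
  let ?s2 = "s1\<lparr>wreg := (wreg s1)(75 := 2 ^ L, 83 := 0)\<rparr>"
  have f: "wp W (fill 5 (WReg 0)) (\<lambda>t s'. (\<forall>x. warr s' 5 x = (if x < n then 0 else warr ?s2 5 x)) \<and> t \<le> 40 * n + 20) ?s2"
   by (rule fill) (use st1 W_small(12,14) in auto)
  have "wp W (fill 5 (WReg 0)) (\<lambda>t2. wp W (SetW 70 (WConst 1)) (\<lambda>t3. wp W (While (WReg 70 [\<le>] WReg 6) ?c)
   (\<lambda>t4 s'. (\<forall>v<n. decode_distance (warr s' 5 v) (rarr s' 1 v) = Dst s u v \<beta>) \<and>
     t1 + (20 + (t2 + (t3 + t4))) \<le> 1200 * L * (L + 2) * (n + 2 * m)))) ?s2"
  proof (rule wp_call[OF f])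
   fix t2 s2 assume p2: "(\<forall>x. warr s2 5 x = (if x < n then 0 else warr ?s2 5 x)) \<and> t2 \<le> 40 * n + 20"
    and ag2: "agrees (fill 5 (WReg 0)) ?s2 s2"
   let ?s3 = "s2\<lparr>wreg := (wreg s2)(70 := 1)\<rparr>"
   have "inv ?s2 l" using I1(1) by (simp add: inv_def cls_ok_def)
   from inv_agrees[OF this ag2] have "inv s2 l" "lab s2 = lab ?s2" by simp_all
   then have I3: "inv ?s3 l" "lab ?s3 = lab s" using I1(2) by (auto simp: inv_def cls_ok_def lab_def fun_eq_iff)
   have r3: "wreg ?s3 50 = i" "wreg ?s3 75 = 2 ^ L" "wreg ?s3 3 = u" "wreg ?s3 70 = 1"
    using ag2 r1 by (auto simp: agrees_def)
   have z3: "\<forall>v<n. warr ?s3 5 v = 0" using p2 by simp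
   show "wp W (SetW 70 (WConst 1)) (\<lambda>t3. wp W (While (WReg 70 [\<le>] WReg 6) ?c)
   (\<lambda>t4 s'. (\<forall>v<n. decode_distance (warr s' 5 v) (rarr s' 1 v) = Dst s u v \<beta>) \<and>
     t1 + (20 + (t2 + (t3 + t4))) \<le> 1200 * L * (L + 2) * (n + 2 * m))) s2"
    using W_small(14)
    apply simp
    apply (rule wp_call[OF loop[OF I3 r3 z3]])
    using p1 p2 K by auto
  qed
  then show "wp W (SetW 75 (WCell 7 (WReg 6)) ;; SetW 83 (WConst 0) ;; fill 5 (WReg 0) ;; SetW 70 (WConst 1) ;;
    While (WReg 70 [\<le>] WReg 6) ?c)
   (\<lambda>t2 s'. (\<forall>v<n. decode_distance (warr s' 5 v) (rarr s' 1 v) = Dst s u v \<beta>) \<and>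
    t1 + t2 \<le> 1200 * L * (L + 2) * (n + 2 * m)) s1"
   using r1 st1 W_small(14)
   apply simp
   apply (erule wp_call)
   apply (subst wp_Seq)
   apply (erule wp_call)
   apply (erule wp_call)
   apply auto
   done
 qed
qed

end

section \<open>Initialisation\<close>

definition init_powers :: com where
 "init_powers = SetW 6 (WConst 0) ;; PutW 7 (WConst 0) (WConst 1) ;;
  While (WCell 7 (WReg 6) [<] WReg 0)
   (PutW 7 (WReg 6 [+] WConst 1) (WConst 2 [*] WCell 7 (WReg 6)) ;; SetW 6 (WReg 6 [+] WConst 1))"

definition init_scales :: com where
 "init_scales = PutR 2 (WConst 0) (RReg 2) ;; SetW 7 (WConst 1) ;;
  While (RWord (WConst 4) {*} RCell 2 (WReg 7 [-] WConst 1) {\<le>} RReg 1)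
   (PutR 2 (WReg 7) (RWord (WConst 2) {*} RCell 2 (WReg 7 [-] WConst 1)) ;; SetW 7 (WReg 7 [+] WConst 1))"

definition init_hubs :: com where
 "init_hubs = SetW 84 (WReg 0) ;;
  While (WReg 84 [<] (WReg 6 [+] WConst 1) [*] WReg 0)
   (Cond (WConst 0 [<] WCell 4 (WReg 84))
     (SetW 85 (WReg 84 [div] WReg 0) ;;
     PutW 9 (WReg 85 [*] WReg 0 [+] WCell 8 (WReg 85)) (WReg 84) ;;
     PutW 8 (WReg 85) (WCell 8 (WReg 85) [+] WConst 1))
     Skip ;;
    SetW 84 (WReg 84 [+] WConst 1))"

definition init_arcs :: com where
 "init_arcs = SetW 84 (WConst 0) ;;
  While (WReg 84 [<] WReg 1)
   (PutW 10 (WReg 84) (WCell 0 (WReg 84)) ;; PutW 11 (WReg 84) (WCell 1 (WReg 84)) ;;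
    PutW 10 (WReg 1 [+] WReg 84) (WReg 0 [+] WCell 1 (WReg 84)) ;;
    PutW 11 (WReg 1 [+] WReg 84) (WReg 0 [+] WCell 0 (WReg 84)) ;;
    SetW 84 (WReg 84 [+] WConst 1))"

definition init_lists :: com where
 "init_lists = SetW 84 (WConst 0) ;;
  While (WReg 84 [<] WConst 2 [*] WReg 1)
   (PutW 13 (WReg 84) (WCell 12 (WCell 11 (WReg 84))) ;; PutW 12 (WCell 11 (WReg 84)) (WReg 84 [+] WConst 1) ;;
    PutW 15 (WReg 84) (WCell 14 (WCell 10 (WReg 84))) ;; PutW 14 (WCell 10 (WReg 84)) (WReg 84 [+] WConst 1) ;;
    SetW 84 (WReg 84 [+] WConst 1))"

definition push_all :: com where
 "push_all = SetW 34 (WConst 0) ;;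
  While (WReg 34 [<] WConst 2 [*] WReg 0) (PutW 16 (WReg 34) (WReg 34) ;; SetW 34 (WReg 34 [+] WConst 1))"

definition grow :: com where
 "grow = push_all ;; es_run"

text \<open>The trees are enumerated by \<open>r = i * ((L + 1) * n) + q\<close>.\<close>

definition init_trees :: com where
 "init_trees = SetW 84 (WConst 0) ;;
  While (WReg 84 [<] WReg 7 [*] ((WReg 6 [+] WConst 1) [*] WReg 0))
   (SetW 85 (WReg 84 [mod] ((WReg 6 [+] WConst 1) [*] WReg 0)) ;;
    Cond (BAnd (WReg 0 [\<le>] WReg 85) (WConst 0 [<] WCell 4 (WReg 85)))
     (SetW 86 (WReg 84 [div] ((WReg 6 [+] WConst 1) [*] WReg 0)) ;;
     SetW 87 (WReg 85 [div] WReg 0) ;;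
     SetW 30 (WReg 84 [*] (WConst 2 [*] WReg 0)) ;;
     SetW 31 ((WReg 86 [*] (WReg 6 [+] WConst 1) [+] WReg 87) [*] (WConst 2 [*] WReg 1)) ;;
     SetW 32 (WReg 8 [*] WCell 7 (WReg 87)) ;;
     SetW 33 (WReg 85 [mod] WReg 0) ;;
     grow)
     Skip ;;
    SetW 84 (WReg 84 [+] WConst 1))"

text \<open>The trees are grown for lengths 0, and the given lengths are then fed in like increases;
  the same potential covers them.\<close>

definition init_lengths :: com where
 "init_lengths = SetW 84 (WConst 0) ;;
  While (WReg 84 [<] WReg 1) (SetW 40 (WReg 84) ;; upd ;; SetW 84 (WReg 84 [+] WConst 1))"

definition init_tables :: com where
 "init_tables = init_powers ;; SetW 8 (WFloor (RWord (WConst 4) {/} RReg 0) [+] WConst 2) ;; init_scales ;; init_hubs ;;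
  init_arcs ;; init_lists"

text \<open>The data structure runs with error parameter \<open>\<delta> / 2\<close>: the truncation at \<open>Bd\<close> costs a second error term.\<close>

definition init :: com where
 "init = SetR 0 (RReg 0 {/} RWord (WConst 2)) ;; init_tables ;; init_trees ;; init_lengths"

lemma mods_init [simp]:
 "mw init_powers = {6}" "mr init_powers = {}" "ma init_powers = {7}" "mb init_powers = {}"
 "mw init_scales = {7}" "mr init_scales = {}" "ma init_scales = {}" "mb init_scales = {2}"
 "mw init_hubs = {84, 85}" "mr init_hubs = {}" "ma init_hubs = {8, 9}" "mb init_hubs = {}"
 "mw init_arcs = {84}" "mr init_arcs = {}" "ma init_arcs = {10, 11}" "mb init_arcs = {}"
 "mw init_lists = {84}" "mr init_lists = {}" "ma init_lists = {12, 13, 14, 15}" "mb init_lists = {}"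
 "mw push_all = {34}" "mr push_all = {}" "ma push_all = {16}" "mb push_all = {}"
 "mr init_trees = {}" "ma init_trees = {16, 18, 19}" "mb init_trees = {}"
 by (auto simp: init_powers_def init_scales_def init_hubs_def init_arcs_def init_lists_def push_all_def init_trees_def grow_def)

lemma mods_grow [simp]: "mw grow = {34, 35, 36, 37}" "mr grow = {}" "ma grow = {16, 18, 19}" "mb grow = {}"
 by (auto simp: grow_def)

lemma mods_init_tables [simp]:
 "mw init_tables = {6, 7, 8, 84, 85}" "mr init_tables = {}" "ma init_tables = {7, 8, 9, 10, 11, 12, 13, 14, 15}" "mb init_tables = {2}"
 by (auto simp: init_tables_def)

lemma mods_init_lengths [simp]: "mr init_lengths = {}" "mb init_lengths = {}"
 by (auto simp: init_lengths_def)

lemma wpE: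
 assumes "wp W c Q s"
 obtains t s' where "exec W c s t s'" "Q t s'" "agrees c s s'"
 using assms exec_agrees unfolding wp_def by blast

lemma mw_init_trees [simp]: "mw init_trees = {30, 31, 32, 33, 34, 35, 36, 37, 84, 85, 86, 87}"
 by (auto simp: init_trees_def)

context machine_setup
begin

lemma init_powers:
 assumes n: "wreg s 0 = n" and L': "2 ^ (L - 1) < n"
 shows "wp W init_powers (\<lambda>t s'. wreg s' 6 = L \<and> (\<forall>j\<le>L. warr s' 7 j = 2 ^ j) \<and> t \<le> 40 * L + 30) s"
 unfolding init_powers_def using W_small(14) P_bounds
 apply simp
 apply (rule wp_while[where I = "\<lambda>s'. wreg s' 6 \<le> L \<and> (\<forall>j\<le>wreg s' 6. warr s' 7 j = 2 ^ j)" and F = "\<lambda>s'. 40 * (L - wreg s' 6)"])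
 subgoal by simp
 subgoal premises prems for s'
 proof -
  have n': "wreg s' 0 = n" using prems n by (auto simp: agrees_def)
  define k where "k = wreg s' 6"
  have w: "warr s' 7 k = 2 ^ k" "k \<le> L" using prems by (auto simp: k_def)
  show ?thesis
  proof (cases "2 ^ k < n")
   case True
   have "k \<noteq> L" using True nL by auto
   then have kL: "k < L" using w by simp
   then have "(2::nat) * 2 ^ k \<le> 2 ^ L" using power_increasing[of "Suc k" L "2::nat"] by simp
   then have "2 * 2 ^ k < W" "k + 1 < W" using P_bounds W_small(11) kL by linarith+
   moreover have "(2::nat) ^ (k + 1) = 2 * 2 ^ k" by (simp add: power_add)
   moreover have "j \<le> k + 1 \<longleftrightarrow> j \<le> k \<or> j = k + 1" for j by auto
   ultimately show ?thesis using n' w True kL prems W_small(14) P_bounds by (auto simp: k_def[symmetric])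
  qed (use n' w in \<open>simp add: k_def[symmetric]\<close>)
 qed
 subgoal premises prems for t s'
 proof -
  have n': "wreg s' 0 = n" using prems n by (auto simp: agrees_def)
  have w: "warr s' 7 (wreg s' 6) = 2 ^ wreg s' 6" "wreg s' 6 \<le> L" using prems by auto
  then have "\<not> 2 ^ wreg s' 6 < n" using prems n' w by simp
  moreover have "(2::nat) ^ wreg s' 6 \<le> 2 ^ (L - 1)" if "wreg s' 6 < L" using that by (intro power_increasing) auto
  ultimately have "\<not> wreg s' 6 < L" using L' by (meson le_less_trans)
  then have "wreg s' 6 = L" using w(2) by simp
  then show ?thesis using prems by simp
 qed
 done

lemma init_scales:
 assumes r: "rreg s 1 = Mmax" "rreg s 2 = Mmin" and M: "2 ^ NI * Mmin \<le> Mmax" "Mmax < 2 ^ (NI + 1) * Mmin"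
 shows "wp W init_scales (\<lambda>t s'. wreg s' 7 = NI \<and> (\<forall>i<NI. rarr s' 2 i = beta i) \<and> t \<le> 40 * NI + 30) s"
 unfolding init_scales_def using P_bounds
 apply simp
 apply (rule wp_while[where I = "\<lambda>s'. 1 \<le> wreg s' 7 \<and> wreg s' 7 \<le> NI \<and> (\<forall>i<wreg s' 7. rarr s' 2 i = beta i)" and F = "\<lambda>s'. 40 * (NI - wreg s' 7)"])
 subgoal using NI1 r(2) by (simp add: beta_def)
 subgoal premises prems for s'
 proof -
  have r': "rreg s' 1 = Mmax" using prems r by (auto simp: agrees_def)
  obtain k where k: "wreg s' 7 = Suc k" using prems by (cases "wreg s' 7") auto
  have w: "rarr s' 2 k = beta k" "Suc k \<le> NI" using prems k by auto
  have kW: "k < W" "Suc k < W" "4 < W" using w W_small(1,8) by simp_all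
  have b: "2 * beta k = beta (Suc k)" by (simp add: beta_def)
  show ?thesis
  proof (cases "4 * beta k \<le> Mmax")
   case True
   have "Suc k \<noteq> NI"
   proof
    assume "Suc k = NI"
    then have "4 * beta k = 2 ^ (NI + 1) * Mmin" by (auto simp: beta_def power_add)
    with M True show False by simp
   qed
   then have kN: "Suc k + 1 \<le> NI" using w by simp
   then have kW2: "Suc k + 1 < W" using W_small(8) by simp
   have ext: "i < Suc k + 1 \<longleftrightarrow> i < Suc k \<or> i = Suc k" for i by auto
   have "40 * (NI - (Suc k + 1)) + 40 \<le> 40 * (NI - Suc k)" using kN by simp
   then show ?thesis using k kW kW2 kN w True r' prems P_bounds b ext by (auto simp: not_less)
  qed (use k kW w r' P_bounds in simp)
 qed
 subgoal premises prems for t s'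
 proof -
  have r': "rreg s' 1 = Mmax" using prems r by (auto simp: agrees_def)
  obtain k where k: "wreg s' 7 = Suc k" using prems by (cases "wreg s' 7") auto
  have w: "rarr s' 2 k = beta k" "Suc k \<le> NI" using prems k by auto
  have kW: "k < W" "4 < W" using w W_small(1,8) by simp_all
  have "\<not> 4 * beta k \<le> Mmax" using prems k kW w r' P_bounds by simp
  moreover have "4 * beta k \<le> Mmax" if "Suc k < NI"
  proof -
   have "4 * beta k = beta (Suc (Suc k))" by (simp add: beta_def)
   also have "\<dots> \<le> beta NI" using that by (intro beta_mono) simp
   finally show ?thesis using M by (simp add: beta_def)
  qed
  ultimately have "Suc k = NI" using w by (cases "Suc k < NI") auto
  then show ?thesis using prems k by simp
 qed
 done

text \<open>\<open>Hq k j\<close> are the hubs of level \<open>j\<close> with code below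
  \<open>k\<close>. A level has at most \<open>n\<close> hubs, so rows of length \<open>n\<close> in
  array 9 do not run into each other.\<close>

lemma init_hubs:
 assumes r: "wreg s 0 = n" "wreg s 6 = L" and S4: "\<And>q. q \<in> {n..<Suc L * n} \<Longrightarrow> warr s 4 q = (if q \<in> S then 1 else 0)"
  and z: "\<And>j. warr s 8 j = 0"
 shows "wp W init_hubs (\<lambda>t s'. (\<forall>j\<in>{1..L}. warr s' 8 j = card (H j) \<and> (\<lambda>r. warr s' 9 (j * n + r)) ` {..<card (H j)} = H j) \<and>
  t \<le> 80 * (n * L) + 30) s"
proof -
 let ?b = "WReg 84 [<] (WReg 6 [+] WConst 1) [*] WReg 0"
 let ?c = "Cond (WConst 0 [<] WCell 4 (WReg 84))
     (SetW 85 (WReg 84 [div] WReg 0) ;;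
     PutW 9 (WReg 85 [*] WReg 0 [+] WCell 8 (WReg 85)) (WReg 84) ;;
     PutW 8 (WReg 85) (WCell 8 (WReg 85) [+] WConst 1))
     Skip ;;
    SetW 84 (WReg 84 [+] WConst 1)"
 define Hq where "Hq = (\<lambda>k j. {q \<in> H j. q < k})"
 define J where "J = (\<lambda>a b k. \<forall>j\<in>{1..L}. a j = card (Hq k j) \<and> (\<lambda>r. b (j * n + r)) ` {..<card (Hq k j)} = Hq k j)"
 let ?s = "s\<lparr>wreg := (wreg s)(84 := n)\<rparr>"
 have finH: "finite (Hq k j)" for k j using finite_H by (simp add: Hq_def)
 have loop: "wp W (While ?b ?c) (\<lambda>t s'. J (warr s' 8) (warr s' 9) (Suc L * n) \<and> t \<le> 80 * (n * L) + 15) ?s"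
 proof (rule wp_while[where I = "\<lambda>s'. wreg s' 84 \<in> {n..Suc L * n} \<and> J (warr s' 8) (warr s' 9) (wreg s' 84)" and F = "\<lambda>s'. 80 * (Suc L * n - wreg s' 84)"])
  have "Hq n j = {}" for j using S_sub by (auto simp: Hq_def H_def)
  then show "wreg ?s 84 \<in> {n..Suc L * n} \<and> J (warr ?s 8) (warr ?s 9) (wreg ?s 84)" using z by (simp add: J_def)
  fix s' assume I: "wreg s' 84 \<in> {n..Suc L * n} \<and> J (warr s' 8) (warr s' 9) (wreg s' 84)" and ag: "agrees ?c ?s s'"
  have rr: "wreg s' 0 = n" "wreg s' 6 = L" "warr s' 4 = warr s 4" using ag r by (auto simp: agrees_def)
  define q where "q = wreg s' 84"
  show "eval_bool W s' ?b \<noteq> None \<and> (eval_bool W s' ?b = Some True \<longrightarrow> wp W ?c (\<lambda>t s''.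
   (wreg s'' 84 \<in> {n..Suc L * n} \<and> J (warr s'' 8) (warr s'' 9) (wreg s'' 84)) \<and>
   1 + cost_bool ?b + t + 80 * (Suc L * n - wreg s'' 84) \<le> 80 * (Suc L * n - wreg s' 84)) s')"
  proof (cases "q < Suc L * n")
   case True
   have q: "n \<le> q" using I by (simp add: q_def)
   have qW: "q + 1 < W" "q < W" using True W_small(5) by simp_all
   have S4': "warr s' 4 q = (if q \<in> S then 1 else 0)" using S4[of q] q True rr by simp
   have eq: "80 * (Suc L * n - q) = 80 * (Suc L * n - (q + 1)) + 80" using True by simp
   have lt: "x < q + 1 \<longleftrightarrow> x < q \<or> x = q" for x by auto
   have JJ: "J (warr s' 8) (warr s' 9) q" using I by (simp add: q_def)
   show ?thesis
   proof (cases "q \<in> S")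
    case False
    then have "Hq (q + 1) j = Hq q j" for j using False by (auto simp: Hq_def H_def lt)
    then have "J (warr s' 8) (warr s' 9) (q + 1)" using JJ by (simp add: J_def)
    then show ?thesis using False S4' rr qW True q eq W_small(5,11,12,14)
     by (simp add: q_def[symmetric] Suc_eq_plus1[of L, symmetric] del: mult_Suc)
   next
    case qS: True
    define j where "j = q div n"
    note qb = S_bounds[OF qS, folded j_def]
    have jL: "j \<in> {1..L}" using qb by simp
    define k where "k = card (Hq q j)"
    have kw: "warr s' 8 j = k" using JJ jL by (simp add: J_def k_def)
    have qH: "q \<in> H j" using qS by (simp add: H_def j_def)
    have Hn: "Hq (q + 1) j = insert q (Hq q j)" using qH by (auto simp: Hq_def lt)
    have qn: "q \<notin> Hq q j" by (simp add: Hq_def)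
    have ck: "card (Hq (q + 1) j) = k + 1" using Hn qn finH by (simp add: k_def)
    have "card (Hq (q + 1) j) \<le> card (H j)" using finite_H by (intro card_mono) (auto simp: Hq_def)
    then have kn: "k < n" using ck card_H[of j] by simp
    have "j * n \<le> L * n" using qb(3) by (rule mult_le_mono1)
    then have jk: "j * n + k < W" "j * n < W" "j < W" "k + 1 < W" using kn W_small(5,9,12) qb(3) unfolding mult_Suc by linarith+
    have Ho: "Hq (q + 1) j' = Hq q j'" if "j' \<noteq> j" for j' using that by (auto simp: Hq_def H_def lt j_def)
    have blk: "j' * n + r = j * n + k \<longleftrightarrow> j' = j \<and> r = k" if "r < n" for j' r by (rule block_eq[OF that kn])
    have "J ((warr s' 8)(j := k + 1)) ((warr s' 9)(j * n + k := q)) (q + 1)"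
     unfolding J_def
    proof
     fix j' assume j': "j' \<in> {1..L}"
     have old: "warr s' 8 j' = card (Hq q j')" "(\<lambda>r. warr s' 9 (j' * n + r)) ` {..<card (Hq q j')} = Hq q j'"
      using JJ j' by (auto simp: J_def)
     have cn: "card (Hq q j') \<le> n"
     proof -
      have "card (Hq q j') \<le> card (H j')" using finite_H by (intro card_mono) (auto simp: Hq_def)
      then show ?thesis using card_H[of j'] by simp
     qed
     show "((warr s' 8)(j := k + 1)) j' = card (Hq (q + 1) j') \<and>
      (\<lambda>r. ((warr s' 9)(j * n + k := q)) (j' * n + r)) ` {..<card (Hq (q + 1) j')} = Hq (q + 1) j'"
     proof (cases "j' = j")
      case True
      have "(\<lambda>r. ((warr s' 9)(j * n + k := q)) (j * n + r)) ` {..<k} = (\<lambda>r. warr s' 9 (j * n + r)) ` {..<k}"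
       by (rule image_cong) auto
      also have "\<dots> = Hq q j" using old True by (simp add: k_def)
      finally have im: "(\<lambda>r. ((warr s' 9)(j * n + k := q)) (j * n + r)) ` {..<k} = Hq q j" .
      have "{..<k + 1} = insert k {..<k}" by auto
      then have "(\<lambda>r. ((warr s' 9)(j * n + k := q)) (j * n + r)) ` {..<k + 1} = insert q (Hq q j)"
       by (simp only: image_insert im fun_upd_same)
      then show ?thesis using True ck Hn by simp
     next
      case False
      have "(\<lambda>r. ((warr s' 9)(j * n + k := q)) (j' * n + r)) ` {..<card (Hq q j')} = (\<lambda>r. warr s' 9 (j' * n + r)) ` {..<card (Hq q j')}"
       by (rule image_cong) (use blk cn False in auto)
      then show ?thesis using False Ho[OF False] old by simp
     qed
    qed
    then show ?thesis using qS S4' rr qW True q eq jk kw W_small(5,11,12,14)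
     by (simp add: q_def[symmetric] j_def[symmetric] Suc_eq_plus1[of L, symmetric] del: mult_Suc)
   qed
  next
   case False
   then show ?thesis using rr W_small(5,11,14) by (simp add: q_def Suc_eq_plus1[of L, symmetric] del: mult_Suc)
  qed
 next
  fix t s' assume I: "wreg s' 84 \<in> {n..Suc L * n} \<and> J (warr s' 8) (warr s' 9) (wreg s' 84)" and ag: "agrees ?c ?s s'"
   and ev: "eval_bool W s' ?b = Some False"
   and t: "t + 80 * (Suc L * n - wreg s' 84) \<le> 80 * (Suc L * n - wreg ?s 84) + 1 + cost_bool ?b"
  have rr: "wreg s' 0 = n" "wreg s' 6 = L" using ag r by (auto simp: agrees_def)
  have "wreg s' 84 = Suc L * n" using ev rr W_small(5,11,14) I by (simp add: Suc_eq_plus1[of L, symmetric] del: mult_Suc)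
  moreover have "Suc L * n - n = n * L" by simp
  ultimately show "J (warr s' 8) (warr s' 9) (Suc L * n) \<and> t \<le> 80 * (n * L) + 15" using I t by (simp add: mult.commute[of n L])
 qed
 have "Hq (Suc L * n) j = H j" for j using S_bounds(1) H_S by (auto simp: Hq_def simp del: mult_Suc)
 then show ?thesis
  unfolding init_hubs_def using r
  apply simp
  apply (rule wp_call[OF loop])
  apply (simp add: J_def)
  done
qed

lemma init_arcs:
 assumes r: "wreg s 0 = n" "wreg s 1 = m" and e: "\<And>e. e < m \<Longrightarrow> warr s 0 e = ta e \<and> warr s 1 e = he e"
 shows "wp W init_arcs (\<lambda>t s'. (\<forall>a<2 * m. warr s' 10 a = TL a \<and> warr s' 11 a = HD a) \<and> t \<le> 80 * m + 20) s"
 unfolding init_arcs_def using W_small(14)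
 apply simp
 apply (rule wp_while[where I = "\<lambda>s'. wreg s' 84 \<le> m \<and> (\<forall>e<wreg s' 84. warr s' 10 e = ta e \<and> warr s' 11 e = he e \<and>
   warr s' 10 (m + e) = n + he e \<and> warr s' 11 (m + e) = n + ta e)" and F = "\<lambda>s'. 80 * (m - wreg s' 84)"])
 subgoal by simp
 subgoal premises prems for s'
 proof -
  have rr: "wreg s' 0 = n" "wreg s' 1 = m" "warr s' 0 = warr s 0" "warr s' 1 = warr s 1" using prems r by (auto simp: agrees_def)
  define k where "k = wreg s' 84"
  show ?thesis
  proof (cases "k < m")
   case True
   have lt: "x < k + 1 \<longleftrightarrow> x < k \<or> x = k" for x by auto
   have kW: "k + 1 < W" "m + k < W" "n + he k < W" "n + ta k < W"
    using True W_small(6,7,13) ta_less[OF True] he_less[OF True] by simp_all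
   show ?thesis using rr True kW e[OF True] prems(2) W_small(14) by (auto simp: k_def[symmetric] lt)
  qed (use rr in \<open>simp add: k_def\<close>)
 qed
 subgoal premises prems for t s'
 proof -
  have rr: "wreg s' 1 = m" using prems r by (auto simp: agrees_def)
  then have k: "wreg s' 84 = m" using prems by simp
  have "warr s' 10 a = TL a \<and> warr s' 11 a = HD a" if "a < 2 * m" for a
  proof (cases "a < m")
   case True then show ?thesis using prems(2) k by (simp add: TL_def HD_def)
  next
   case False
   then obtain e where "a = m + e" using le_Suc_ex not_less by blast
   then show ?thesis using prems(2) k that by (simp add: TL_def HD_def)
  qed
  then show ?thesis using prems k by simp
 qed
 done

text \<open>Arcs are inserted in increasing order, so the head of the list found when
  \<open>a\<close> is inserted is \<open>prv h v a\<close>, exactly the successor that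
  \<open>adj\<close> demands.\<close>

lemma init_lists:
 assumes r: "wreg s 1 = m" and e: "\<And>a. a < 2 * m \<Longrightarrow> warr s 10 a = TL a \<and> warr s 11 a = HD a"
  and z: "\<And>x. warr s 12 x = 0" "\<And>x. warr s 14 x = 0"
 shows "wp W init_lists (\<lambda>t s'. (\<forall>v. warr s' 12 v = prv HD v (2 * m)) \<and> (\<forall>a<2 * m. warr s' 13 a = prv HD (HD a) a) \<and>
  (\<forall>v. warr s' 14 v = prv TL v (2 * m)) \<and> (\<forall>a<2 * m. warr s' 15 a = prv TL (TL a) a) \<and> t \<le> 120 * m + 20) s"
 unfolding init_lists_def using W_small(14)
 apply simp
 apply (rule wp_while[where I = "\<lambda>s'. wreg s' 84 \<le> 2 * m \<and> (\<forall>v. warr s' 12 v = prv HD v (wreg s' 84)) \<and> (\<forall>a<wreg s' 84. warr s' 13 a = prv HD (HD a) a) \<and>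
  (\<forall>v. warr s' 14 v = prv TL v (wreg s' 84)) \<and> (\<forall>a<wreg s' 84. warr s' 15 a = prv TL (TL a) a)" and F = "\<lambda>s'. 60 * (2 * m - wreg s' 84)"])
 subgoal using z by simp
 subgoal premises prems for s'
 proof -
  have rr: "wreg s' 1 = m" "warr s' 10 = warr s 10" "warr s' 11 = warr s 11" using prems r by (auto simp: agrees_def)
  define k where "k = wreg s' 84"
  show ?thesis
  proof (cases "k < 2 * m")
   case True
   have lt: "x < k + 1 \<longleftrightarrow> x < k \<or> x = k" for x by auto
   have pS: "prv h v (k + 1) = (if h k = v then k + 1 else prv h v k)" for h v by (simp add: Suc_eq_plus1[symmetric] del: Suc_eq_plus1)
   have kW: "k + 1 < W" "2 * m < W" "2 < W" using True W_small(6) P_bounds by simp_all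
   show ?thesis using rr True kW e[OF True] prems(2) W_small(14)
    by (auto simp: k_def[symmetric] lt pS)
  qed (use rr W_small(6) P_bounds in \<open>simp add: k_def\<close>)
 qed
 subgoal premises prems for t s'
 proof -
  have rr: "wreg s' 1 = m" using prems r by (auto simp: agrees_def)
  then have "wreg s' 84 = 2 * m" using prems W_small(6) P_bounds by simp
  then show ?thesis using prems by simp
 qed
 done

lemma push_all:
 assumes r: "wreg s 0 = n"
 shows "wp W push_all (\<lambda>t s'. wreg s' 34 = 2 * n \<and> (\<forall>x<2 * n. warr s' 16 x = x) \<and> t \<le> 26 * n + 30) s"
 unfolding push_all_def using W_small(14)
 apply simp
 apply (rule wp_while[where I = "\<lambda>s'. wreg s' 34 \<le> 2 * n \<and> (\<forall>x<wreg s' 34. warr s' 16 x = x)" and F = "\<lambda>s'. 13 * (2 * n - wreg s' 34)"])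
 subgoal by simp
 subgoal premises prems for s'
 proof -
  have rr: "wreg s' 0 = n" using prems r by (auto simp: agrees_def)
  define k where "k = wreg s' 34"
  show ?thesis
  proof (cases "k < 2 * n")
   case True
   have lt: "x < k + 1 \<longleftrightarrow> x < k \<or> x = k" for x by auto
   have kW: "k + 1 < W" "2 * n < W" "2 < W" using True W_small(7) P_bounds by simp_all
   show ?thesis using rr True kW prems(2) W_small(14) by (auto simp: k_def[symmetric] lt)
  qed (use rr W_small(7) P_bounds in \<open>simp add: k_def\<close>)
 qed
 subgoal premises prems for t s'
 proof -
  have rr: "wreg s' 0 = n" using prems r by (auto simp: agrees_def)
  then have "wreg s' 34 = 2 * n" using prems W_small(7) P_bounds by simp
  then show ?thesis using prems by simp
 qed
 done

lemma tree_cong: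
 assumes "tree s i q K" "warr s' 17 = warr s 17"
  and "\<And>x. x < 2 * n \<Longrightarrow> warr s' 18 (vb i q + x) = warr s 18 (vb i q + x) \<and> warr s' 19 (vb i q + x) = warr s 19 (vb i q + x)"
 shows "tree s' i q K"
 using assms(1) unfolding tree_def assms(2) by (rule es_inv_cong) (use assms(3) in \<open>auto simp: sl_def\<close>)

text \<open>A fresh tree starts with all \<open>2 * n\<close> vertices on the stack: 200 per vertex
  of the graph for their steps and 26 for pushing the two copies.\<close>

lemma grow:
 assumes st: "static s" and i: "i < NI" and q: "q \<in> S" "j = q div n"
  and r: "wreg s 30 = vb i q" "wreg s 31 = cb i j" "wreg s 32 = Bd j" "wreg s 33 = q mod n"
  and c: "\<And>a. warr s 17 a = 0"
  and z: "\<And>x. x < 2 * n \<Longrightarrow> warr s 18 (vb i q + x) = 0 \<and> warr s 19 (vb i q + x) = 0"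
 shows "wp W grow (\<lambda>t s'. tree s' i q {} \<and>
  (\<forall>i'<NI. \<forall>q'\<in>S. (i', q') \<noteq> (i, q) \<longrightarrow> (\<forall>x<2 * n. warr s' 18 (vb i' q' + x) = warr s 18 (vb i' q' + x) \<and>
    warr s' 19 (vb i' q' + x) = warr s 19 (vb i' q' + x))) \<and> t + treepot s' \<le> treepot s + 226 * n + 50) s"
proof -
 note qb = S_bounds[OF q(1)]
 have r0: "wreg s 0 = n" using st by simp
 obtain t1 s1 where e1: "exec W push_all s t1 s1" and p: "wreg s1 34 = 2 * n \<and> (\<forall>x<2 * n. warr s1 16 x = x) \<and> t1 \<le> 26 * n + 30"
  and ag: "agrees push_all s s1" by (rule wpE[OF push_all[OF r0]])
 have same: "wreg s1 30 = vb i q" "wreg s1 31 = cb i j" "wreg s1 32 = Bd j" "wreg s1 33 = q mod n"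
  "warr s1 17 = warr s 17" "warr s1 18 = warr s 18" "warr s1 19 = warr s 19" using ag r by (auto simp: agrees_def)
 have adj: "adj s1" by (rule static_adj(1)[OF static_agrees[OF st ag]]) auto
 have "stack (warr s1 16) (wreg s1 34) = (\<lambda>x. x) ` {..<2 * n}" unfolding stack_def using p by (intro image_cong) auto
 then have stk: "stack (warr s1 16) (wreg s1 34) = {..<2 * n}" by simp
 have pot0: "pot (Bd j) (sl (warr s1 18) (vb i q)) (sl (warr s1 19) (vb i q)) = (Bd j + 1) * (200 * n + 300 * (2 * m))"
  unfolding pot_start[symmetric] by (rule pot_cong) (use z same in \<open>auto simp: sl_def\<close>)
 have jL: "j \<le> L" using qb q by simp
 obtain t2 s' where e2: "exec W es_run s1 t2 s'" and post: "es_inv (q mod n) (Bd j) (sl (warr s1 17) (cb i j)) (sl (warr s' 18) (vb i q)) (sl (warr s' 19) (vb i q)) {} \<and>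
  (\<forall>x. x \<notin> {vb i q..<vb i q + 2*n} \<longrightarrow> warr s' 18 x = warr s1 18 x \<and> warr s' 19 x = warr s1 19 x) \<and>
  t2 + pot (Bd j) (sl (warr s' 18) (vb i q)) (sl (warr s' 19) (vb i q)) \<le>
   pot (Bd j) (sl (warr s1 18) (vb i q)) (sl (warr s1 19) (vb i q)) + 100 * wreg s1 34 + 10" and ag2: "agrees es_run s1 s'"
 proof (rule wpE[OF es_run[OF adj same(1-4)]])
  show "warr s1 17 (cb i j + a) \<le> Bd j" for a using c same by simp
  show "es_inv (q mod n) (Bd j) (sl (warr s1 17) (cb i j)) (sl (warr s1 18) (vb i q)) (sl (warr s1 19) (vb i q)) (stack (warr s1 16) (wreg s1 34))"
   unfolding stk by (rule es_inv_cong[OF es_inv_start]) (use z c same in \<open>auto simp: sl_def\<close>)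
  show "stack (warr s1 16) (wreg s1 34) \<subseteq> {..<2*n}" using stk by simp
  have "(Bd j + 1) * (200 * n + 300 * (2 * m)) + 200 * n \<le> (Bd L + 1) * (200 * n + 300 * (2 * m)) + (Bd L + 1) * (200 * n)"
   using Bd_mono[OF jL] mult_le_mono1[of 1 "Bd L + 1" "200 * n"] by (intro add_mono mult_le_mono1) auto
  also have "\<dots> \<le> (Bd L + 1) * (1000 * (n + m))" unfolding add_mult_distrib2[symmetric] by (intro mult_le_mono) auto
  also have "\<dots> < W" using W_B by (simp add: Bd_def)
  finally show "pot (Bd j) (sl (warr s1 18) (vb i q)) (sl (warr s1 19) (vb i q)) + 100 * wreg s1 34 < W"
   unfolding pot0 using p by simp
  show "vb i q + 2 * n < W" using vb_le[of i q] i qb by simp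
  show "cb i j + 2 * m < W" using cb_le jL i by auto
  show "2 * Bd j + 2 < W" using W_small(1) Bd_mono[OF jL] by auto
 qed
 have c': "warr s' 17 = warr s 17" using ag2 same by (simp add: agrees_def)
 have 1: "tree s' i q {}" using post c' same q by (simp add: tree_def)
 have keep: "warr s' 18 (vb i' q' + v) = warr s 18 (vb i' q' + v) \<and> warr s' 19 (vb i' q' + v) = warr s 19 (vb i' q' + v)"
  if "q' \<in> S" "(i', q') \<noteq> (i, q)" "v < 2 * n" for i' q' v
 proof -
  have "vb i' q' + v \<noteq> vb i q + v'" if "v' < 2 * n" for v'
   by (rule vb_disjoint) (use S_bounds(1) \<open>q' \<in> S\<close> q \<open>(i', q') \<noteq> (i, q)\<close> \<open>v < 2 * n\<close> that in auto)
  then have "vb i' q' + v \<notin> {vb i q..<vb i q + 2 * n}"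
   by (metis atLeastLessThan_iff le_add_diff_inverse nat_add_left_cancel_less)
  with post same show ?thesis by simp
 qed
 have keep': "sl (warr s' 18) (vb i' q') v = sl (warr s 18) (vb i' q') v \<and> sl (warr s' 19) (vb i' q') v = sl (warr s 19) (vb i' q') v"
  if "q' \<in> S" "(i', q') \<noteq> (i, q)" "v < 2 * n" for i' q' v
  using keep[OF that] by (simp add: sl_def)
 have ipot_keep: "ipot s' i' q' = ipot s i' q'" if "q' \<in> S" "(i', q') \<noteq> (i, q)" for i' q'
  unfolding ipot_def by (rule pot_cong) (use keep'[OF that] in blast)+
 have "(\<Sum>(i, q)\<in>{..<NI} \<times> S. ipot s' i q) + (case (i, q) of (i, q) \<Rightarrow> ipot s i q) =
  (\<Sum>(i, q)\<in>{..<NI} \<times> S. ipot s i q) + (case (i, q) of (i, q) \<Rightarrow> ipot s' i q)"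
 proof (rule sum_fun_upd)
  show "finite ({..<NI} \<times> S)" using finite_S by simp
  show "(i, q) \<in> {..<NI} \<times> S" using i q by simp
  fix y assume "y \<in> {..<NI} \<times> S" "y \<noteq> (i, q)"
  then show "(case y of (i, q) \<Rightarrow> ipot s' i q) = (case y of (i, q) \<Rightarrow> ipot s i q)"
   by (cases y) (simp add: ipot_keep)
 qed
 then have "treepot s' + ipot s i q = treepot s + ipot s' i q" by (simp add: treepot_def)
 moreover have "t2 + ipot s' i q \<le> ipot s i q + 200 * n + 10"
 proof -
  have "t2 + pot (Bd j) (sl (warr s' 18) (vb i q)) (sl (warr s' 19) (vb i q)) \<le>
   pot (Bd j) (sl (warr s1 18) (vb i q)) (sl (warr s1 19) (vb i q)) + 100 * wreg s1 34 + 10" using post by blast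
  moreover have "100 * wreg s1 34 = 200 * n" using p by simp
  ultimately show ?thesis unfolding ipot_def q(2)[symmetric] same by linarith
 qed
 moreover have "t1 \<le> 26 * n + 30" using p by blast
 ultimately have "t1 + t2 + treepot s' \<le> treepot s + 226 * n + 50" by linarith
 then show ?thesis unfolding wp_def grow_def
  by (intro exI[of _ "t1 + t2"] exI[of _ s'] conjI exec_Seq[OF e1 e2] 1) (use keep in auto)
qed

lemma init_trees:
 assumes st: "static s" and c: "\<And>a. warr s 17 a = 0" and z: "\<And>a. warr s 18 a = 0 \<and> warr s 19 a = 0"
 shows "wp W init_trees (\<lambda>t s'. trees_ok s' \<and>
  t + treepot s' \<le> treepot s + 120 * (NI * (Suc L * n)) + 300 * n * (NI * card S) + 40) s"
proof -
 define Q where "Q = Suc L * n"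
 define J where "J = (\<lambda>s' k. \<forall>i<NI. \<forall>q\<in>S. if i * Q + q < k then tree s' i q {}
  else \<forall>x<2 * n. warr s' 18 (vb i q + x) = 0 \<and> warr s' 19 (vb i q + x) = 0)"
 \<comment> \<open>The budget for the constant part of the trees that are still to be grown.\<close>
 define G where "G = (\<lambda>k. \<Sum>(i, q)\<in>{..<NI} \<times> S. if i * Q + q < k then 0 else 300 * n)"
 have QL: "(L + 1) * n = Q" by (simp add: Q_def algebra_simps)
 have Qp: "0 < Q" using n2 by (simp add: Q_def)
 have QW: "Q < W" using W_small(5) by (simp only: Q_def)
 have "NI * Q * 1 \<le> NI * Q * (2 * n)" using n2 by (intro mult_le_mono2) simp
 moreover have "NI * Q * (2 * n) + Q * (2 * n) = Suc NI * (Suc L * n) * (2 * n)" by (simp add: Q_def algebra_simps)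
 moreover have "0 < Q * (2 * n)" using Qp n2 by simp
 ultimately have RW: "NI * Q + 1 \<le> Suc NI * (Suc L * n) * (2 * n)" by linarith
 then have RW: "NI * Q + 1 < W" using W_vb by linarith
 let ?b = "WReg 84 [<] WReg 7 [*] ((WReg 6 [+] WConst 1) [*] WReg 0)"
 let ?c = "SetW 85 (WReg 84 [mod] ((WReg 6 [+] WConst 1) [*] WReg 0)) ;;
    Cond (BAnd (WReg 0 [\<le>] WReg 85) (WConst 0 [<] WCell 4 (WReg 85)))
     (SetW 86 (WReg 84 [div] ((WReg 6 [+] WConst 1) [*] WReg 0)) ;;
     SetW 87 (WReg 85 [div] WReg 0) ;;
     SetW 30 (WReg 84 [*] (WConst 2 [*] WReg 0)) ;;
     SetW 31 ((WReg 86 [*] (WReg 6 [+] WConst 1) [+] WReg 87) [*] (WConst 2 [*] WReg 1)) ;;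
     SetW 32 (WReg 8 [*] WCell 7 (WReg 87)) ;;
     SetW 33 (WReg 85 [mod] WReg 0) ;;
     grow)
     Skip ;;
    SetW 84 (WReg 84 [+] WConst 1)"
 let ?s = "s\<lparr>wreg := (wreg s)(84 := 0)\<rparr>"
 let ?F = "\<lambda>s'. 120 * (NI * Q - wreg s' 84) + G (wreg s' 84) + treepot s'"
 have st0: "static ?s" using st by simp
 have loop: "wp W (While ?b ?c) (\<lambda>t s'. trees_ok s' \<and> t + treepot s' \<le> treepot s + 120 * (NI * Q) + 300 * n * (NI * card S) + 30) ?s"
 proof (rule wp_while[where I = "\<lambda>s'. wreg s' 84 \<le> NI * Q \<and> J s' (wreg s' 84)" and F = ?F])
  show "wreg ?s 84 \<le> NI * Q \<and> J ?s (wreg ?s 84)" using z by (simp add: J_def)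
 next
  fix s' assume I: "wreg s' 84 \<le> NI * Q \<and> J s' (wreg s' 84)" and ag: "agrees ?c ?s s'"
  have st': "static s'" by (rule static_agrees[OF st0 ag]) auto
  have c': "warr s' 17 a = 0" for a using ag c by (simp add: agrees_def)
  define k where "k = wreg s' 84"
  have JJ: "J s' k" using I by (simp add: k_def)
  note W' = QW RW QL W_small(7,11,12,14) P_bounds(2)
  show "eval_bool W s' ?b \<noteq> None \<and> (eval_bool W s' ?b = Some True \<longrightarrow> wp W ?c (\<lambda>t s''.
   (wreg s'' 84 \<le> NI * Q \<and> J s'' (wreg s'' 84)) \<and> 1 + cost_bool ?b + t + ?F s'' \<le> ?F s') s')"
  proof (cases "k < NI * Q")
   case False
   then show ?thesis using st' W' by (simp add: k_def)
  next
   case True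
   define i q where "i = k div Q" and "q = k mod Q"
   have k: "i * Q + q = k" by (simp add: i_def q_def)
   have qQ: "q < Q" using Qp by (simp add: q_def)
   have iN: "i < NI" using True by (simp add: i_def less_mult_imp_div_less)
   have eq: "120 * (NI * Q - k) = 120 * (NI * Q - (k + 1)) + 120" using True by simp
   \<comment> \<open>Hub codes lie below \<open>Q\<close>, so division by \<open>Q\<close> recovers
     scale and hub from the counter.\<close>
   have uniq: "i' = i \<and> q' = q" if "i' * Q + q' = k" "q' \<in> S" for i' q'
   proof -
    have "q' < Q" using S_bounds(1)[OF that(2)] by (simp only: Q_def)
    then have "k div Q = i'" "k mod Q = q'" unfolding that(1)[symmetric] by simp_all
    then show ?thesis by (simp add: i_def q_def)
   qed
   have kW: "k < W" "k + 1 < W" using True RW by linarith+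
   have qW: "q < W" using qQ QW by simp
   have lt: "x < k + 1 \<longleftrightarrow> x < k \<or> x = k" for x by auto
   have hub: "n \<le> q \<and> 0 < warr s' 4 q \<longleftrightarrow> q \<in> S"
   proof (cases "n \<le> q")
    case True
    then have "q \<in> {n..<Suc L * n}" using qQ by (simp only: Q_def atLeastLessThan_iff)
    then show ?thesis using static_tables(3)[OF st'] True by simp
   next
    case False
    then show ?thesis using S_sub by auto
   qed
   show ?thesis
   proof (cases "q \<in> S")
    case False
    have ne: "i' * Q + q' \<noteq> k" if "q' \<in> S" for i' q' using uniq that False by blast
    have "J s' (k + 1)" using JJ ne unfolding J_def lt by auto
    moreover have "G (k + 1) = G k" unfolding G_def lt by (rule sum.cong) (use ne in auto)
    moreover have "J (s'\<lparr>wreg := f\<rparr>) x = J s' x" for f x by (simp add: J_def)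
    moreover have nh: "n \<le> q \<Longrightarrow> warr s' 4 q = 0" using hub False by auto
    ultimately show ?thesis using st' W' True eq kW qW
     by (cases "n \<le> q") (simp_all add: k_def[symmetric] q_def[symmetric])
   next
    case qS: True
    define j where "j = q div n"
    note qb = S_bounds[OF qS, folded j_def]
    have h: "n \<le> q" "0 < warr s' 4 q" using hub qS by auto
    have vW: "vb i q < W" using vb_le[of i q] iN qb by simp
    have vk: "k * (2 * n) = vb i q" using k by (simp add: vb_def Q_def)
    have cv: "(i * (L + 1) + j) * (2 * m) = cb i j" by (simp add: cb_def algebra_simps)
    have cW: "cb i j < W" using cb_le[of i j] iN qb by simp
    have "(i * (L + 1) + j) * 1 \<le> (i * (L + 1) + j) * (2 * m)" using m1 by (intro mult_le_mono2) simp
    then have "i * (L + 1) + j \<le> cb i j" by (simp only: cv mult_1_right)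
    then have ijW1: "i * (L + 1) + j < W" using cW by (rule le_less_trans)
    have ijW: "i * (L + 1) + j < W" "i * (L + 1) < W" "j < W"
     by (fact ijW1, rule le_less_trans[OF le_add1 ijW1], rule le_less_trans[OF le_add2 ijW1])
    have BW1: "Bd j < W" using W_small(1) Bd_mono[OF qb(3)] by linarith
    have BW2: "Dl * 2 ^ j = Bd j" by (simp add: Bd_def)
    note BW = BW1 BW2
    have iW: "i < W" using iN W_small(8) by simp
    have modW: "q mod n < W" using qW by (meson le_less_trans mod_less_eq_dividend)
    have t7: "warr s' 7 j = 2 ^ j" using static_tables(2)[OF st'] qb by simp
    have "\<not> i * Q + q < k" using k by simp
    then have z': "warr s' 18 (vb i q + x) = 0 \<and> warr s' 19 (vb i q + x) = 0" if "x < 2 * n" for x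
     using JJ iN qS that unfolding J_def by fastforce
    have "(\<Sum>(i, q)\<in>{..<NI} \<times> S. if i * Q + q < k + 1 then 0 else 300 * n) + (case (i, q) of (i, q) \<Rightarrow> if i * Q + q < k then 0 else 300 * n) =
     (\<Sum>(i, q)\<in>{..<NI} \<times> S. if i * Q + q < k then 0 else 300 * n) + (case (i, q) of (i, q) \<Rightarrow> if i * Q + q < k + 1 then 0 else 300 * n)"
    proof (rule sum_fun_upd)
     show "finite ({..<NI} \<times> S)" using finite_S by simp
     show "(i, q) \<in> {..<NI} \<times> S" using iN qS by simp
     fix y assume y: "y \<in> {..<NI} \<times> S" "y \<noteq> (i, q)"
     obtain i' q' where yy: "y = (i', q')" by (cases y)
     then have "i' * Q + q' \<noteq> k" using y uniq[of i' q'] by blast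
     then show "(case y of (i, q) \<Rightarrow> if i * Q + q < k + 1 then 0 else 300 * n) = (case y of (i, q) \<Rightarrow> if i * Q + q < k then 0 else 300 * n)"
      unfolding yy prod.case lt by simp
    qed
    then have Gk: "G (k + 1) + 300 * n = G k" unfolding G_def prod.case k lt by simp
    have fin: "J (s''\<lparr>wreg := f\<rparr>) (k + 1)" if "tree s'' i q {}" "warr s'' 17 = warr s' 17"
     and o: "\<forall>i'<NI. \<forall>q'\<in>S. (i', q') \<noteq> (i, q) \<longrightarrow> (\<forall>x<2 * n. warr s'' 18 (vb i' q' + x) = warr s' 18 (vb i' q' + x) \<and>
      warr s'' 19 (vb i' q' + x) = warr s' 19 (vb i' q' + x))" for s'' f
     unfolding J_def
    proof (intro allI impI ballI)
     fix i' q' assume i': "i' < NI" and q': "q' \<in> S"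
     have J1: "if i' * Q + q' < k then tree s' i' q' {} else \<forall>x<2 * n. warr s' 18 (vb i' q' + x) = 0 \<and> warr s' 19 (vb i' q' + x) = 0"
      using JJ i' q' by (simp add: J_def)
     show "if i' * Q + q' < k + 1 then tree (s''\<lparr>wreg := f\<rparr>) i' q' {} else
      \<forall>x<2 * n. warr (s''\<lparr>wreg := f\<rparr>) 18 (vb i' q' + x) = 0 \<and> warr (s''\<lparr>wreg := f\<rparr>) 19 (vb i' q' + x) = 0"
     proof (cases "(i', q') = (i, q)")
      case True then show ?thesis using that(1) k by simp
     next
      case False
      then have ne: "i' * Q + q' \<noteq> k" using uniq q' by blast
      have keep: "\<forall>x<2 * n. warr s'' 18 (vb i' q' + x) = warr s' 18 (vb i' q' + x) \<and>
       warr s'' 19 (vb i' q' + x) = warr s' 19 (vb i' q' + x)" using o i' q' False by blast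
      show ?thesis
      proof (cases "i' * Q + q' < k")
       case True
       then have "tree s'' i' q' {}" using J1 keep that(2) tree_cong[of s' i' q' "{}" s''] by auto
       then show ?thesis using True by simp
      next
       case False
       then show ?thesis using J1 keep ne by simp
      qed
     qed
    qed
    have pp: "wp W grow (\<lambda>t s''. J (s''\<lparr>wreg := (wreg s'')(84 := k + 1)\<rparr>) (k + 1) \<and> wreg s'' 84 = k \<and> t + treepot s'' \<le> treepot s' + 226 * n + 50)
     (s'\<lparr>wreg := (wreg s')(85 := q, 86 := i, 87 := j, 30 := vb i q, 31 := cb i j, 32 := Bd j, 33 := q mod n)\<rparr>)"
    proof (rule wp_call[OF grow[OF _ iN qS j_def]], goal_cases)
     case (8 t s'')
     have "warr s'' 17 = warr s' 17" "wreg s'' 84 = k" using 8(2) by (simp_all add: agrees_def k_def)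
     then show ?case using 8(1) fin[of s''] by simp
    qed (use st' c' z' in \<open>simp_all\<close>)
    show ?thesis using st' W' True h kW qW vW cW ijW BW iW modW t7 W_small(6)
     apply (simp add: k_def[symmetric] q_def[symmetric] i_def[symmetric] j_def[symmetric] vk cv)
     apply (rule wp_call[OF pp])
     subgoal for t s''
      using eq Gk n2 kW W_small(14) by ((simp; fail) | (clarsimp, linarith) | (auto, linarith))
     done
   qed
  qed
 next
  fix t s' assume I: "wreg s' 84 \<le> NI * Q \<and> J s' (wreg s' 84)" and ag: "agrees ?c ?s s'"
   and ev: "eval_bool W s' ?b = Some False" and t: "t + ?F s' \<le> ?F ?s + 1 + cost_bool ?b"
  have st': "static s'" by (rule static_agrees[OF st0 ag]) auto
  have k: "wreg s' 84 = NI * Q" using ev st' I QW RW QL W_small(11,14) by simp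
  have "trees_ok s'" unfolding trees_ok_def
  proof (intro allI impI ballI)
   fix i q assume i: "i < NI" and q: "q \<in> S"
   have "q < Q" using S_bounds(1)[OF q] by (simp only: Q_def)
   then have "i * Q + q < i * Q + Q" by (rule add_strict_left_mono)
   also have "i * Q + Q = (i + 1) * Q" by (simp add: algebra_simps)
   also have "\<dots> \<le> NI * Q" using i by (intro mult_le_mono1) simp
   finally show "tree s' i q {}" using I i q unfolding k J_def by simp
  qed
  moreover have "G 0 = 300 * n * (NI * card S)" by (simp add: G_def card_cartesian_product case_prod_unfold)
  ultimately show "trees_ok s' \<and> t + treepot s' \<le> treepot s + 120 * (NI * Q) + 300 * n * (NI * card S) + 30"
   using t by simp
 qed
 show ?thesis
  unfolding init_trees_def using P_bounds
  apply (simp del: mult_Suc)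
  apply (rule wp_call[OF loop])
  apply (simp add: Q_def del: mult_Suc)
  done
qed

lemma inv_cong:
 assumes "\<And>e. e < m \<Longrightarrow> l' e = l e"
 shows "inv s l' = inv s l" "Phi s l' = Phi s l"
proof -
 have N: "Nl l' i j e = Nl l i j e" if "e < m" for i j e using assms that by (simp add: Nl_def)
 have "cost_ok s (Nl l') = cost_ok s (Nl l)" by (rule iffI; erule cost_ok_cong) (simp_all add: N)
 moreover have "cls_ok s (\<lambda>e. cl (l' e)) = cls_ok s (\<lambda>e. cl (l e))" using assms by (simp add: cls_ok_def)
 ultimately show "inv s l' = inv s l" using assms by (simp add: inv_def)
 show "Phi s l' = Phi s l"
  using N assms cpot_cong[of "Nl l'" "Nl l"] cpotL_cong[of "Nl l'" "Nl l"] by (simp add: Phi_def clpot_def)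
qed

lemma init_lengths:
 assumes I: "inv s (\<lambda>_. 0)" and l: "\<And>e. e < m \<Longrightarrow> rarr s 0 e = l e \<and> 0 \<le> l e"
 shows "wp W init_lengths (\<lambda>t s'. inv s' l \<and> t + Phi s' l \<le> Phi s (\<lambda>_. 0) + 200 * m + 20) s"
proof -
 define lk where "lk = (\<lambda>k e. if e < k then l e else 0)"
 let ?c = "SetW 40 (WReg 84) ;; upd ;; SetW 84 (WReg 84 [+] WConst 1)"
 let ?s = "s\<lparr>wreg := (wreg s)(84 := 0)\<rparr>"
 have up: "inv (s'\<lparr>wreg := (wreg s')(x := y)\<rparr>) l'" if "inv s' l'" "x \<in> {40, 84}" for s' l' x y
  by (rule inv_agrees(1)[OF that(1), of "SetW x (WConst y)"]) (use that in \<open>auto simp: agrees_def\<close>)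
 have Ph: "Phi (s'\<lparr>wreg := f\<rparr>) l' = Phi s' l'" for s' f l' by (simp add: Phi_def)
 have loop: "wp W (While (WReg 84 [<] WReg 1) ?c) (\<lambda>t s'. inv s' l \<and> t + Phi s' l \<le> Phi s (\<lambda>_. 0) + 200 * m + 10) ?s"
 proof (rule wp_while[where I = "\<lambda>s'. wreg s' 84 \<le> m \<and> inv s' (lk (wreg s' 84))" and F = "\<lambda>s'. 200 * (m - wreg s' 84) + Phi s' (lk (wreg s' 84))"])
  show "wreg ?s 84 \<le> m \<and> inv ?s (lk (wreg ?s 84))" using up[OF I, of 84 0] by (simp add: lk_def)
 next
  fix s' assume I': "wreg s' 84 \<le> m \<and> inv s' (lk (wreg s' 84))" and ag: "agrees ?c ?s s'"
  define k where "k = wreg s' 84"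
  have r1: "wreg s' 1 = m" using I' by (simp add: inv_def)
  have x: "rarr s' 0 = rarr s 0" using ag by (simp add: agrees_def)
  let ?s1 = "s'\<lparr>wreg := (wreg s')(40 := k)\<rparr>"
  show "eval_bool W s' (WReg 84 [<] WReg 1) \<noteq> None \<and> (eval_bool W s' (WReg 84 [<] WReg 1) = Some True \<longrightarrow>
   wp W ?c (\<lambda>t s''. (wreg s'' 84 \<le> m \<and> inv s'' (lk (wreg s'' 84))) \<and> 1 + cost_bool (WReg 84 [<] WReg 1) + t +
    (200 * (m - wreg s'' 84) + Phi s'' (lk (wreg s'' 84))) \<le> 200 * (m - wreg s' 84) + Phi s' (lk (wreg s' 84))) s')"
  proof (cases "k < m")
   case True
   have lk': "(lk k)(k := l k) = lk (k + 1)" by (auto simp: lk_def)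
   have I1: "inv ?s1 (lk k)" using up[of s' "lk k" 40 k] I' by (simp add: k_def)
   have kW: "k + 1 < W" using True W_small(13) by simp
   have call: "wp W upd (\<lambda>t s''. inv s'' (lk (k + 1)) \<and> t + Phi s'' (lk (k + 1)) \<le> Phi s' (lk k) + 150) ?s1"
    using upd[OF I1, of k "l k"] True l[OF True] x unfolding lk' Ph by (simp add: lk_def)
   show ?thesis using r1 True kW W_small(14)
    apply (simp add: k_def[symmetric])
    apply (rule wp_call[OF call])
    subgoal for t s''
     using up[of s'' "lk (k + 1)" 84 "k + 1"] True by (auto simp: Ph agrees_def k_def)
    done
  qed (use r1 in \<open>simp add: k_def\<close>)
 next
  fix t s' assume I': "wreg s' 84 \<le> m \<and> inv s' (lk (wreg s' 84))" and ag: "agrees ?c ?s s'"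
   and ev: "eval_bool W s' (WReg 84 [<] WReg 1) = Some False"
   and t: "t + (200 * (m - wreg s' 84) + Phi s' (lk (wreg s' 84))) \<le> 200 * (m - wreg ?s 84) + Phi ?s (lk (wreg ?s 84)) + 1 + cost_bool (WReg 84 [<] WReg 1)"
  have "wreg s' 1 = m" using I' by (simp add: inv_def)
  then have k: "wreg s' 84 = m" using ev I' by simp
  have lm: "inv s' (lk m) = inv s' l" "Phi s' (lk m) = Phi s' l" by (rule inv_cong; simp add: lk_def)+
  have "lk 0 = (\<lambda>_. 0)" by (simp add: lk_def)
  then show "inv s' l \<and> t + Phi s' l \<le> Phi s (\<lambda>_. 0) + 200 * m + 10" using t I' unfolding k lm by (simp add: Ph)
 qed
 show ?thesis
  unfolding init_lengths_def using P_bounds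
  apply simp
  apply (rule wp_call[OF loop])
  apply simp
  done
qed

lemma init_tables:
 assumes inp: "wreg s 0 = n" "wreg s 1 = m" "rreg s 0 = \<delta>" "rreg s 1 = Mmax" "rreg s 2 = Mmin"
  and e: "\<And>e. e < m \<Longrightarrow> warr s 0 e = ta e \<and> warr s 1 e = he e"
  and S4: "\<And>q. q \<in> {n..<Suc L * n} \<Longrightarrow> warr s 4 q = (if q \<in> S then 1 else 0)"
  and z: "\<And>a x. a \<in> {8, 12, 14} \<Longrightarrow> warr s a x = 0"
  and L': "2 ^ (L - 1) < n" and M: "2 ^ NI * Mmin \<le> Mmax" "Mmax < 2 ^ (NI + 1) * Mmin"
  and Dl': "Dl = nat \<lfloor>4 / \<delta>\<rfloor> + 2"
 shows "wp W init_tables (\<lambda>t s'. static s' \<and> t \<le> 40 * L + 40 * NI + 80 * (n * L) + 200 * m + 150) s"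
proof -
 obtain t1 s1 where e1: "exec W init_powers s t1 s1" and p1: "wreg s1 6 = L \<and> (\<forall>j\<le>L. warr s1 7 j = 2 ^ j) \<and> t1 \<le> 40 * L + 30"
  and a1: "agrees init_powers s s1" by (rule wpE[OF init_powers[OF inp(1) L']])
 let ?s2 = "s1\<lparr>wreg := (wreg s1)(8 := Dl)\<rparr>"
 have "rreg s1 0 = \<delta>" using a1 inp by (simp add: agrees_def)
 then have "eval_word W s1 (WFloor (RWord (WConst 4) {/} RReg 0) [+] WConst 2) = Some Dl"
  using W_small(1,2) P_bounds Dl' by simp
 note e2 = exec_SetW[OF this, of 8]
 have r2: "rreg ?s2 1 = Mmax" "rreg ?s2 2 = Mmin" using a1 inp by (simp_all add: agrees_def)
 obtain t3 s3 where e3: "exec W init_scales ?s2 t3 s3" and p3: "wreg s3 7 = NI \<and> (\<forall>i<NI. rarr s3 2 i = beta i) \<and> t3 \<le> 40 * NI + 30"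
  and a3: "agrees init_scales ?s2 s3" by (rule wpE[OF init_scales[OF r2 M]])
 have r3: "wreg s3 0 = n" "wreg s3 6 = L" "warr s3 4 = warr s 4" "warr s3 8 = warr s 8"
  using a1 a3 inp p1 by (simp_all add: agrees_def)
 have r3': "\<And>q. q \<in> {n..<Suc L * n} \<Longrightarrow> warr s3 4 q = (if q \<in> S then 1 else 0)" "\<And>j. warr s3 8 j = 0"
  unfolding r3(3,4) using S4 z by auto
 obtain t4 s4 where e4: "exec W init_hubs s3 t4 s4"
  and p4: "(\<forall>j\<in>{1..L}. warr s4 8 j = card (H j) \<and> (\<lambda>r. warr s4 9 (j * n + r)) ` {..<card (H j)} = H j) \<and> t4 \<le> 80 * (n * L) + 30"
  and a4: "agrees init_hubs s3 s4" by (rule wpE[OF init_hubs[OF r3(1,2) r3']])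
 have r4: "wreg s4 0 = n" "wreg s4 1 = m" "\<And>e. e < m \<Longrightarrow> warr s4 0 e = ta e \<and> warr s4 1 e = he e"
  using a1 a3 a4 inp e by (simp_all add: agrees_def)
 obtain t5 s5 where e5: "exec W init_arcs s4 t5 s5" and p5: "(\<forall>a<2 * m. warr s5 10 a = TL a \<and> warr s5 11 a = HD a) \<and> t5 \<le> 80 * m + 20"
  and a5: "agrees init_arcs s4 s5" by (rule wpE[OF init_arcs[OF r4]])
 have r5: "wreg s5 1 = m" "\<And>a. a < 2 * m \<Longrightarrow> warr s5 10 a = TL a \<and> warr s5 11 a = HD a" "\<And>x. warr s5 12 x = 0" "\<And>x. warr s5 14 x = 0"
  using a1 a3 a4 a5 inp p5 z by (simp_all add: agrees_def)
 obtain t6 s6 where e6: "exec W init_lists s5 t6 s6" and p6: "(\<forall>v. warr s6 12 v = prv HD v (2 * m)) \<and> (\<forall>a<2 * m. warr s6 13 a = prv HD (HD a) a) \<and>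
  (\<forall>v. warr s6 14 v = prv TL v (2 * m)) \<and> (\<forall>a<2 * m. warr s6 15 a = prv TL (TL a) a) \<and> t6 \<le> 120 * m + 20"
  and a6: "agrees init_lists s5 s6" by (rule wpE[OF init_lists[OF r5]])
 have c: "wreg s6 0 = n" "wreg s6 1 = m" "wreg s6 6 = L" "wreg s6 7 = NI" "wreg s6 8 = Dl" "rreg s6 0 = \<delta>"
  "rarr s6 2 = rarr s3 2" "warr s6 7 = warr s1 7" "warr s6 8 = warr s4 8" "warr s6 9 = warr s4 9" "warr s6 4 = warr s 4"
  "warr s6 10 = warr s5 10" "warr s6 11 = warr s5 11"
  using a1 a3 a4 a5 a6 inp p1 p3 by (simp_all add: agrees_def)
 have "adj s6" using p5 p6 c by (simp add: adj_def)
 then have "static s6" unfolding static_def using c p1 p3 p4 S4 by (simp del: mult_Suc)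
 moreover have "exec W init_tables s (t1 + ((1 + cost_word (WFloor (RWord (WConst 4) {/} RReg 0) [+] WConst 2)) + (t3 + (t4 + (t5 + t6))))) s6"
  unfolding init_tables_def by (rule exec_Seq[OF e1 exec_Seq[OF e2 exec_Seq[OF e3 exec_Seq[OF e4 exec_Seq[OF e5 e6]]]]])
 moreover have "t1 + ((1 + cost_word (WFloor (RWord (WConst 4) {/} RReg 0) [+] WConst 2)) + (t3 + (t4 + (t5 + t6)))) \<le>
  40 * L + 40 * NI + 80 * (n * L) + 200 * m + 150"
  using p1 p3 p4 p5 p6 by simp
 ultimately show ?thesis unfolding wp_def by blast
qed

text \<open>The random quantity in the initial potential: the number of label values summed over the
  hubs. It also dominates the number of hubs.\<close>

definition hubsize :: nat where "hubsize = (\<Sum>q\<in>S. Bd (q div n) + 1)"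

lemma treepot_start:
 assumes "\<And>a. warr s 18 a = 0 \<and> warr s 19 a = 0"
 shows "treepot s = NI * (hubsize * (200 * n + 300 * (2 * m)))"
proof -
 have "ipot s i q = (Bd (q div n) + 1) * (200 * n + 300 * (2 * m))" for i q
  unfolding ipot_def pot_start[symmetric] by (rule pot_cong) (use assms in \<open>auto simp: sl_def\<close>)
 moreover have "treepot s = (\<Sum>i<NI. \<Sum>q\<in>S. ipot s i q)" by (simp only: treepot_def sum.cartesian_product)
 ultimately have "treepot s = (\<Sum>i<NI. \<Sum>q\<in>S. (Bd (q div n) + 1) * (200 * n + 300 * (2 * m)))" by (simp only:)
 then show ?thesis by (simp only: hubsize_def sum_distrib_right sum_constant card_lessThan of_nat_id)
qed

text \<open>Grouping the hubs by level turns the sum of \<open>Bd j * card (H j)\<close> into a sum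
  over all hubs, which \<open>hubsize\<close> dominates; the per-level constants give the second
  term.\<close>

lemma cpot_start: "cpot (\<lambda>_ _ _. 0) \<le> NI * (m * (400 * hubsize + 100 * (L * Bd L)))"
proof -
 have H: "(\<Sum>j\<in>{1..L}. Bd j * card (H j)) \<le> hubsize"
 proof -
  have "(\<Sum>j\<in>{1..L}. Bd j * card (H j)) = (\<Sum>j\<in>{1..L}. \<Sum>q\<in>{q \<in> S. q div n = j}. Bd (q div n))"
   by (simp add: H_def mult.commute)
  also have "\<dots> = (\<Sum>q\<in>S. Bd (q div n))"
   by (rule sum.group) (use finite_S S_bounds(2,3) in auto)
  also have "\<dots> \<le> hubsize" unfolding hubsize_def by (rule sum_mono) simp
  finally show ?thesis .
 qed
 have "(\<Sum>j\<in>{1..L}. Bd j) \<le> (\<Sum>j\<in>{1..L}. Bd L)" by (rule sum_mono) (simp add: Bd_mono)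
 then have B: "(\<Sum>j\<in>{1..L}. Bd j) \<le> L * Bd L" by simp
 have "cpot (\<lambda>_ _ _. 0) = (\<Sum>i<NI. \<Sum>j\<in>{1..L}. \<Sum>e<m. (Bd j - 0) * (400 * card (H j) + 100))"
  by (simp only: cpot_def sum.cartesian_product)
 also have "\<dots> = NI * (m * (400 * (\<Sum>j\<in>{1..L}. Bd j * card (H j)) + 100 * (\<Sum>j\<in>{1..L}. Bd j)))"
  by (simp add: sum_distrib_left sum_distrib_right sum.distrib algebra_simps)
 also have "\<dots> \<le> NI * (m * (400 * hubsize + 100 * (L * Bd L)))"
  using H B by (intro mult_le_mono2 add_mono) auto
 finally show ?thesis .
qed

text \<open>The bound covers the time of the initialisation together with the potential left over,
  out of which all later maintenance beyond a constant per increase is paid.\<close>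

lemma init:
 assumes inp: "wreg s 0 = n" "wreg s 1 = m" "rreg s 0 = 2 * \<delta>" "rreg s 1 = Mmax" "rreg s 2 = Mmin"
  and e: "\<And>e. e < m \<Longrightarrow> warr s 0 e = ta e \<and> warr s 1 e = he e"
  and S4: "\<And>q. q \<in> {n..<Suc L * n} \<Longrightarrow> warr s 4 q = (if q \<in> S then 1 else 0)"
  and z: "\<And>a x. a \<in> {8, 12, 14, 17, 18, 19, 22, 23} \<Longrightarrow> warr s a x = 0"
  and l: "\<And>e. e < m \<Longrightarrow> rarr s 0 e = l e \<and> 0 \<le> l e"
  and L': "2 ^ (L - 1) < n" and M: "2 ^ NI * Mmin \<le> Mmax" "Mmax < 2 ^ (NI + 1) * Mmin"
  and Dl': "Dl = nat \<lfloor>4 / \<delta>\<rfloor> + 2"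
 shows "wp W init (\<lambda>t s'. inv s' l \<and> (\<forall>e<m. rarr s' 0 e = l e) \<and>
  t + Phi s' l \<le> 2000 * (NI * ((n + m) * (hubsize + (L + 1) * (Bd L + n))))) s"
proof -
 let ?s1 = "s\<lparr>rreg := (rreg s)(0 := \<delta>)\<rparr>"
 have "eval_real W s (RReg 0 {/} RWord (WConst 2)) = Some \<delta>" using inp P_bounds by simp
 note e1 = exec_SetR[OF this, of 0]
 have f1: "wreg ?s1 0 = n" "wreg ?s1 1 = m" "rreg ?s1 0 = \<delta>" "rreg ?s1 1 = Mmax" "rreg ?s1 2 = Mmin" using inp by simp_all
 have e1': "warr ?s1 0 e = ta e \<and> warr ?s1 1 e = he e" if "e < m" for e using e[OF that] by simp
 have f2: "warr ?s1 4 q = (if q \<in> S then 1 else 0)" if "q \<in> {n..<Suc L * n}" for q using S4[OF that] by simp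
 have f3: "warr ?s1 a x = 0" if "a \<in> {8, 12, 14}" for a x using z[of a x] that by auto
 obtain t2 s2 where e2: "exec W init_tables ?s1 t2 s2" and p2: "static s2 \<and> t2 \<le> 40 * L + 40 * NI + 80 * (n * L) + 200 * m + 150"
  and a2: "agrees init_tables ?s1 s2"
  by (rule wpE[OF init_tables[OF f1 e1' f2 f3 L' M Dl']])
 have z2: "\<And>a. warr s2 17 a = 0" "\<And>a. warr s2 18 a = 0 \<and> warr s2 19 a = 0" "rarr s2 0 = rarr s 0" "\<And>a. warr s2 22 a = 0" "\<And>a. warr s2 23 a = 0"
  using a2 z by (simp_all add: agrees_def)
 have st2: "static s2" using p2 by simp
 obtain t3 s3 where e3: "exec W init_trees s2 t3 s3"
  and p3: "trees_ok s3 \<and> t3 + treepot s3 \<le> treepot s2 + 120 * (NI * (Suc L * n)) + 300 * n * (NI * card S) + 40"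
  and a3: "agrees init_trees s2 s3" by (rule wpE[OF init_trees[OF st2 z2(1,2)]])
 have z3: "\<And>a. warr s3 17 a = 0" "rarr s3 0 = rarr s 0" "\<And>a. warr s3 22 a = 0" "\<And>a. warr s3 23 a = 0"
  using a3 z2 by (simp_all add: agrees_def)
 have N0: "Nl (\<lambda>_. 0) = (\<lambda>_ _ _. 0)" by (simp add: Nl_def Nf_zero fun_eq_iff)
 have cl0: "cl 0 = 0" by (rule cl_eqI) (use beta_pos[of 0] in auto)
 have I3: "inv s3 (\<lambda>_. 0)"
  unfolding inv_def cost_ok_def cls_ok_def N0 cl0
  using static_agrees[OF st2 a3] p3 z3 by simp
 have l3: "rarr s3 0 e = l e \<and> 0 \<le> l e" if "e < m" for e using l[OF that] z3(2) by simp
 obtain t4 s4 where e4: "exec W init_lengths s3 t4 s4" and p4: "inv s4 l \<and> t4 + Phi s4 l \<le> Phi s3 (\<lambda>_. 0) + 200 * m + 20"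
  and a4: "agrees init_lengths s3 s4" by (rule wpE[OF init_lengths[OF I3 l3]])
 have l4: "\<forall>e<m. rarr s4 0 e = l e" using a4 l3 by (simp add: agrees_def)
 have ex: "exec W init s ((1 + cost_real (RReg 0 {/} RWord (WConst 2))) + (t2 + (t3 + t4))) s4"
  unfolding init_def by (rule exec_Seq[OF e1 exec_Seq[OF e2 exec_Seq[OF e3 e4]]])
 \<comment> \<open>The bound is split into the monomials for hubs, for grid values and for plain
   tables; every contribution is compared with one or more of them.\<close>
 define a where "a = NI * ((n + m) * hubsize)"
 define b where "b = NI * ((n + m) * ((L + 1) * Bd L))"
 define c where "c = NI * ((n + m) * ((L + 1) * n))"
 have abc: "NI * ((n + m) * (hubsize + (L + 1) * (Bd L + n))) = a + b + c" by (simp add: a_def b_def c_def algebra_simps)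
 have p_mono: "x1 * (x2 * (x3 * x4)) \<le> NI * ((n + m) * ((L + 1) * n))" if "x1 \<le> NI" "x2 \<le> n + m" "x3 \<le> L + 1" "x4 \<le> n" for x1 x2 x3 x4
  using that by (intro mult_le_mono)
 have c1: "n * L \<le> c" "L \<le> c" "NI \<le> c" "m \<le> c" "1 \<le> c" "NI * (Suc L * n) \<le> c" "m * (NI * n) \<le> c"
  using p_mono[of 1 1 L n] p_mono[of 1 1 L 1] p_mono[of NI 1 1 1] p_mono[of 1 m 1 1] p_mono[of 1 1 1 1] p_mono[of NI 1 "Suc L" n] p_mono[of NI m 1 n] NI1 n2
  by (simp_all add: c_def mult.commute mult.left_commute del: mult_Suc)
 have cardS: "card S \<le> hubsize"
 proof -
  have "(\<Sum>q\<in>S. 1) \<le> hubsize" unfolding hubsize_def by (rule sum_mono) simp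
  then show ?thesis by simp
 qed
 have a1: "n * (NI * card S) \<le> a"
 proof -
  have "NI * (n * card S) \<le> a" unfolding a_def by (intro mult_le_mono cardS) auto
  then show ?thesis by (simp add: mult.left_commute)
 qed
 have "NI * (hubsize * (200 * n + 300 * (2 * m))) \<le> NI * (hubsize * (600 * (n + m)))" by (intro mult_le_mono2) simp
 also have "\<dots> = 600 * a" by (simp add: a_def algebra_simps)
 finally have tp: "treepot s2 \<le> 600 * a" using treepot_start[OF z2(2)] by simp
 have "NI * (m * (400 * hubsize + 100 * (L * Bd L))) \<le> NI * ((n + m) * (400 * hubsize + 100 * ((L + 1) * Bd L)))"
  by (intro mult_le_mono add_mono) auto
 also have "\<dots> = 400 * a + 100 * b" by (simp add: a_def b_def algebra_simps)
 finally have cp: "cpot (Nl (\<lambda>_. 0)) \<le> 400 * a + 100 * b" using cpot_start N0 by simp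
 have "cpotL (Nl (\<lambda>_. 0)) = (\<Sum>i<NI. \<Sum>e<m. (Bd L - 0) * (400 * (L + 1)))" by (simp only: cpotL_def N0 sum.cartesian_product)
 also have "\<dots> = NI * (m * (400 * ((L + 1) * Bd L)))" by (simp add: algebra_simps)
 also have "\<dots> \<le> NI * ((n + m) * (400 * ((L + 1) * Bd L)))" by (intro mult_le_mono) auto
 also have "\<dots> = 400 * b" by (simp add: b_def algebra_simps)
 finally have cl: "cpotL (Nl (\<lambda>_. 0)) \<le> 400 * b" .
 have "clpot (\<lambda>_. 0) = m * (NI * (60 * n + 200))" by (simp add: clpot_def cl0)
 also have "\<dots> \<le> m * (NI * (160 * n))" using n2 by (intro mult_le_mono2) simp
 also have "\<dots> \<le> 160 * c" using c1(7) by (simp add: mult.left_commute)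
 finally have clp: "clpot (\<lambda>_. 0) \<le> 160 * c" .
 have t2: "t2 \<le> 40 * L + 40 * NI + 80 * (n * L) + 200 * m + 150" using p2 by blast
 have "t2 \<le> 40 * c + 40 * c + 80 * c + 200 * c + 150 * c"
  by (rule order_trans[OF t2]) (intro add_mono mult_le_mono2 c1, use c1(5) in simp)
 moreover have "t3 + treepot s3 \<le> 600 * a + 120 * c + 300 * a + 40"
 proof -
  have "120 * (NI * (Suc L * n)) \<le> 120 * c" by (rule mult_le_mono2[OF c1(6)])
  moreover have "300 * n * (NI * card S) \<le> 300 * a" using mult_le_mono2[OF a1, of 300] by (simp only: mult.assoc)
  moreover have "t3 + treepot s3 \<le> treepot s2 + 120 * (NI * (Suc L * n)) + 300 * n * (NI * card S) + 40" using p3 by blast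
  ultimately show ?thesis using order_trans[OF _ add_mono[OF add_mono[OF add_mono[OF tp]] order_refl]] by blast
 qed
 moreover have "t4 + Phi s4 l \<le> Phi s3 (\<lambda>_. 0) + 200 * m + 20" using p4 by blast
 moreover have "Phi s3 (\<lambda>_. 0) \<le> treepot s3 + (400 * a + 100 * b) + 400 * b + 160 * c"
  unfolding Phi_def by (intro add_mono order_refl cp cl clp)
 ultimately have tot: "k + (t2 + (t3 + t4)) + Phi s4 l \<le> 2000 * (a + b + c)" if "k \<le> 10" for k
  using that c1(4) c1(5)[unfolded One_nat_def] by (simp only: add_mult_distrib2)
 have "(1 + cost_real (RReg 0 {/} RWord (WConst 2))) + (t2 + (t3 + t4)) + Phi s4 l \<le> 2000 * (a + b + c)"
  by (rule tot) simp
 then show ?thesis using ex p4 l4 unfolding wp_def abc by blast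
qed

end

section \<open>Correctness of the distance queries\<close>

lemma sum_list_upper:
 fixes f :: "'a \<Rightarrow> real"
 assumes "\<And>x. x \<in> set p \<Longrightarrow> f x \<le> c"
 shows "(\<Sum>x\<leftarrow>p. f x) \<le> real (length p) * c"
 using assms by (induction p) (auto simp: algebra_simps intro: add_mono)

lemma sum_list_member:
 fixes f :: "'a \<Rightarrow> real"
 assumes "\<And>x. x \<in> set p \<Longrightarrow> 0 \<le> f x" "y \<in> set p"
 shows "f y \<le> (\<Sum>x\<leftarrow>p. f x)"
 using assms
proof (induction p)
 case (Cons a p)
 have "0 \<le> (\<Sum>x\<leftarrow>p. f x)" using Cons.prems by (intro sum_list_nonneg) auto
 moreover have "y = a \<or> f y \<le> (\<Sum>x\<leftarrow>p. f x)" using Cons by auto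
 moreover have "0 \<le> f a" using Cons.prems by simp
 ultimately show ?case by auto
qed simp

context machine_setup
begin

text \<open>Class \<open>k > 0\<close> means length at least
  \<open>4 * beta (k - 1) = 2 * beta k\<close>, so an arc of length at most
  \<open>2 * \<beta>\<close> has an admissible class. \<open>k = NI\<close> is excluded because
  \<open>2 * beta NI\<close> exceeds \<open>Mmax\<close>. The class then occurs in a sorted block
  and is seen by \<open>top_class\<close>.\<close>

lemma arc_class:
 assumes I: "inv s l" and e: "e < m" and b: "okc \<beta> 0" "2 * \<beta> \<le> Mmax" "Mmax < 2 ^ (NI + 1) * Mmin" and le: "l e \<le> 2 * \<beta>"
 shows "cl (l e) < NI" "cl (l e) \<le> top_class (warr s 23) \<beta> (n * n)"
proof -
 define k where "k = cl (l e)"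
 have ok: "okc \<beta> k"
 proof (cases k)
  case 0 then show ?thesis using b by simp
 next
  case (Suc k')
  have "4 * beta k' \<le> l e" using below_cl[of k' "l e"] Suc by (simp add: k_def)
  moreover have bk: "beta k = 2 * beta k'" by (simp add: Suc beta_def)
  ultimately have b2: "beta k \<le> \<beta>" using le by simp
  have "k \<noteq> NI"
  proof
   assume "k = NI"
   then have "2 * beta k = 2 ^ (NI + 1) * Mmin" by (simp add: beta_def power_add)
   with b b2 show False by linarith
  qed
  then have "k < NI" using cl_le[of "l e"] by (simp add: k_def)
  then show ?thesis using b2 by (simp add: okc_def)
 qed
 then show "cl (l e) < NI" by (simp add: okc_def k_def)
 have g: "e div n < n" using e mnn by (simp add: less_mult_imp_div_less)
 have p: "e mod n < n" using n2 by simp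
 have c: "cls_ok s (\<lambda>e. cl (l e))" using I by (simp add: inv_def)
 have "image_mset (\<lambda>p. warr s 23 (e div n * n + p)) (mset_set {..<n}) = image_mset (\<lambda>p. warr s 22 (e div n * n + p)) (mset_set {..<n})"
  using c g unfolding cls_ok_def by blast
 then have "set_mset (image_mset (\<lambda>p. warr s 23 (e div n * n + p)) (mset_set {..<n})) = set_mset (image_mset (\<lambda>p. warr s 22 (e div n * n + p)) (mset_set {..<n}))"
  by (rule arg_cong)
 then have im: "(\<lambda>p. warr s 23 (e div n * n + p)) ` {..<n} = (\<lambda>p. warr s 22 (e div n * n + p)) ` {..<n}" by simp
 have "warr s 22 (e div n * n + e mod n) = k" using c e by (simp add: cls_ok_def k_def)
 then have "k \<in> (\<lambda>p. warr s 22 (e div n * n + p)) ` {..<n}" using p by (intro image_eqI[of _ _ "e mod n"]) auto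
 then obtain p' where p': "p' < n" "warr s 23 (e div n * n + p') = k" unfolding im[symmetric] by auto
 have "(e div n + 1) * n \<le> n * n" using g by (intro mult_le_mono1) simp
 moreover have "e div n * n + p' < (e div n + 1) * n" using p'(1) by (simp add: add_mult_distrib)
 ultimately have "e div n * n + p' < n * n" by (rule less_le_trans[rotated])
 from top_class_ge[of _ _ \<beta> "warr s 23", OF this] show "cl (l e) \<le> top_class (warr s 23) \<beta> (n * n)"
  using p' ok by (simp add: k_def)
qed

text \<open>If the next scale is admissible too, the chosen one lies \<open>L\<close> above the
  class of the longest arc, and \<open>n \<le> 2 ^ L\<close> arcs of that length stay below
  \<open>4 * beta\<close>. Otherwise the chosen scale is the largest admissible one, and doubling it
  exceeds \<open>\<beta>\<close>, or \<open>Mmax / 2\<close> if it is the last.\<close>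

lemma below_scale:
 assumes I: "inv s l" and p: "wk u p v" "length p \<le> n" and b: "okc \<beta> 0" "2 * \<beta> \<le> Mmax" "Mmax < 2 ^ (NI + 1) * Mmin"
  and d: "(\<Sum>e\<leftarrow>p. l e) \<le> 2 * \<beta>"
 shows "(\<Sum>e\<leftarrow>p. l e) < 4 * beta (scale (warr s 23) \<beta>)"
proof (cases "p = []")
 case True then show ?thesis using beta_pos by simp
next
 case False
 let ?i = "scale (warr s 23) \<beta>"
 have pos: "0 \<le> l e \<and> e < m" if "e \<in> set p" for e using I wk_ta[OF p(1) that] by (auto simp: inv_def)
 have "Max (l ` set p) \<in> l ` set p" using False by (intro Max_in) auto
 then obtain e where e: "e \<in> set p" "l e = Max (l ` set p)" by auto
 have mx: "l e' \<le> l e" if "e' \<in> set p" for e' using that e by simp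
 have em: "e < m" "0 \<le> l e" using pos[OF e(1)] by auto
 have "l e \<le> (\<Sum>e\<leftarrow>p. l e)" using pos e by (intro sum_list_member) auto
 then have le: "l e \<le> 2 * \<beta>" using d by simp
 note c = arc_class[OF I em(1) b le]
 have sc1: "okc \<beta> ?i" using scale_ok(1)[OF b(1)] .
 show ?thesis
 proof (cases "okc \<beta> (?i + 1)")
  case True
  then have "\<not> ?i + 1 \<le> top_class (warr s 23) \<beta> (n * n) + L" using scale_ok(3)[OF b(1), of "?i + 1" "warr s 23"] by auto
  then have iL: "cl (l e) + L \<le> ?i" using c by simp
  have "l e < 4 * beta (cl (l e))" using c by (intro cl_less) auto
  then have "real n * l e < real n * (4 * beta (cl (l e)))" using n2 by (intro mult_strict_left_mono) auto
  also have "\<dots> \<le> 2 ^ L * (4 * beta (cl (l e)))"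
   using of_nat_mono[OF nL, where 'a = real] beta_pos[of "cl (l e)"] by (intro mult_right_mono) auto
  also have "\<dots> = 4 * beta (cl (l e) + L)" by (simp add: beta_def power_add)
  also have "\<dots> \<le> 4 * beta ?i" using beta_mono[OF iL] by simp
  finally have "real n * l e < 4 * beta ?i" .
  moreover have "(\<Sum>e\<leftarrow>p. l e) \<le> real (length p) * l e" using mx by (rule sum_list_upper)
  moreover have "real (length p) * l e \<le> real n * l e" using p em by (intro mult_right_mono) auto
  ultimately show ?thesis by linarith
 next
  case False
  then consider "?i + 1 = NI" | "\<beta> < beta (?i + 1)" using sc1 by (fastforce simp: okc_def)
  then show ?thesis
  proof cases
   case 1
   have "4 * beta ?i = 2 * beta (?i + 1)" by (simp add: beta_def power_add)
   also have "\<dots> = 2 * beta NI" by (simp only: 1)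
   also have "\<dots> = 2 ^ (NI + 1) * Mmin" by (simp add: beta_def power_add)
   finally show ?thesis using d b by linarith
  next
   case 2
   moreover have "beta (?i + 1) = 2 * beta ?i" by (simp add: beta_def power_add)
   ultimately show ?thesis using d by linarith
  qed
 qed
qed

text \<open>Rounding up costs at most one unit per arc.\<close>

lemma nsum_unit:
 assumes "\<And>e. e \<in> set p \<Longrightarrow> 0 \<le> l e \<and> l e < 4 * beta i"
 shows "real (nsum l i j p) * unit i j \<le> (\<Sum>e\<leftarrow>p. l e) + real (length p) * unit i j"
 using assms
proof (induction p)
 case (Cons e p)
 have "(Nf i j (l e) + 1) * unit i j \<le> l e + unit i j" using Cons.prems by (intro Nf_unit) auto
 moreover have "real (nsum l i j p) * unit i j \<le> (\<Sum>e\<leftarrow>p. l e) + real (length p) * unit i j" using Cons by auto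
 ultimately show ?case by (simp add: algebra_simps)
qed simp

text \<open>Splitting the path at the hub bounds both labels. At most \<open>2 ^ j\<close> arcs lose
  one unit each, together \<open>\<delta> * beta i \<le> \<delta> * \<beta>\<close>, and the length
  below \<open>4 * beta i\<close> keeps the sum within the truncation bound, so the hub is a
  candidate.\<close>

lemma Dst_path:
 assumes I: "inv s l" and b: "okc \<beta> 0" and p: "wk u p v" "u < n" and q: "q \<in> S" "j = q div n" "q mod n \<in> set (vs u p)" "length p \<le> 2 ^ j"
  and d: "(\<Sum>e\<leftarrow>p. l e) < 4 * beta (scale (warr s 23) \<beta>)"
 shows "Dst s u v \<beta> \<le> ereal ((\<Sum>e\<leftarrow>p. l e) + \<delta> * \<beta>)"
proof -
 define i where "i = scale (warr s 23) \<beta>"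
 have i: "i < NI" "beta i \<le> \<beta>" using scale_ok(1)[OF b, of "warr s 23"] by (auto simp: okc_def i_def)
 have pos: "0 \<le> l e" if "e \<in> set p" for e using I wk_ta[OF p(1) that] by (auto simp: inv_def)
 have lt: "0 \<le> l e \<and> l e < 4 * beta i" if "e \<in> set p" for e
 proof -
  have "l e \<le> (\<Sum>e\<leftarrow>p. l e)" by (rule sum_list_member) (use pos that in auto)
  then show ?thesis using pos[OF that] d by (simp add: i_def)
 qed
 obtain a r where ar: "p = a @ r" "wk u a (q mod n)" "wk (q mod n) r v" using wk_split[OF p(1) q(3)] by blast
 have "lab s i q (n + u) \<le> nsum l i j a" "lab s i q v \<le> nsum l i j r"
  using lab_walk[OF I i(1) q(1,2) ar(2)] lab_walk[OF I i(1) q(1,2) ar(3)] lab_source[OF I i(1) q(1)] by simp_all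
 then have ds: "dsum s i q u v \<le> nsum l i j p" by (simp add: dsum_def ar(1))
 have u: "2 ^ j * unit i j = \<delta> * beta i" by (simp add: unit_def)
 have "real (length p) * unit i j \<le> 2 ^ j * unit i j"
  using of_nat_mono[OF q(4), where 'a = real] unit_pos[of i j] by (intro mult_right_mono) auto
 then have up: "real (nsum l i j p) * unit i j \<le> (\<Sum>e\<leftarrow>p. l e) + \<delta> * beta i" using nsum_unit[where p = p and l = l and i = i and j = j, OF lt] u by linarith
 then have "real (nsum l i j p) * unit i j \<le> 4 * beta i + 2 ^ j * unit i j" using d u by (simp add: i_def)
 then have "real (nsum l i j p) \<le> (4 * beta i + 2 ^ j * unit i j) / unit i j" using unit_pos[of i j] by (simp add: pos_le_divide_eq)
 also have "\<dots> = 4 * 2 ^ j / \<delta> + 2 ^ j" using unit_pos[of i j] by (simp add: add_divide_distrib four_beta_div_unit)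
 also have "\<dots> = (4 / \<delta> + 1) * 2 ^ j" by (simp add: algebra_simps)
 also have "\<dots> \<le> real Dl * 2 ^ j" using Dl by (intro mult_right_mono) auto
 finally have "real (nsum l i j p) \<le> real (Bd j)" by (simp add: Bd_def)
 then have "nsum l i j p \<le> Bd j" by (simp only: of_nat_le_iff)
 then have "q \<in> cand s i u v" using ds q by (simp add: cand_def)
 then have "Dst s u v \<beta> \<le> ereal (dval s i q u v)" unfolding Dst_def Dm_def i_def by (rule INF_lower)
 also have "dval s i q u v \<le> real (nsum l i j p) * unit i j"
  unfolding dval_def q(2)[symmetric] using ds unit_pos[of i j] by (intro mult_right_mono) auto
 also have "\<dots> \<le> (\<Sum>e\<leftarrow>p. l e) + \<delta> * \<beta>"
 proof -
  have "\<delta> * beta i \<le> \<delta> * \<beta>" using i(2) delta0 by (intro mult_left_mono) auto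
  then show ?thesis using up by linarith
 qed
 finally show ?thesis by simp
qed

text \<open>A candidate has at most \<open>Bd j\<close> units, which is
  \<open>Dl * \<delta> * beta i\<close> at every level. This serves paths of length at least
  \<open>4 * beta\<close>, about which the labels of the chosen scale say nothing.\<close>

lemma Dst_cap:
 assumes b: "okc \<beta> 0" and D: "real Dl \<le> 4 / \<delta> + 2"
 shows "Dst s u v \<beta> = \<infinity> \<or> Dst s u v \<beta> \<le> ereal (4 * beta (scale (warr s 23) \<beta>) + 2 * \<delta> * \<beta>)"
proof -
 define i where "i = scale (warr s 23) \<beta>"
 have i: "beta i \<le> \<beta>" using scale_ok(1)[OF b, of "warr s 23"] by (auto simp: okc_def i_def)
 show ?thesis
 proof (cases "cand s i u v = {}")
  case True
  then show ?thesis by (simp add: Dst_def Dm_def i_def[symmetric] top_ereal_def)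
 next
  case False
  then obtain q where q: "q \<in> cand s i u v" by blast
  define j where "j = q div n"
  have "Dst s u v \<beta> \<le> ereal (dval s i q u v)" unfolding Dst_def Dm_def i_def[symmetric] using q by (rule INF_lower)
  also have "dval s i q u v \<le> real (Bd j) * unit i j"
   unfolding dval_def j_def[symmetric] using q unit_pos[of i j] by (intro mult_right_mono) (auto simp: cand_def j_def)
  also have "\<dots> = real Dl * (\<delta> * beta i)" by (simp add: Bd_def unit_def)
  also have "\<dots> \<le> (4 / \<delta> + 2) * (\<delta> * beta i)" using D delta0 beta_pos[of i] by (intro mult_right_mono) auto
  also have "\<dots> = 4 * beta i + 2 * (\<delta> * beta i)" using delta0 by (simp add: algebra_simps)
  also have "\<dots> \<le> 4 * beta i + 2 * \<delta> * \<beta>" using i delta0 mult_left_mono[of "beta i" \<beta> \<delta>] by simp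
  finally show ?thesis by (simp add: i_def)
 qed
qed

text \<open>Paths shorter than four times the scale are found up to one error term. Longer ones
  exceed \<open>2 * \<beta>\<close>, and for them the cap, with two error terms, or
  \<open>\<infinity>\<close> suffices.\<close>

lemma Dst_correct:
 assumes I: "inv s l" and b: "okc \<beta> 0" "2 * \<beta> \<le> Mmax" "Mmax < 2 ^ (NI + 1) * Mmin" and D: "real Dl \<le> 4 / \<delta> + 2"
  and p: "wk u p v" "u < n" "distinct (vs u p)" and q: "q \<in> S" "q mod n \<in> set (vs u p)" "length p \<le> 2 ^ (q div n)"
 shows "(\<Sum>e\<leftarrow>p. l e) \<le> 2 * \<beta> \<Longrightarrow> Dst s u v \<beta> \<le> ereal ((\<Sum>e\<leftarrow>p. l e) + 2 * \<delta> * \<beta>)"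
  "Dst s u v \<beta> \<le> ereal ((\<Sum>e\<leftarrow>p. l e) + 2 * \<delta> * \<beta>) \<or> Dst s u v \<beta> = \<infinity>"
proof -
 have "beta 0 \<le> \<beta>" using b by (simp add: okc_def)
 then have "0 \<le> \<delta> * \<beta>" using beta_pos[of 0] delta0 by simp
 then have near: "Dst s u v \<beta> \<le> ereal ((\<Sum>e\<leftarrow>p. l e) + 2 * \<delta> * \<beta>)" if "(\<Sum>e\<leftarrow>p. l e) < 4 * beta (scale (warr s 23) \<beta>)"
 proof -
  have "Dst s u v \<beta> \<le> ereal ((\<Sum>e\<leftarrow>p. l e) + \<delta> * \<beta>)" by (rule Dst_path[OF I b(1) p(1,2) q(1) refl q(2,3) that])
  also have "\<dots> \<le> ereal ((\<Sum>e\<leftarrow>p. l e) + 2 * \<delta> * \<beta>)" using \<open>0 \<le> \<delta> * \<beta>\<close> by (simp add: mult.commute[of \<beta> \<delta>])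
  finally show ?thesis .
 qed
 have len: "length p \<le> n" using distinct_vs_length[OF p(3,1,2)] by simp
 show "(\<Sum>e\<leftarrow>p. l e) \<le> 2 * \<beta> \<Longrightarrow> Dst s u v \<beta> \<le> ereal ((\<Sum>e\<leftarrow>p. l e) + 2 * \<delta> * \<beta>)"
  by (rule near, rule below_scale[OF I p(1) len b])
 show "Dst s u v \<beta> \<le> ereal ((\<Sum>e\<leftarrow>p. l e) + 2 * \<delta> * \<beta>) \<or> Dst s u v \<beta> = \<infinity>"
 proof (cases "(\<Sum>e\<leftarrow>p. l e) < 4 * beta (scale (warr s 23) \<beta>)")
  case True then show ?thesis using near by blast
 next
  case False
  then have "ereal (4 * beta (scale (warr s 23) \<beta>) + 2 * \<delta> * \<beta>) \<le> ereal ((\<Sum>e\<leftarrow>p. l e) + 2 * \<delta> * \<beta>)" by simp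
  then show ?thesis using Dst_cap[OF b(1) D, of s u v] order_trans by blast
 qed
qed

text \<open>Queries write none of the arrays on which \<open>Dst\<close> and \<open>Phi\<close>
  depend; hence they preserve the answers and need not be paid for by the potential.\<close>

lemma same_answers:
 assumes I: "inv s l" and ag: "agrees c s s'" and c: "mw c \<inter> {0, 1, 6, 7, 8} = {}" "0 \<notin> mr c" "2 \<notin> mb c" "0 \<notin> mb c"
  "ma c \<inter> {4, 7, 8, 9, 10, 11, 12, 13, 14, 15, 17, 18, 19, 22, 23} = {}"
 shows "inv s' l" "Dst s' = Dst s" "Phi s' l = Phi s l" "rarr s' 0 = rarr s 0"
proof -
 note I' = inv_agrees[OF I ag c(1-3,5)]
 show "inv s' l" by (rule I'(1))
 have w: "warr s' 23 = warr s 23" "warr s' 18 = warr s 18" "warr s' 19 = warr s 19" "rarr s' 0 = rarr s 0"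
 proof -
  have "23 \<notin> ma c" "18 \<notin> ma c" "19 \<notin> ma c" using c(5) by auto
  then show "warr s' 23 = warr s 23" "warr s' 18 = warr s 18" "warr s' 19 = warr s 19" "rarr s' 0 = rarr s 0"
   using ag c(4) by (simp_all add: agrees_def)
 qed
 show "rarr s' 0 = rarr s 0" by (rule w(4))
 show "Dst s' = Dst s" by (simp add: fun_eq_iff Dst_def Dm_def cand_def dval_def dsum_def I'(2) w)
 show "Phi s' l = Phi s l" by (simp add: Phi_def treepot_def ipot_def w)
qed

end

section \<open>The graph and the requests\<close>

fun prog :: "request \<Rightarrow> com" where
 "prog (Distance _ _ _) = distance_query"
| "prog (Increase _ _) = increase"
| "prog (Path _ _ _) = path_query"
| "prog (SSrcDist _ _) = ssrc_query"

fun time_ok :: "nat \<Rightarrow> nat \<Rightarrow> nat \<Rightarrow> request \<Rightarrow> nat \<Rightarrow> bool" where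
 "time_ok n m L (SSrcDist _ _) t \<longleftrightarrow> t \<le> 1200 * L * (L + 2) * (n + 2 * m)"
| "time_ok n m L (Increase _ _) t \<longleftrightarrow> True"
| "time_ok n m L _ t \<longleftrightarrow> t \<le> 1000 * n * L"

text \<open>The parameter \<open>\<delta>\<close> of this locale is the internal one; the
  specification is met for \<open>2 * \<delta>\<close>. \<open>S\<close> is the family
  \<open>hubs\<close> written as a set of codes \<open>j * n + w\<close>.\<close>

locale adsp_setup = machine_setup n m L NI Dl W "tail G" "head G" \<delta> Mmin S
 for n m L NI Dl W and G :: "(nat, nat) pre_digraph" and \<delta> Mmin S +
 fixes pairs :: "(nat \<times> nat) list" and Mmax :: real and hubs :: "nat \<Rightarrow> nat set"
 assumes V: "verts G = {..<n}" and A: "arcs G = {..<m}" and no_loop: "(a, b) \<in> set pairs \<Longrightarrow> a \<noteq> b"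
  and Dl_eq: "Dl = nat \<lfloor>4 / \<delta>\<rfloor> + 2" and L_tight: "2 ^ (L - 1) < n" "2 ^ L \<le> 2 * n" and L_eq: "L = num_levels n"
  and M: "2 ^ NI * Mmin \<le> Mmax" "Mmax < 2 ^ (NI + 1) * Mmin"
  and S_eq: "S = {q \<in> {n..<Suc L * n}. q mod n \<in> hubs (q div n)}"
begin

lemma cas_wk: "pre_digraph.cas G u p v \<and> set p \<subseteq> arcs G \<longleftrightarrow> wk u p v"
 by (induction p arbitrary: u) (auto simp: pre_digraph.cas.simps A)

lemma verts_vs: "wk u p v \<Longrightarrow> pre_digraph.awalk_verts G u p = vs u p"
proof (induction p arbitrary: u)
 case (Cons e p)
 then have "pre_digraph.awalk_verts G (head G e) p = vs (head G e) p" by simp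
 then show ?case using Cons.prems by (simp add: pre_digraph.awalk_verts.simps vs_def)
qed (simp add: pre_digraph.awalk_verts.simps vs_def)

lemma apath_wk: "pre_digraph.apath G u p v \<longleftrightarrow> u < n \<and> wk u p v \<and> distinct (vs u p)"
 unfolding pre_digraph.apath_def pre_digraph.awalk_def V using cas_wk[of u p v] verts_vs[of u p v] by auto

text \<open>Finiteness turns the infimum in \<open>shortest_in\<close> into a minimum, attained by a
  path that passes through a hub.\<close>

lemma finite_paths: "finite {p. pre_digraph.apath G u p v}"
proof (rule finite_subset)
 show "{p. pre_digraph.apath G u p v} \<subseteq> {p. set p \<subseteq> {..<m} \<and> length p \<le> n}"
  using cas_wk distinct_vs_length A by (fastforce simp: apath_wk)
 show "finite {p. set p \<subseteq> {..<m} \<and> length p \<le> n}" by (rule finite_lists_length_le) simp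
qed

text \<open>Sources differ from sinks, so the path is nonempty and its first arc determines the
  start vertex; the hub supplied by \<open>hub_paths\<close> therefore lies on the path as seen from
  \<open>u\<close>.\<close>

lemma path_hub:
 assumes p: "p \<in> hub_paths G pairs hubs" "pre_digraph.apath G u p v"
 obtains q where "q \<in> S" "q mod n \<in> set (vs u p)" "length p \<le> 2 ^ (q div n)"
proof -
 have n: "card (verts G) = n" by (simp add: V)
 obtain j u' v' w where j: "j \<in> {1..L}" "length p \<le> 2 ^ j" "p \<in> pair_paths G pairs" "pre_digraph.apath G u' p v'"
  "w \<in> set (pre_digraph.awalk_verts G u' p)" "w \<in> hubs j"
  using p(1) unfolding hub_paths_def short_paths_through_def n L_eq[symmetric] by blast
 have "p \<noteq> []"
 proof
  assume "p = []"
  with j(3) obtain a b where "(a, b) \<in> set pairs" "wk a [] b" unfolding pair_paths_def apath_wk by auto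
  then show False using no_loop by auto
 qed
 moreover have wks: "wk u p v" "wk u' p v'" "u' < n" using p(2) j(4) by (auto simp: apath_wk)
 ultimately have "u' = u" by (cases p) auto
 then have w: "w \<in> set (vs u p)" using j(5) verts_vs wks by simp
 then have wn: "w < n" using wk_less[OF wks(1)] \<open>u' = u\<close> wks(3) by blast
 note hc = hub_code[OF j(1) wn]
 have "j * n + w \<in> S" unfolding S_eq using hc j(6) by simp
 then show ?thesis using that[of "j * n + w"] hc w j(2) by simp
qed

lemma okc_range: "\<beta> \<in> {Mmin..Mmax / 2} \<Longrightarrow> okc \<beta> 0 \<and> 2 * \<beta> \<le> Mmax"
 using NI1 by (simp add: okc_def beta_def)

lemma Dl_upper: "real Dl \<le> 4 / \<delta> + 2"
proof -
 have "0 \<le> 4 / \<delta>" using delta0 by simp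
 then show ?thesis unfolding Dl_eq by linarith
qed

lemma spec:
 assumes I: "inv s l"
 shows "distance_spec G (2 * \<delta>) Mmax Mmin (hub_paths G pairs hubs) l (Dst s)"
 unfolding distance_spec_def Let_def
proof (intro ballI)
 fix u v \<beta> assume uv: "u \<in> verts G" "v \<in> verts G" and b: "\<beta> \<in> {Mmin..Mmax / 2}"
 let ?P = "{p \<in> hub_paths G pairs hubs. pre_digraph.apath G u p v}"
 let ?d = "shortest_in G (hub_paths G pairs hubs) l u v"
 note b' = okc_range[OF b]
 have near: "(\<Sum>e\<leftarrow>p. l e) \<le> 2 * \<beta> \<Longrightarrow> Dst s u v \<beta> \<le> ereal ((\<Sum>e\<leftarrow>p. l e) + 2 * \<delta> * \<beta>)"
  "Dst s u v \<beta> \<le> ereal ((\<Sum>e\<leftarrow>p. l e) + 2 * \<delta> * \<beta>) \<or> Dst s u v \<beta> = \<infinity>" if p: "p \<in> ?P" for p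
 proof -
  obtain q where q: "q \<in> S" "q mod n \<in> set (vs u p)" "length p \<le> 2 ^ (q div n)" by (rule path_hub[of p u v]) (use p in auto)
  have "wk u p v" "u < n" "distinct (vs u p)" using p by (auto simp: apath_wk)
  note * = Dst_correct[OF I b'[THEN conjunct1] b'[THEN conjunct2] M(2) Dl_upper this q]
  show "(\<Sum>e\<leftarrow>p. l e) \<le> 2 * \<beta> \<Longrightarrow> Dst s u v \<beta> \<le> ereal ((\<Sum>e\<leftarrow>p. l e) + 2 * \<delta> * \<beta>)"
   "Dst s u v \<beta> \<le> ereal ((\<Sum>e\<leftarrow>p. l e) + 2 * \<delta> * \<beta>) \<or> Dst s u v \<beta> = \<infinity>" by (fact *)+
 qed
 show "if ?d \<le> ereal (2 * \<beta>) then Dst s u v \<beta> \<le> ?d + ereal (2 * \<delta> * \<beta>)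
  else Dst s u v \<beta> \<le> ?d + ereal (2 * \<delta> * \<beta>) \<or> Dst s u v \<beta> = \<infinity>"
 proof (cases "?P = {}")
  case True
  have "?d = \<infinity>" unfolding shortest_in_def True by (simp add: top_ereal_def)
  then show ?thesis by simp
 next
  case False
  let ?E = "(\<lambda>p. ereal (\<Sum>e\<leftarrow>p. l e)) ` ?P"
  have fin: "finite ?E" using finite_paths[of u v] by (intro finite_imageI) (rule finite_subset[rotated], auto)
  have "?d = Min ?E" unfolding shortest_in_def using fin False by (intro cInf_eq_Min) auto
  moreover have "Min ?E \<in> ?E" using fin False by (intro Min_in) auto
  ultimately obtain p where p: "p \<in> ?P" "?d = ereal (\<Sum>e\<leftarrow>p. l e)" by auto
  show ?thesis using near[OF p(1)] unfolding p(2) by auto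
 qed
qed

definition ok :: "machine_state \<Rightarrow> (nat \<Rightarrow> real) \<Rightarrow> bool" where
 "ok s l \<longleftrightarrow> inv s l \<and> (\<forall>e<m. rarr s 0 e = l e)"

lemma load:
 assumes "inv s l"
 shows "inv (load_request r s) l" "Dst (load_request r s) = Dst s" "Phi (load_request r s) l = Phi s l" "rarr (load_request r s) 0 = rarr s 0"
proof -
 \<comment> \<open>A program that is never run: it only provides the frame of passing the arguments,
   so that \<open>same_answers\<close> applies.\<close>
 let ?c = "SetW 3 (WConst 0) ;; SetW 4 (WConst 0) ;; SetR 3 (RWord (WConst 0))"
 have ag: "agrees ?c s (load_request r s)" by (cases r) (auto simp: agrees_def)
 show "inv (load_request r s) l" "Dst (load_request r s) = Dst s" "Phi (load_request r s) l = Phi s l" "rarr (load_request r s) 0 = rarr s 0"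
  by (rule same_answers[OF assms ag]; simp)+
qed

lemma step:
 assumes ok: "ok s l" and r: "valid_request G Mmax Mmin r"
 shows "\<exists>t s'. exec W (prog r) (load_request r s) t s' \<and> ok s' (update_length l r) \<and> answer_spec G l (Dst s) r (read_answer r s') \<and>
  (\<not> is_increase r \<longrightarrow> Dst s' = Dst s \<and> Phi s' l = Phi s l) \<and>
  (is_increase r \<longrightarrow> t + Phi s' (update_length l r) \<le> Phi s l + 200) \<and> time_ok n m L r t"
proof -
 have I: "inv s l" and l: "\<forall>e<m. rarr s 0 e = l e" using ok by (auto simp: ok_def)
 let ?s = "load_request r s"
 note ld = load[OF I, of r]
 have q: "\<exists>t s'. exec W (prog r) ?s t s' \<and> ok s' (update_length l r) \<and> answer_spec G l (Dst s) r (read_answer r s') \<and>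
  (\<not> is_increase r \<longrightarrow> Dst s' = Dst s \<and> Phi s' l = Phi s l) \<and>
  (is_increase r \<longrightarrow> t + Phi s' (update_length l r) \<le> Phi s l + 200) \<and> time_ok n m L r t"
  if w: "wp W (prog r) (\<lambda>t s'. answer_spec G l (Dst s) r (read_answer r s') \<and> time_ok n m L r t) ?s"
   and c: "mw (prog r) \<inter> {0, 1, 6, 7, 8} = {}" "0 \<notin> mr (prog r)" "2 \<notin> mb (prog r)" "0 \<notin> mb (prog r)"
    "ma (prog r) \<inter> {4, 7, 8, 9, 10, 11, 12, 13, 14, 15, 17, 18, 19, 22, 23} = {}" and nr: "\<not> is_increase r"
 proof -
  obtain t s' where e: "exec W (prog r) ?s t s'" "answer_spec G l (Dst s) r (read_answer r s') \<and> time_ok n m L r t"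
   using w unfolding wp_def by blast
  note sa = same_answers[OF ld(1) exec_agrees[OF e(1)] c]
  have u: "update_length l r = l" using nr by (cases r) auto
  show ?thesis using e sa ld l nr unfolding u ok_def by (intro exI[of _ t] exI[of _ s']) simp
 qed
 show ?thesis
 proof (cases r)
  case (Distance u v \<beta>)
  have b: "okc \<beta> 0" "u < n" "v < n" using r okc_range unfolding Distance by (auto simp: V)
  have "wp W distance_query (\<lambda>t s'. decode_distance (wreg s' 5) (rreg s' 4) = Dst ?s u v \<beta> \<and> t \<le> 600 * n * L) ?s"
   by (intro distance_query[OF ld(1)]) (use b in \<open>simp_all add: Distance\<close>)
  then obtain t s' where e: "exec W distance_query ?s t s'" "decode_distance (wreg s' 5) (rreg s' 4) = Dst s u v \<beta>" "t \<le> 600 * n * L"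
   unfolding wp_def ld(2) by blast
  have "600 * n * L \<le> 1000 * n * L" by (intro mult_le_mono) auto
  then have t: "t \<le> 1000 * n * L" using e(3) by (rule order_trans[rotated])
  have w: "wp W (prog r) (\<lambda>t s'. answer_spec G l (Dst s) r (read_answer r s') \<and> time_ok n m L r t) ?s"
   unfolding wp_def by (intro exI[of _ t] exI[of _ s']) (use e(1,2) t in \<open>simp add: Distance\<close>)
  show ?thesis by (rule q[OF w]) (simp_all add: Distance)
 next
  case (Path u v \<beta>)
  have b: "okc \<beta> 0" "u < n" "v < n" using r okc_range unfolding Path by (auto simp: V)
  have "wp W path_query (\<lambda>t s'. (Dst ?s u v \<beta> \<noteq> \<infinity> \<longrightarrow> (\<exists>p. map (warr s' 6) [0..<wreg s' 5] = p \<and> wk u p v \<and>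
    distinct (vs u p) \<and> ereal (\<Sum>e\<leftarrow>p. l e) \<le> Dst ?s u v \<beta>)) \<and> t \<le> 1000 * n * L) ?s"
   by (intro path_query[OF ld(1)]) (use b in \<open>simp_all add: Path\<close>)
  then obtain t s' where e: "exec W path_query ?s t s'" "Dst s u v \<beta> \<noteq> \<infinity> \<longrightarrow> (\<exists>p. map (warr s' 6) [0..<wreg s' 5] = p \<and> wk u p v \<and>
    distinct (vs u p) \<and> ereal (\<Sum>e\<leftarrow>p. l e) \<le> Dst s u v \<beta>)" "t \<le> 1000 * n * L"
   unfolding wp_def ld(2) by blast
  have w: "wp W (prog r) (\<lambda>t s'. answer_spec G l (Dst s) r (read_answer r s') \<and> time_ok n m L r t) ?s"
   unfolding wp_def by (intro exI[of _ t] exI[of _ s']) (use e b in \<open>simp add: Path apath_wk\<close>)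
  show ?thesis by (rule q[OF w]) (simp_all add: Path)
 next
  case (SSrcDist u \<beta>)
  have b: "okc \<beta> 0" "u < n" using r okc_range unfolding SSrcDist by (auto simp: V)
  have "wp W ssrc_query (\<lambda>t s'. (\<forall>v<n. decode_distance (warr s' 5 v) (rarr s' 1 v) = Dst ?s u v \<beta>) \<and>
   t \<le> 1200 * L * (L + 2) * (n + 2 * m)) ?s"
   by (intro ssrc_query[OF ld(1)] L_tight(2)) (use b in \<open>simp_all add: SSrcDist\<close>)
  then obtain t s' where e: "exec W ssrc_query ?s t s'" "\<forall>v<n. decode_distance (warr s' 5 v) (rarr s' 1 v) = Dst s u v \<beta>"
   "t \<le> 1200 * L * (L + 2) * (n + 2 * m)" unfolding wp_def ld(2) by blast
  have tk: "time_ok n m L r t" unfolding SSrcDist time_ok.simps by (rule e(3))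
  have w: "wp W (prog r) (\<lambda>t s'. answer_spec G l (Dst s) r (read_answer r s') \<and> time_ok n m L r t) ?s"
   unfolding wp_def by (intro exI[of _ t] exI[of _ s'] conjI tk) (use e(1,2) V in \<open>simp_all add: SSrcDist\<close>)
  show ?thesis by (rule q[OF w]) (simp_all add: SSrcDist)
 next
  case (Increase e \<omega>)
  have b: "e < m" "0 \<le> \<omega>" using r unfolding Increase by (auto simp: A)
  have up: "update_length l r = l(e := l e + \<omega>)" by (simp add: Increase)
  have "wp W increase (\<lambda>t s'. inv s' (l(e := l e + rreg ?s 3)) \<and> (\<forall>e'<m. rarr s' 0 e' = (l(e := l e + rreg ?s 3)) e') \<and>
   t + Phi s' (l(e := l e + rreg ?s 3)) \<le> Phi ?s l + 200) ?s"
   using b ld(4) l by (intro increase[OF ld(1)]) (simp_all add: Increase)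
  moreover have "rreg ?s 3 = \<omega>" "prog r = increase" "is_increase r" "answer_spec G l (Dst s) r x" "time_ok n m L r t" for x t
   by (simp_all add: Increase)
  ultimately show ?thesis unfolding wp_def ok_def up ld(3) by auto
 qed
qed

end

section \<open>The random sets\<close>

lemma hub_prob_range: "2 \<le> n \<Longrightarrow> 0 \<le> hub_prob n j \<and> hub_prob n j \<le> 1"
 by (simp add: hub_prob_def)

text \<open>With finite support every function of the hub sets is integrable, including times that
  depend on arbitrarily chosen histories.\<close>

lemma finite_hub_sets: "finite (set_pmf (hub_sets n))"
 unfolding hub_sets_def set_map_pmf by (intro finite_imageI) (auto simp: set_Pi_pmf intro!: finite_PiE_dflt)

lemma expectation_hub:
 fixes c :: real
 assumes n: "2 \<le> n" and j: "j \<in> {1..num_levels n}" and w: "w < n"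
 shows "measure_pmf.expectation (hub_sets n) (\<lambda>S. if w \<in> S j then c else 0) = hub_prob n j * c"
proof -
 let ?A = "{1..num_levels n} \<times> {..<n}"
 let ?P = "Pi_pmf ?A False (\<lambda>(j, v). bernoulli_pmf (hub_prob n j))"
 have "measure_pmf.expectation (hub_sets n) (\<lambda>S. if w \<in> S j then c else 0) = measure_pmf.expectation ?P (\<lambda>X. if X (j, w) then c else 0)"
  unfolding hub_sets_def by simp
 also have "\<dots> = measure_pmf.expectation (map_pmf (\<lambda>X. X (j, w)) ?P) (\<lambda>b. if b then c else 0)" by simp
 also have "map_pmf (\<lambda>X. X (j, w)) ?P = bernoulli_pmf (hub_prob n j)" using j w by (subst Pi_pmf_component) auto
 also have "measure_pmf.expectation (bernoulli_pmf (hub_prob n j)) (\<lambda>b. if b then c else 0) = hub_prob n j * c"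
  using hub_prob_range[OF n, of j] by (subst integral_bernoulli_pmf) auto
 finally show ?thesis .
qed

text \<open>Linearity of expectation reduces the sum to the marginals of the single
  coordinates.\<close>

lemma expectation_hubs:
 fixes f :: "nat \<Rightarrow> real"
 assumes n: "2 \<le> n"
 shows "measure_pmf.expectation (hub_sets n) (\<lambda>S. \<Sum>j\<in>{1..num_levels n}. \<Sum>w<n. if w \<in> S j then f j else 0) =
  (\<Sum>j\<in>{1..num_levels n}. real n * (hub_prob n j * f j))"
proof -
 have int: "integrable (measure_pmf (hub_sets n)) g" for g :: "(nat \<Rightarrow> nat set) \<Rightarrow> real"
  by (rule integrable_measure_pmf_finite[OF finite_hub_sets])
 have "measure_pmf.expectation (hub_sets n) (\<lambda>S. \<Sum>j\<in>{1..num_levels n}. \<Sum>w<n. if w \<in> S j then f j else 0) =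
  (\<Sum>j\<in>{1..num_levels n}. \<Sum>w<n. measure_pmf.expectation (hub_sets n) (\<lambda>S. if w \<in> S j then f j else 0))"
  using int by (simp add: Bochner_Integration.integral_sum)
 also have "\<dots> = (\<Sum>j\<in>{1..num_levels n}. \<Sum>w<n. hub_prob n j * f j)"
  using n by (intro sum.cong refl expectation_hub) auto
 finally show ?thesis by simp
qed

section \<open>The data structure\<close>

definition adsp_structure :: data_structure where
 "adsp_structure = \<lparr>init_prog = init, distance_prog = distance_query, increase_prog = increase,
  path_prog = path_query, ssrc_prog = ssrc_query\<rparr>"

lemma request_prog: "request_prog adsp_structure r = prog r"
 by (cases r) (simp_all add: adsp_structure_def)

lemma update_length_query: "\<not> is_increase r \<Longrightarrow> update_length l r = l"
 by (cases r) auto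

context adsp_setup
begin

text \<open>\<open>step\<close> provides one good run; since execution is deterministic, its
  properties hold for every transition of the server.\<close>

lemma serve_step:
 assumes ok: "ok s l" and r: "valid_request G Mmax Mmin r"
 shows "\<exists>a t s'. serve W adsp_structure r s a t s'"
  "serve W adsp_structure r s a t s' \<Longrightarrow> ok s' (update_length l r) \<and> answer_spec G l (Dst s) r a \<and>
   (\<not> is_increase r \<longrightarrow> Dst s' = Dst s \<and> Phi s' l = Phi s l) \<and>
   (is_increase r \<longrightarrow> t + Phi s' (update_length l r) \<le> Phi s l + 200) \<and> time_ok n m L r t"
proof -
 obtain t1 s1 where e: "exec W (prog r) (load_request r s) t1 s1" and post: "ok s1 (update_length l r)" "answer_spec G l (Dst s) r (read_answer r s1)"
  "\<not> is_increase r \<longrightarrow> Dst s1 = Dst s \<and> Phi s1 l = Phi s l"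
  "is_increase r \<longrightarrow> t1 + Phi s1 (update_length l r) \<le> Phi s l + 200" "time_ok n m L r t1"
  using step[OF ok r] by blast
 show "\<exists>a t s'. serve W adsp_structure r s a t s'" unfolding serve_def request_prog using e by blast
 assume sv: "serve W adsp_structure r s a t s'"
 then have "exec W (prog r) (load_request r s) t s'" "a = read_answer r s'" by (auto simp: serve_def request_prog)
 moreover from exec_deterministic[OF e this(1)] have "t = t1" "s' = s1" by auto
 ultimately show "ok s' (update_length l r) \<and> answer_spec G l (Dst s) r a \<and>
   (\<not> is_increase r \<longrightarrow> Dst s' = Dst s \<and> Phi s' l = Phi s l) \<and>
   (is_increase r \<longrightarrow> t + Phi s' (update_length l r) \<le> Phi s l + 200) \<and> time_ok n m L r t"
  using post by simp
qed

text \<open>Coinduction over the states with intact invariant, with \<open>D\<close> read off the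
  state.\<close>

lemma adsp_ok:
 assumes "ok s l"
 shows "adsp_state G (2 * \<delta>) Mmax Mmin (hub_paths G pairs hubs) (serve W adsp_structure) l (Dst s) s"
proof -
 define X where "X = (\<lambda>l D s. ok s l \<and> D = Dst s)"
 have "X l (Dst s) s" using assms by (simp add: X_def)
 then show ?thesis
 proof (rule adsp_state.coinduct, goal_cases)
  case (1 l D s)
  then have ok: "ok s l" and D: "D = Dst s" by (auto simp: X_def)
  have c1: "distance_spec G (2 * \<delta>) Mmax Mmin (hub_paths G pairs hubs) l D"
   unfolding D by (rule spec) (use ok in \<open>simp add: ok_def\<close>)
  have c2: "\<exists>a t s'. serve W adsp_structure r s a t s'" if "valid_request G Mmax Mmin r" for r
   by (rule serve_step(1)[OF ok that])
  have c3: "answer_spec G l D r a" if "valid_request G Mmax Mmin r" "serve W adsp_structure r s a t s'" for r a t s'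
   using serve_step(2)[OF ok that] D by blast
  have c4: "\<exists>D'. (is_increase r \<or> D' = D) \<and> X (update_length l r) D' s'"
   if "valid_request G Mmax Mmin r" "serve W adsp_structure r s a t s'" for r a t s'
   using serve_step(2)[OF ok that] unfolding X_def D by (intro exI[of _ "Dst s'"]) auto
  show ?case
   apply (rule exI[of _ l], rule exI[of _ D], rule exI[of _ s])
   apply (intro conjI refl)
    apply (rule c1)
    apply (intro allI impI, erule c2)
   apply (intro allI impI, erule (1) c3)
   apply (intro allI impI, drule (1) c4, elim exE conjE)
   subgoal for r a t s' D' by (rule exI[of _ D']) (intro conjI disjI1[of "X _ _ _"])
   done
 qed
qed

text \<open>The potential telescopes along the session: an increase costs at most 200 plus what it
  takes from \<open>Phi\<close>, and queries leave \<open>Phi\<close> unchanged.\<close>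

lemma session_ok:
 assumes ok: "ok s0 l" and v: "\<And>as. valid_request G Mmax Mmin (\<sigma> as)"
 shows "\<exists>h s l'. session (serve W adsp_structure) \<sigma> s0 h s \<and> ok s l' \<and> length h = N \<and>
  (\<forall>(r, a, t)\<in>set h. time_ok n m L r t) \<and> increase_time h + Phi s l' \<le> Phi s0 l + 200 * num_increases h"
proof (induction N)
 case 0
 show ?case
  by (rule exI[of _ "[]"], rule exI[of _ s0], rule exI[of _ l])
   (use ok in \<open>simp add: session_Nil increase_time_def num_increases_def\<close>)
next
 case (Suc N)
 then obtain h s l' where h: "session (serve W adsp_structure) \<sigma> s0 h s" "ok s l'" "length h = N"
  "\<forall>(r, a, t)\<in>set h. time_ok n m L r t" "increase_time h + Phi s l' \<le> Phi s0 l + 200 * num_increases h" by blast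
 define r where "r = \<sigma> (map (\<lambda>(_, a, _). a) h)"
 have r: "valid_request G Mmax Mmin r" using v by (simp add: r_def)
 obtain a t s' where st: "serve W adsp_structure r s a t s'" using serve_step(1)[OF h(2) r] by blast
 note post = serve_step(2)[OF h(2) r st]
 have p1: "is_increase r \<longrightarrow> t + Phi s' (update_length l' r) \<le> Phi s l' + 200" "\<not> is_increase r \<longrightarrow> Phi s' l' = Phi s l'"
  using post by blast+
 have time: "increase_time (h @ [(r, a, t)]) + Phi s' (update_length l' r) \<le> Phi s0 l + 200 * num_increases (h @ [(r, a, t)])"
 proof (cases "is_increase r")
  case True
  then have "increase_time (h @ [(r, a, t)]) = increase_time h + t" "num_increases (h @ [(r, a, t)]) = num_increases h + 1"
   by (simp_all add: increase_time_def num_increases_def)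
  then show ?thesis using h(5) p1(1) True by linarith
 next
  case False
  then have "increase_time (h @ [(r, a, t)]) = increase_time h" "num_increases (h @ [(r, a, t)]) = num_increases h"
   by (simp_all add: increase_time_def num_increases_def)
  then show ?thesis using h(5) p1(2) False by (simp only: update_length_query[OF False] simp_thms)
 qed
 show ?case
 proof (rule exI[of _ "h @ [(r, a, t)]"], rule exI[of _ s'], rule exI[of _ "update_length l' r"], intro conjI)
  show "session (serve W adsp_structure) \<sigma> s0 (h @ [(r, a, t)]) s'" by (rule session_snoc[OF h(1) r_def st])
  show "ok s' (update_length l' r)" using post by blast
  show "length (h @ [(r, a, t)]) = Suc N" using h(3) by simp
  have "time_ok n m L r t" using post by blast
  then show "\<forall>(r, a, t)\<in>set (h @ [(r, a, t)]). time_ok n m L r t" using h(4) by simp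
 qed (rule time)
qed

text \<open>The codes are translated back into pairs of level and vertex, the form in which the
  expectation is taken.\<close>

lemma hubsize_eq: "hubsize = (\<Sum>j\<in>{1..L}. \<Sum>w<n. if w \<in> hubs j then Bd j + 1 else 0)"
proof -
 have n0: "0 < n" using n2 by simp
 have "hubsize = (\<Sum>q\<in>{q \<in> {n..<Suc L * n}. q mod n \<in> hubs (q div n)}. Bd (q div n) + 1)"
  unfolding hubsize_def by (rule sum.cong[OF S_eq refl])
 also have "\<dots> = (\<Sum>q\<in>{n..<Suc L * n}. if q mod n \<in> hubs (q div n) then Bd (q div n) + 1 else 0)"
  by (rule sum.inter_filter) simp
 also have "\<dots> = (\<Sum>(j, w)\<in>{1..L} \<times> {..<n}. if w \<in> hubs j then Bd j + 1 else 0)"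
 proof (rule sum.reindex_bij_witness[of _ "\<lambda>(j, w). j * n + w" "\<lambda>q. (q div n, q mod n)"])
  fix q assume q: "q \<in> {n..<Suc L * n}"
  then have "q div n < Suc L" by (simp add: less_mult_imp_div_less del: mult_Suc)
  moreover have "1 \<le> q div n" using div_le_mono[of n q n] q n0 by simp
  ultimately show "(q div n, q mod n) \<in> {1..L} \<times> {..<n}" using n0 by simp
  show "(case (q div n, q mod n) of (j, w) \<Rightarrow> j * n + w) = q" by simp
  show "(case (q div n, q mod n) of (j, w) \<Rightarrow> if w \<in> hubs j then Bd j + 1 else 0) =
   (if q mod n \<in> hubs (q div n) then Bd (q div n) + 1 else 0)" by simp
 next
  fix x assume "x \<in> {1..L} \<times> {..<n}"
  then obtain j w where x: "x = (j, w)" "j \<in> {1..L}" "w < n" by auto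
  show "(case x of (j, w) \<Rightarrow> j * n + w) \<in> {n..<Suc L * n}" using hub_code(3)[OF x(2,3)] by (simp only: x prod.case)
  show "((case x of (j, w) \<Rightarrow> j * n + w) div n, (case x of (j, w) \<Rightarrow> j * n + w) mod n) = x"
   using hub_code(1,2)[OF x(2,3)] by (simp only: x prod.case)
 qed
 finally show ?thesis by (simp only: sum.cartesian_product)
qed

lemma run:
 assumes l: "\<And>e. e \<in> arcs G \<Longrightarrow> 0 < l e"
 shows "\<exists>t s. exec W init (input_state G pairs (2 * \<delta>) Mmax Mmin l hubs) t s \<and>
  adsp G (2 * \<delta>) Mmax Mmin (hub_paths G pairs hubs) (serve W adsp_structure) l s \<and>
  (\<forall>\<sigma> N. (\<forall>as. valid_request G Mmax Mmin (\<sigma> as)) \<longrightarrow> (\<exists>h s'. session (serve W adsp_structure) \<sigma> s h s' \<and> length h = N \<and>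
   (\<forall>(r, a, t)\<in>set h. time_ok n m L r t) \<and>
   t + increase_time h \<le> 2000 * (NI * ((n + m) * ((\<Sum>j\<in>{1..L}. \<Sum>w<n. if w \<in> hubs j then Dl * 2 ^ j + 1 else 0) + (L + 1) * (Dl * 2 ^ L + n)))) +
    200 * num_increases h))"
proof -
 let ?s = "input_state G pairs (2 * \<delta>) Mmax Mmin l hubs"
 have c: "card (verts G) = n" "card (arcs G) = m" by (simp_all add: V A)
 have S4: "warr ?s 4 q = (if q \<in> S then 1 else 0)" if q: "q \<in> {n..<Suc L * n}" for q
 proof -
  have "q div n < Suc L" using q by (simp add: less_mult_imp_div_less del: mult_Suc)
  moreover have "1 \<le> q div n" using div_le_mono[of n q n] q n2 by simp
  ultimately have "q div n \<in> {1..num_levels n}" by (simp add: L_eq[symmetric])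
  then show ?thesis using q by (simp add: input_state_def Let_def c S_eq del: mult_Suc)
 qed
 have i1: "wreg ?s 0 = n" "wreg ?s 1 = m" "rreg ?s 0 = 2 * \<delta>" "rreg ?s 1 = Mmax" "rreg ?s 2 = Mmin"
  by (simp_all add: input_state_def Let_def c)
 have i2: "warr ?s 0 e = tail G e \<and> warr ?s 1 e = head G e" if "e < m" for e using that by (simp add: input_state_def Let_def c)
 have i3: "warr ?s a x = 0" if "a \<in> {8, 12, 14, 17, 18, 19, 22, 23}" for a x using that by (auto simp: input_state_def Let_def)
 have i4: "rarr ?s 0 e = l e \<and> 0 \<le> l e" if "e < m" for e using that l[of e] by (simp add: input_state_def Let_def c A)
 obtain t s where e: "exec W init ?s t s" and p: "inv s l \<and> (\<forall>e<m. rarr s 0 e = l e) \<and>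
  t + Phi s l \<le> 2000 * (NI * ((n + m) * (hubsize + (L + 1) * (Bd L + n))))"
  by (rule wpE[OF init[OF i1 i2 S4 i3 i4 L_tight(1) M Dl_eq]])
 have ok: "ok s l" using p by (simp add: ok_def)
 have ss: "\<exists>h s'. session (serve W adsp_structure) \<sigma> s h s' \<and> length h = N \<and> (\<forall>(r, a, t)\<in>set h. time_ok n m L r t) \<and>
   t + increase_time h \<le> 2000 * (NI * ((n + m) * (hubsize + (L + 1) * (Bd L + n)))) + 200 * num_increases h"
  if v: "\<forall>as. valid_request G Mmax Mmin (\<sigma> as)" for \<sigma> N
 proof -
  obtain h s' l' where h: "session (serve W adsp_structure) \<sigma> s h s'" "length h = N"
   "\<forall>(r, a, t)\<in>set h. time_ok n m L r t" "increase_time h + Phi s' l' \<le> Phi s l + 200 * num_increases h"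
   using session_ok[OF ok, of \<sigma> N] v by blast
  then have "t + increase_time h \<le> 2000 * (NI * ((n + m) * (hubsize + (L + 1) * (Bd L + n)))) + 200 * num_increases h"
   using p by linarith
  then show ?thesis by (intro exI[of _ h] exI[of _ s'] conjI h(1-3))
 qed
 have "adsp G (2 * \<delta>) Mmax Mmin (hub_paths G pairs hubs) (serve W adsp_structure) l s"
  unfolding adsp_def by (rule exI, rule adsp_ok[OF ok])
 then show ?thesis
  by (intro exI[of _ t] exI[of _ s] conjI allI impI e) (assumption, erule ss[unfolded hubsize_eq Bd_def])
qed

end

section \<open>Parameters\<close>

lemma levels:
 assumes n: "2 \<le> n"
 shows "1 \<le> num_levels n" "n \<le> 2 ^ num_levels n" "2 ^ (num_levels n - 1) < n" "2 ^ num_levels n \<le> 2 * n"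
  "real (num_levels n) \<le> 1 + log 2 (real n)" "num_levels n \<le> n"
proof -
 define L where "L = num_levels n"
 have lg: "1 \<le> log 2 (real n)" using n by (simp add: le_log_iff)
 have L1: "log 2 (real n) \<le> real L" unfolding L_def num_levels_def by (rule real_nat_ceiling_ge)
 have L2: "real L < log 2 (real n) + 1" unfolding L_def num_levels_def using lg by linarith
 show L3: "1 \<le> num_levels n" using lg L1 unfolding L_def by linarith
 have "real n \<le> 2 powr real L" using L1 n by (simp add: log_le_iff)
 then have "real n \<le> real (2 ^ L)" by (simp add: powr_realpow)
 then show "n \<le> 2 ^ num_levels n" unfolding L_def of_nat_le_iff .
 have "real (L - 1) < log 2 (real n)" using L2 L3 by (simp add: L_def of_nat_diff)
 then have "2 powr real (L - 1) < real n" using n by (simp add: less_log_iff)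
 then have "real (2 ^ (L - 1)) < real n" by (simp add: powr_realpow)
 then show L4: "2 ^ (num_levels n - 1) < n" unfolding L_def of_nat_less_iff .
 have "(2::nat) ^ num_levels n = 2 * 2 ^ (num_levels n - 1)" using L3 by (cases "num_levels n") auto
 then show "2 ^ num_levels n \<le> 2 * n" using L4 by linarith
 show "real (num_levels n) \<le> 1 + log 2 (real n)" using L2 by (simp add: L_def)
 have "num_levels n - 1 < 2 ^ (num_levels n - 1)" by (rule less_exp)
 then show "num_levels n \<le> n" using L3 L4 by linarith
qed

lemma scales:
 fixes Mmax Mmin :: real
 assumes M: "2 * Mmin \<le> Mmax" "0 < Mmin" and NI: "NI = nat \<lfloor>log 2 (Mmax / Mmin)\<rfloor>"
 shows "1 \<le> NI" "2 ^ NI * Mmin \<le> Mmax" "Mmax < 2 ^ (NI + 1) * Mmin" "real NI \<le> log 2 (Mmax / Mmin)" "1 \<le> log 2 (Mmax / Mmin)"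
proof -
 define x where "x = Mmax / Mmin"
 have x: "2 \<le> x" "Mmax = x * Mmin" using M by (auto simp: x_def field_simps)
 show lg: "1 \<le> log 2 (Mmax / Mmin)" using x(1) by (simp add: x_def[symmetric] le_log_iff)
 then show "1 \<le> NI" unfolding NI by linarith
 show up: "real NI \<le> log 2 (Mmax / Mmin)" unfolding NI using lg by linarith
 then have "2 powr real NI \<le> x" using x(1) by (simp add: x_def[symmetric] le_log_iff)
 then show "2 ^ NI * Mmin \<le> Mmax" using M x by (simp add: powr_realpow)
 have "log 2 x < real (NI + 1)" unfolding NI x_def using lg by linarith
 then have "x < 2 powr real (NI + 1)" using x by (subst (asm) log_less_iff) auto
 then have "x < 2 ^ (NI + 1)" by (simp only: powr_realpow)
 then show "Mmax < 2 ^ (NI + 1) * Mmin" using M x by simp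
qed

text \<open>Every quantity involved is at most a constant times a small power of the base
  \<open>b\<close>; all three products are at most \<open>42000 * b ^ 4\<close>.\<close>

lemma word_bounds:
 fixes \<delta> Mmax Mmin :: real
 assumes n: "2 \<le> n" and m: "m \<le> n * n" and d: "0 < \<delta>" "\<delta> < 1" and M: "2 * Mmin \<le> Mmax" "0 < Mmin"
  and NI: "NI = nat \<lfloor>log 2 (Mmax / Mmin)\<rfloor>" and Dl: "Dl = nat \<lfloor>8 / \<delta>\<rfloor> + 2"
 defines "W \<equiv> word_bound 13 n \<delta> Mmax Mmin" and "L \<equiv> num_levels n"
 shows "Suc NI * (Suc L * n) * (2 * n) < W" "Suc NI * Suc L * (2 * m) < W" "(Dl * 2 ^ L + 1) * (1000 * (n + m)) < W"
proof -
 define x where "x = real n + 1 / \<delta> + log 2 (Mmax / Mmin)"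
 define b where "b = nat \<lceil>x\<rceil>"
 have W: "W = b ^ 13" by (simp add: W_def word_bound_def b_def x_def)
 note sc = scales[OF M NI]
 have d1: "1 < 1 / \<delta>" using d by simp
 have xb: "x \<le> real b" unfolding b_def by (rule real_nat_ceiling_ge)
 have b: "n \<le> b" "NI + 1 \<le> b" "1 / \<delta> \<le> real b" "4 \<le> b"
 proof -
  show "n \<le> b" "NI + 1 \<le> b" "1 / \<delta> \<le> real b" "4 \<le> b" using xb sc(4,5) d1 n unfolding x_def by linarith+
 qed
 have L1: "Suc L \<le> 2 * b" using levels(6)[OF n] b(1,4) by (simp add: L_def)
 have "2 ^ L \<le> 2 * n" unfolding L_def by (rule levels(4)[OF n])
 also have "\<dots> \<le> 2 * b" using b(1) by simp
 finally have L2: "2 ^ L \<le> 2 * b" .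
 note L = L1 L2
 have "0 \<le> 8 / \<delta>" using d by simp
 then have "real Dl \<le> 8 / \<delta> + 2" unfolding Dl by linarith
 then have "real Dl \<le> 8 * (1 / \<delta>) + 2" by simp
 also have "\<dots> \<le> real (10 * b)" using b(3,4) by simp
 finally have D: "Dl \<le> 10 * b" by (simp only: of_nat_le_iff)
 have mb: "m \<le> b * b" using m mult_le_mono[OF b(1) b(1)] by simp
 have p0: "4 ^ k \<le> b ^ k" for k using b(4) by (rule power_mono) simp
 \<comment> \<open>This fixes the exponent 13: as \<open>b \<ge> 4\<close>, eight factors
   \<open>b\<close> absorb every constant up to \<open>4 ^ 8 = 65536\<close>, and one more makes the
   inequality strict.\<close>
 have big: "c * b ^ 4 < W" if "c \<le> 65536" for c
 proof -
  have "c \<le> b ^ 8" using that p0[of 8] by simp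
  then have "c * b ^ 4 \<le> b ^ 8 * b ^ 4" by (rule mult_le_mono1)
  also have "\<dots> = b ^ 12" by (simp add: power_add[symmetric])
  also have "\<dots> < b ^ 13" using b(4) by (intro power_strict_increasing) auto
  finally show ?thesis by (simp add: W)
 qed
 have "Suc NI * (Suc L * n) * (2 * n) \<le> b * (2 * b * b) * (2 * b)" using b L by (intro mult_le_mono) auto
 also have "\<dots> = 4 * b ^ 4" by (simp add: power4_eq_xxxx)
 also have "\<dots> < W" by (rule big) simp
 finally show "Suc NI * (Suc L * n) * (2 * n) < W" .
 have "Suc NI * Suc L * (2 * m) \<le> b * (2 * b) * (2 * (b * b))" using b L mb by (intro mult_le_mono) auto
 also have "\<dots> = 4 * b ^ 4" by (simp add: power4_eq_xxxx)
 also have "\<dots> < W" by (rule big) simp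
 finally show "Suc NI * Suc L * (2 * m) < W" .
 have b1: "1 \<le> b" using b(4) by simp
 have "Dl * 2 ^ L + 1 \<le> 10 * b * (2 * b) + b * b" using D L by (intro add_mono mult_le_mono order_trans[OF b1 le_square]) auto
 also have "\<dots> = 21 * (b * b)" by simp
 finally have "Dl * 2 ^ L + 1 \<le> 21 * (b * b)" .
 moreover have "1000 * (n + m) \<le> 1000 * (b * b + b * b)" using mb by (intro mult_le_mono2 add_mono order_trans[OF b(1) le_square]) auto
 then have "1000 * (n + m) \<le> 2000 * (b * b)" by simp
 ultimately have "(Dl * 2 ^ L + 1) * (1000 * (n + m)) \<le> 21 * (b * b) * (2000 * (b * b))" by (rule mult_le_mono)
 also have "\<dots> = 42000 * b ^ 4" by (simp add: power4_eq_xxxx)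
 also have "\<dots> < W" by (rule big) simp
 finally show "(Dl * 2 ^ L + 1) * (1000 * (n + m)) < W" .
qed

context commodity_graph
begin

lemma finite_graph: "finite (verts G)" "finite (arcs G)"
 by (subst verts_numbered, simp) (subst arcs_numbered, simp)

text \<open>Without parallel arcs an arc is determined by its ends. Loops are possible, hence the
  full square.\<close>

lemma few_arcs: "card (arcs G) \<le> card (verts G) * card (verts G)"
proof -
 have "inj_on (arc_to_ends G) (arcs G)" by (rule inj_onI) (use no_multi_arcs in blast)
 moreover have "arc_to_ends G ` arcs G \<subseteq> verts G \<times> verts G" by (auto simp: arc_to_ends_def)
 ultimately have "card (arcs G) \<le> card (verts G \<times> verts G)" using finite_graph by (intro card_inj_on_le) auto
 then show ?thesis by (simp add: card_cartesian_product)
qed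

text \<open>Every vertex is an end of some arc. This makes \<open>n + m\<close> of order
  \<open>m\<close> in the time bounds.\<close>

lemma few_verts: "card (verts G) \<le> 2 * card (arcs G)"
proof -
 have "verts G \<subseteq> tail G ` arcs G \<union> head G ` arcs G" using no_isolated by blast
 then have "card (verts G) \<le> card (tail G ` arcs G \<union> head G ` arcs G)" using finite_graph by (intro card_mono) auto
 also have "\<dots> \<le> card (tail G ` arcs G) + card (head G ` arcs G)" by (rule card_Un_le)
 also have "\<dots> \<le> card (arcs G) + card (arcs G)" using finite_graph by (intro add_mono card_image_le)
 finally show ?thesis by simp
qed

lemma parameters_ok:
 fixes \<delta> Mmax Mmin :: real
 assumes d: "0 < \<delta>" "\<delta> < 1" and M: "2 * Mmin \<le> Mmax" "0 < Mmin"
 defines "n \<equiv> card (verts G)" and "m \<equiv> card (arcs G)"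
 shows "adsp_setup n m (num_levels n) (nat \<lfloor>log 2 (Mmax / Mmin)\<rfloor>) (nat \<lfloor>8 / \<delta>\<rfloor> + 2) (word_bound 13 n \<delta> Mmax Mmin)
  G (\<delta> / 2) Mmin {q \<in> {n..<Suc (num_levels n) * n}. q mod n \<in> hubs (q div n)} pairs Mmax hubs"
proof -
 have n2: "2 \<le> n" using two_verts by (simp add: n_def)
 have mn: "m \<le> n * n" "n \<le> 2 * m" using few_arcs few_verts by (simp_all add: n_def m_def)
 have V: "verts G = {..<n}" and A: "arcs G = {..<m}" using verts_numbered arcs_numbered by (simp_all add: n_def m_def)
 note W = word_bounds[OF n2 mn(1) d M refl refl]
 note sc = scales[OF M refl]
 note lv = levels[OF n2]
 have D: "4 / (\<delta> / 2) = 8 / \<delta>" by simp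
 have DD: "4 / (\<delta> / 2) + 1 \<le> real (nat \<lfloor>8 / \<delta>\<rfloor> + 2)" unfolding D using d by linarith
 have ends: "tail G e < n" "head G e < n" if "e < m" for e
  using tail_in_verts[of e] head_in_verts[of e] that by (simp_all add: V A)
 have m1: "1 \<le> m" using mn n2 by simp
 have d2: "0 < \<delta> / 2" using d by simp
 have Deq: "nat \<lfloor>8 / \<delta>\<rfloor> + 2 = nat \<lfloor>4 / (\<delta> / 2)\<rfloor> + 2" by simp
 have Ssub: "{q \<in> {n..<Suc (num_levels n) * n}. q mod n \<in> hubs (q div n)} \<subseteq> {n..<Suc (num_levels n) * n}" by blast
 show ?thesis
  by (intro adsp_setup.intro machine_setup.intro adsp_setup_axioms.intro)
   (fact n2 m1 mn(1) d2 M(2) sc(1,2,3) lv(1,2,3,4) DD Ssub W V A Deq refl | erule ends | erule source_neq_sink)+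
qed

end

lemma polylog_ge:
 assumes n: "2 \<le> n" and d: "0 < \<delta>" "\<delta> < 1"
 shows "(1 + log 2 (real n)) ^ 2 \<le> polylog 2 n \<delta>"
proof -
 have "0 \<le> log 2 (1 / \<delta>)" using d by (subst zero_le_log_cancel_iff) auto
 then have "1 ^ 2 \<le> (1 + log 2 (1 / \<delta>)) ^ 2" by (intro power_mono) auto
 then show ?thesis unfolding polylog_def using mult_left_mono[of 1 "(1 + log 2 (1 / \<delta>)) ^ 2" "(1 + log 2 (real n)) ^ 2"] by simp
qed

lemma query_time:
 assumes n: "2 \<le> n" "n \<le> 2 * m" and c: "card (verts G) = n" "card (arcs G) = m" and d: "0 < \<delta>" "\<delta> < 1"
  and t: "time_ok n m (num_levels n) r t"
 shows "query_time_bound G (2000000 * polylog 2 n \<delta>) r t"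
proof -
 define a where "a = 1 + log 2 (real n)"
 define L where "L = num_levels n"
 have a: "2 \<le> a" using n by (simp add: a_def le_log_iff)
 have L: "real L \<le> a" "real (L + 2) \<le> 2 * a" using levels(5)[OF n(1)] a by (simp_all add: L_def a_def)
 have pl: "a ^ 2 \<le> polylog 2 n \<delta>" using polylog_ge[OF n(1) d] by (simp add: a_def)
 have aa: "a \<le> a ^ 2" using a by (simp add: power2_eq_square)
 have P0: "0 \<le> polylog 2 n \<delta>" using pl zero_le_power2[of a] by linarith
 have lin: "real t \<le> 2000000 * polylog 2 n \<delta> * real n" if "t \<le> 1000 * n * L"
 proof -
  have "real t \<le> 1000 * real n * real L" using of_nat_mono[OF that, where 'a = real] by simp
  also have "\<dots> \<le> 1000 * real n * polylog 2 n \<delta>" using L aa pl by (intro mult_left_mono) auto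
  also have "\<dots> \<le> 2000000 * polylog 2 n \<delta> * real n"
  proof -
   have "0 \<le> real n * polylog 2 n \<delta>" using P0 by simp
   then show ?thesis by (simp add: mult.commute)
  qed
  finally show ?thesis .
 qed
 have ssrc: "real t \<le> 2000000 * polylog 2 n \<delta> * real m" if "t \<le> 1200 * L * (L + 2) * (n + 2 * m)"
 proof -
  have "real t \<le> 1200 * (real L * real (L + 2)) * real (n + 2 * m)" using of_nat_mono[OF that, where 'a = real] unfolding of_nat_mult by (simp only: mult.assoc of_nat_numeral)
  also have "\<dots> \<le> 1200 * (a * (2 * a)) * (4 * real m)" using L a n by (intro mult_mono) auto
  also have "\<dots> = 9600 * (a ^ 2 * real m)" by (simp add: power2_eq_square)
  also have "\<dots> \<le> 2000000 * (polylog 2 n \<delta> * real m)" using pl P0 by (intro mult_mono) auto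
  finally show ?thesis by (simp add: mult.assoc)
 qed
 show ?thesis using t lin ssrc by (cases r) (simp_all add: c L_def)
qed

text \<open>The inclusion probability cancels the growth of the trees with the level:
  \<open>hub_prob n j * 2 ^ j\<close> is at most \<open>10 * ln n\<close>, so each level contributes
  order \<open>n * log n / \<delta>\<close> to the expected \<open>hubsize\<close>.\<close>

lemma total_time:
 fixes \<delta> lM :: real
 assumes n: "2 \<le> n" "n \<le> 2 * m" and d: "0 < \<delta>" "\<delta> < 1" and NI: "real NI \<le> lM"
  and L: "L = num_levels n" and Dl: "Dl = nat \<lfloor>8 / \<delta>\<rfloor> + 2"
 shows "2000 * (real NI * (real (n + m) * ((\<Sum>j\<in>{1..L}. real n * (hub_prob n j * real (Dl * 2 ^ j + 1))) + real ((L + 1) * (Dl * 2 ^ L + n)))))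
  \<le> 2000000 * polylog 2 n \<delta> * (real m * real n * lM / \<delta>)"
proof -
 define a where "a = 1 + log 2 (real n)"
 define x where "x = real n / \<delta>"
 have a: "2 \<le> a" using n by (simp add: a_def le_log_iff)
 have La: "real L \<le> a" "real (L + 1) \<le> 2 * a" using levels(5)[OF n(1)] a by (simp_all add: L a_def)
 have d1: "1 \<le> 1 / \<delta>" using d by simp
 have "0 \<le> 8 / \<delta>" using d by simp
 then have "real Dl \<le> 8 / \<delta> + 2" unfolding Dl by linarith
 also have "\<dots> \<le> 10 / \<delta>" using d1 by simp
 finally have D: "real Dl \<le> 10 / \<delta>" .
 have x: "real n \<le> x" using d d1 n mult_left_mono[OF d1, of "real n"] by (simp add: x_def)
 have "ln (real n) \<le> log 2 (real n)"
 proof -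
  have "ln (2::real) \<le> 1" using ln_add_one_self_le_self[of "1::real"] by simp
  moreover have "0 \<le> ln (real n)" "0 < ln (2::real)" using n by auto
  ultimately show ?thesis by (simp add: log_def pos_le_divide_eq mult_left_le)
 qed
 then have ln: "0 \<le> ln (real n)" "ln (real n) \<le> a" using n by (auto simp: a_def)
 have "real n * (hub_prob n j * real (Dl * 2 ^ j + 1)) \<le> 200 * a * x" for j
 proof -
  have "0 < Dl * 2 ^ j" using Dl by simp
  then have "1 \<le> Dl * 2 ^ j" by linarith
  then have "real (Dl * 2 ^ j + 1) \<le> 2 * (real Dl * 2 ^ j)"
   using of_nat_mono[of 1 "Dl * 2 ^ j", where 'a = real] by simp
  moreover have "hub_prob n j \<le> 10 * ln (real n) / 2 ^ j" by (simp add: hub_prob_def)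
  ultimately have "hub_prob n j * real (Dl * 2 ^ j + 1) \<le> 10 * ln (real n) / 2 ^ j * (2 * (real Dl * 2 ^ j))"
   using ln by (intro mult_mono) auto
  also have "\<dots> = 20 * (ln (real n) * real Dl)" by simp
  also have "\<dots> \<le> 20 * (a * (10 / \<delta>))" using ln D a by (intro mult_left_mono mult_mono) auto
  finally have le: "real n * (hub_prob n j * real (Dl * 2 ^ j + 1)) \<le> real n * (20 * (a * (10 / \<delta>)))" by (intro mult_left_mono) auto
  have eq: "real n * (20 * (a * (10 / \<delta>))) = 200 * a * x" by (simp add: x_def algebra_simps)
  show ?thesis using le unfolding eq .
 qed
 then have "(\<Sum>j\<in>{1..L}. real n * (hub_prob n j * real (Dl * 2 ^ j + 1))) \<le> real L * (200 * a * x)"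
  using sum_bounded_above[of "{1..L}" "\<lambda>j. real n * (hub_prob n j * real (Dl * 2 ^ j + 1))" "200 * a * x"] by simp
 also have "\<dots> \<le> a * (200 * a * x)" using La a x by (intro mult_right_mono) auto
 also have "\<dots> = 200 * (a ^ 2 * x)" by (simp add: power2_eq_square algebra_simps)
 finally have s1: "(\<Sum>j\<in>{1..L}. real n * (hub_prob n j * real (Dl * 2 ^ j + 1))) \<le> 200 * (a ^ 2 * x)" .
 have aa: "a \<le> a ^ 2" using a by (simp add: power2_eq_square)
 have "real (Dl * 2 ^ L + n) \<le> 10 / \<delta> * (2 * real n) + real n"
 proof -
  have "real (2 ^ L) \<le> real (2 * n)" using levels(4)[OF n(1)] unfolding L of_nat_le_iff .
  then have "real Dl * real (2 ^ L) \<le> 10 / \<delta> * (2 * real n)" using D d by (intro mult_mono) auto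
  then show ?thesis by simp
 qed
 also have "\<dots> \<le> 21 * x" using x by (simp add: x_def)
 finally have "real (L + 1) * real (Dl * 2 ^ L + n) \<le> 2 * a * (21 * x)" using La a by (intro mult_mono) auto
 also have "\<dots> = 42 * (a * x)" by simp
 also have "\<dots> \<le> 42 * (a ^ 2 * x)" using aa x by (intro mult_left_mono mult_right_mono) auto
 finally have s2: "real ((L + 1) * (Dl * 2 ^ L + n)) \<le> 42 * (a ^ 2 * x)" by (simp only: of_nat_mult)
 have "n + m \<le> 3 * m" using n by linarith
 then have nm: "real (n + m) \<le> 3 * real m" using of_nat_mono[of "n + m" "3 * m", where 'a = real] by simp
 have ax: "0 \<le> a ^ 2 * x" using x by simp
 have lM: "0 \<le> lM" using NI by linarith
 define T where "T = (\<Sum>j\<in>{1..L}. real n * (hub_prob n j * real (Dl * 2 ^ j + 1))) + real ((L + 1) * (Dl * 2 ^ L + n))"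
 have T: "T \<le> 242 * (a ^ 2 * x)" using s1 s2 unfolding T_def by linarith
 have T0: "0 \<le> T" unfolding T_def using hub_prob_range[OF n(1)] by (intro add_nonneg_nonneg sum_nonneg mult_nonneg_nonneg) auto
 have pg: "a ^ 2 \<le> polylog 2 n \<delta>" using polylog_ge[OF n(1) d] by (simp add: a_def)
 have Z0: "0 \<le> real m * real n * lM / \<delta>" using lM d by simp
 have "2000 * (real NI * (real (n + m) * T)) \<le> 2000 * (lM * (3 * real m * (242 * (a ^ 2 * x))))"
  using NI nm T T0 lM by (intro mult_left_mono mult_mono) auto
 also have "\<dots> = 1452000 * (a ^ 2 * (real m * real n * lM / \<delta>))" by (simp add: x_def algebra_simps)
 also have "\<dots> \<le> 2000000 * (polylog 2 n \<delta> * (real m * real n * lM / \<delta>))"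
  by (rule mult_mono[OF _ mult_right_mono[OF pg Z0] _ mult_nonneg_nonneg[OF zero_le_power2 Z0]]) simp_all
 finally show ?thesis unfolding T_def by (simp only: mult.assoc)
qed

theorem theorem8:
 shows "\<exists>(A :: data_structure) (w :: nat) (c :: nat) (C :: real).
  \<forall>(G :: (nat, nat) pre_digraph) (pairs :: (nat \<times> nat) list)
   (\<delta> :: real) (Mmax :: real) (Mmin :: real) (l :: nat \<Rightarrow> real).
  commodity_graph G pairs \<and> 0 < \<delta> \<and> \<delta> < 1 \<and> Mmax \<ge> 2 * Mmin \<and> Mmin > 0 \<and>
  (\<forall>e\<in>arcs G. l e > 0) \<longrightarrow>
  (let n = card (verts G); m = card (arcs G);
    W = word_bound w n \<delta> Mmax Mmin; K = C * polylog c n \<delta>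
  in \<exists>(t0 :: (nat \<Rightarrow> nat set) \<Rightarrow> nat) (s0 :: (nat \<Rightarrow> nat set) \<Rightarrow> machine_state).
   (\<forall>S\<in>set_pmf (hub_sets n).
     exec W (init_prog A) (input_state G pairs \<delta> Mmax Mmin l S) (t0 S) (s0 S) \<and>
     adsp G \<delta> Mmax Mmin (hub_paths G pairs S) (serve W A) l (s0 S)) \<and>
   (\<forall>(\<sigma> :: strategy) (N :: nat). (\<forall>as. valid_request G Mmax Mmin (\<sigma> as)) \<longrightarrow>
     (\<exists>h :: (nat \<Rightarrow> nat set) \<Rightarrow> (request \<times> answer \<times> nat) list.
      (\<forall>S\<in>set_pmf (hub_sets n).
        (\<exists>s. session (serve W A) \<sigma> (s0 S) (h S) s) \<and> length (h S) = N \<and>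
        (\<forall>(r, a, t)\<in>set (h S). query_time_bound G K r t)) \<and>
      measure_pmf.expectation (hub_sets n) (\<lambda>S. real (t0 S + increase_time (h S)))
       \<le> K * (real m * real n * log 2 (Mmax / Mmin) / \<delta>)
        + C * measure_pmf.expectation (hub_sets n) (\<lambda>S. real (num_increases (h S))))))"
\<comment> \<open>13 comes from \<open>word_bounds\<close>. The exponent 2 of the logarithm stands
  for the number of levels times the \<open>ln n\<close> in the inclusion probabilities; in
  single-source queries it stands for levels times depth of the tournament tree.\<close>
proof (rule exI[of _ adsp_structure], rule exI[of _ 13], rule exI[of _ 2], rule exI[of _ 2000000], intro allI impI, elim conjE)
 fix G :: "(nat, nat) pre_digraph" and pairs :: "(nat \<times> nat) list" and \<delta> Mmax Mmin :: real and l :: "nat \<Rightarrow> real"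
 assume cg: "commodity_graph G pairs" and d: "0 < \<delta>" "\<delta> < 1" and M: "Mmax \<ge> 2 * Mmin" "Mmin > 0" and l: "\<forall>e\<in>arcs G. l e > 0"
 interpret commodity_graph G pairs by (rule cg)
 define n where "n = card (verts G)"
 define m where "m = card (arcs G)"
 define W where "W = word_bound 13 n \<delta> Mmax Mmin"
 define L where "L = num_levels n"
 define NI where "NI = nat \<lfloor>log 2 (Mmax / Mmin)\<rfloor>"
 define Dl where "Dl = nat \<lfloor>8 / \<delta>\<rfloor> + 2"
 define X where "X = (\<lambda>S :: nat \<Rightarrow> nat set. \<Sum>j\<in>{1..L}. \<Sum>w<n. if w \<in> S j then Dl * 2 ^ j + 1 else 0)"
 define R where "R = (L + 1) * (Dl * 2 ^ L + n)"
 let ?K = "2000000 * polylog 2 n \<delta>"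
 have n2: "2 \<le> n" using two_verts by (simp add: n_def)
 have nm: "n \<le> 2 * m" using few_verts by (simp add: n_def m_def)
 have st: "adsp_setup n m L NI Dl W G (\<delta> / 2) Mmin {q \<in> {n..<Suc L * n}. q mod n \<in> S (q div n)} pairs Mmax S" for S
  unfolding n_def m_def L_def NI_def Dl_def W_def by (rule parameters_ok[OF d M])
 define PP where "PP = (\<lambda>S t s. exec W init (input_state G pairs \<delta> Mmax Mmin l S) t s \<and>
  adsp G \<delta> Mmax Mmin (hub_paths G pairs S) (serve W adsp_structure) l s \<and>
  (\<forall>\<sigma> N. (\<forall>as. valid_request G Mmax Mmin (\<sigma> as)) \<longrightarrow> (\<exists>h s'. session (serve W adsp_structure) \<sigma> s h s' \<and> length h = N \<and>
   (\<forall>(r, a, t)\<in>set h. time_ok n m L r t) \<and>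
   t + increase_time h \<le> 2000 * (NI * ((n + m) * (X S + R))) + 200 * num_increases h)))"
 have "\<forall>S. \<exists>t s. PP S t s"
 proof
  fix S
  have two: "2 * (\<delta> / 2) = \<delta>" by simp
  have pl: "0 < l e" if "e \<in> arcs G" for e using l that by blast
  show "\<exists>t s. PP S t s"
   using adsp_setup.run[OF st[of S], where l = l, OF pl] unfolding two PP_def X_def R_def .
 qed
 then have "\<exists>t0. \<forall>S. \<exists>s. PP S (t0 S) s" by (rule choice)
 then obtain t0 where "\<forall>S. \<exists>s. PP S (t0 S) s" by (rule exE)
 then have "\<exists>s0. \<forall>S. PP S (t0 S) (s0 S)" by (rule choice)
 then obtain s0 where PP: "\<forall>S. PP S (t0 S) (s0 S)" by (rule exE)
 have run: "exec W init (input_state G pairs \<delta> Mmax Mmin l S) (t0 S) (s0 S)"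
  "adsp G \<delta> Mmax Mmin (hub_paths G pairs S) (serve W adsp_structure) l (s0 S)" for S
  using PP[THEN spec, of S] unfolding PP_def by (rule conjunct1, rule conjunct2[THEN conjunct1])
 have run3: "\<exists>h s'. session (serve W adsp_structure) \<sigma> (s0 S) h s' \<and> length h = N \<and>
   (\<forall>(r, a, t)\<in>set h. time_ok n m L r t) \<and>
   t0 S + increase_time h \<le> 2000 * (NI * ((n + m) * (X S + R))) + 200 * num_increases h"
  if "\<forall>as. valid_request G Mmax Mmin (\<sigma> as)" for S \<sigma> N
  using PP[THEN spec, of S, unfolded PP_def, THEN conjunct2, THEN conjunct2, THEN spec, THEN spec, THEN mp, OF that] .
 have int: "integrable (measure_pmf (hub_sets n)) g" for g :: "(nat \<Rightarrow> nat set) \<Rightarrow> real"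
  by (rule integrable_measure_pmf_finite[OF finite_hub_sets])
 have sess: "\<exists>h :: (nat \<Rightarrow> nat set) \<Rightarrow> (request \<times> answer \<times> nat) list.
  (\<forall>S\<in>set_pmf (hub_sets n). (\<exists>s. session (serve W adsp_structure) \<sigma> (s0 S) (h S) s) \<and> length (h S) = N \<and>
   (\<forall>(r, a, t)\<in>set (h S). query_time_bound G ?K r t)) \<and>
  measure_pmf.expectation (hub_sets n) (\<lambda>S. real (t0 S + increase_time (h S)))
   \<le> ?K * (real m * real n * log 2 (Mmax / Mmin) / \<delta>) + 2000000 * measure_pmf.expectation (hub_sets n) (\<lambda>S. real (num_increases (h S)))"
  if v: "\<forall>as. valid_request G Mmax Mmin (\<sigma> as)" for \<sigma> N
 proof -
  \<comment> \<open>The history depends on \<open>S\<close>, because the strategy reacts to answers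
    and these depend on the hubs.\<close>
  define HH where "HH = (\<lambda>S h. (\<exists>s'. session (serve W adsp_structure) \<sigma> (s0 S) h s') \<and> length h = N \<and>
   (\<forall>(r, a, t)\<in>set h. time_ok n m L r t) \<and>
   t0 S + increase_time h \<le> 2000 * (NI * ((n + m) * (X S + R))) + 200 * num_increases h)"
  have "\<exists>h. HH S h" for S
  proof -
   have "\<exists>h s'. session (serve W adsp_structure) \<sigma> (s0 S) h s' \<and> length h = N \<and>
    (\<forall>(r, a, t)\<in>set h. time_ok n m L r t) \<and>
    t0 S + increase_time h \<le> 2000 * (NI * ((n + m) * (X S + R))) + 200 * num_increases h"
    by (rule run3[OF v])
   then obtain h s' where "session (serve W adsp_structure) \<sigma> (s0 S) h s'" "length h = N" "\<forall>(r, a, t)\<in>set h. time_ok n m L r t"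
    "t0 S + increase_time h \<le> 2000 * (NI * ((n + m) * (X S + R))) + 200 * num_increases h"
    by (elim exE conjE)
   then show ?thesis unfolding HH_def by (intro exI[of _ h] exI[of _ s'] conjI)
  qed
  then have "\<forall>S. \<exists>h. HH S h" by (rule allI)
  then have "\<exists>h. \<forall>S. HH S (h S)" by (rule choice)
  then obtain h where HH: "\<forall>S. HH S (h S)" by (rule exE)
  note hc = HH[THEN spec, unfolded HH_def]
  have h1: "\<exists>s'. session (serve W adsp_structure) \<sigma> (s0 S) (h S) s'" for S by (rule conjunct1[OF hc])
  have h2: "length (h S) = N" for S by (rule conjunct1[OF conjunct2[OF hc]])
  have h3: "\<forall>(r, a, t)\<in>set (h S). time_ok n m L r t" for S by (rule conjunct1[OF conjunct2[OF conjunct2[OF hc]]])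
  have h4: "t0 S + increase_time (h S) \<le> 2000 * (NI * ((n + m) * (X S + R))) + 200 * num_increases (h S)" for S
   by (rule conjunct2[OF conjunct2[OF conjunct2[OF hc]]])
  note qt = query_time[OF n2 nm n_def[symmetric] m_def[symmetric] d]
  have q: "\<forall>(r, a, t)\<in>set (h S). query_time_bound G ?K r t" for S
  proof -
   have "\<forall>x\<in>set (h S). time_ok n m (num_levels n) (fst x) (snd (snd x))"
    using h3[of S] unfolding case_prod_beta L_def .
   then have "\<forall>x\<in>set (h S). query_time_bound G ?K (fst x) (snd (snd x))"
    by ((rule ballI, drule (1) bspec, erule qt) | (blast intro: qt))
   then show ?thesis unfolding case_prod_beta .
  qed
  define c where "c = 2000 * (real NI * real (n + m))"
  let ?E = "measure_pmf.expectation (hub_sets n)"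
  \<comment> \<open>The bound holds for each \<open>S\<close> separately, whatever requests the
    strategy issues. Besides the number of increases only \<open>X S\<close> is random, and its
    expectation does not involve the requests.\<close>
  have pw: "real (t0 S + increase_time (h S)) \<le> c * real (X S) + c * real R + 200 * real (num_increases (h S))" for S
  proof -
   have "real (t0 S + increase_time (h S)) \<le> real (2000 * (NI * ((n + m) * (X S + R))) + 200 * num_increases (h S))"
    unfolding of_nat_le_iff by (rule h4)
   also have "\<dots> = c * real (X S) + c * real R + 200 * real (num_increases (h S))" by (simp add: c_def algebra_simps)
   finally show ?thesis .
  qed
  have E1: "?E (\<lambda>S. real (t0 S + increase_time (h S))) \<le> ?E (\<lambda>S. c * real (X S) + c * real R + 200 * real (num_increases (h S)))"
   by (rule integral_mono[OF int int]) (rule pw)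
  have E2: "?E (\<lambda>S. c * real (X S) + c * real R + 200 * real (num_increases (h S))) =
   c * ?E (\<lambda>S. real (X S)) + c * real R + 200 * ?E (\<lambda>S. real (num_increases (h S)))"
   by ((simp add: int; fail) | (subst Bochner_Integration.integral_add, rule int, rule int, simp add: int))
  have XS: "real (X S) = (\<Sum>j\<in>{1..num_levels n}. \<Sum>w<n. if w \<in> S j then real (Dl * 2 ^ j + 1) else 0)" for S
   unfolding X_def L_def of_nat_sum by (intro sum.cong refl) simp
  have EX: "?E (\<lambda>S. real (X S)) = (\<Sum>j\<in>{1..num_levels n}. real n * (hub_prob n j * real (Dl * 2 ^ j + 1)))"
   unfolding XS by (rule expectation_hubs[OF n2])
  have tot: "c * (\<Sum>j\<in>{1..num_levels n}. real n * (hub_prob n j * real (Dl * 2 ^ j + 1))) + c * real R \<le>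
   ?K * (real m * real n * log 2 (Mmax / Mmin) / \<delta>)"
  proof -
   have "real NI \<le> log 2 (Mmax / Mmin)" by (rule scales(4)[OF M NI_def])
   from total_time[OF n2 nm d this L_def Dl_def] show ?thesis
    unfolding c_def R_def L_def by (simp only: mult.assoc distrib_left)
  qed
  have "?E (\<lambda>S. real (t0 S + increase_time (h S))) \<le>
   c * (\<Sum>j\<in>{1..num_levels n}. real n * (hub_prob n j * real (Dl * 2 ^ j + 1))) + c * real R + 200 * ?E (\<lambda>S. real (num_increases (h S)))"
   using E1 unfolding E2 EX .
  also have "\<dots> \<le> ?K * (real m * real n * log 2 (Mmax / Mmin) / \<delta>) + 200 * ?E (\<lambda>S. real (num_increases (h S)))"
   by (rule add_right_mono[OF tot])
  also have "\<dots> \<le> ?K * (real m * real n * log 2 (Mmax / Mmin) / \<delta>) + 2000000 * ?E (\<lambda>S. real (num_increases (h S)))"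
  proof -
   have "0 \<le> ?E (\<lambda>S. real (num_increases (h S)))" by (rule Bochner_Integration.integral_nonneg) simp
   then show ?thesis by (intro add_left_mono mult_right_mono) simp_all
  qed
  finally have fin: "?E (\<lambda>S. real (t0 S + increase_time (h S))) \<le>
   ?K * (real m * real n * log 2 (Mmax / Mmin) / \<delta>) + 2000000 * ?E (\<lambda>S. real (num_increases (h S)))" .
  show ?thesis by (intro exI[of _ h] conjI ballI h1 h2 q fin)
 qed
 have ip: "init_prog adsp_structure = init" by (simp add: adsp_structure_def)
 show "let n = card (verts G); m = card (arcs G);
    W = word_bound 13 n \<delta> Mmax Mmin; K = 2000000 * polylog 2 n \<delta>
  in \<exists>(t0 :: (nat \<Rightarrow> nat set) \<Rightarrow> nat) (s0 :: (nat \<Rightarrow> nat set) \<Rightarrow> machine_state).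
   (\<forall>S\<in>set_pmf (hub_sets n).
     exec W (init_prog adsp_structure) (input_state G pairs \<delta> Mmax Mmin l S) (t0 S) (s0 S) \<and>
     adsp G \<delta> Mmax Mmin (hub_paths G pairs S) (serve W adsp_structure) l (s0 S)) \<and>
   (\<forall>(\<sigma> :: strategy) (N :: nat). (\<forall>as. valid_request G Mmax Mmin (\<sigma> as)) \<longrightarrow>
     (\<exists>h :: (nat \<Rightarrow> nat set) \<Rightarrow> (request \<times> answer \<times> nat) list.
      (\<forall>S\<in>set_pmf (hub_sets n).
        (\<exists>s. session (serve W adsp_structure) \<sigma> (s0 S) (h S) s) \<and> length (h S) = N \<and>
        (\<forall>(r, a, t)\<in>set (h S). query_time_bound G K r t)) \<and>
      measure_pmf.expectation (hub_sets n) (\<lambda>S. real (t0 S + increase_time (h S)))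
       \<le> K * (real m * real n * log 2 (Mmax / Mmin) / \<delta>)
        + 2000000 * measure_pmf.expectation (hub_sets n) (\<lambda>S. real (num_increases (h S)))))"
  unfolding Let_def n_def[symmetric] m_def[symmetric] W_def[symmetric] ip
  by (intro exI[of _ t0] exI[of _ s0] conjI ballI allI impI run) (erule sess)
qed

end
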